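(* Let $\mathfrak g$ be a finite dimensional complex Lie algebra, $B\colon\mathfrak g\to\mathfrak g$ an automorphism of order $n$, and $\mathfrak g=\bigoplus_{j\in\mathbb Z/n\mathbb Z}\mathfrak g_j$ with $\mathfrak g_j:=\ker(B-e^{2i\pi j/n})$. Put $\mathfrak l:=\mathfrak g_0=\ker(B-\mathrm{id})$. Let $\mathfrak g$ be equipped with a non-degenerate symmetric bilinear form $(\cdot,\cdot)$ that is $\mathrm{ad}$- and $B$-invariant, and let $\Omega_{\mathfrak l}$ be the Casimir element of the restriction of the form to $\mathfrak l$. Let $\varepsilon\in\mathbb C$, $\varepsilon\neq0$, and define $r'_{trig}\colon\mathcal N_{\mathfrak l}(0)\to\mathrm{End}(\mathfrak g)\simeq\mathfrak g\otimes\mathfrak g$ by $r'_{trig}(A)|_{\mathfrak g_j}=f_j^{trig}(\mathrm{ad}\,A)$, where $$f_0^{trig}(s)=\tfrac12\coth\bigl(\tfrac12s\bigr)-\tfrac\varepsilon2\coth\bigl(\tfrac\varepsilon2s\bigr),\qquad f_j^{trig}(s)=-\tfrac\varepsilon2\coth\bigl(\tfrac\varepsilon2s+\tfrac{i\pi j}{n}\bigr),\quad j\neq0.$$ Suppose that $\mathfrak l$ has a quasitriangular Lie bialgebra structure $(r_{\mathfrak l},\Omega_{\mathfrak l})$. Then $r_{trig}=r'_{trig}-r_{\mathfrak l}$ is a Poisson Lie dynamical r-matrix over $\mathcal N_{\mathfrak l}(0)$.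
   Context: Functions are analytic or meromorphic. An element $\sum a\otimes b\in\mathfrak g\otimes\mathfrak g$ is identified with the operator $x\mapsto\sum(a,x)b$ in $\mathrm{End}(\mathfrak g)$ via the form $(\cdot,\cdot)$ (pairing with the first tensor component). The function $f_0^{trig}$ is regular at $s=0$ (value $0$ there), so $r'_{trig}$ is analytic near $A=0$. For $A\in\mathfrak g\otimes\mathfrak g$ put $\mathrm{CYB}(A):=[A_{12},A_{13}]+[A_{12},A_{23}]+[A_{13},A_{23}]$. For $B\in\mathfrak g^{\otimes 3}$ put $\mathrm{Alt}(B):=B_{123}-B_{213}+B_{231}$, where for $B=b_1\otimes b_2\otimes b_3$ one has $B_{213}=b_2\otimes b_1\otimes b_3$ and $B_{231}=b_2\otimes b_3\otimes b_1$. A quasitriangular structure $(r_{\mathfrak l},\Omega_{\mathfrak l})$ on $\mathfrak l$ means: the cobracket on $\mathfrak l$ is $\delta(\xi)=[\xi\otimes1+1\otimes\xi,r_{\mathfrak l}]$ with $r_{\mathfrak l}\in\wedge^2\mathfrak l$, and $\Omega_{\mathfrak l}\in(S^2\mathfrak l)^{\mathfrak l}$ satisfies $\mathrm{CYB}(r_{\mathfrak l}+\tfrac12\Omega_{\mathfrak l})=0$. Elements of $\mathfrak l\otimes\mathfrak l$ define linear operators $\mathfrak l^*\to\mathfrak l$ via pairing with the first tensor component. The base manifold $\mathcal N_{\mathfrak l}(0)$: let $\mathrm{Exp}\,\mathfrak l$ be the connected simply connected Lie group of $\mathfrak l$. $\mathcal N_{\mathfrak l}(0)\subset\mathfrak l$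 is an open domain (connected open set) containing $0$ that parameterizes, by the exponential map, a neighborhood of the identity in $\mathrm{Exp}\,\mathfrak l$. For $\xi\in\mathfrak l$ let $\xi^l f(g)=\frac{d}{dt}f(ge^{t\xi})|_{t=0}$ and $\xi^r f(g)=\frac{d}{dt}f(e^{t\xi}g)|_{t=0}$; these vector fields are transported to $\mathcal N_{\mathfrak l}(0)$ by the exponential map. The elements $\xi\in\mathfrak l$ and $\eta\in\mathfrak l^*_{op}$ of the double $\mathfrak D\mathfrak l=\mathfrak l\bowtie\mathfrak l^*_{op}$ act on functions by the vector fields $$\xi\triangleright:=\xi^l-\xi^r,\qquad \nabla_\eta:=r_{\mathfrak l}(\eta)^r-r_{\mathfrak l}(\eta)^l+\tfrac12\bigl(\Omega_{\mathfrak l}(\eta)^l+\Omega_{\mathfrak l}(\eta)^r\bigr).$$ A function $r\colon\mathcal N_{\mathfrak l}(0)\to\wedge^2\mathfrak g$ is quasi-invariant if $\xi\triangleright r(\lambda)+[\xi\otimes1+1\otimes\xi,r(\lambda)]=-\delta(\xi)$ for all $\xi\in\mathfrak l$. A quasi-invariant $r$ is a (Poisson Lie) dynamical r-matrix over $\mathcal N_{\mathfrak l}(0)$ if $$\sum_i\mathrm{Alt}\bigl(\xi_i\otimes\nabla_{\eta^i}r(\lambda)\bigr)+\mathrm{CYB}\bigl(r(\lambda)\bigr)=Z,$$ where $\{\xi_i\}\subset\mathfrak l$, $\{\eta^i\}\subset\mathfrak l^*$ are dual bases and $Z\in(\wedge^3\mathfrak g)^{\mathfrak g}$ is an invariant element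 (constant in $\lambda$). *)

theory Defs
  imports "HOL-Complex_Analysis.Complex_Analysis"
begin

section \<open>Lie algebras\<close>

text \<open>Finite dimensional complex vector spaces are given in coordinates as
  \<^typ>\<open>complex^'n\<close>, with complex scalar multiplication \<^const>\<open>vector_scalar_mult\<close>.\<close>

definition complex_bilinear ::
    "('a::ab_group_add \<Rightarrow> 'a \<Rightarrow> 'b::ab_group_add) \<Rightarrow> (complex \<Rightarrow> 'a \<Rightarrow> 'a) \<Rightarrow> (complex \<Rightarrow> 'b \<Rightarrow> 'b) \<Rightarrow> bool" where
  "complex_bilinear b scA scB \<longleftrightarrow>
     (\<forall>x. Vector_Spaces.linear scA scB (\<lambda>y. b x y)) \<and> (\<forall>y. Vector_Spaces.linear scA scB (\<lambda>x. b x y))"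

definition complex_lie_algebra :: "(complex^'n \<Rightarrow> complex^'n \<Rightarrow> complex^'n) \<Rightarrow> bool" where
  "complex_lie_algebra br \<longleftrightarrow>
     complex_bilinear br (*s) (*s) \<and> (\<forall>x. br x x = 0) \<and>
     (\<forall>x y z. br x (br y z) + br y (br z x) + br z (br x y) = 0)"

definition lie_automorphism ::
    "(complex^'n \<Rightarrow> complex^'n \<Rightarrow> complex^'n) \<Rightarrow> (complex^'n \<Rightarrow> complex^'n) \<Rightarrow> bool" where
  "lie_automorphism br B \<longleftrightarrow>
     Vector_Spaces.linear (*s) (*s) B \<and> bij B \<and> (\<forall>x y. B (br x y) = br (B x) (B y))"

definition has_order :: "('a \<Rightarrow> 'a) \<Rightarrow> nat \<Rightarrow> bool" where
  "has_order B n \<longleftrightarrow> n > 0 \<and> B ^^ n = id \<and> (\<forall>m. 0 < m \<and> m < n \<longrightarrow> B ^^ m \<noteq> id)"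

definition graded_part :: "(complex^'n \<Rightarrow> complex^'n) \<Rightarrow> nat \<Rightarrow> nat \<Rightarrow> (complex^'n) set" where
  "graded_part B n j = {x. B x = exp (2 * \<i> * of_real pi * of_nat j / of_nat n) *s x}"

definition nondegenerate_symmetric_form :: "(complex^'n \<Rightarrow> complex^'n \<Rightarrow> complex) \<Rightarrow> bool" where
  "nondegenerate_symmetric_form form \<longleftrightarrow>
     complex_bilinear form (*s) (*) \<and> (\<forall>x y. form x y = form y x) \<and>
     (\<forall>x. (\<forall>y. form x y = 0) \<longrightarrow> x = 0)"


section \<open>Tensors\<close>

text \<open>The tensor \<open>\<Sum>i j. t$i$j (e\<^sub>i \<otimes> e\<^sub>j)\<close>, with \<open>e\<^sub>i = axis i 1\<close>, is
  represented by its coefficients \<open>t :: complex^'n^'n\<close>; similarly for three factors.\<close>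

definition tensor2 :: "complex^'n \<Rightarrow> complex^'n \<Rightarrow> complex^'n^'n" where
  "tensor2 a b = (\<chi> p q. a $ p * b $ q)"

definition tensor12 :: "complex^'n \<Rightarrow> complex^'n^'n \<Rightarrow> complex^'n^'n^'n" where
  "tensor12 a t = (\<chi> p q r. a $ p * t $ q $ r)"

definition scale2 :: "complex \<Rightarrow> complex^'n^'n \<Rightarrow> complex^'n^'n" where
  "scale2 c t = (\<chi> p q. c * t $ p $ q)"

text \<open>The generating set is closed under complex multiples, so the real span is
  the complex one.\<close>

definition tensor_square :: "(complex^'n) set \<Rightarrow> (complex^'n^'n) set" where
  "tensor_square V = span {tensor2 a b | a b. a \<in> V \<and> b \<in> V}"

definition symmetric2 :: "complex^'n^'n \<Rightarrow> bool" where
  "symmetric2 t \<longleftrightarrow> (\<forall>p q. t $ p $ q = t $ q $ p)"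

definition antisymmetric2 :: "complex^'n^'n \<Rightarrow> bool" where
  "antisymmetric2 t \<longleftrightarrow> (\<forall>p q. t $ p $ q = - (t $ q $ p))"

definition antisymmetric3 :: "complex^'n^'n^'n \<Rightarrow> bool" where
  "antisymmetric3 t \<longleftrightarrow>
     (\<forall>p q r. t $ p $ q $ r = - (t $ q $ p $ r) \<and> t $ p $ q $ r = - (t $ p $ r $ q))"

text \<open>\<open>ad2 br x t = [x \<otimes> 1 + 1 \<otimes> x, t]\<close>, and \<open>ad3\<close> is the analogous action on
  the third tensor power.\<close>

definition ad2 ::
    "(complex^'n \<Rightarrow> complex^'n \<Rightarrow> complex^'n) \<Rightarrow> complex^'n \<Rightarrow> complex^'n^'n \<Rightarrow> complex^'n^'n" where
  "ad2 br x t = (\<chi> p q.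
     (\<Sum>i\<in>UNIV. t $ i $ q * br x (axis i 1) $ p) + (\<Sum>i\<in>UNIV. t $ p $ i * br x (axis i 1) $ q))"

definition ad3 ::
    "(complex^'n \<Rightarrow> complex^'n \<Rightarrow> complex^'n) \<Rightarrow> complex^'n \<Rightarrow> complex^'n^'n^'n \<Rightarrow> complex^'n^'n^'n" where
  "ad3 br x t = (\<chi> p q r.
     (\<Sum>i\<in>UNIV. t $ i $ q $ r * br x (axis i 1) $ p) +
     (\<Sum>i\<in>UNIV. t $ p $ i $ r * br x (axis i 1) $ q) +
     (\<Sum>i\<in>UNIV. t $ p $ q $ i * br x (axis i 1) $ r))"

text \<open>The three summands are the \<open>e\<^sub>p \<otimes> e\<^sub>q \<otimes> e\<^sub>r\<close> coefficients of
  \<open>[t\<^sub>1\<^sub>2,t\<^sub>1\<^sub>3] = \<Sum> t$i$j t$k$l [e\<^sub>i,e\<^sub>k] \<otimes> e\<^sub>j \<otimes> e\<^sub>l\<close>,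
  \<open>[t\<^sub>1\<^sub>2,t\<^sub>2\<^sub>3] = \<Sum> t$i$j t$k$l e\<^sub>i \<otimes> [e\<^sub>j,e\<^sub>k] \<otimes> e\<^sub>l\<close> and
  \<open>[t\<^sub>1\<^sub>3,t\<^sub>2\<^sub>3] = \<Sum> t$i$j t$k$l e\<^sub>i \<otimes> e\<^sub>k \<otimes> [e\<^sub>j,e\<^sub>l]\<close>.\<close>

definition CYB ::
    "(complex^'n \<Rightarrow> complex^'n \<Rightarrow> complex^'n) \<Rightarrow> complex^'n^'n \<Rightarrow> complex^'n^'n^'n" where
  "CYB br t = (\<chi> p q r.
     (\<Sum>i\<in>UNIV. \<Sum>k\<in>UNIV. t $ i $ q * t $ k $ r * br (axis i 1) (axis k 1) $ p) +
     (\<Sum>j\<in>UNIV. \<Sum>k\<in>UNIV. t $ p $ j * t $ k $ r * br (axis j 1) (axis k 1) $ q) +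
     (\<Sum>j\<in>UNIV. \<Sum>l\<in>UNIV. t $ p $ j * t $ q $ l * br (axis j 1) (axis l 1) $ r))"

text \<open>\<open>Alt b = b\<^sub>1\<^sub>2\<^sub>3 - b\<^sub>2\<^sub>1\<^sub>3 + b\<^sub>2\<^sub>3\<^sub>1\<close>: for \<open>b = b\<^sub>1 \<otimes> b\<^sub>2 \<otimes> b\<^sub>3\<close> the
  coefficient of \<open>b\<^sub>2 \<otimes> b\<^sub>3 \<otimes> b\<^sub>1\<close> at \<open>(p,q,r)\<close> is that of \<open>b\<close> at \<open>(r,p,q)\<close>.\<close>

definition Alt :: "complex^'n^'n^'n \<Rightarrow> complex^'n^'n^'n" where
  "Alt b = (\<chi> p q r. b $ p $ q $ r - b $ q $ p $ r + b $ r $ p $ q)"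

text \<open>The operator \<open>x \<mapsto> \<Sum> (a,x) b\<close> attached to \<open>\<Sum> a \<otimes> b\<close>, and the contraction
  \<open>\<eta> \<mapsto> \<Sum> \<eta>(a) b\<close>. Elements of the dual of a subspace are represented by linear
  functionals on the whole space; on \<^term>\<open>t \<in> tensor_square V\<close> the contraction
  depends only on the restriction of \<open>\<eta>\<close> to \<open>V\<close>.\<close>

definition tensor_operator ::
    "(complex^'n \<Rightarrow> complex^'n \<Rightarrow> complex) \<Rightarrow> complex^'n^'n \<Rightarrow> complex^'n \<Rightarrow> complex^'n" where
  "tensor_operator form t x = (\<chi> q. \<Sum>p\<in>UNIV. t $ p $ q * form (axis p 1) x)"

definition contract :: "complex^'n^'n \<Rightarrow> (complex^'n \<Rightarrow> complex) \<Rightarrow> complex^'n" where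
  "contract t \<eta> = (\<chi> q. \<Sum>p\<in>UNIV. t $ p $ q * \<eta> (axis p 1))"

definition basis_of :: "(complex^'n) set \<Rightarrow> (complex^'n) set \<Rightarrow> bool" where
  "basis_of V S \<longleftrightarrow> vec.independent S \<and> vec.span S = V"

definition dual_bases ::
    "(complex^'n) set \<Rightarrow> (complex^'n) set \<Rightarrow> (complex^'n \<Rightarrow> complex^'n \<Rightarrow> complex) \<Rightarrow> bool" where
  "dual_bases V S \<eta> \<longleftrightarrow> basis_of V S \<and>
     (\<forall>b\<in>S. Vector_Spaces.linear (*s) (*) (\<eta> b)) \<and>
     (\<forall>b\<in>S. \<forall>b'\<in>S. \<eta> b b' = (if b = b' then 1 else 0))"

definition casimir_element ::
    "(complex^'n \<Rightarrow> complex^'n \<Rightarrow> complex) \<Rightarrow> (complex^'n) set \<Rightarrow> complex^'n^'n \<Rightarrow> bool" where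
  "casimir_element form V \<Omega> \<longleftrightarrow>
     (\<exists>S D. basis_of V S \<and> (\<forall>b\<in>S. D b \<in> V) \<and>
        (\<forall>b\<in>S. \<forall>b'\<in>S. form (D b) b' = (if b = b' then 1 else 0)) \<and>
        \<Omega> = (\<Sum>b\<in>S. tensor2 b (D b)))"

definition quasitriangular_structure ::
    "(complex^'n \<Rightarrow> complex^'n \<Rightarrow> complex^'n) \<Rightarrow> (complex^'n) set \<Rightarrow> (complex^'n \<Rightarrow> complex^'n^'n)
      \<Rightarrow> complex^'n^'n \<Rightarrow> complex^'n^'n \<Rightarrow> bool" where
  "quasitriangular_structure br l \<delta> rl \<Omega> \<longleftrightarrow>
     (\<forall>\<xi>\<in>l. \<delta> \<xi> = ad2 br \<xi> rl) \<and>
     rl \<in> tensor_square l \<and> antisymmetric2 rl \<and>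
     \<Omega> \<in> tensor_square l \<and> symmetric2 \<Omega> \<and> (\<forall>\<xi>\<in>l. ad2 br \<xi> \<Omega> = 0) \<and>
     CYB br (rl + (1/2) *\<^sub>R \<Omega>) = 0"


section \<open>Holomorphic and meromorphic functions on a subspace\<close>

definition complex_differentiable ::
    "(complex \<Rightarrow> 'a \<Rightarrow> 'a) \<Rightarrow> (complex \<Rightarrow> 'b \<Rightarrow> 'b) \<Rightarrow> 'a::real_normed_vector set
      \<Rightarrow> ('a \<Rightarrow> 'b::real_normed_vector) \<Rightarrow> 'a \<Rightarrow> bool" where
  "complex_differentiable scA scB V f x \<longleftrightarrow>
     (\<exists>L. (f has_derivative L) (at x within V) \<and> (\<forall>c. \<forall>v\<in>V. L (scA c v) = scB c (L v)))"

definition analytic_at ::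
    "(complex^'n) set \<Rightarrow> (complex^'n) set \<Rightarrow> (complex^'n \<Rightarrow> complex^'n^'n) \<Rightarrow> complex^'n \<Rightarrow> bool" where
  "analytic_at l N r A \<longleftrightarrow>
     (\<exists>U. openin (top_of_set l) U \<and> A \<in> U \<and> U \<subseteq> N \<and>
        (\<forall>x\<in>U. complex_differentiable (*s) scale2 l r x))"

text \<open>Locally a quotient \<open>p / h\<close> of holomorphic functions, with \<open>h\<close> vanishing
  identically on no nonempty open set. The values of \<open>r\<close> at its poles are
  arbitrary.\<close>

definition meromorphic_on_domain ::
    "(complex^'n) set \<Rightarrow> (complex^'n) set \<Rightarrow> (complex^'n \<Rightarrow> complex^'n^'n) \<Rightarrow> bool" where
  "meromorphic_on_domain l N r \<longleftrightarrow>
     (\<forall>A\<in>N. \<exists>U p h. openin (top_of_set l) U \<and> A \<in> U \<and> U \<subseteq> N \<and>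
        (\<forall>x\<in>U. complex_differentiable (*s) scale2 l p x) \<and>
        (\<forall>x\<in>U. complex_differentiable (*s) (*) l h x) \<and>
        U \<subseteq> closure {x\<in>U. h x \<noteq> 0} \<and>
        (\<forall>x\<in>U. h x \<noteq> 0 \<longrightarrow> r x = scale2 (1 / h x) (p x)))"


section \<open>The Lie group and its exponential chart\<close>

text \<open>\<open>E\<close> restricts to a homeomorphism of the open set \<open>N\<close> of \<open>l\<close>, containing \<open>0\<close>,
  onto an open neighbourhood of the identity. Groups are written additively, as in
  \<^class>\<open>topological_group_add\<close>, although they need not be commutative:
  \<open>0\<close> is the identity and \<open>g + h\<close> the product \<open>gh\<close>.\<close>

definition exp_parametrizes ::
    "(complex^'n) set \<Rightarrow> (complex^'n \<Rightarrow> 'g::topological_group_add) \<Rightarrow> (complex^'n) set \<Rightarrow> bool" where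
  "exp_parametrizes l E N \<longleftrightarrow>
     openin (top_of_set l) N \<and> 0 \<in> N \<and>
     inj_on E N \<and> open (E ` N) \<and> continuous_on N E \<and> continuous_on (E ` N) (inv_into N E)"

text \<open>The type \<open>'g\<close> is the connected simply connected complex Lie group of \<open>l\<close>, with
  exponential map \<open>E\<close> (of which only the restriction to \<open>l\<close> matters): \<open>E\<close> is
  a one-parameter group along each line, and on some neighbourhood of \<open>0\<close> it
  is a chart in which the multiplication is holomorphic and whose group commutator
  has second order term the bracket of \<open>l\<close>. For a connected topological group such
  a chart at the identity determines the complex Lie group structure.
  \<^const>\<open>simply_connected\<close> includes path-connectedness.\<close>

definition simply_connected_lie_group ::
    "(complex^'n \<Rightarrow> complex^'n \<Rightarrow> complex^'n) \<Rightarrow> (complex^'n) set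
      \<Rightarrow> (complex^'n \<Rightarrow> 'g::{topological_group_add,t2_space}) \<Rightarrow> bool" where
  "simply_connected_lie_group br l E \<longleftrightarrow>
     simply_connected (UNIV :: 'g set) \<and>
     continuous_on l E \<and>
     (\<forall>\<xi>\<in>l. \<forall>s t. E ((s + t) *s \<xi>) = E (s *s \<xi>) + E (t *s \<xi>)) \<and>
     (\<exists>U. exp_parametrizes l E U \<and>
        (\<forall>x\<in>U. \<forall>y\<in>U. E x + E y \<in> E ` U \<longrightarrow>
           complex_differentiable (\<lambda>c (u, v). (c *s u, c *s v)) (*s) (l \<times> l)
             (\<lambda>(x, y). inv_into U E (E x + E y)) (x, y)) \<and>
        (\<forall>x\<in>l. \<forall>y\<in>l.
           ((\<lambda>t::real. (1 / t\<^sup>2) *\<^sub>R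
               inv_into U E (E (t *\<^sub>R x) + E (t *\<^sub>R y) - E (t *\<^sub>R x) - E (t *\<^sub>R y)))
             \<longlongrightarrow> br x y) (at 0)))"

definition left_field ::
    "(complex^'n) set \<Rightarrow> (complex^'n \<Rightarrow> 'g::group_add) \<Rightarrow> complex^'n
      \<Rightarrow> (complex^'n \<Rightarrow> 'b::real_normed_vector) \<Rightarrow> complex^'n \<Rightarrow> 'b" where
  "left_field N E \<xi> f A =
     vector_derivative (\<lambda>t::real. f (inv_into N E (E A + E (t *\<^sub>R \<xi>)))) (at 0)"

definition right_field ::
    "(complex^'n) set \<Rightarrow> (complex^'n \<Rightarrow> 'g::group_add) \<Rightarrow> complex^'n
      \<Rightarrow> (complex^'n \<Rightarrow> 'b::real_normed_vector) \<Rightarrow> complex^'n \<Rightarrow> 'b" where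
  "right_field N E \<xi> f A =
     vector_derivative (\<lambda>t::real. f (inv_into N E (E (t *\<^sub>R \<xi>) + E A))) (at 0)"

definition adjoint_field ::
    "(complex^'n) set \<Rightarrow> (complex^'n \<Rightarrow> 'g::group_add) \<Rightarrow> complex^'n
      \<Rightarrow> (complex^'n \<Rightarrow> 'b::real_normed_vector) \<Rightarrow> complex^'n \<Rightarrow> 'b" where
  "adjoint_field N E \<xi> f A = left_field N E \<xi> f A - right_field N E \<xi> f A"

definition nabla_field ::
    "complex^'n^'n \<Rightarrow> complex^'n^'n \<Rightarrow> (complex^'n) set \<Rightarrow> (complex^'n \<Rightarrow> 'g::group_add)
      \<Rightarrow> (complex^'n \<Rightarrow> complex) \<Rightarrow> (complex^'n \<Rightarrow> 'b::real_normed_vector) \<Rightarrow> complex^'n \<Rightarrow> 'b" where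
  "nabla_field rl \<Omega> N E \<eta> f A =
     right_field N E (contract rl \<eta>) f A - left_field N E (contract rl \<eta>) f A +
     (1/2) *\<^sub>R (left_field N E (contract \<Omega> \<eta>) f A + right_field N E (contract \<Omega> \<eta>) f A)"


section \<open>Poisson Lie dynamical r-matrices\<close>

text \<open>\<open>r\<close> is a meromorphic function; the conditions on it are imposed at every point of \<open>N\<close>
  where it is analytic.\<close>

definition quasi_invariant ::
    "(complex^'n \<Rightarrow> complex^'n \<Rightarrow> complex^'n) \<Rightarrow> (complex^'n) set \<Rightarrow> (complex^'n \<Rightarrow> complex^'n^'n)
      \<Rightarrow> (complex^'n \<Rightarrow> 'g::group_add) \<Rightarrow> (complex^'n) set \<Rightarrow> (complex^'n \<Rightarrow> complex^'n^'n) \<Rightarrow> bool" where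
  "quasi_invariant br l \<delta> E N r \<longleftrightarrow>
     (\<forall>A\<in>N. analytic_at l N r A \<longrightarrow>
        (\<forall>\<xi>\<in>l. adjoint_field N E \<xi> r A + ad2 br \<xi> (r A) = - \<delta> \<xi>))"

definition dynamical_r_matrix ::
    "(complex^'n \<Rightarrow> complex^'n \<Rightarrow> complex^'n) \<Rightarrow> (complex^'n) set \<Rightarrow> (complex^'n \<Rightarrow> complex^'n^'n)
      \<Rightarrow> complex^'n^'n \<Rightarrow> complex^'n^'n
      \<Rightarrow> (complex^'n \<Rightarrow> 'g::group_add) \<Rightarrow> (complex^'n) set \<Rightarrow> (complex^'n \<Rightarrow> complex^'n^'n) \<Rightarrow> bool" where
  "dynamical_r_matrix br l \<delta> rl \<Omega> E N r \<longleftrightarrow>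
     meromorphic_on_domain l N r \<and>
     (\<forall>A\<in>N. analytic_at l N r A \<longrightarrow> antisymmetric2 (r A)) \<and>
     quasi_invariant br l \<delta> E N r \<and>
     (\<exists>Z. antisymmetric3 Z \<and> (\<forall>x. ad3 br x Z = 0) \<and>
        (\<forall>A\<in>N. analytic_at l N r A \<longrightarrow>
           (\<forall>S \<eta>. dual_bases l S \<eta> \<longrightarrow>
              (\<Sum>b\<in>S. Alt (tensor12 b (nabla_field rl \<Omega> N E (\<eta> b) r A))) + CYB br (r A) = Z)))"


section \<open>The trigonometric r-matrix\<close>

text \<open>The operator \<open>f(T)\<close> for a meromorphic function \<open>f\<close>: on the generalized
  eigenspace of \<open>T\<close> for the eigenvalue \<open>\<mu>\<close>, it is the Taylor expansion of \<open>f\<close> at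
  \<open>\<mu>\<close> evaluated at \<open>T\<close> (the power \<open>CARD('n)\<close> suffices). \<^const>\<open>remove_sings\<close> fills in the
  removable singularities of \<open>f\<close>; on generalized eigenspaces belonging to poles of \<open>f\<close>
  the value is meaningless. For a \<open>T\<close>-invariant subspace \<open>W\<close>, the restriction of
  \<open>f(T)\<close> to \<open>W\<close> is \<open>f\<close> of the restriction of \<open>T\<close> and involves only the eigenvalues of \<open>T\<close>
  on \<open>W\<close>.\<close>

definition operator_function ::
    "(complex \<Rightarrow> complex) \<Rightarrow> (complex^'n \<Rightarrow> complex^'n) \<Rightarrow> complex^'n \<Rightarrow> complex^'n" where
  "operator_function f T =
     (THE F. Vector_Spaces.linear (*s) (*s) F \<and>
        (\<forall>\<mu> x. ((\<lambda>y. T y - \<mu> *s y) ^^ CARD('n)) x = 0 \<longrightarrow>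
           F x = (\<Sum>k<CARD('n).
              ((deriv ^^ k) (remove_sings f) \<mu> / fact k) *s ((\<lambda>y. T y - \<mu> *s y) ^^ k) x)))"

definition coth :: "complex \<Rightarrow> complex" where
  "coth z = cosh z / sinh z"

definition f_trig :: "nat \<Rightarrow> complex \<Rightarrow> nat \<Rightarrow> complex \<Rightarrow> complex" where
  "f_trig n \<epsilon> j s =
     (if j = 0 then coth (s / 2) / 2 - \<epsilon> / 2 * coth (\<epsilon> / 2 * s)
      else - (\<epsilon> / 2) * coth (\<epsilon> / 2 * s + \<i> * of_real pi * of_nat j / of_nat n))"

definition r_trig' ::
    "(complex^'n \<Rightarrow> complex^'n \<Rightarrow> complex^'n) \<Rightarrow> (complex^'n \<Rightarrow> complex^'n \<Rightarrow> complex)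
      \<Rightarrow> (complex^'n \<Rightarrow> complex^'n) \<Rightarrow> nat \<Rightarrow> complex \<Rightarrow> complex^'n \<Rightarrow> complex^'n^'n" where
  "r_trig' br form B n \<epsilon> A =
     (THE t. \<forall>j<n. \<forall>x\<in>graded_part B n j.
        tensor_operator form t x = operator_function (f_trig n \<epsilon> j) (br A) x)"

end

theory Submission
  imports Defs "HOL-Computational_Algebra.Fundamental_Theorem_Algebra"
begin

text \<open>The operator of the trigonometric r-matrix at \<open>A\<close> is \<open>R (D) = \<Sum>j. f\<^sub>j (D) P\<^sub>j\<close> with \<open>D = ad A\<close> and \<open>P\<^sub>j\<close> the
  projection onto the part of degree \<open>j\<close>. Tensors are treated as operators and elements of the third
  tensor power as trilinear functions built from the invariant form \<open>\<beta> (x, y, z) = (x, [y, z])\<close>. The proof has three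
  ingredients.

  \<^item> The dynamical equation of \<open>R\<close>. For scalars with \<open>a + b + c = 0\<close> the operators \<open>exp (\<epsilon> (D + a)) B\<close>,
    \<open>exp (\<epsilon> (D + b)) B\<close>, \<open>exp (\<epsilon> (D + c)) B\<close> jointly preserve \<open>\<beta>\<close>, because at \<open>a = b = c = 0\<close> they are one
    automorphism; so do \<open>exp (D + a)\<close>, \<open>exp (D + b)\<close>, \<open>exp (D + c)\<close>. Cayley transforms of operators that jointly
    preserve a trilinear form satisfy the modified classical Yang-Baxter equation (\<open>cayley_trilinear\<close>). On the
    other hand \<open>R (D + a) = C\<^sub>a - G\<^sub>a\<close> is the difference of two such transforms, the first one supported on \<open>l\<close>
    (\<open>R_shift\<close>): this is the addition of \<open>i \<pi> j / n\<close> to the argument of the hyperbolic cotangent. The derivative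
    of \<open>R\<close> in the direction prescribed by the group fields is a noncommutative divided difference, and
    after the shifts it becomes a commutator with \<open>ad (C\<^sub>a x)\<close> (\<open>shifted_term\<close>). These commutators cancel
    the mixed terms and leave the Yang-Baxter expression of \<open>G\<close> minus that of \<open>C\<close>. Letting the shifts tend to \<open>0\<close> gives
    \<open>dynamical_identity\<close>, also at those \<open>A\<close> for which the unshifted Cayley transforms do not exist.

  \<^item> The vector fields of the group. The Lie group is given by one-parameter groups, a holomorphic chart and the
    second order term of the commutator. Schwarz's lemma gives the quadratic estimates from which the
    adjoint action (\<open>conjugation\<close>) and the differential \<open>(exp D - 1) / D\<close> of the exponential map (\<open>dexp_estimate\<close>) are
    computed. Since the chart is injective near \<open>A\<close>, this differential is invertible on \<open>l\<close>
    (\<open>phi_injective_on_l\<close>); the invariant fields are therefore derivatives in explicit directions.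

  \<^item> The poles. All functions \<open>f\<^sub>j\<close> have one entire denominator, so that \<open>R\<close> is holomorphic where a determinant
    \<open>den\<close> does not vanish. At a point \<open>A\<close> where the r-matrix is analytic although \<open>den A = 0\<close>, the identities follow
    from those at \<open>\<tau> A\<close> for \<open>\<tau>\<close> close to \<open>1\<close>, because derivatives of holomorphic functions are continuous.

  Subtracting \<open>rl\<close> is compatible with both conditions (\<open>r_trig_dynamical\<close>): equivariance of \<open>R\<close> turns the part of the
  connection that contains \<open>rl\<close> into the negative of the mixed terms of \<open>CYB (r' - rl)\<close>, and the Yang-Baxter
  equation of \<open>rl + \<Omega> / 2\<close> makes \<open>CYB (rl)\<close> the negative of the term of the dynamical equation of \<open>R\<close> that is supported
  on \<open>l\<close>. What remains is \<open>- \<epsilon>\<^sup>2 / 4\<close> times the invariant element attached to \<open>\<beta>\<close>.\<close>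

(* $ denotes coordinates of vectors, not coefficients of power series *)
unbundle no fps_syntax

section \<open>The Banach algebra of complex linear operators\<close>

text \<open>Complex linear operators form a Banach algebra over the reals, in which the exponential and other power series
  converge. The complex scalars enter as the central elements \<open>scal c\<close>.\<close>

typedef (overloaded) 'n endo =
  "{f :: (complex^'n::finite) \<Rightarrow>\<^sub>L (complex^'n). \<forall>c x. blinfun_apply f (c *s x) = c *s blinfun_apply f x}"
  morphisms blin Endo
  by (rule exI[of _ 0]) auto

definition app :: "'n::finite endo \<Rightarrow> complex^'n \<Rightarrow> complex^'n" where
  "app T = blinfun_apply (blin T)"

lemma app_scale: "app T (c *s x) = c *s app T x"
  using blin[of T] by (simp add: app_def)

lemma endo_eqI: "(\<And>x. app S x = app T x) \<Longrightarrow> S = T"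
  by (simp add: app_def blin_inject[symmetric] blinfun_eqI)

lemma scaleR_as_scale: "r *\<^sub>R (x::complex^'n) = complex_of_real r *s x"
  by (vector scaleR_conv_of_real)

lemma blinfun_eq_iff: "f = g \<longleftrightarrow> (\<forall>x. blinfun_apply f x = blinfun_apply g x)"
  by (auto intro: blinfun_eqI)

instantiation endo :: (finite) real_normed_algebra_1
begin

definition "0 = Endo 0"
definition "1 = Endo id_blinfun"
definition "S + T = Endo (blin S + blin T)"
definition "S - T = Endo (blin S - blin T)"
definition "- T = Endo (- blin T)"
definition "S * T = Endo (blin S o\<^sub>L blin T)"
definition "r *\<^sub>R T = Endo (r *\<^sub>R blin T)"
definition "norm T = norm (blin T)"
definition "dist S T = norm (S - T)" for S T :: "'a endo"
definition "sgn T = inverse (norm T) *\<^sub>R T" for T :: "'a endo"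
definition "uniformity = (INF e\<in>{0 <..}. principal {(x :: 'a endo, y). dist x y < e})"
definition "open U \<longleftrightarrow> (\<forall>x\<in>U. eventually (\<lambda>(x', y). x' = x \<longrightarrow> y \<in> U) uniformity)" for U :: "'a endo set"

lemma blin_endo_simps:
  "blin (0 :: 'a endo) = 0" "blin (1 :: 'a endo) = id_blinfun"
  "blin (S + T) = blin S + blin T" "blin (S - T) = blin S - blin T" "blin (- T) = - blin T"
  "blin (S * T) = blin S o\<^sub>L blin T" "blin (r *\<^sub>R T) = r *\<^sub>R blin T"
proof -
  have s: "c *s (x + y) = c *s x + c *s y" "c *s (x - y) = c *s x - c *s y"
    "c *s (- x) = - (c *s x)" "c *s (r *\<^sub>R x) = r *\<^sub>R (c *s x)" for c r and x y :: "complex^'a"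
    by (vector algebra_simps)+
  have b: "blinfun_apply (blin T) (c *s x) = c *s blinfun_apply (blin T) x" for T :: "'a endo" and c x
    using blin[of T] by simp
  show "blin (0 :: 'a endo) = 0" "blin (1 :: 'a endo) = id_blinfun"
  "blin (S + T) = blin S + blin T" "blin (S - T) = blin S - blin T" "blin (- T) = - blin T"
  "blin (S * T) = blin S o\<^sub>L blin T" "blin (r *\<^sub>R T) = r *\<^sub>R blin T"
    unfolding zero_endo_def one_endo_def plus_endo_def minus_endo_def uminus_endo_def
      times_endo_def scaleR_endo_def
    by (subst Endo_inverse; simp add: s b blinfun.bilinear_simps)+
qed

instance
proof
  fix S T W :: "'a endo" and r :: real and U :: "'a endo set"
  show "dist S T = norm (S - T)" by (rule dist_endo_def)
  show "sgn S = inverse (norm S) *\<^sub>R S" by (rule sgn_endo_def)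
  show "uniformity = (INF e\<in>{0 <..}. principal {(x :: 'a endo, y). dist x y < e})"
    by (rule uniformity_endo_def)
  show "open U \<longleftrightarrow> (\<forall>x\<in>U. eventually (\<lambda>(x', y). x' = x \<longrightarrow> y \<in> U) uniformity)"
    by (rule open_endo_def)
  show "(norm S = 0) = (S = 0)"
    by (simp add: norm_endo_def blin_inject[symmetric] blin_endo_simps)
  show "norm (S + T) \<le> norm S + norm T"
    by (simp add: norm_endo_def blin_endo_simps norm_triangle_ineq)
  show "norm (S * T) \<le> norm S * norm T"
    by (simp add: norm_endo_def blin_endo_simps norm_blinfun_compose)
  show "S * T * W = S * (T * W)"
    by (rule blin_inject[THEN iffD1]) (simp add: blin_endo_simps blinfun_eqI)
  show "(0 :: 'a endo) \<noteq> 1"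
    by (metis blin_endo_simps(1,2) norm_blinfun_id norm_zero zero_neq_one)
qed (simp_all add: blin_inject[symmetric] blin_endo_simps norm_endo_def blinfun_eq_iff
       blinfun.bilinear_simps algebra_simps)

end

lemma app_simps [simp]:
  "app 0 x = 0" "app 1 x = x" "app (S * T) x = app S (app T x)"
  "app T 0 = 0"
  by (simp_all add: app_def blin_endo_simps blinfun.bilinear_simps)

lemma app_lin:
  "app (S + T) x = app S x + app T x" "app (S - T) x = app S x - app T x" "app (- T) x = - app T x"
  "app (r *\<^sub>R T) x = r *\<^sub>R app T x" "app T (x + y) = app T x + app T y"
  "app T (x - y) = app T x - app T y" "app T (- x) = - app T x" "app T (r *\<^sub>R x) = r *\<^sub>R app T x"
  by (simp_all add: app_def blin_endo_simps blinfun.bilinear_simps)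

lemma norm_app: "norm (app T x) \<le> norm T * norm x"
  by (simp add: app_def norm_endo_def norm_blinfun)

lemma bounded_bilinear_app: "bounded_bilinear app"
  by (rule bounded_bilinear.intro) (auto simp: app_lin intro!: exI[of _ 1] norm_app)

interpretation app: bounded_bilinear app by (rule bounded_bilinear_app)

instance endo :: (finite) banach
proof
  fix X :: "nat \<Rightarrow> 'a endo"
  assume "Cauchy X"
  then have "Cauchy (\<lambda>k. blin (X k))"
    by (simp add: Cauchy_def dist_norm norm_endo_def blin_endo_simps)
  then obtain L where L: "(\<lambda>k. blin (X k)) \<longlonglongrightarrow> L"
    using Cauchy_convergent_iff convergent_def by blast
  have ap: "(\<lambda>k. blinfun_apply (blin (X k)) x) \<longlonglongrightarrow> blinfun_apply L x" for x
    by (intro tendsto_intros L)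
  have "blinfun_apply L (c *s x) = c *s blinfun_apply L x" for c x
  proof (rule LIMSEQ_unique[OF ap])
    have bl: "bounded_linear (\<lambda>v :: complex^'a. c *s v)"
      by (rule linear_conv_bounded_linear[THEN iffD1], rule linearI) (vector algebra_simps)+
    show "(\<lambda>k. blinfun_apply (blin (X k)) (c *s x)) \<longlonglongrightarrow> c *s blinfun_apply L x"
      unfolding app_scale[unfolded app_def] by (rule bounded_linear.tendsto[OF bl ap])
  qed
  then have "blin (Endo L) = L" by (simp add: Endo_inverse)
  then have "(\<lambda>k. X k) \<longlonglongrightarrow> Endo L"
    using L by (simp add: LIMSEQ_iff norm_endo_def blin_endo_simps)
  then show "convergent X" by (auto simp: convergent_def)
qed

lemma linear_imp_bounded_linear:
  fixes f :: "complex^'n \<Rightarrow> complex^'m"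
  assumes "Vector_Spaces.linear (*s) (*s) f"
  shows "bounded_linear f"
proof -
  interpret f: Vector_Spaces.linear "(*s)" "(*s)" f by fact
  show ?thesis
    by (rule linear_conv_bounded_linear[THEN iffD1], rule linearI)
       (simp_all add: f.add f.scale scaleR_as_scale)
qed

definition op :: "(complex^'n \<Rightarrow> complex^'n) \<Rightarrow> 'n::finite endo" where
  "op f = Endo (Blinfun f)"

lemma app_op:
  assumes "Vector_Spaces.linear (*s) (*s) f"
  shows "app (op f) x = f x"
proof -
  interpret f: Vector_Spaces.linear "(*s)" "(*s)" f by fact
  have "blinfun_apply (Blinfun f) = f"
    using linear_imp_bounded_linear[OF assms] by (rule bounded_linear_Blinfun_apply)
  then show ?thesis by (simp add: op_def app_def Endo_inverse f.scale)
qed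

lemma linear_scaleI:
  fixes f :: "complex^'n \<Rightarrow> complex^'m"
  assumes "\<And>x y. f (x + y) = f x + f y" "\<And>c x. f (c *s x) = c *s f x"
  shows "Vector_Spaces.linear (*s) (*s) f"
  by unfold_locales (auto simp: assms vec.scale_right_distrib vec.scale_left_distrib)

lemma linear_app: "Vector_Spaces.linear (*s) (*s) (app T)"
  by (intro linear_scaleI) (simp_all add: app_lin app_scale)

definition scal :: "complex \<Rightarrow> 'n::finite endo" where
  "scal c = op (\<lambda>x. c *s x)"

lemma app_scal [simp]: "app (scal c) x = c *s x"
  unfolding scal_def by (subst app_op) (auto intro!: linear_scaleI simp: vec.scale_right_distrib mult.commute)

lemma scal_simps:
  "scal 0 = 0" "scal 1 = 1" "scal (a + b) = scal a + scal b" "scal (a - b) = scal a - scal b"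
  "scal (- a) = - scal a" "scal (a * b) = scal a * scal b"
  by (rule endo_eqI; simp add: app_lin vec.scale_left_distrib vec.scale_left_diff_distrib)+

lemma scal_commute: "scal c * T = T * scal c"
  by (rule endo_eqI) (simp add: app_scale)

lemma scal_left_commute: "T * (scal c * S) = scal c * (T * S)"
  by (metis scal_commute mult.assoc)

lemma scal_of_real: "scal (complex_of_real r) = r *\<^sub>R 1"
  by (rule endo_eqI) (simp add: app_lin scaleR_as_scale)

lemma scal_of_real_mult: "scal (complex_of_real r) * T = r *\<^sub>R T"
  by (simp add: scal_of_real)

lemma norm_scale_vec: "norm (c *s (x::complex^'n)) = norm c * norm x"
  by (simp add: norm_vec_def norm_mult L2_set_right_distrib)

lemma norm_endo_le: "(\<And>x. norm (app T x) \<le> b * norm x) \<Longrightarrow> 0 \<le> b \<Longrightarrow> norm T \<le> b"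
  unfolding norm_endo_def app_def by (rule norm_blinfun_bound)

lemma norm_scal: "norm (scal c :: 'n::finite endo) = norm c"
proof (rule antisym)
  show "norm (scal c :: 'n endo) \<le> norm c"
    by (rule norm_endo_le) (simp_all add: norm_scale_vec)
  have v: "(axis undefined 1 :: complex^'n) \<noteq> 0" by simp
  have "norm c * norm (axis undefined 1 :: complex^'n) \<le> norm (scal c :: 'n endo) * norm (axis undefined 1 :: complex^'n)"
    using norm_app[of "scal c" "axis undefined 1 :: complex^'n"] by (simp only: app_scal norm_scale_vec)
  then show "norm c \<le> norm (scal c :: 'n endo)" using v by simp
qed

lemma bounded_linear_scal: "bounded_linear scal"
  by (rule bounded_linear_intro[of _ 1]) (simp_all add: scal_simps norm_scal scaleR_conv_of_real scal_of_real)

section \<open>Entire functions of an operator\<close>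

text \<open>For an entire \<open>f\<close> the operator \<open>f(T)\<close> is the sum of the Taylor series at \<open>0\<close>. Every meromorphic function
  that is needed below is a quotient of two entire ones, which reduces all analysis to such series.\<close>

definition tcoeff :: "(complex \<Rightarrow> complex) \<Rightarrow> nat \<Rightarrow> complex" where
  "tcoeff f k = (deriv ^^ k) f 0 / fact k"

definition fcalc :: "(complex \<Rightarrow> complex) \<Rightarrow> 'n::finite endo \<Rightarrow> 'n endo" where
  "fcalc f T = (\<Sum>k. scal (tcoeff f k) * T ^ k)"

abbreviation entire :: "(complex \<Rightarrow> complex) \<Rightarrow> bool" where
  "entire f \<equiv> f holomorphic_on UNIV"

lemma entire_expansion: "entire f \<Longrightarrow> f has_fps_expansion fps_expansion f 0"
  by (rule has_fps_expansion_fps_expansion[of UNIV]) auto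

lemma tcoeff_fps: "f has_fps_expansion F \<Longrightarrow> tcoeff f k = fps_nth F k"
  by (simp add: tcoeff_def fps_nth_fps_expansion)

lemma tcoeff_summable:
  assumes "entire f" "r \<ge> 0"
  shows "summable (\<lambda>k. norm (tcoeff f k) * r ^ k)"
proof -
  have "(\<lambda>k. tcoeff f k * (complex_of_real (r + 1) - 0) ^ k) sums f (complex_of_real (r + 1))"
    unfolding tcoeff_def
    by (rule holomorphic_power_series[of _ 0 "r + 2"])
       (use assms in \<open>auto intro: holomorphic_on_subset simp del: of_real_add\<close>)
  then have "summable (\<lambda>k. norm (tcoeff f k * complex_of_real r ^ k))"
    by (intro powser_insidea[where x = "complex_of_real (r + 1)"])
       (use assms in \<open>auto simp: sums_iff simp del: of_real_add\<close>)
  then show ?thesis using assms(2) by (simp add: norm_mult norm_power)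
qed

lemma tcoeff_summable_linear:
  assumes "entire f" "r \<ge> 0"
  shows "summable (\<lambda>k. norm (tcoeff f k) * (real k * r ^ k))"
proof (rule summable_comparison_test'[where N = 0])
  show "summable (\<lambda>k. norm (tcoeff f k) * (2 * r) ^ k)"
    by (rule tcoeff_summable) (use assms in auto)
  have "real k \<le> 2 ^ k" for k by (rule less_imp_le[OF of_nat_less_two_power])
  then show "norm (norm (tcoeff f k) * (real k * r ^ k)) \<le> norm (tcoeff f k) * (2 * r) ^ k" for k
    using assms(2) by (auto simp: power_mult_distrib norm_mult norm_power intro!: mult_left_mono mult_right_mono)
qed

lemma summable_norm_fcalc:
  assumes "entire f"
  shows "summable (\<lambda>k. norm (scal (tcoeff f k) * T ^ k))"
proof (rule summable_comparison_test'[where N = 0])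
  show "summable (\<lambda>k. norm (tcoeff f k) * norm T ^ k)"
    by (rule tcoeff_summable) (use assms in auto)
  show "norm (norm (scal (tcoeff f k) * T ^ k)) \<le> norm (tcoeff f k) * norm T ^ k" for k
    using order_trans[OF norm_mult_ineq[of "scal (tcoeff f k)" "T ^ k"] mult_left_mono[OF norm_power_ineq]]
    by (simp add: norm_scal)
qed

lemma fcalc_sums:
  "entire f \<Longrightarrow> (\<lambda>k. scal (tcoeff f k) * T ^ k) sums fcalc f T"
  unfolding fcalc_def by (rule summable_sums[OF summable_norm_cancel[OF summable_norm_fcalc]])

text \<open>The Cauchy product of the two series; both converge absolutely.\<close>

lemma fcalc_mult:
  assumes "entire f" "entire g"
  shows "fcalc (\<lambda>s. f s * g s) T = fcalc f T * fcalc g T"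
proof -
  let ?F = "fps_expansion f 0" and ?G = "fps_expansion g 0"
  have c: "tcoeff (\<lambda>s. f s * g s) k = (\<Sum>i\<le>k. tcoeff f i * tcoeff g (k - i))" for k
    using tcoeff_fps[OF has_fps_expansion_mult[OF entire_expansion entire_expansion, OF assms]]
      tcoeff_fps[OF entire_expansion, OF assms(1)] tcoeff_fps[OF entire_expansion, OF assms(2)]
    by (simp add: fps_mult_nth atLeast0AtMost)
  have "(\<lambda>k. \<Sum>i\<le>k. (scal (tcoeff f i) * T ^ i) * (scal (tcoeff g (k - i)) * T ^ (k - i)))
      sums (fcalc f T * fcalc g T)"
    unfolding fcalc_def by (rule Cauchy_product_sums; rule summable_norm_fcalc; fact)
  also have "(\<lambda>k. \<Sum>i\<le>k. (scal (tcoeff f i) * T ^ i) * (scal (tcoeff g (k - i)) * T ^ (k - i)))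
      = (\<lambda>k. scal (tcoeff (\<lambda>s. f s * g s) k) * T ^ k)"
  proof
    fix k
    have "(scal (tcoeff f i) * T ^ i) * (scal (tcoeff g (k - i)) * T ^ (k - i))
        = scal (tcoeff f i * tcoeff g (k - i)) * T ^ k" if "i \<le> k" for i
    proof -
      have "T ^ i * T ^ (k - i) = T ^ k" using that by (simp flip: power_add)
      then show ?thesis
        by (simp add: mult.assoc scal_left_commute[of "T ^ i"] scal_simps)
    qed
    then show "(\<Sum>i\<le>k. (scal (tcoeff f i) * T ^ i) * (scal (tcoeff g (k - i)) * T ^ (k - i)))
        = scal (tcoeff (\<lambda>s. f s * g s) k) * T ^ k"
      by (simp add: c sum_distrib_right linear_sum[OF bounded_linear.linear[OF bounded_linear_scal]])
  qed
  finally show ?thesis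
    using fcalc_sums[of "\<lambda>s. f s * g s" T] assms
    by (metis holomorphic_on_mult sums_unique2)
qed

lemma fcalc_linear:
  assumes "entire f" "entire g"
  shows "fcalc (\<lambda>s. f s + g s) T = fcalc f T + fcalc g T"
    "fcalc (\<lambda>s. f s - g s) T = fcalc f T - fcalc g T"
proof -
  have c: "tcoeff (\<lambda>s. f s + g s) k = tcoeff f k + tcoeff g k"
    "tcoeff (\<lambda>s. f s - g s) k = tcoeff f k - tcoeff g k" for k
    using tcoeff_fps[OF has_fps_expansion_add[OF entire_expansion entire_expansion, OF assms]]
      tcoeff_fps[OF has_fps_expansion_diff[OF entire_expansion entire_expansion, OF assms]]
      tcoeff_fps[OF entire_expansion, OF assms(1)] tcoeff_fps[OF entire_expansion, OF assms(2)]
    by simp_all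
  show "fcalc (\<lambda>s. f s + g s) T = fcalc f T + fcalc g T"
    using sums_add[OF fcalc_sums fcalc_sums, OF assms, of T T] unfolding fcalc_def
    by (simp add: c scal_simps distrib_right sums_iff)
  show "fcalc (\<lambda>s. f s - g s) T = fcalc f T - fcalc g T"
    using sums_diff[OF fcalc_sums fcalc_sums, OF assms, of T T] unfolding fcalc_def
    by (simp add: c scal_simps left_diff_distrib sums_iff)
qed

lemma fcalc_const: "fcalc (\<lambda>s. c) T = scal c"
proof -
  have "(\<lambda>k. scal (tcoeff (\<lambda>s. c) k) * T ^ k) sums (\<Sum>k\<in>{0}. scal (tcoeff (\<lambda>s. c) k) * T ^ k)"
    by (rule sums_finite) (auto simp: tcoeff_fps[OF has_fps_expansion_const] scal_simps)
  then show ?thesis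
    unfolding fcalc_def by (simp add: sums_iff tcoeff_fps[OF has_fps_expansion_const])
qed

lemma fcalc_id: "fcalc (\<lambda>s. s) T = T"
proof -
  have "(\<lambda>k. scal (tcoeff (\<lambda>s. s) k) * T ^ k) sums (\<Sum>k\<in>{1}. scal (tcoeff (\<lambda>s. s) k) * T ^ k)"
    by (rule sums_finite) (auto simp: tcoeff_fps[OF has_fps_expansion_fps_X] scal_simps)
  then show ?thesis
    unfolding fcalc_def by (simp add: sums_iff tcoeff_fps[OF has_fps_expansion_fps_X] scal_simps)
qed

lemma fcalc_exp: "fcalc (\<lambda>s. exp (c * s)) T = exp (scal c * T)"
proof -
  have p: "(scal c * T) ^ k = scal (c ^ k) * T ^ k" for k
  proof (induction k)
    case (Suc k)
    then show ?case
      by (simp add: scal_simps mult.assoc scal_left_commute[of T])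
  qed (simp add: scal_simps)
  have "scal (tcoeff (\<lambda>s. exp (c * s)) k) * T ^ k = (scal c * T) ^ k /\<^sub>R fact k" for k
  proof -
    have "tcoeff (\<lambda>s. exp (c * s)) k = complex_of_real (1 / fact k) * c ^ k"
      by (simp add: tcoeff_fps[OF has_fps_expansion_exp])
    then show ?thesis
      by (simp only: scal_simps mult.assoc p scal_of_real_mult) (simp add: inverse_eq_divide)
  qed
  then show ?thesis by (simp add: fcalc_def exp_def)
qed

lemma fcalc_exp1: "fcalc exp T = exp T"
  using fcalc_exp[of 1 T] by (simp add: scal_simps)

text \<open>The value at \<open>X\<close> of the noncommutative divided difference of \<open>s ^ k\<close>, that is the sum of
  \<open>S ^ i * X * T ^ j\<close> over \<open>i + j = k - 1\<close>.\<close>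

fun power_dd :: "nat \<Rightarrow> 'n::finite endo \<Rightarrow> 'n endo \<Rightarrow> 'n endo \<Rightarrow> 'n endo" where
  "power_dd 0 S T X = 0"
| "power_dd (Suc k) S T X = S * power_dd k S T X + X * T ^ k"

lemma power_dd_intertwines: "S ^ k * Y - Y * T ^ k = power_dd k S T (S * Y - Y * T)"
proof (induction k)
  case (Suc k)
  have "S ^ Suc k * Y - Y * T ^ Suc k = S * (S ^ k * Y - Y * T ^ k) + (S * Y - Y * T) * T ^ k"
    by (simp add: algebra_simps)
  then show ?case using Suc by simp
qed simp

lemma power_dd_lin:
  "power_dd k S T (X + Y) = power_dd k S T X + power_dd k S T Y"
  "power_dd k S T (r *\<^sub>R X) = r *\<^sub>R power_dd k S T X"
  "power_dd k S T (scal c * X) = scal c * power_dd k S T X"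
  by (induction k) (simp_all add: algebra_simps scal_left_commute[of S] mult.assoc)

lemma norm_power_dd:
  assumes "norm S \<le> r" "norm T \<le> r" "1 \<le> r"
  shows "norm (power_dd k S T X) \<le> real k * r ^ k * norm X"
proof (induction k)
  case (Suc k)
  have r0: "0 \<le> r" using assms by simp
  have "norm (S * power_dd k S T X) \<le> r * (real k * r ^ k * norm X)"
    by (rule order_trans[OF norm_mult_ineq mult_mono[OF assms(1) Suc]]) (use r0 in auto)
  moreover have "norm (X * T ^ k) \<le> norm X * (r * r ^ k)"
  proof (rule order_trans[OF norm_mult_ineq mult_left_mono])
    have "norm (T ^ k) \<le> norm T ^ k" by (rule norm_power_ineq)
    also have "\<dots> \<le> r ^ k" using assms by (intro power_mono) auto
    also have "\<dots> \<le> r * r ^ k" using assms(3) r0 mult_right_mono[of 1 r "r ^ k"] by simp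
    finally show "norm (T ^ k) \<le> r * r ^ k" .
  qed simp
  ultimately show ?case
    by (simp add: norm_triangle_ineq[THEN order_trans] algebra_simps)
qed simp

text \<open>The divided difference of \<open>f\<close>, in which \<open>S\<close> acts from the left and \<open>T\<close> from the right. It is the derivative
  of \<open>f(T)\<close> when \<open>S = T\<close>. Different \<open>S\<close> and \<open>T\<close> occur when an operator intertwines \<open>T\<close> with a translate
  of \<open>T\<close> by a scalar.\<close>

definition fdd :: "(complex \<Rightarrow> complex) \<Rightarrow> 'n::finite endo \<Rightarrow> 'n endo \<Rightarrow> 'n endo \<Rightarrow> 'n endo" where
  "fdd f S T X = (\<Sum>k. scal (tcoeff f k) * power_dd k S T X)"

lemma norm_fdd_term:
  assumes "norm S \<le> r" "norm T \<le> r" "1 \<le> r"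
  shows "norm (scal (tcoeff f k) * power_dd k S T X) \<le> norm (tcoeff f k) * (real k * r ^ k) * norm X"
proof -
  have "norm (scal (tcoeff f k) * power_dd k S T X) \<le> norm (tcoeff f k) * norm (power_dd k S T X)"
    using norm_mult_ineq[of "scal (tcoeff f k)" "power_dd k S T X"] by (simp add: norm_scal)
  also have "\<dots> \<le> norm (tcoeff f k) * (real k * r ^ k * norm X)"
    by (intro mult_left_mono norm_power_dd assms) auto
  finally show ?thesis by (simp add: mult.assoc)
qed

lemma fdd_sums:
  assumes "entire f"
  shows "(\<lambda>k. scal (tcoeff f k) * power_dd k S T X) sums fdd f S T X"
  unfolding fdd_def
proof (rule summable_sums, rule summable_comparison_test'[where N = 0])
  define r where "r = 1 + norm S + norm T"
  show "summable (\<lambda>k. norm (tcoeff f k) * (real k * r ^ k) * norm X)"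
    by (intro summable_mult2 tcoeff_summable_linear assms) (simp add: r_def)
  show "norm (scal (tcoeff f k) * power_dd k S T X) \<le> norm (tcoeff f k) * (real k * r ^ k) * norm X" for k
    by (rule norm_fdd_term) (auto simp: r_def)
qed

lemma fdd_intertwines:
  assumes "entire f"
  shows "fcalc f S * Y - Y * fcalc f T = fdd f S T (S * Y - Y * T)"
proof -
  have s: "(\<lambda>k. (scal (tcoeff f k) * S ^ k) * Y - Y * (scal (tcoeff f k) * T ^ k))
      sums (fcalc f S * Y - Y * fcalc f T)"
    by (intro sums_diff sums_mult sums_mult2 fcalc_sums assms)
  have e: "(\<lambda>k. (scal (tcoeff f k) * S ^ k) * Y - Y * (scal (tcoeff f k) * T ^ k))
      = (\<lambda>k. scal (tcoeff f k) * power_dd k S T (S * Y - Y * T))"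
    by (rule ext)
       (simp only: power_dd_intertwines[symmetric] mult.assoc scal_left_commute[of Y] right_diff_distrib)
  show ?thesis
    by (rule sums_unique2[OF s[unfolded e] fdd_sums[OF assms]])
qed

lemma fdd_lin:
  assumes "entire f"
  shows "fdd f S T (X + Y) = fdd f S T X + fdd f S T Y"
    "fdd f S T (r *\<^sub>R X) = r *\<^sub>R fdd f S T X"
    "fdd f S T (scal c * X) = scal c * fdd f S T X"
proof -
  show "fdd f S T (X + Y) = fdd f S T X + fdd f S T Y"
    using sums_add[OF fdd_sums fdd_sums, OF assms assms, of S T X S T Y] fdd_sums[OF assms, of S T "X + Y"]
    by (simp add: power_dd_lin distrib_left sums_iff)
  show "fdd f S T (r *\<^sub>R X) = r *\<^sub>R fdd f S T X"
    using bounded_linear.sums[OF bounded_linear_scaleR_right fdd_sums[OF assms], of r S T X]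
      fdd_sums[OF assms, of S T "r *\<^sub>R X"]
    by (simp add: power_dd_lin sums_iff)
  show "fdd f S T (scal c * X) = scal c * fdd f S T X"
    using sums_mult[OF fdd_sums[OF assms], of "scal c" S T X]
      fdd_sums[OF assms, of S T "scal c * X"]
    by (simp add: power_dd_lin sums_iff scal_left_commute[of "scal _"])
qed

lemma fdd_zero: "entire f \<Longrightarrow> fdd f S T 0 = 0"
  using fdd_lin(2)[of f S T 0 0] by simp

lemma continuous_power_dd:
  "continuous_on A (\<lambda>p. power_dd k (fst p) (fst (snd p)) (snd (snd p)))"
  by (induction k) (auto intro!: continuous_intros)

text \<open>The series of the divided difference converges uniformly on bounded sets of arguments.\<close>

lemma tendsto_fdd:
  fixes S :: "'b \<Rightarrow> 'n::finite endo"
  assumes f: "entire f" and "(S \<longlongrightarrow> S0) F" "(T \<longlongrightarrow> T0) F" "(X \<longlongrightarrow> X0) F"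
  shows "((\<lambda>i. fdd f (S i) (T i) (X i)) \<longlongrightarrow> fdd f S0 T0 X0) F"
proof -
  define r where "r = 1 + norm S0 + norm T0 + norm X0"
  define A where "A = ball (0::'n endo) r \<times> ball (0::'n endo) r \<times> ball (0::'n endo) r"
  let ?t = "\<lambda>k p. scal (tcoeff f k) * power_dd k (fst p) (fst (snd p)) (snd (snd p))"
  have r: "1 \<le> r" by (simp add: r_def)
  have "uniform_limit A (\<lambda>n p. \<Sum>k<n. ?t k p) (\<lambda>p. \<Sum>k. ?t k p) sequentially"
  proof (rule Weierstrass_m_test)
    show "summable (\<lambda>k. norm (tcoeff f k) * (real k * r ^ k) * r)"
      by (intro summable_mult2 tcoeff_summable_linear f) (use r in simp)
    fix k p assume "p \<in> A"
    then have "norm (fst p) \<le> r" "norm (fst (snd p)) \<le> r" and x: "norm (snd (snd p)) \<le> r"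
      by (auto simp: A_def)
    then have "norm (?t k p) \<le> norm (tcoeff f k) * (real k * r ^ k) * norm (snd (snd p))"
      by (intro norm_fdd_term r)
    also have "\<dots> \<le> norm (tcoeff f k) * (real k * r ^ k) * r"
      by (intro mult_left_mono x) (use r in auto)
    finally show "norm (?t k p) \<le> norm (tcoeff f k) * (real k * r ^ k) * r" .
  qed
  then have "continuous_on A (\<lambda>p. \<Sum>k. ?t k p)"
    by (rule uniform_limit_theorem[rotated])
       (auto intro!: always_eventually continuous_intros continuous_power_dd)
  moreover have "open A" "(S0, T0, X0) \<in> A"
    unfolding A_def r_def by (auto intro!: open_Times add_pos_nonneg)
  ultimately have "isCont (\<lambda>p. \<Sum>k. ?t k p) (S0, T0, X0)"
    by (simp add: continuous_on_eq_continuous_at)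
  from isCont_tendsto_compose[OF this, of "\<lambda>i. (S i, T i, X i)" F] show ?thesis
    using assms by (simp add: fdd_def tendsto_Pair)
qed

lemma tendsto_fcalc:
  assumes "entire f" "(S \<longlongrightarrow> S0) F"
  shows "((\<lambda>i. fcalc f (S i)) \<longlongrightarrow> fcalc f S0) F"
proof -
  have "((\<lambda>i. fdd f (S i) S0 (S i - S0)) \<longlongrightarrow> fdd f S0 S0 (S0 - S0)) F"
    by (intro tendsto_fdd tendsto_intros assms)
  moreover have "fdd f (S i) S0 (S i - S0) = fcalc f (S i) - fcalc f S0" for i
    using fdd_intertwines[OF assms(1), of "S i" 1 S0] by simp
  ultimately show ?thesis
    using LIM_zero_cancel by (fastforce simp: fdd_zero[OF assms(1)])
qed

lemma fcalc_commute:
  assumes "entire f" "T * Y = Y * T"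
  shows "fcalc f T * Y = Y * fcalc f T"
  using fdd_intertwines[OF assms(1), of T Y T] assms by (simp add: fdd_zero)

lemma fcalc_commute_fcalc:
  assumes "entire f" "entire g"
  shows "fcalc f T * fcalc g T = fcalc g T * fcalc f T"
  by (rule fcalc_commute[OF assms(1)]) (rule fcalc_commute[OF assms(2), symmetric, THEN sym, symmetric], simp)

text \<open>A difference quotient that is linear in the direction and converges in every direction
  gives a Frechet derivative, because the space of directions is finite dimensional.\<close>

lemma has_derivative_from_slope:
  fixes f :: "'a::euclidean_space \<Rightarrow> 'b::real_normed_vector"
  assumes lin: "\<And>x. linear (N x)"
    and conv: "\<And>b. b \<in> Basis \<Longrightarrow> ((\<lambda>x. N x b) \<longlongrightarrow> N A b) (at A within V)"
    and eq: "\<forall>\<^sub>F x in at A within V. f x - f A = N x (x - A)"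
  shows "(f has_derivative N A) (at A within V)"
proof -
  have bl: "bounded_linear (N A)" using lin linear_conv_bounded_linear by blast
  define g where "g x = (\<Sum>b\<in>Basis. norm (N x b - N A b))" for x
  have "(g \<longlongrightarrow> (\<Sum>b\<in>(Basis::'a set). 0)) (at A within V)"
    unfolding g_def by (intro tendsto_sum tendsto_norm_zero LIM_zero conv)
  then have g0: "(g \<longlongrightarrow> 0) (at A within V)" by simp
  have bound: "norm (N x v - N A v) \<le> norm v * g x" for x v
  proof -
    interpret x: linear "N x" by (rule lin)
    interpret A: linear "N A" by (rule lin)
    have "N x v - N A v = N x (\<Sum>b\<in>Basis. (v \<bullet> b) *\<^sub>R b) - N A (\<Sum>b\<in>Basis. (v \<bullet> b) *\<^sub>R b)"
      by (simp add: euclidean_representation)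
    also have "\<dots> = (\<Sum>b\<in>Basis. (v \<bullet> b) *\<^sub>R (N x b - N A b))"
      by (simp add: x.sum A.sum x.scaleR A.scaleR sum_subtractf scaleR_diff_right)
    finally have "norm (N x v - N A v) = norm (\<Sum>b\<in>Basis. (v \<bullet> b) *\<^sub>R (N x b - N A b))"
      by (rule arg_cong)
    also have "\<dots> \<le> (\<Sum>b\<in>Basis. norm ((v \<bullet> b) *\<^sub>R (N x b - N A b)))"
      by (rule norm_sum)
    also have "\<dots> \<le> (\<Sum>b\<in>Basis. norm v * norm (N x b - N A b))"
      by (intro sum_mono) (auto intro!: mult_right_mono Basis_le_norm)
    finally show ?thesis by (simp add: g_def sum_distrib_left)
  qed
  show ?thesis
    unfolding has_derivative_within
  proof (intro conjI bl)
    show "((\<lambda>y. (1 / norm (y - A)) *\<^sub>R (f y - (f A + N A (y - A)))) \<longlongrightarrow> 0) (at A within V)"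
    proof (rule Lim_null_comparison[OF _ g0])
      show "\<forall>\<^sub>F y in at A within V. norm ((1 / norm (y - A)) *\<^sub>R (f y - (f A + N A (y - A)))) \<le> g y"
        using eq
      proof (eventually_elim)
        case (elim y)
        have "f y - (f A + N A (y - A)) = N y (y - A) - N A (y - A)"
          using elim by (simp add: algebra_simps)
        note e = this
        have "0 \<le> g y" by (simp add: g_def sum_nonneg)
        show ?case
        proof (cases "y = A")
          case False
          have "norm ((1 / norm (y - A)) *\<^sub>R (f y - (f A + N A (y - A))))
              = norm (N y (y - A) - N A (y - A)) / norm (y - A)"
            unfolding e by simp
          then show ?thesis
            using bound[of y "y - A"] False by (simp add: divide_le_eq mult.commute)
        qed (use \<open>0 \<le> g y\<close> in simp)
      qed
    qed
  qed
qed

section \<open>Determinants and inverses of operators\<close>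

definition edet :: "'n::finite endo \<Rightarrow> complex" where
  "edet T = det (matrix (app T))"

definition einv :: "'n::finite endo \<Rightarrow> 'n endo" where
  "einv T = op ((*v) (matrix_inv (matrix (app T))))"

lemma matrix_app: "matrix (app T) *v x = app T x"
  by (rule matrix_works) (rule linear_app)

lemma edet_mult: "edet (S * T) = edet S * edet T"
proof -
  have "app (S * T) = app S \<circ> app T" by (simp add: fun_eq_iff)
  then have "matrix (app (S * T)) = matrix (app S) ** matrix (app T)"
    by (simp add: matrix_compose_gen[OF linear_app linear_app])
  then show ?thesis by (simp add: edet_def det_mul)
qed

lemma edet_one: "edet (1 :: 'n::finite endo) = 1"
proof -
  have "matrix (app (1 :: 'n endo)) = mat 1"
    by (simp add: matrix_eq matrix_app)
  then show ?thesis by (simp add: edet_def)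
qed

lemma einv:
  assumes "edet T \<noteq> 0"
  shows "einv T * T = 1" "T * einv T = 1"
proof -
  let ?M = "matrix (app T)"
  have "invertible ?M" using assms by (simp add: edet_def invertible_det_nz)
  then have "?M ** matrix_inv ?M = mat 1" "matrix_inv ?M ** ?M = mat 1"
    unfolding invertible_def matrix_inv_def by (metis (mono_tags, lifting) someI_ex)+
  moreover have "app (einv T) x = matrix_inv ?M *v x" for x
    unfolding einv_def by (subst app_op) (auto intro!: linear_scaleI simp: matrix_vector_right_distrib vector_scalar_commute)
  ultimately have "app (einv T) (app T x) = x" "app T (app (einv T) x) = x" for x
    by (simp_all only: matrix_app[of T, symmetric] matrix_vector_mul_assoc matrix_vector_mul_lid)
  then show "einv T * T = 1" "T * einv T = 1"
    by (auto intro!: endo_eqI)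
qed

lemma einv_app:
  assumes "edet T \<noteq> 0"
  shows "app (einv T) (app T x) = x" "app T (app (einv T) x) = x"
  using einv[OF assms] by (metis app_simps(2,3))+

lemma edet_nonzero:
  assumes "V * T = 1"
  shows "edet T \<noteq> 0"
  using edet_mult[of V T] by (auto simp: assms edet_one)

lemma edet_nonzero_inj:
  assumes "\<And>x. app T x = 0 \<Longrightarrow> x = 0"
  shows "edet T \<noteq> 0"
proof -
  have "inj ((*v) (matrix (app T)))"
  proof (rule injI)
    fix x y assume "matrix (app T) *v x = matrix (app T) *v y"
    then have "app T (x - y) = 0" by (simp add: matrix_app app_lin)
    then show "x = y" using assms by force
  qed
  then show ?thesis
    by (simp add: edet_def invertible_det_nz[symmetric] invertible_left_inverse
        matrix_left_invertible_injective)
qed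

lemma einv_unique: "V * T = 1 \<Longrightarrow> V = einv T"
  by (metis edet_nonzero einv(2) mult.assoc mult.left_neutral mult.right_neutral)

lemma einv_commute:
  assumes "edet T \<noteq> 0" "T * Y = Y * T"
  shows "einv T * Y = Y * einv T"
proof -
  have "einv T * Y = einv T * (Y * T) * einv T"
    by (simp add: mult.assoc einv(2)[OF assms(1)])
  also have "\<dots> = (einv T * T) * Y * einv T"
    by (simp only: assms(2)[symmetric] mult.assoc)
  finally show ?thesis by (simp add: einv(1)[OF assms(1)])
qed

text \<open>Cramer's rule: the entries of the inverse are quotients of polynomials in the entries.\<close>

definition cramer_num :: "'n::finite endo \<Rightarrow> complex^'n \<Rightarrow> 'n \<Rightarrow> complex" where
  "cramer_num T b k = det (\<chi> i j. if j = k then b $ i else app T (axis j 1) $ i)"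

lemma einv_cramer:
  assumes "edet T \<noteq> 0"
  shows "app (einv T) b $ k = cramer_num T b k / edet T"
proof -
  have "matrix (app T) *v app (einv T) b = b"
    by (simp add: matrix_app einv_app[OF assms])
  then have "app (einv T) b = (\<chi> k. det (\<chi> i j. if j = k then b $ i else matrix (app T) $ i $ j)
      / det (matrix (app T)))"
    using cramer[of "matrix (app T)"] assms by (simp add: edet_def)
  then show ?thesis by (simp add: cramer_num_def edet_def matrix_def cong: if_cong)
qed

lemma vec_axis_sum: "(x :: complex^'n::finite) = (\<Sum>j\<in>UNIV. x $ j *s axis j 1)"
  by (simp add: basis_expansion)

lemma app_sum: "app T (\<Sum>i\<in>I. f i) = (\<Sum>i\<in>I. app T (f i))"
  by (induction I rule: infinite_finite_induct) (auto simp: app_lin)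

lemma app_sum_left: "app (\<Sum>i\<in>I. f i) x = (\<Sum>i\<in>I. app (f i) x)"
  by (induction I rule: infinite_finite_induct) (auto simp: app_lin)

lemma tendsto_app:
  "(T \<longlongrightarrow> T0) F \<Longrightarrow> (x \<longlongrightarrow> x0) F \<Longrightarrow> ((\<lambda>i. app (T i) (x i)) \<longlongrightarrow> app T0 x0) F"
  by (rule app.tendsto)

lemma tendsto_endoI:
  fixes T :: "'b \<Rightarrow> 'n::finite endo"
  assumes "\<And>j. ((\<lambda>i. app (T i) (axis j 1)) \<longlongrightarrow> app T0 (axis j 1)) F"
  shows "(T \<longlongrightarrow> T0) F"
proof (rule LIM_zero_cancel, rule Lim_null_comparison)
  have nb: "norm (S :: 'n endo) \<le> (\<Sum>j\<in>UNIV. norm (app S (axis j 1)))" for S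
  proof (rule norm_endo_le)
    fix x :: "complex^'n"
    have "norm (app S x) = norm (\<Sum>j\<in>UNIV. x $ j *s app S (axis j 1))"
      by (subst vec_axis_sum[of x]) (simp add: app_sum app_scale)
    also have "\<dots> \<le> (\<Sum>j\<in>UNIV. norm (x $ j) * norm (app S (axis j 1)))"
      by (rule order_trans[OF norm_sum]) (simp add: norm_scale_vec)
    also have "\<dots> \<le> (\<Sum>j\<in>UNIV. norm x * norm (app S (axis j 1)))"
      by (intro sum_mono mult_right_mono Finite_Cartesian_Product.norm_nth_le) auto
    finally show "norm (app S x) \<le> (\<Sum>j\<in>UNIV. norm (app S (axis j 1))) * norm x"
      by (simp add: sum_distrib_left mult.commute)
  qed (simp add: sum_nonneg)
  show "\<forall>\<^sub>F i in F. norm (T i - T0) \<le> (\<Sum>j\<in>UNIV. norm (app (T i) (axis j 1) - app T0 (axis j 1)))"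
    using nb[of "T _ - T0"] by (simp add: app_lin always_eventually)
  have "((\<lambda>i. \<Sum>j\<in>UNIV. norm (app (T i) (axis j 1) - app T0 (axis j 1))) \<longlongrightarrow> (\<Sum>j\<in>(UNIV::'n set). 0)) F"
    by (intro tendsto_sum tendsto_norm_zero LIM_zero assms)
  then show "((\<lambda>i. \<Sum>j\<in>UNIV. norm (app (T i) (axis j 1) - app T0 (axis j 1))) \<longlongrightarrow> 0) F"
    by simp
qed

lemma tendsto_det:
  fixes M :: "'b \<Rightarrow> complex^'n::finite^'n"
  assumes "\<And>i j. ((\<lambda>x. M x $ i $ j) \<longlongrightarrow> M0 $ i $ j) F"
  shows "((\<lambda>x. det (M x)) \<longlongrightarrow> det M0) F"
  unfolding det_def by (intro tendsto_intros assms)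

lemma tendsto_edet:
  assumes "(T \<longlongrightarrow> T0) F"
  shows "((\<lambda>i. edet (T i)) \<longlongrightarrow> edet T0) F"
  unfolding edet_def
  by (rule tendsto_det) (auto simp: matrix_def intro!: tendsto_intros tendsto_app assms)

lemma tendsto_einv:
  fixes T :: "'b \<Rightarrow> 'n::finite endo"
  assumes "(T \<longlongrightarrow> T0) F" "edet T0 \<noteq> 0"
  shows "((\<lambda>i. einv (T i)) \<longlongrightarrow> einv T0) F"
proof (rule tendsto_endoI)
  fix j :: 'n
  have ev: "\<forall>\<^sub>F i in F. edet (T i) \<noteq> 0"
    by (rule tendsto_imp_eventually_ne[OF tendsto_edet[OF assms(1)] assms(2)])
  show "((\<lambda>i. app (einv (T i)) (axis j 1)) \<longlongrightarrow> app (einv T0) (axis j 1)) F"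
  proof (rule vec_tendstoI)
    fix k
    have "((\<lambda>i. cramer_num (T i) (axis j 1) k / edet (T i)) \<longlongrightarrow> cramer_num T0 (axis j 1) k / edet T0) F"
    proof (intro tendsto_divide tendsto_edet assms)
      show "((\<lambda>i. cramer_num (T i) (axis j 1) k) \<longlongrightarrow> cramer_num T0 (axis j 1) k) F"
        unfolding cramer_num_def
      proof (rule tendsto_det)
        fix p q
        show "((\<lambda>x. (\<chi> i m. if m = k then axis j 1 $ i else app (T x) (axis m 1) $ i) $ p $ q)
          \<longlongrightarrow> (\<chi> i m. if m = k then axis j 1 $ i else app T0 (axis m 1) $ i) $ p $ q) F"
          by (cases "q = k") (auto intro!: tendsto_intros tendsto_app assms)
      qed
    qed
    then show "((\<lambda>i. app (einv (T i)) (axis j 1) $ k) \<longlongrightarrow> app (einv T0) (axis j 1) $ k) F"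
      unfolding einv_cramer[OF assms(2)]
      by (rule tendsto_cong[THEN iffD1, rotated])
         (rule eventually_mono[OF ev], simp add: einv_cramer)
  qed
qed

section \<open>Generalized eigenspaces\<close>

definition geig :: "'n::finite endo \<Rightarrow> complex \<Rightarrow> (complex^'n) set" where
  "geig T \<mu> = {x. \<exists>m. app ((T - scal \<mu>) ^ m) x = 0}"

lemma app_power_zero_mono:
  assumes "app (T ^ m) x = 0" "m \<le> k"
  shows "app (T ^ k) x = 0"
proof -
  have "T ^ k = T ^ (k - m) * T ^ m" using assms(2) by (simp flip: power_add)
  then show ?thesis using assms(1) by simp
qed

lemma geig_add: "x \<in> geig T \<mu> \<Longrightarrow> y \<in> geig T \<mu> \<Longrightarrow> x + y \<in> geig T \<mu>"
proof -
  assume "x \<in> geig T \<mu>" "y \<in> geig T \<mu>"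
  then obtain m k where "app ((T - scal \<mu>) ^ m) x = 0" "app ((T - scal \<mu>) ^ k) y = 0"
    by (auto simp: geig_def)
  then have "app ((T - scal \<mu>) ^ max m k) (x + y) = 0"
    by (simp add: app_lin app_power_zero_mono)
  then show ?thesis by (auto simp: geig_def)
qed

lemma geig_scale: "x \<in> geig T \<mu> \<Longrightarrow> c *s x \<in> geig T \<mu>"
  by (auto simp: geig_def app_scale)

lemma vec_subspaceI:
  assumes "0 \<in> S" "\<And>x y. x \<in> S \<Longrightarrow> y \<in> S \<Longrightarrow> x + y \<in> S" "\<And>c x. x \<in> S \<Longrightarrow> c *s x \<in> S"
  shows "vec.subspace S"
  using assms by (auto simp: vec.subspace_def)

text \<open>A strictly increasing chain of subspaces would exceed the dimension.\<close>

lemma subspace_chain_stops: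
  fixes S :: "nat \<Rightarrow> (complex^'n::finite) set"
  assumes "\<And>i. vec.subspace (S i)" "\<And>i. S i \<subseteq> S (Suc i)"
  shows "\<exists>i\<le>CARD('n). S (Suc i) = S i"
proof (rule ccontr)
  assume "\<not> ?thesis"
  then have ne: "S i \<subset> S (Suc i)" if "i \<le> CARD('n)" for i using assms(2)[of i] that by auto
  have "i \<le> vec.dim (S i)" if "i \<le> Suc CARD('n)" for i
    using that
  proof (induction i)
    case (Suc i)
    then have "vec.dim (S i) < vec.dim (S (Suc i))"
      using ne[of i] assms(1)[of i] assms(1)[of "Suc i"]
      by (intro vec.dim_psubset) (simp only: vec.span_eq_iff[THEN iffD2])
    then show ?case using Suc by simp
  qed simp
  from this[of "Suc CARD('n)"] show False
    using vec.dim_subset_UNIV[of "S (Suc CARD('n))"] by (simp add: vec.dimension_def vec_dim_card card_cart_basis)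
qed

text \<open>The kernels of the powers of \<open>T - \<mu>\<close> form a chain that is constant from its first repetition on.\<close>

lemma geig_power_card:
  assumes "x \<in> geig T \<mu>"
  shows "app ((T - scal \<mu>) ^ CARD('n)) (x :: complex^'n::finite) = 0"
proof -
  let ?N = "T - scal \<mu>"
  define S where "S i = {x. app (?N ^ i) x = 0}" for i
  have "\<exists>i\<le>CARD('n). S (Suc i) = S i"
    by (rule subspace_chain_stops)
       (auto simp: S_def app_lin app_scale intro!: vec_subspaceI intro: app_power_zero_mono[where m = "i" for i] simp del: power_Suc)
  then obtain i where i: "i \<le> CARD('n)" "S (Suc i) = S i" by blast
  have "S (i + k) = S i" for k
  proof (induction k)
    case (Suc k)
    have "x \<in> S i" if "x \<in> S (i + Suc k)" for x
    proof -
      have "app ?N x \<in> S (i + k)"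
        using that by (simp add: S_def power_commutes flip: app_simps(3))
      then have "app ?N x \<in> S i" using Suc by simp
      then have "x \<in> S (Suc i)" by (simp add: S_def power_commutes flip: app_simps(3))
      then show ?thesis using i by simp
    qed
    moreover have "x \<in> S (i + Suc k)" if "x \<in> S i" for x
      using that app_power_zero_mono[of ?N i x "i + Suc k"] by (simp add: S_def)
    ultimately show ?case by blast
  qed simp
  moreover obtain m where m: "app (?N ^ m) x = 0" using assms by (auto simp: geig_def)
  then have "x \<in> S (i + m)" using app_power_zero_mono[OF m, of "i + m"] by (simp add: S_def)
  ultimately have "x \<in> S i" by simp
  then show ?thesis using app_power_zero_mono[of ?N i x] i by (simp add: S_def)
qed

text \<open>On a generalized eigenspace for \<open>\<nu> \<noteq> \<mu>\<close> the operator \<open>T - \<mu>\<close> is the nonzero scalar \<open>\<nu> - \<mu>\<close> plus a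
  nilpotent operator.\<close>

lemma shift_surj_geig:
  assumes "app ((T - scal \<nu>) ^ m) w = 0" "\<nu> \<noteq> \<mu>"
  shows "\<exists>y. app ((T - scal \<nu>) ^ m) y = 0 \<and> app (T - scal \<mu>) y = w"
  using assms(1)
proof (induction m arbitrary: w)
  case 0
  then show ?case by (intro exI[of _ 0]) simp
next
  case (Suc m)
  let ?N = "T - scal \<nu>"
  have "app (?N ^ m) (app ?N w) = 0"
    using Suc.prems by (simp add: power_commutes flip: app_simps(3))
  then obtain y where y: "app (?N ^ m) y = 0" "app (T - scal \<mu>) y = app ?N w" using Suc.IH by blast
  have e: "app (T - scal \<mu>) u = app ?N u + (\<nu> - \<mu>) *s u" for u
    by (simp add: app_lin vec.scale_left_diff_distrib)
  define z where "z = (1 / (\<nu> - \<mu>)) *s (w - y)"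
  have "app (T - scal \<mu>) (w - y) = (\<nu> - \<mu>) *s w"
    unfolding app_lin(6) y(2) e[of w] by (simp only: add_diff_cancel_left')
  then have "app (T - scal \<mu>) z = w"
    unfolding z_def app_scale by (simp only: vec.scale_scale) (use assms(2) in simp)
  moreover have "app (?N ^ Suc m) z = 0"
    using Suc.prems app_power_zero_mono[OF y(1), of "Suc m"] by (simp add: z_def app_scale app_lin(6) del: power_Suc)
  ultimately show ?case by blast
qed

text \<open>If \<open>(T - \<mu>) x\<close> is a sum of generalized eigenvectors, then one can solve for each component whose eigenvalue
  is not \<open>\<mu>\<close>; what remains of \<open>x\<close> is a generalized eigenvector for \<open>\<mu>\<close>. By induction along the linear factors
  of an annihilating polynomial, the generalized eigenspaces span.\<close>

lemma geig_span_shift: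
  fixes T :: "'n::finite endo"
  defines "W \<equiv> vec.span (\<Union>\<nu>. geig T \<nu>)"
  assumes "app (T - scal \<mu>) x \<in> W"
  shows "x \<in> W"
proof -
  have "\<exists>y\<in>W. app (T - scal \<mu>) y - w \<in> geig T \<mu>" if "w \<in> W" for w
    using that unfolding W_def
  proof (induction rule: vec.span_induct_alt)
    case base
    show ?case by (intro bexI[of _ 0]) (auto simp: geig_def vec.span_zero)
  next
    case (step c w w')
    then obtain y' \<nu> where y': "y' \<in> W" "app (T - scal \<mu>) y' - w' \<in> geig T \<mu>" and w: "w \<in> geig T \<nu>"
      by (auto simp: W_def)
    have "\<exists>y\<in>W. app (T - scal \<mu>) y - w \<in> geig T \<mu>"
    proof (cases "\<nu> = \<mu>")
      case True
      then show ?thesis using w geig_scale[OF w, of "-1"]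
        by (intro bexI[of _ 0]) (auto simp: W_def vec.span_zero vec.scale_minus_left)
    next
      case False
      then obtain y m where "app ((T - scal \<nu>) ^ m) y = 0" "app (T - scal \<mu>) y = w"
        using w shift_surj_geig by (force simp: geig_def)
      then show ?thesis
        by (intro bexI[of _ y]) (auto simp: W_def geig_def intro!: vec.span_base)
    qed
    then obtain y where y: "y \<in> W" "app (T - scal \<mu>) y - w \<in> geig T \<mu>" by blast
    have "app (T - scal \<mu>) (c *s y + y') - (c *s w + w')
        = c *s (app (T - scal \<mu>) y - w) + (app (T - scal \<mu>) y' - w')"
      by (simp only: app_lin(5) app_scale vec.scale_right_diff_distrib) simp
    then have "app (T - scal \<mu>) (c *s y + y') - (c *s w + w') \<in> geig T \<mu>"
      using geig_add[OF geig_scale[OF y(2)] y'(2)] by (simp only:)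
    moreover have "c *s y + y' \<in> W"
      using y(1) y'(1) unfolding W_def by (intro vec.span_add vec.span_scale)
    ultimately show ?case unfolding W_def by blast
  qed
  from this[OF assms(2)] obtain y where y: "y \<in> W" "app (T - scal \<mu>) y - app (T - scal \<mu>) x \<in> geig T \<mu>" by blast
  then have "app (T - scal \<mu>) (y - x) \<in> geig T \<mu>" by (simp add: app_lin(6))
  then obtain m where "app ((T - scal \<mu>) ^ Suc m) (y - x) = 0"
    by (auto simp: geig_def power_commutes simp flip: app_simps(3))
  then have "y - x \<in> W" unfolding W_def by (intro vec.span_base) (auto simp: geig_def simp del: power_Suc)
  then have "y - (y - x) \<in> W" unfolding W_def by (rule vec.span_diff[OF y(1)[unfolded W_def]])
  moreover have "y - (y - x) = x" by simp
  ultimately show ?thesis by (simp only:)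
qed

lemma entire_poly: "entire (poly p)"
  by (intro holomorphic_intros)

lemma fcalc_pCons: "fcalc (poly (pCons a p)) T = scal a + T * fcalc (poly p) T"
proof -
  have "fcalc (\<lambda>s. a + s * poly p s) T = scal a + T * fcalc (poly p) T"
    by (simp add: fcalc_linear fcalc_mult fcalc_const fcalc_id holomorphic_intros entire_poly)
  moreover have "poly (pCons a p) = (\<lambda>s. a + s * poly p s)" by (simp add: fun_eq_iff)
  ultimately show ?thesis by simp
qed

lemma poly_annihilates_into_geig_span:
  assumes "p \<noteq> 0" "app (fcalc (poly p) T) x \<in> vec.span (\<Union>\<nu>. geig T \<nu>)"
  shows "x \<in> vec.span (\<Union>\<nu>. geig T \<nu>)"
  using assms
proof (induction "degree p" arbitrary: p)
  case 0
  then obtain c where c: "p = [:c:]" "c \<noteq> 0" by (metis degree_eq_zeroE pCons_eq_0_iff)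
  have "poly p = (\<lambda>s. c)" by (simp add: c(1) fun_eq_iff)
  then have "app (fcalc (poly p) T) x = c *s x"
    using fcalc_const[of c T] by simp
  then have "(1 / c) *s (c *s x) \<in> vec.span (\<Union>\<nu>. geig T \<nu>)"
    using 0 vec.span_scale by metis
  then show ?case using c by simp
next
  case (Suc d)
  then obtain \<mu> where "poly p \<mu> = 0" using alg_closed_imp_poly_has_root[of p] by auto
  then obtain q where q: "p = [:- \<mu>, 1:] * q" by (auto simp: poly_eq_0_iff_dvd)
  then have q0: "q \<noteq> 0" using Suc by auto
  then have dq: "d = degree q" using Suc(2) q by (simp add: degree_mult_eq del: mult_pCons_left)
  have "poly p = (\<lambda>s. (s - \<mu>) * poly q s)" by (simp add: q fun_eq_iff algebra_simps)
  moreover have "fcalc (\<lambda>s. (s - \<mu>) * poly q s) T = (T - scal \<mu>) * fcalc (poly q) T"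
    by (simp add: fcalc_linear fcalc_mult fcalc_const fcalc_id holomorphic_intros entire_poly)
  ultimately have "app (T - scal \<mu>) (app (fcalc (poly q) T) x) \<in> vec.span (\<Union>\<nu>. geig T \<nu>)"
    using Suc.prems by simp
  then show ?case using Suc.hyps(1)[OF dq q0] geig_span_shift by blast
qed

text \<open>The orbit of \<open>x\<close> under the powers of \<open>T\<close> is linearly dependent.\<close>

lemma exists_annihilating_poly:
  fixes T :: "'n::finite endo"
  shows "\<exists>p. p \<noteq> 0 \<and> app (fcalc (poly p) T) x = 0"
proof -
  define S where "S i = vec.span {app (T ^ k) x |k. k < i}" for i
  have "\<exists>i\<le>CARD('n). S (Suc i) = S i"
    by (rule subspace_chain_stops) (auto simp: S_def intro!: vec.span_mono)
  then obtain i where "S (Suc i) = S i" by blast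
  moreover have "app (T ^ i) x \<in> S (Suc i)" unfolding S_def by (rule vec.span_base) auto
  ultimately have "app (T ^ i) x \<in> S i" by simp
  have mon: "fcalc (poly (monom c k)) T = scal c * T ^ k" for c k
  proof (induction k)
    case (Suc k)
    show ?case
      by (simp only: monom_Suc fcalc_pCons Suc scal_simps(1) scal_left_commute[of T] power_Suc add_0_left)
  next
    case 0
    have "poly (monom c 0) = (\<lambda>s. c)" by (simp add: fun_eq_iff poly_monom)
    then show ?case using fcalc_const[of c T] by simp
  qed
  have add: "fcalc (poly (p + q)) T = fcalc (poly p) T + fcalc (poly q) T"
    "fcalc (poly (p - q)) T = fcalc (poly p) T - fcalc (poly q) T" for p q
  proof -
    have "poly (p + q) = (\<lambda>s. poly p s + poly q s)" "poly (p - q) = (\<lambda>s. poly p s - poly q s)"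
      by (simp_all add: fun_eq_iff)
    then show "fcalc (poly (p + q)) T = fcalc (poly p) T + fcalc (poly q) T"
      "fcalc (poly (p - q)) T = fcalc (poly p) T - fcalc (poly q) T"
      using fcalc_linear[OF entire_poly entire_poly, of p q T] by simp_all
  qed
  have "\<exists>q. (\<forall>k\<ge>i. coeff q k = 0) \<and> app (fcalc (poly q) T) x = y" if "y \<in> S i" for y
    using that unfolding S_def
  proof (induction rule: vec.span_induct_alt)
    case base
    show ?case using fcalc_const[of 0 T] by (intro exI[of _ 0]) (simp add: scal_simps)
  next
    case (step c y z)
    then obtain q k where q: "\<forall>k\<ge>i. coeff q k = 0" "app (fcalc (poly q) T) x = z" "k < i" "y = app (T ^ k) x"
      by blast
    then have "app (fcalc (poly (monom c k + q)) T) x = c *s y + z"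
      by (simp only: add mon app_lin(1) app_simps(3) app_scal)
    moreover have "\<forall>j\<ge>i. coeff (monom c k + q) j = 0" using q(1,3) by simp
    ultimately show ?case by blast
  qed
  from this[OF \<open>app (T ^ i) x \<in> S i\<close>] obtain q where
    q: "\<forall>k\<ge>i. coeff q k = 0" "app (fcalc (poly q) T) x = app (T ^ i) x" by blast
  have "app (fcalc (poly (monom 1 i - q)) T) x = 0"
    using q(2) by (simp add: add mon app_lin)
  moreover have "coeff (monom 1 i - q) i = 1" using q(1) by simp
  then have "monom 1 i - q \<noteq> 0" by (metis coeff_0 zero_neq_one)
  ultimately show ?thesis by blast
qed

lemma geig_span: "vec.span (\<Union>\<nu>. geig T \<nu>) = UNIV"
  using exists_annihilating_poly poly_annihilates_into_geig_span vec.span_zero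
  by (metis UNIV_eq_I)

section \<open>Meromorphic functions of an operator\<close>

lemma entire_eventually_nonzero:
  assumes f: "entire f" and a: "f a \<noteq> 0"
  shows "\<forall>\<^sub>F s in at b. f s \<noteq> 0"
proof (cases "f b = 0")
  case True
  obtain r where r: "0 < r" "\<And>z. z \<in> ball b r - {b} \<Longrightarrow> f z \<noteq> 0"
    using isolated_zeros[OF f open_UNIV connected_UNIV UNIV_I True UNIV_I a] by metis
  then show ?thesis unfolding eventually_at by (intro exI[of _ r]) (auto simp: dist_commute)
next
  case False
  have "isCont f b" using f holomorphic_on_imp_continuous_on continuous_on_eq_continuous_at by blast
  then show ?thesis using tendsto_imp_eventually_ne[OF _ False] by (simp add: isCont_def)
qed

definition taylor :: "(complex \<Rightarrow> complex) \<Rightarrow> complex \<Rightarrow> nat \<Rightarrow> complex" where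
  "taylor f \<mu> k = (deriv ^^ k) f \<mu> / fact k"

lemma taylor_fps: "(\<lambda>s. f (\<mu> + s)) has_fps_expansion F \<Longrightarrow> taylor f \<mu> k = fps_nth F k"
proof -
  assume F: "(\<lambda>s. f (\<mu> + s)) has_fps_expansion F"
  have "(deriv ^^ k) (\<lambda>s. f (\<mu> + s)) 0 = (deriv ^^ k) f \<mu>"
    by (simp add: higher_deriv_shift_0[of k f \<mu>] o_def)
  then show ?thesis using fps_nth_fps_expansion[OF F, of k] by (simp add: taylor_def)
qed

lemma analytic_expansion:
  "f analytic_on {\<mu>} \<Longrightarrow> (\<lambda>s. f (\<mu> + s)) has_fps_expansion fps_expansion f \<mu>"
  by (rule analytic_at_imp_has_fps_expansion)

lemma taylor_analytic: "f analytic_on {\<mu>} \<Longrightarrow> taylor f \<mu> k = fps_nth (fps_expansion f \<mu>) k"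
  by (rule taylor_fps[OF analytic_expansion])

lemma taylor_mult:
  assumes "f analytic_on {\<mu>}" "g analytic_on {\<mu>}"
  shows "taylor (\<lambda>s. f s * g s) \<mu> k = (\<Sum>i\<le>k. taylor f \<mu> i * taylor g \<mu> (k - i))"
  using taylor_fps[OF has_fps_expansion_mult[OF analytic_expansion analytic_expansion, OF assms]]
  by (simp add: fps_mult_nth atLeast0AtMost taylor_analytic assms)

lemma entire_divide:
  assumes "entire g" "g a = 0"
  obtains G where "entire G" "\<And>s. g s = (s - a) * G s"
proof
  show "entire (\<lambda>z. if z = a then deriv g a else (g z - g a) / (z - a))"
    by (rule pole_lemma_open) (use assms in auto)
qed (use assms in auto)

lemma entire_analytic: "entire f \<Longrightarrow> f analytic_on {\<mu>}"
  using analytic_at by blast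

text \<open>On the kernel of \<open>(T - \<mu>) ^ m\<close> only the Taylor polynomial of \<open>f\<close> at \<open>\<mu>\<close> matters. Dividing \<open>f - f(\<mu>)\<close> by
  \<open>s - \<mu>\<close> shifts the Taylor coefficients by one and lowers \<open>m\<close>.\<close>

lemma fcalc_on_geig:
  assumes "entire f" "app ((T - scal \<mu>) ^ m) x = 0"
  shows "app (fcalc f T) x = (\<Sum>k<m. taylor f \<mu> k *s app ((T - scal \<mu>) ^ k) x)"
  using assms
proof (induction m arbitrary: f x)
  case (Suc m)
  let ?N = "T - scal \<mu>"
  have "entire (\<lambda>s. f s - f \<mu>)" using Suc.prems(1) by (intro holomorphic_intros)
  then obtain G where G: "entire G" "\<And>s. f s - f \<mu> = (s - \<mu>) * G s"
    using entire_divide[of "\<lambda>s. f s - f \<mu>" \<mu>] by auto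
  have f: "f = (\<lambda>s. f \<mu> + G s * (s - \<mu>))" using G(2) by (force simp: algebra_simps)
  have ff: "fcalc f T = scal (f \<mu>) + fcalc G T * ?N"
    by (subst f) (simp add: fcalc_linear fcalc_mult fcalc_const fcalc_id holomorphic_intros G(1))
  have "(\<lambda>s. f \<mu> + G (\<mu> + s) * s) has_fps_expansion (fps_const (f \<mu>) + fps_expansion G \<mu> * fps_X)"
    by (intro fps_expansion_intros analytic_expansion entire_analytic G(1))
  moreover have "(\<lambda>s. f (\<mu> + s)) = (\<lambda>s. f \<mu> + G (\<mu> + s) * s)" by (subst f) simp
  ultimately have tf: "taylor f \<mu> k = fps_nth (fps_const (f \<mu>) + fps_expansion G \<mu> * fps_X) k" for k
    using taylor_fps by metis
  then have t0: "taylor f \<mu> 0 = f \<mu>" and tS: "taylor f \<mu> (Suc k) = taylor G \<mu> k" for k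
    by (simp_all add: taylor_analytic entire_analytic G(1))
  have "app (?N ^ m) (app ?N x) = 0" using Suc.prems(2) by (simp add: power_commutes flip: app_simps(3))
  then have "app (fcalc G T) (app ?N x) = (\<Sum>k<m. taylor G \<mu> k *s app (?N ^ k) (app ?N x))"
    using Suc.IH[OF G(1)] by blast
  also have "\<dots> = (\<Sum>k<m. taylor f \<mu> (Suc k) *s app (?N ^ Suc k) x)"
    by (simp add: tS power_commutes flip: app_simps(3))
  finally have "app (fcalc f T) x = f \<mu> *s x + (\<Sum>k<m. taylor f \<mu> (Suc k) *s app (?N ^ Suc k) x)"
    by (simp only: ff app_lin(1) app_simps(3) app_scal)
  then show ?case
    by (simp only: sum.lessThan_Suc_shift t0 power_0 app_simps(2))
qed (simp add: fcalc_def)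

lemma op_shift_funpow:
  "((\<lambda>y. app T y - \<mu> *s y) ^^ k) x = app ((T - scal \<mu>) ^ k) x"
  by (induction k) (simp_all add: app_lin)

text \<open>If \<open>f = k / w\<close> with \<open>w(T)\<close> invertible, then \<open>w\<close> does not vanish at the eigenvalues of \<open>T\<close>. On each
  generalized eigenspace the Taylor polynomial \<open>p\<close> of \<open>f\<close> satisfies \<open>p(T) w(T) = k(T)\<close>, and the generalized
  eigenspaces span; hence \<open>k(T) / w(T)\<close> is the operator characterized by the definition of \<open>f(T)\<close>.\<close>

lemma operator_function_quotient:
  fixes T :: "'n::finite endo"
  assumes w: "entire w" and k: "entire k" and d: "edet (fcalc w T) \<noteq> 0"
    and f: "\<And>\<mu>. w \<mu> \<noteq> 0 \<Longrightarrow> \<forall>\<^sub>F s in at \<mu>. f s = k s / w s"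
  shows "operator_function f (app T) x = app (einv (fcalc w T) * fcalc k T) x"
proof -
  let ?n = "CARD('n)"
  let ?F = "einv (fcalc w T) * fcalc k T"
  define P where "P F \<longleftrightarrow> Vector_Spaces.linear (*s) (*s) F \<and>
     (\<forall>\<mu> x. app ((T - scal \<mu>) ^ ?n) x = 0 \<longrightarrow>
        F x = (\<Sum>k<?n. taylor (remove_sings f) \<mu> k *s app ((T - scal \<mu>) ^ k) x))"
    for F :: "complex^'n \<Rightarrow> complex^'n"
  have "app ?F x = (\<Sum>k<?n. taylor (remove_sings f) \<mu> k *s app ((T - scal \<mu>) ^ k) x)"
    if x: "app ((T - scal \<mu>) ^ ?n) x = 0" for \<mu> x
  proof (cases "x = 0")
    case False
    let ?N = "T - scal \<mu>"
    have "w \<mu> \<noteq> 0"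
    proof
      assume w0: "w \<mu> = 0"
      \<comment> \<open>the last nonzero iterate is an eigenvector, which \<open>w(T)\<close> would annihilate\<close>
      define i where "i = (LEAST i. app (?N ^ i) x = 0)"
      have i: "app (?N ^ i) x = 0" unfolding i_def by (rule LeastI) (rule x)
      then obtain j where j: "i = Suc j" using False by (cases i) auto
      have "app (?N ^ j) x \<noteq> 0" using not_less_Least[of j "\<lambda>i. app (?N ^ i) x = 0"] j i_def by auto
      moreover have "app (?N ^ 1) (app (?N ^ j) x) = 0" using i j by simp
      then have "app (fcalc w T) (app (?N ^ j) x) = 0"
        using fcalc_on_geig[OF w, of T \<mu> 1] w0 by (simp add: taylor_def)
      then have "app (?N ^ j) x = 0" using einv_app(1)[OF d] by (metis app_simps(4))
      ultimately show False by simp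
    qed
    note w\<mu> = this
    define q where "q s = k s / w s" for s
    have wne: "\<forall>\<^sub>F z in nhds \<mu>. w z \<noteq> 0"
    proof -
      have "isCont w \<mu>" using w holomorphic_on_imp_continuous_on continuous_on_eq_continuous_at by blast
      then have "(w \<longlongrightarrow> w \<mu>) (nhds \<mu>)" by (simp add: isCont_def tendsto_at_iff_tendsto_nhds)
      from tendsto_imp_eventually_ne[OF this w\<mu>] show ?thesis .
    qed
    have fa: "q analytic_on {\<mu>}"
      unfolding q_def by (intro analytic_intros entire_analytic k w) (use w\<mu> in auto)
    have fw: "\<forall>\<^sub>F s in nhds \<mu>. q s * w s = k s"
      using wne by eventually_elim (simp add: q_def)
    have rq: "remove_sings f z = q z" if wz: "w z \<noteq> 0" for z
    proof (rule remove_sings_eqI)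
      have "q analytic_on {z}"
        unfolding q_def by (intro analytic_intros entire_analytic k w) (use wz in auto)
      then have "q \<midarrow>z\<rightarrow> q z" by (intro isContD analytic_at_imp_isCont)
      then show "f \<midarrow>z\<rightarrow> q z"
        by (rule Lim_transform_eventually) (use f[OF wz] in \<open>simp add: q_def eq_commute\<close>)
    qed
    have rs: "taylor (remove_sings f) \<mu> i = taylor q \<mu> i" for i
      unfolding taylor_def
      by (intro arg_cong2[where f = "(/)"] higher_deriv_cong_ev refl eventually_mono[OF wne] rq)
    define a where "a i = (if i < ?n then taylor q \<mu> i else 0)" for i
    define p where "p s = (\<Sum>i<?n. a i * (s - \<mu>) ^ i)" for s
    have p: "entire p" unfolding p_def by (intro holomorphic_intros)
    have fp: "((\<lambda>s. p (\<mu> + s)) has_fps_expansion (\<Sum>i<?n. fps_const (a i) * fps_X ^ i))"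
      unfolding p_def by (simp, intro fps_expansion_intros)
    have tp: "taylor p \<mu> i = a i" for i
      by (subst taylor_fps[OF fp]) (auto simp: fps_sum_nth a_def if_distrib cong: if_cong)
    have tk: "taylor (\<lambda>s. p s * w s) \<mu> i = taylor k \<mu> i" if "i < ?n" for i
    proof -
      have "taylor k \<mu> i = taylor (\<lambda>s. q s * w s) \<mu> i"
        unfolding taylor_def
        by (intro arg_cong2[where f = "(/)"] higher_deriv_cong_ev refl eventually_mono[OF fw]) auto
      also have "\<dots> = (\<Sum>j\<le>i. taylor q \<mu> j * taylor w \<mu> (i - j))"
        by (intro taylor_mult fa entire_analytic w)
      also have "\<dots> = (\<Sum>j\<le>i. taylor p \<mu> j * taylor w \<mu> (i - j))"
        using that by (intro sum.cong) (auto simp: tp a_def)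
      also have "\<dots> = taylor (\<lambda>s. p s * w s) \<mu> i"
        by (intro taylor_mult[symmetric] entire_analytic w p)
      finally show ?thesis by simp
    qed
    have "app (fcalc (\<lambda>s. p s * w s) T) x = app (fcalc k T) x"
      using tk by (simp add: fcalc_on_geig[OF _ x] k holomorphic_on_mult p w)
    then have "app (fcalc w T) (app (fcalc p T) x) = app (fcalc k T) x"
      using fcalc_commute_fcalc[OF p w, of T] by (simp add: fcalc_mult p w flip: app_simps(3))
    then have "app ?F x = app (fcalc p T) x" using einv_app(1)[OF d] by (metis app_simps(3))
    also have "\<dots> = (\<Sum>k<?n. taylor (remove_sings f) \<mu> k *s app (?N ^ k) x)"
      by (subst fcalc_on_geig[OF p x]) (auto simp: tp a_def rs)
    finally show ?thesis .
  qed simp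
  then have "P (app ?F)" by (simp add: P_def linear_app)
  moreover have "F = app ?F" if PF: "P F" for F
  proof
    fix x
    interpret F: Vector_Spaces.linear "(*s)" "(*s)" F using PF by (simp add: P_def)
    have "x \<in> vec.span (\<Union>\<nu>. geig T \<nu>)" by (simp add: geig_span)
    then show "F x = app ?F x"
    proof (induction rule: vec.span_induct_alt)
      case base
      show ?case by (simp only: F.zero app_simps)
    next
      case (step c y z)
      then obtain \<mu> where "y \<in> geig T \<mu>" by auto
      then have y: "app ((T - scal \<mu>) ^ ?n) y = 0" by (rule geig_power_card)
      have "F y = app ?F y"
        using PF[unfolded P_def, THEN conjunct2, rule_format, OF y]
          \<open>P (app ?F)\<close>[unfolded P_def, THEN conjunct2, rule_format, OF y] by (rule trans[OF _ sym])
      then show ?case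
        by (simp only: step.IH F.add F.scale app_lin app_scale)
    qed
  qed
  ultimately have "(THE F. P F) = app ?F" by (rule the_equality)
  moreover have "operator_function f (app T) = (THE F. P F)"
    unfolding operator_function_def P_def op_shift_funpow taylor_def ..
  ultimately show ?thesis by simp
qed

section \<open>The exponential chart of the Lie group\<close>

text \<open>The Schwarz lemma for a disc of radius \<open>R\<close> and the bound \<open>M\<close>, and its second order version. They turn the
  holomorphy of the group multiplication into quantitative estimates, in place of Taylor expansions in several
  variables.\<close>

lemma schwarz_bound:
  assumes hol: "f holomorphic_on ball 0 R" and R: "0 < R" and f0: "f 0 = 0"
    and M: "\<And>z. norm z < R \<Longrightarrow> norm (f z) < M" and z: "norm z < R"
  shows "norm (f z) \<le> M * norm z / R" "norm (deriv f 0) \<le> M / R"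
proof -
  have M0: "0 < M" using M[of 0] R f0 by simp
  define g where "g u = f (of_real R * u) / of_real M" for u
  have mem: "norm (of_real R * u) < R" if "norm u < 1" for u :: complex
    using that R by (simp add: norm_mult)
  have im: "((*) (complex_of_real R)) ` ball 0 1 \<subseteq> ball 0 R" using mem by auto
  have "(f \<circ> (*) (complex_of_real R)) holomorphic_on ball 0 1"
    by (intro holomorphic_on_compose_gen[OF _ hol im] holomorphic_intros)
  then have g: "g holomorphic_on ball 0 1"
    unfolding g_def o_def by (intro holomorphic_intros) (use M0 in auto)
  have g0: "g 0 = 0" by (simp add: g_def f0)
  have gn: "norm (g u) < 1" if "norm u < 1" for u
    using M[OF mem[OF that]] M0 by (simp add: g_def norm_divide)
  have "norm (z / of_real R) < 1" using z R by (simp add: norm_divide)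
  from Schwarz_Lemma(1)[OF g g0 gn this] show "norm (f z) \<le> M * norm z / R"
    using R M0 by (simp add: g_def norm_divide field_simps)
  have "(f has_field_derivative deriv f 0) (at 0)"
    using hol R holomorphic_derivI[of f "ball 0 R" 0] by auto
  then have "(g has_field_derivative (deriv f 0 * of_real R / of_real M)) (at 0)"
    unfolding g_def using M0 by (auto intro!: derivative_eq_intros DERIV_chain2[of f])
  then have "deriv g 0 = deriv f 0 * of_real R / of_real M" by (rule DERIV_imp_deriv)
  with Schwarz_Lemma(2)[OF g g0 gn, of 0] show "norm (deriv f 0) \<le> M / R"
    using R M0 by (simp add: norm_divide norm_mult field_simps)
qed

lemma schwarz_second_order:
  assumes hol: "f holomorphic_on ball 0 R" and R: "0 < R" and f0: "f 0 = 0"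
    and M: "\<And>z. norm z < R \<Longrightarrow> norm (f z) < M" and z: "norm z < R"
  shows "norm (f z - z * deriv f 0) \<le> 3 * M * (norm z)\<^sup>2 / R\<^sup>2"
proof -
  have M0: "0 < M" using M[of 0] R f0 by simp
  define g where "g z = (if z = 0 then deriv f 0 else (f z - f 0) / (z - 0))" for z
  have g: "g holomorphic_on ball 0 R"
    unfolding g_def by (rule pole_lemma_open[OF hol]) auto
  have gb: "norm (g u) \<le> M / R" if "norm u < R" for u
  proof (cases "u = 0")
    case True
    then show ?thesis using schwarz_bound(2)[OF hol R f0 M that] by (simp add: g_def)
  next
    case False
    then show ?thesis using schwarz_bound(1)[OF hol R f0 M that]
      by (simp add: g_def f0 norm_divide divide_le_eq)
  qed
  have h: "(\<lambda>u. g u - g 0) holomorphic_on ball 0 R" by (intro holomorphic_intros g)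
  have "norm (g u - g 0) < 3 * M / R" if "norm u < R" for u
  proof -
    have "norm (g u - g 0) \<le> M / R + M / R"
      by (rule order_trans[OF norm_triangle_ineq4]) (intro add_mono gb that, simp add: R)
    also have "\<dots> < 3 * M / R" using M0 R by (simp add: field_simps)
    finally show ?thesis .
  qed
  from schwarz_bound(1)[OF h R _ this z]
  have "norm (g z - g 0) \<le> 3 * M / R * norm z / R" by simp
  moreover have "f z - z * deriv f 0 = z * (g z - g 0)"
    by (simp add: g_def f0 right_diff_distrib)
  ultimately have "norm (f z - z * deriv f 0) \<le> norm z * (3 * M / R * norm z / R)"
    by (simp only: norm_mult mult_left_mono norm_ge_zero)
  also have "\<dots> = 3 * M * (norm z)\<^sup>2 / R\<^sup>2" by (simp add: power2_eq_square)
  finally show ?thesis .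
qed

definition ad_op :: "(complex^'n \<Rightarrow> complex^'n \<Rightarrow> complex^'n) \<Rightarrow> complex^'n \<Rightarrow> 'n::finite endo" where
  "ad_op br x = op (br x)"

text \<open>Complex derivatives of curves are expressed by Frechet derivatives, since \<open>complex^'n\<close> carries only a real
  vector space structure as a type.\<close>

definition cderiv :: "(complex \<Rightarrow> complex^'n) \<Rightarrow> complex^'n \<Rightarrow> complex \<Rightarrow> bool" where
  "cderiv f v t \<longleftrightarrow> (f has_derivative (\<lambda>h. h *s v)) (at t)"

lemma bounded_linear_scale_left: "bounded_linear (\<lambda>h::complex. h *s (v::complex^'n::finite))"
  by (rule bounded_linear_intro[of _ "norm v"])
     (simp_all add: vec.scale_left_distrib scaleR_as_scale norm_scale_vec scaleR_conv_of_real)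

lemma cderiv_scale: "cderiv (\<lambda>t. t *s v) v t"
  unfolding cderiv_def by (rule bounded_linear.has_derivative[OF bounded_linear_scale_left has_derivative_ident])

lemma cderiv_const: "cderiv (\<lambda>t. v) 0 t"
  by (simp add: cderiv_def)

lemma cderiv_nth: "cderiv f v t \<Longrightarrow> ((\<lambda>t. f t $ i) has_field_derivative (v $ i)) (at t)"
  unfolding cderiv_def has_field_derivative_def
  using bounded_linear.has_derivative[OF bounded_linear_vec_nth, of f "\<lambda>h. h *s v" "at t" i]
  by (simp add: mult.commute[of _ "v $ i"])

lemma cderiv_diff: "cderiv f v t \<Longrightarrow> cderiv g w t \<Longrightarrow> cderiv (\<lambda>t. f t - g t) (v - w) t"
  unfolding cderiv_def by (drule (1) has_derivative_diff) (simp add: vec.scale_right_diff_distrib)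

lemma cderiv_add: "cderiv f v t \<Longrightarrow> cderiv g w t \<Longrightarrow> cderiv (\<lambda>t. f t + g t) (v + w) t"
  unfolding cderiv_def by (drule (1) has_derivative_add) (simp add: vec.scale_right_distrib)

lemma cderiv_minus_scale: "cderiv (\<lambda>t. - (t *s v)) (- v) t"
  using cderiv_diff[OF cderiv_const[of 0] cderiv_scale[of v]] by simp

lemma cderiv_real:
  assumes "cderiv f v 0"
  shows "((\<lambda>t::real. f (of_real t)) has_vector_derivative v) (at 0)"
proof -
  have "(complex_of_real has_derivative of_real) (at 0)"
    by (rule bounded_linear_imp_has_derivative) (rule bounded_linear_of_real)
  from has_derivative_compose[OF this, of f "\<lambda>h. h *s v"] assms
  show ?thesis by (simp add: cderiv_def has_vector_derivative_def scaleR_as_scale)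
qed

lemma vec_linear_real: "vec.subspace (l :: (complex^'n) set) \<Longrightarrow> subspace l"
  by (auto simp: subspace_def vec.subspace_def scaleR_as_scale)

lemma has_vector_derivative_at_0_iff:
  fixes f :: "real \<Rightarrow> 'a::real_normed_vector"
  shows "(f has_vector_derivative v) (at 0) \<longleftrightarrow> ((\<lambda>t. (1 / t) *\<^sub>R (f t - f 0)) \<longlongrightarrow> v) (at 0)"
proof -
  have "norm (f t - f 0 - t *\<^sub>R v) / norm t = norm ((1 / t) *\<^sub>R (f t - f 0) - v)" if "t \<noteq> 0" for t
  proof -
    have "f t - f 0 - t *\<^sub>R v = t *\<^sub>R ((1 / t) *\<^sub>R (f t - f 0) - v)"
      using that by (simp add: scaleR_diff_right)
    then show ?thesis using that by (simp only: norm_scaleR) simp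
  qed
  then have "((\<lambda>t. norm (f t - f 0 - t *\<^sub>R v) / norm t) \<longlongrightarrow> 0) (at 0)
      \<longleftrightarrow> ((\<lambda>t. norm ((1 / t) *\<^sub>R (f t - f 0) - v)) \<longlongrightarrow> 0) (at 0)"
    by (intro Lim_cong_within) auto
  then show ?thesis
    by (simp only: has_vector_derivative_def has_derivative_at bounded_linear_scaleR_left add_0_left
        tendsto_norm_zero_iff LIM_zero_iff simp_thms)
qed

text \<open>Difference quotients stay in \<open>l\<close>, which is closed.\<close>

lemma vector_derivative_in_subspace:
  fixes f :: "real \<Rightarrow> 'a::euclidean_space"
  assumes f: "(f has_vector_derivative v) (at 0)" and l: "subspace l"
    and ev: "\<forall>\<^sub>F t in at 0. f t \<in> l" and f0: "f 0 \<in> l"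
  shows "v \<in> l"
proof (rule Lim_in_closed_set[OF closed_subspace[OF l]])
  show "\<forall>\<^sub>F t in at 0. (1 / t) *\<^sub>R (f t - f 0) \<in> l"
    using ev by eventually_elim (intro subspace_scale[OF l] subspace_diff[OF l] f0)
  show "((\<lambda>t. (1 / t) *\<^sub>R (f t - f 0)) \<longlongrightarrow> v) (at 0)"
    using f by (simp add: has_vector_derivative_at_0_iff)
qed simp

text \<open>The function \<open>exp (- s D) y(s)\<close> has derivative \<open>0\<close>.\<close>

lemma exp_solves_linear_ode:
  fixes D :: "'n::finite endo" and y :: "real \<Rightarrow> complex^'n"
  assumes "\<And>s. (y has_vector_derivative app D (y s)) (at s)"
  shows "y s = app (exp (s *\<^sub>R D)) (y 0)"
proof -
  define z where "z s = app (exp (s *\<^sub>R (- D))) (y s)" for s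
  have "(z has_vector_derivative 0) (at s)" for s
  proof -
    have "(z has_vector_derivative
        (app (exp (s *\<^sub>R (- D))) (app D (y s)) + app (exp (s *\<^sub>R (- D)) * (- D)) (y s))) (at s)"
      unfolding z_def
      by (rule app.has_vector_derivative[OF exp_scaleR_has_vector_derivative_right assms])
    then show ?thesis by (simp add: app_lin)
  qed
  then obtain c where "\<And>s. z s = c"
    using has_vector_derivative_zero_constant[of UNIV z] by auto
  then have "z s = z 0" by simp
  then have "app (exp (s *\<^sub>R D)) (z s) = app (exp (s *\<^sub>R D)) (y 0)" by (simp add: z_def)
  moreover have "exp (s *\<^sub>R D) * exp (s *\<^sub>R (- D)) = 1"
    using exp_minus_inverse[of "s *\<^sub>R D"] by simp
  ultimately show ?thesis by (simp add: z_def flip: app_simps(3))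
qed

primrec npow :: "nat \<Rightarrow> 'g::group_add \<Rightarrow> 'g" where
  "npow 0 h = 0"
| "npow (Suc k) h = npow k h + h"

lemma npow_conj: "npow k (g + h - g) = g + npow k h - g"
proof (induction k)
  case (Suc k)
  show ?case
    by (simp only: npow.simps Suc) (simp only: diff_conv_add_uminus add.assoc minus_add_cancel)
qed simp

text \<open>What is used of the Lie group: one-parameter groups along the rays of \<open>l\<close>, a chart \<open>U\<close> in which the
  multiplication is holomorphic, and the bracket as the second order term of the group commutator.\<close>

locale lie_group_chart =
  fixes br :: "complex^'n::finite \<Rightarrow> complex^'n \<Rightarrow> complex^'n" and l :: "(complex^'n) set"
    and E :: "complex^'n \<Rightarrow> 'g::{topological_group_add,t2_space}" and U :: "(complex^'n) set"
  assumes lie: "complex_lie_algebra br"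
    and sub: "vec.subspace l" and br_l: "\<And>x y. x \<in> l \<Longrightarrow> y \<in> l \<Longrightarrow> br x y \<in> l"
    and cont_E: "continuous_on l E"
    and hom_E: "\<And>\<xi> s t. \<xi> \<in> l \<Longrightarrow> E ((s + t) *s \<xi>) = E (s *s \<xi>) + E (t *s \<xi>)"
    and par_U: "exp_parametrizes l E U"
    and mult_diff: "\<And>x y. x \<in> U \<Longrightarrow> y \<in> U \<Longrightarrow> E x + E y \<in> E ` U \<Longrightarrow>
           complex_differentiable (\<lambda>c (u, v). (c *s u, c *s v)) (*s) (l \<times> l)
             (\<lambda>(x, y). inv_into U E (E x + E y)) (x, y)"
    and comm_E: "\<And>x y. x \<in> l \<Longrightarrow> y \<in> l \<Longrightarrow> ((\<lambda>t::real. (1 / t\<^sup>2) *\<^sub>R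
               inv_into U E (E (t *\<^sub>R x) + E (t *\<^sub>R y) - E (t *\<^sub>R x) - E (t *\<^sub>R y)))
             \<longlongrightarrow> br x y) (at 0)"
begin

lemma lin_br: "Vector_Spaces.linear (*s) (*s) (br x)" "Vector_Spaces.linear (*s) (*s) (\<lambda>x. br x y)"
  using lie by (auto simp: complex_lie_algebra_def complex_bilinear_def)

lemma app_ad: "app (ad_op br x) y = br x y"
  unfolding ad_op_def by (rule app_op[OF lin_br(1)])

lemma br_self: "br x x = 0"
  using lie by (simp add: complex_lie_algebra_def)

lemma br_add: "br (x + y) z = br x z + br y z" "br x (y + z) = br x y + br x z"
  using vec.linear_add[OF lin_br(1)] vec.linear_add[OF lin_br(2)] by auto

lemma br_scale: "br (c *s x) z = c *s br x z" "br x (c *s z) = c *s br x z"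
  using vec.linear_scale[OF lin_br(1)] vec.linear_scale[OF lin_br(2)] by auto

lemma br_anti: "br x y = - br y x"
proof -
  have "br x (x + y) + br y (x + y) = 0" using br_self[of "x + y"] by (simp only: br_add(1))
  then have "br x y + br y x = 0" by (simp add: br_add(2) br_self)
  then show ?thesis by (simp add: eq_neg_iff_add_eq_0)
qed

lemma sub_real: "subspace l" by (rule vec_linear_real[OF sub])

lemma closed_l: "closed l" by (rule closed_subspace[OF sub_real])

lemmas l_closed = subspace_0[OF sub_real] subspace_add[OF sub_real] subspace_diff[OF sub_real]
  subspace_neg[OF sub_real] subspace_scale[OF sub_real] vec.subspace_scale[OF sub]

lemma E_add_scaleR: "\<xi> \<in> l \<Longrightarrow> E ((s + t) *\<^sub>R \<xi>) = E (s *\<^sub>R \<xi>) + E (t *\<^sub>R \<xi>)"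
  using hom_E[of \<xi> "of_real s" "of_real t"] by (simp add: scaleR_as_scale)

lemma E_0: "E 0 = 0"
  using E_add_scaleR[of 0 0 0] l_closed(1) by (simp, metis add.right_neutral add_left_cancel)

lemma E_uminus: "x \<in> l \<Longrightarrow> E (- x) = - E x"
proof -
  assume "x \<in> l"
  then have "E x + E (- x) = 0" using E_add_scaleR[of x 1 "-1"] by (simp add: E_0)
  then show ?thesis by (simp add: minus_unique)
qed

lemma E_npow: "x \<in> l \<Longrightarrow> E (real k *\<^sub>R x) = npow k (E x)"
proof (induction k)
  case (Suc k)
  then show ?case using E_add_scaleR[of x "real k" 1] by (simp add: add.commute)
qed (simp add: E_0)

lemma tendsto_E:
  "(f \<longlongrightarrow> x) F \<Longrightarrow> \<forall>\<^sub>F i in F. f i \<in> l \<Longrightarrow> x \<in> l \<Longrightarrow> ((\<lambda>i. E (f i)) \<longlongrightarrow> E x) F"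
  by (rule continuous_on_tendsto_compose[OF cont_E])

definition lg :: "'g \<Rightarrow> complex^'n" where "lg g = inv_into U E g"

definition mu :: "complex^'n \<Rightarrow> complex^'n \<Rightarrow> complex^'n" where "mu x y = lg (E x + E y)"

lemma U_facts: "U \<subseteq> l" "0 \<in> U" "inj_on E U" "open (E ` U)" "continuous_on (E ` U) lg"
  using par_U openin_imp_subset[of euclidean l U]
  by (auto simp: exp_parametrizes_def lg_def[abs_def])

lemma lg_E: "x \<in> U \<Longrightarrow> lg (E x) = x"
  unfolding lg_def by (rule inv_into_f_f[OF U_facts(3)])

lemma E_lg: "g \<in> E ` U \<Longrightarrow> lg g \<in> U \<and> E (lg g) = g"
  unfolding lg_def by (simp add: inv_into_into f_inv_into_f)

lemma lg_in_l: "g \<in> E ` U \<Longrightarrow> lg g \<in> l"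
  using E_lg U_facts(1) by blast

lemma lg_0: "lg 0 = 0"
  using lg_E[OF U_facts(2)] E_0 by simp

lemma zero_in_EU: "0 \<in> E ` U"
  using U_facts(2) E_0 by force

lemma U_ball: "\<exists>r>0. \<forall>x\<in>l. norm x < r \<longrightarrow> x \<in> U"
proof -
  have "openin (top_of_set l) U" using par_U by (simp add: exp_parametrizes_def)
  then obtain T where "open T" "U = l \<inter> T" by (auto simp: openin_open)
  then obtain r where "r > 0" "ball 0 r \<subseteq> T" using U_facts(2) openE[of T 0] by auto
  then show ?thesis using \<open>U = l \<inter> T\<close> by (metis IntI dist_0_norm mem_ball subsetD)
qed

text \<open>A neighbourhood of the identity with bounded logarithms; the bound is the one needed in the Schwarz lemma.\<close>

definition V1 :: "'g set" where "V1 = {g \<in> E ` U. norm (lg g) < 1}"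

lemma V1: "open V1" "0 \<in> V1"
proof -
  have "V1 = E ` U \<inter> lg -` ball 0 1" by (auto simp: V1_def)
  then show "open V1" using continuous_open_preimage[OF U_facts(5,4), of "ball 0 1"] by simp
  show "0 \<in> V1" using zero_in_EU by (simp add: V1_def lg_0)
qed

lemma near_identity:
  fixes f :: "'a::real_normed_vector \<times> (complex^'n) \<Rightarrow> 'g"
  assumes "continuous_on (X \<times> l) f" "0 \<in> X" "f (0, 0) = 0"
  shows "\<exists>\<rho>>0. \<forall>s\<in>X. \<forall>y\<in>l. norm s < \<rho> \<longrightarrow> norm y < \<rho> \<longrightarrow> f (s, y) \<in> V1"
proof -
  obtain T where T: "open T" "T \<inter> (X \<times> l) = f -` V1 \<inter> (X \<times> l)"
    using continuous_on_open_invariant[THEN iffD1, OF assms(1), rule_format, OF V1(1)] by blast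
  have "(0, 0) \<in> T" using T(2) assms l_closed(1) V1(2) by auto
  then obtain e where e: "e > 0" "ball (0, 0) e \<subseteq> T" using openE[OF T(1)] by blast
  have "f (s, y) \<in> V1"
    if a: "s \<in> X" "y \<in> l" "norm s < e / 2" "norm y < e / 2" for s y
  proof -
    have "norm (s, y) \<le> norm s + norm y" by (rule norm_Pair_le)
    moreover have "dist (0, 0) (s, y) = norm (s, y)" by (metis dist_0_norm zero_prod_def)
    ultimately have "(s, y) \<in> ball (0, 0) e" using a by simp
    then show "f (s, y) \<in> V1" using a(1,2) T(2) e(2) by blast
  qed
  then show ?thesis using e(1) by (intro exI[of _ "e / 2"]) auto
qed

text \<open>The derivative lies in \<open>l\<close> because the multiplication of the chart takes values in \<open>l\<close>.\<close>

lemma cderiv_mu: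
  assumes a: "cderiv a a' t" and b: "cderiv b b' t" and S: "open S" "t \<in> S"
    and in_U: "\<And>t. t \<in> S \<Longrightarrow> a t \<in> U \<and> b t \<in> U \<and> E (a t) + E (b t) \<in> E ` U"
    and l': "a' \<in> l" "b' \<in> l"
  obtains w where "cderiv (\<lambda>t. mu (a t) (b t)) w t" "w \<in> l"
proof -
  let ?f = "\<lambda>(x, y). inv_into U E (E x + E y)"
  obtain L where L: "(?f has_derivative L) (at (a t, b t) within l \<times> l)"
    and hom: "\<And>c v. v \<in> l \<times> l \<Longrightarrow> L ((\<lambda>(u, v). (c *s u, c *s v)) v) = c *s L v"
    using mult_diff[of "a t" "b t"] in_U[OF S(2)] by (auto simp: complex_differentiable_def)
  have ab: "((\<lambda>t. (a t, b t)) has_derivative (\<lambda>h. (h *s a', h *s b'))) (at t within S)"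
    using a b unfolding cderiv_def by (intro has_derivative_Pair) (auto intro: has_derivative_at_withinI)
  have "(?f has_derivative L) (at (a t, b t) within (\<lambda>t. (a t, b t)) ` S)"
    by (rule has_derivative_subset[OF L]) (use in_U U_facts(1) in auto)
  from has_derivative_in_compose[OF ab this]
  have "((\<lambda>t. mu (a t) (b t)) has_derivative (\<lambda>h. L (h *s a', h *s b'))) (at t within S)"
    by (simp add: mu_def lg_def)
  moreover have "L (h *s a', h *s b') = h *s L (a', b')" for h
    using hom[of "(a', b')" h] l' by simp
  ultimately have c: "cderiv (\<lambda>t. mu (a t) (b t)) (L (a', b')) t"
    using at_within_open[OF S(2,1)] by (simp add: cderiv_def)
  define F where "F r = mu (a (t + r)) (b (t + r))" for r :: complex
  have F: "cderiv F (L (a', b')) 0"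
  proof -
    have "((\<lambda>r. t + r) has_derivative (\<lambda>h. h)) (at 0)" by (auto intro!: derivative_eq_intros)
    from has_derivative_compose[OF this, of "\<lambda>t. mu (a t) (b t)" "\<lambda>h. h *s L (a', b')"] c
    show ?thesis by (simp add: cderiv_def F_def[abs_def])
  qed
  have ev: "\<forall>\<^sub>F r::real in nhds 0. F (of_real r) \<in> l"
  proof -
    have "((\<lambda>r::real. t + of_real r) \<longlongrightarrow> t + of_real 0) (nhds 0)"
      by (intro tendsto_intros filterlim_ident)
    from topological_tendstoD[OF this S(1)] S(2)
    have "\<forall>\<^sub>F r::real in nhds 0. t + of_real r \<in> S" by simp
    then show ?thesis by eventually_elim (use in_U lg_in_l in \<open>auto simp: F_def mu_def\<close>)
  qed
  then have ev0: "\<forall>\<^sub>F r::real in at 0. F (of_real r) \<in> l" "F (of_real 0) \<in> l"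
    unfolding eventually_nhds_conv_at by simp_all
  have "L (a', b') \<in> l"
    by (rule vector_derivative_in_subspace[OF cderiv_real[OF F] sub_real ev0])
  then show ?thesis using that c by blast
qed

text \<open>The multiplication in the chart differs from the addition by a holomorphic function that
  vanishes when either argument does; the Schwarz lemma in each argument bounds it by the
  product of the norms.\<close>

lemma mult_estimate:
  "\<exists>r>0. \<exists>C>0. \<forall>x\<in>l. \<forall>y\<in>l. norm x < r \<longrightarrow> norm y < r \<longrightarrow>
       x \<in> U \<and> y \<in> U \<and> E x + E y \<in> E ` U \<and> norm (mu x y - x - y) \<le> C * norm x * norm y"
proof -
  obtain r0 where r0: "r0 > 0" "\<And>x. x \<in> l \<Longrightarrow> norm x < r0 \<Longrightarrow> x \<in> U" using U_ball by blast
  have "continuous_on (l \<times> l) (\<lambda>p. E (fst p) + E (snd p))"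
    by (intro continuous_intros continuous_on_compose2[OF cont_E]) auto
  from near_identity[OF this l_closed(1)] E_0
  obtain \<rho> where \<rho>: "\<rho> > 0"
    "\<And>x y. x \<in> l \<Longrightarrow> y \<in> l \<Longrightarrow> norm x < \<rho> \<Longrightarrow> norm y < \<rho> \<Longrightarrow> E x + E y \<in> V1"
    by auto
  define r where "r = min 1 (min r0 \<rho>) / 2"
  have r: "r > 0" "r < 1" "2 * r \<le> r0" "2 * r \<le> \<rho>" using r0 \<rho> by (auto simp: r_def)
  define C where "C = real CARD('n) * (5 / r\<^sup>2)"
  have C: "C > 0" using r by (simp add: C_def)
  have "x \<in> U \<and> y \<in> U \<and> E x + E y \<in> E ` U \<and> norm (mu x y - x - y) \<le> C * norm x * norm y"
    if xy: "x \<in> l" "y \<in> l" "norm x < r" "norm y < r" for x y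
  proof -
    have ok: "u \<in> U \<and> v \<in> U \<and> E u + E v \<in> V1" if "u \<in> l" "v \<in> l" "norm u < 2 * r" "norm v < 2 * r" for u v
      using that r r0(2) \<rho>(2) by auto
    have okU: "u \<in> U \<and> v \<in> U \<and> E u + E v \<in> E ` U" if "u \<in> l" "v \<in> l" "norm u < 2 * r" "norm v < 2 * r" for u v
      using ok[OF that] by (auto simp: V1_def)
    have mu_0: "mu 0 v = v" "mu u 0 = u" if "u \<in> l" "v \<in> l" "norm u < 2 * r" "norm v < 2 * r" for u v
      using ok[OF that] by (auto simp: mu_def E_0 lg_E)
    have "norm ((mu x y - x - y) $ i) \<le> 5 / r\<^sup>2 * norm x * norm y" for i
    proof (cases "x = 0 \<or> y = 0")
      case True
      then show ?thesis using mu_0[OF xy(1,2)] xy r by auto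
    next
      case False
      define X Y where "X = norm x" and "Y = norm y"
      have XY: "X > 0" "Y > 0" "X < r" "Y < r" using False xy by (auto simp: X_def Y_def)
      define K where "K s t = (mu (s *s x) (t *s y) - s *s x - t *s y) $ i" for s t
      \<comment> \<open>\<open>P\<close> and \<open>Q\<close> are the radii for which \<open>s *s x\<close> and \<open>t *s y\<close> have norm less than \<open>2 * r\<close>\<close>
      define P Q where "P = 2 * r / X" and "Q = 2 * r / Y"
      have PQ: "P > 1" "Q > 1" using XY r by (auto simp: P_def Q_def)
      have st: "s *s x \<in> l" "t *s y \<in> l" "norm (s *s x) < 2 * r" "norm (t *s y) < 2 * r"
        if "norm s < P" "norm t < Q" for s t
        using that XY xy l_closed(6) by (auto simp: norm_scale_vec P_def Q_def X_def Y_def field_simps)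
      have Kb: "norm (K s t) < 5" if "norm s < P" "norm t < Q" for s t
      proof -
        note s = st[OF that]
        have "norm (mu (s *s x) (t *s y)) < 1" using ok[OF s] by (simp add: V1_def mu_def)
        moreover have "norm (K s t) \<le> norm (mu (s *s x) (t *s y) - s *s x - t *s y)"
          unfolding K_def by (rule Finite_Cartesian_Product.norm_nth_le)
        moreover have "\<dots> \<le> norm (mu (s *s x) (t *s y)) + norm (s *s x) + norm (t *s y)"
          by (metis (no_types, opaque_lifting) add_right_mono norm_triangle_ineq4 order_trans)
        ultimately show ?thesis using s r by linarith
      qed
      have K0: "K 0 t = 0" "K s 0 = 0" if "norm s < P" "norm t < Q" for s t
        using mu_0[OF st[OF that]] by (auto simp: K_def)
      have hs: "(\<lambda>s. K s t) holomorphic_on ball 0 P" if t: "norm t < Q" for t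
      proof (rule holomorphic_onI)
        fix s :: complex assume s: "s \<in> ball 0 P"
        obtain w where "cderiv (\<lambda>s. mu (s *s x) (t *s y)) w s"
          by (rule cderiv_mu[OF cderiv_scale[of x] cderiv_const[of "t *s y"] open_ball s])
             (use okU[OF st[OF _ t]] xy l_closed in auto)
        from cderiv_nth[OF cderiv_diff[OF cderiv_diff[OF this cderiv_scale[of x]] cderiv_const[of "t *s y"]]]
        show "(\<lambda>s. K s t) field_differentiable at s within ball 0 P"
          unfolding K_def field_differentiable_def by (blast intro: DERIV_subset)
      qed
      have ht: "(\<lambda>t. K s t) holomorphic_on ball 0 Q" if s: "norm s < P" for s
      proof (rule holomorphic_onI)
        fix t :: complex assume t: "t \<in> ball 0 Q"
        obtain w where "cderiv (\<lambda>t. mu (s *s x) (t *s y)) w t"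
          by (rule cderiv_mu[OF cderiv_const[of "s *s x"] cderiv_scale[of y] open_ball t])
             (use okU[OF st[OF s]] xy l_closed in auto)
        from cderiv_nth[OF cderiv_diff[OF cderiv_diff[OF this cderiv_const[of "s *s x"]] cderiv_scale[of y]]]
        show "(\<lambda>t. K s t) field_differentiable at t within ball 0 Q"
          unfolding K_def field_differentiable_def by (blast intro: DERIV_subset)
      qed
      have 1: "norm (K 1 t) < 6 / P" if t: "norm t < Q" for t
      proof -
        have "norm (K 1 t) \<le> 5 * norm (1::complex) / P"
          by (rule schwarz_bound(1)[OF hs[OF t]]) (use PQ K0(1)[of 0] Kb t in auto)
        also have "\<dots> < 6 / P" using PQ by (simp add: divide_strict_right_mono)
        finally show ?thesis .
      qed
      have "norm (K 1 1) \<le> 6 / P * norm (1::complex) / Q"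
        by (rule schwarz_bound(1)[OF ht]) (use PQ K0(2)[of 1 0] 1 in auto)
      also have "\<dots> \<le> 5 / r\<^sup>2 * X * Y"
      proof -
        have "6 / P * norm (1::complex) / Q = 3 / 2 * (X * Y / r\<^sup>2)"
          using XY r by (simp add: P_def Q_def power2_eq_square)
        also have "\<dots> \<le> 5 * (X * Y / r\<^sup>2)" using XY by (intro mult_right_mono) auto
        finally show ?thesis by simp
      qed
      finally show ?thesis by (simp add: K_def X_def Y_def)
    qed
    then have "norm (mu x y - x - y) \<le> (\<Sum>i\<in>(UNIV::'n set). 5 / r\<^sup>2 * norm x * norm y)"
      unfolding norm_vec_def[of "mu x y - x - y"]
      by (intro order_trans[OF L2_set_le_sum] sum_mono) auto
    then show "x \<in> U \<and> y \<in> U \<and> E x + E y \<in> E ` U \<and> norm (mu x y - x - y) \<le> C * norm x * norm y"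
      using okU[OF xy(1,2)] xy r by (simp add: C_def)
  qed
  then show ?thesis using r(1) C by blast
qed

end

context lie_group_chart
begin

text \<open>The adjoint action of \<open>g\<close>, as a relation: that it is defined on all of \<open>l\<close> has to be proved first.\<close>

definition conj_rel :: "'g \<Rightarrow> complex^'n \<Rightarrow> complex^'n \<Rightarrow> bool" where
  "conj_rel g x y \<longleftrightarrow> x \<in> l \<and> y \<in> l \<and> (\<forall>t::real. g + E (t *\<^sub>R x) - g = E (t *\<^sub>R y))"

lemma conj_rel_compose:
  assumes "conj_rel g x y" "conj_rel h y z"
  shows "conj_rel (h + g) x z"
proof -
  have "(h + g) + E (t *\<^sub>R x) - (h + g) = h + (g + E (t *\<^sub>R x) - g) - h" for t
    by (simp only: diff_conv_add_uminus minus_add add.assoc)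
  then show ?thesis using assms by (simp add: conj_rel_def)
qed

lemma E_inj_rays:
  assumes "x \<in> l" "y \<in> l" "\<And>t::real. E (t *\<^sub>R x) = E (t *\<^sub>R y)"
  shows "x = y"
proof -
  obtain r where r: "r > 0" "\<forall>x\<in>l. norm x < r \<longrightarrow> x \<in> U" using U_ball by blast
  define p where "p = 1 + norm x + norm y"
  define t where "t = r / (2 * p)"
  have p: "p > 0" by (simp add: p_def add_pos_nonneg)
  then have t: "t > 0" using r by (simp add: t_def)
  have "t * norm z < r" if "norm z \<le> p" for z :: "complex^'n"
  proof -
    have "t * norm z \<le> t * p" using that t by (intro mult_left_mono) auto
    also have "\<dots> = r / 2" using p by (simp add: t_def)
    finally show ?thesis using r by simp
  qed
  then have "t * norm x < r" "t * norm y < r" by (auto simp: p_def)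
  then have "t *\<^sub>R x \<in> U" "t *\<^sub>R y \<in> U" using r t assms l_closed(5) by auto
  then have "t *\<^sub>R x = t *\<^sub>R y" using assms(3)[of t] U_facts(3) by (auto dest: inj_onD)
  then show ?thesis using t by simp
qed

lemma conj_rel_unique: "conj_rel g x y \<Longrightarrow> conj_rel g x z \<Longrightarrow> y = z"
  by (rule E_inj_rays) (auto simp: conj_rel_def)

text \<open>A continuous one-parameter group with derivative \<open>w\<close> is the ray of \<open>w\<close>: its value at \<open>t\<close> is
  the \<open>k\<close>-th power of its value at \<open>t / k\<close>, hence \<open>E\<close> of a vector that tends to \<open>t w\<close>.\<close>

lemma conj_relI:
  assumes x: "x \<in> l" and w: "w \<in> l"
    and d: "((\<lambda>t::real. lg (g + E (t *\<^sub>R x) - g)) has_vector_derivative w) (at 0)"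
  shows "conj_rel g x w"
proof -
  define c where "c t = lg (g + E (t *\<^sub>R x) - g)" for t :: real
  have c0: "c 0 = 0" by (simp add: c_def E_0 lg_0)
  have lim: "((\<lambda>t. (1 / t) *\<^sub>R c t) \<longlongrightarrow> w) (at 0)"
    using d c0 by (simp add: has_vector_derivative_at_0_iff flip: c_def)
  have tend: "((\<lambda>t::real. g + E (t *\<^sub>R x) - g) \<longlongrightarrow> g + E (0 *\<^sub>R x) - g) (at 0)"
    by (intro tendsto_intros tendsto_E) (auto simp: l_closed x)
  have ev: "\<forall>\<^sub>F t in at 0. g + E (t *\<^sub>R x) - g \<in> E ` U"
    using topological_tendstoD[OF tend U_facts(4)] zero_in_EU by (simp add: E_0)
  have "g + E (t *\<^sub>R x) - g = E (t *\<^sub>R w)" for t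
  proof (cases "t = 0")
    case False
    let ?s = "\<lambda>k. t / real (Suc k)"
    have s: "filterlim ?s (at 0) sequentially"
      unfolding filterlim_at using False
      by (auto intro!: tendsto_divide_0[OF tendsto_const] filterlim_at_top_imp_at_infinity
          filterlim_tendsto_add_at_top[OF tendsto_const filterlim_real_sequentially])
    have "((\<lambda>k. t *\<^sub>R ((1 / ?s k) *\<^sub>R c (?s k))) \<longlongrightarrow> t *\<^sub>R w) sequentially"
      by (intro tendsto_intros filterlim_compose[OF lim s])
    then have l1: "((\<lambda>k. real (Suc k) *\<^sub>R c (?s k)) \<longlongrightarrow> t *\<^sub>R w) sequentially"
      using False by simp
    have evk: "\<forall>\<^sub>F k in sequentially. g + E (?s k *\<^sub>R x) - g \<in> E ` U"
      by (rule eventually_compose_filterlim[OF ev s])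
    have "((\<lambda>k. E (real (Suc k) *\<^sub>R c (?s k))) \<longlongrightarrow> E (t *\<^sub>R w)) sequentially"
    proof (rule tendsto_E[OF l1])
      show "\<forall>\<^sub>F k in sequentially. real (Suc k) *\<^sub>R c (?s k) \<in> l"
        using evk by eventually_elim (auto simp: c_def intro!: l_closed lg_in_l)
    qed (use w l_closed in auto)
    moreover have "\<forall>\<^sub>F k in sequentially. E (real (Suc k) *\<^sub>R c (?s k)) = g + E (t *\<^sub>R x) - g"
      using evk
    proof eventually_elim
      case (elim k)
      then have "E (c (?s k)) = g + E (?s k *\<^sub>R x) - g" "c (?s k) \<in> l"
        using E_lg lg_in_l by (auto simp: c_def)
      then have "E (real (Suc k) *\<^sub>R c (?s k)) = g + npow (Suc k) (E (?s k *\<^sub>R x)) - g"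
        by (simp only: E_npow npow_conj)
      also have "npow (Suc k) (E (?s k *\<^sub>R x)) = E (real (Suc k) *\<^sub>R (?s k *\<^sub>R x))"
        using x l_closed by (simp only: E_npow)
      also have "real (Suc k) *\<^sub>R (?s k *\<^sub>R x) = t *\<^sub>R x" by simp
      finally show ?case .
    qed
    ultimately have "((\<lambda>k. g + E (t *\<^sub>R x) - g) \<longlongrightarrow> E (t *\<^sub>R w)) sequentially"
      by (rule Lim_transform_eventually)
    then show ?thesis by (simp add: LIMSEQ_const_iff)
  qed (simp add: E_0)
  then show ?thesis using x w by (simp add: conj_rel_def)
qed

text \<open>For small \<open>s\<close>, conjugation by \<open>E (s \<eta>)\<close> acts on the ray of \<open>x\<close> by the derivative of the conjugated ray. The
  derivative of this action at \<open>s = 0\<close> is the mixed second derivative of the commutator \<open>K s t\<close> of the rays of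
  \<open>\<eta>\<close> and \<open>x\<close>. As \<open>K\<close> vanishes on both axes, this derivative can be read off from the values of \<open>K\<close> on the
  diagonal, which the definition of the Lie group relates to the bracket.\<close>

lemma small_conjugation:
  assumes \<eta>: "\<eta> \<in> l"
  obtains \<rho> where "\<rho> > 0" "\<And>s x. norm s < \<rho> \<Longrightarrow> x \<in> l \<Longrightarrow> \<exists>y. conj_rel (E (s *s \<eta>)) x y"
    "\<And>x w. x \<in> l \<Longrightarrow> (\<And>s::real. \<bar>s\<bar> < \<rho> \<Longrightarrow> conj_rel (E (s *\<^sub>R \<eta>)) x (w s)) \<Longrightarrow>
       ((\<lambda>s. (1 / s) *\<^sub>R (w s - x)) \<longlongrightarrow> br \<eta> x) (at 0)"
proof -
  obtain r C where rC: "r > 0" "C > 0"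
    "\<And>x y. x \<in> l \<Longrightarrow> y \<in> l \<Longrightarrow> norm x < r \<Longrightarrow> norm y < r \<Longrightarrow>
       x \<in> U \<and> y \<in> U \<and> E x + E y \<in> E ` U \<and> norm (mu x y - x - y) \<le> C * norm x * norm y"
    using mult_estimate by blast
  have cE: "continuous_on (UNIV \<times> l) (\<lambda>p::complex \<times> (complex^'n). E (fst p *s \<eta>))"
    by (rule continuous_on_compose2[OF cont_E])
       (use \<eta> l_closed in \<open>auto intro!: bounded_linear.continuous_on[OF bounded_linear_scale_left] continuous_intros\<close>)
  have cy: "continuous_on (UNIV \<times> l) (\<lambda>p::complex \<times> (complex^'n). E (snd p))"
    by (rule continuous_on_compose2[OF cont_E]) (auto intro!: continuous_intros)
  have c1: "continuous_on (UNIV \<times> l) (\<lambda>p. E (fst p *s \<eta>) + E (snd p))"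
    by (intro continuous_on_add continuous_on_diff cE cy)
  obtain \<rho>1 where \<rho>1: "\<rho>1 > 0" "\<And>s y. y \<in> l \<Longrightarrow> norm s < \<rho>1 \<Longrightarrow> norm y < \<rho>1 \<Longrightarrow> E (s *s \<eta>) + E y \<in> V1"
    using near_identity[OF c1] by (auto simp: E_0)
  have c2: "continuous_on (UNIV \<times> l) (\<lambda>p. E (fst p *s \<eta>) + E (snd p) - E (fst p *s \<eta>))"
    by (intro continuous_on_add continuous_on_diff cE cy)
  obtain \<rho>2 where \<rho>2: "\<rho>2 > 0" "\<And>s y. y \<in> l \<Longrightarrow> norm s < \<rho>2 \<Longrightarrow> norm y < \<rho>2 \<Longrightarrow>
      E (s *s \<eta>) + E y - E (s *s \<eta>) \<in> V1"
    using near_identity[OF c2] by (auto simp: E_0)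
  have c3: "continuous_on (UNIV \<times> l) (\<lambda>p. E (fst p *s \<eta>) + E (snd p) - E (fst p *s \<eta>) - E (snd p))"
    by (intro continuous_on_add continuous_on_diff cE cy)
  obtain \<rho>3 where \<rho>3: "\<rho>3 > 0" "\<And>s y. y \<in> l \<Longrightarrow> norm s < \<rho>3 \<Longrightarrow> norm y < \<rho>3 \<Longrightarrow>
      E (s *s \<eta>) + E y - E (s *s \<eta>) - E y \<in> V1"
    using near_identity[OF c3] by (auto simp: E_0)
  define \<rho> where "\<rho> = Min {\<rho>1, \<rho>2, \<rho>3, r, r / (1 + norm \<eta>)}"
  have "r / (1 + norm \<eta>) > 0" using rC(1) by (simp add: add_pos_nonneg)
  then have \<rho>: "\<rho> > 0" "\<rho> \<le> \<rho>1" "\<rho> \<le> \<rho>2" "\<rho> \<le> \<rho>3" "\<rho> \<le> r" "\<rho> \<le> r / (1 + norm \<eta>)"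
    using \<rho>1 \<rho>2 \<rho>3 rC(1) by (auto simp: \<rho>_def)
  have s\<eta>: "s *s \<eta> \<in> U" "- (s *s \<eta>) \<in> U" "s *s \<eta> \<in> l" "- (s *s \<eta>) \<in> l" if "norm s < \<rho>" for s
  proof -
    have "norm s * norm \<eta> \<le> norm s * (1 + norm \<eta>)" by (intro mult_left_mono) auto
    also have "\<dots> < r"
      using less_le_trans[OF that \<rho>(6)] by (simp add: pos_less_divide_eq add_pos_nonneg)
    finally have "norm (s *s \<eta>) < r" by (simp add: norm_scale_vec)
    then show "s *s \<eta> \<in> l" "- (s *s \<eta>) \<in> l" "s *s \<eta> \<in> U" "- (s *s \<eta>) \<in> U"
      using rC(3)[of "s *s \<eta>" "- (s *s \<eta>)"] \<eta> l_closed by auto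
  qed
  have yU: "y \<in> U" "- y \<in> U" if "y \<in> l" "norm y < \<rho>" for y
    using rC(3)[of y "- y"] that \<rho>(5) l_closed(4) by auto
  define c where "c s y = lg (E (s *s \<eta>) + E y - E (s *s \<eta>))" for s y
  define K where "K s y = lg (E (s *s \<eta>) + E y - E (s *s \<eta>) - E y)" for s y
  have g: "E (s *s \<eta>) + E y \<in> E ` U" "E (s *s \<eta>) + E y - E (s *s \<eta>) \<in> E ` U"
      "E (s *s \<eta>) + E y - E (s *s \<eta>) - E y \<in> E ` U"
    and K1: "norm (K s y) < 1" if "norm s < \<rho>" "y \<in> l" "norm y < \<rho>" for s y
    using \<rho>1(2)[of y s] \<rho>2(2)[of y s] \<rho>3(2)[of y s] that \<rho> by (auto simp: V1_def K_def)
  have c_mu: "c s y = mu (mu (s *s \<eta>) y) (- (s *s \<eta>))"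
    and K_mu: "K s y = mu (c s y) (- y)" if "norm s < \<rho>" "y \<in> l" "norm y < \<rho>" for s y
    using E_lg[OF g(1)[OF that]] E_lg[OF g(2)[OF that]] s\<eta>[OF that(1)] that(2)
    by (simp_all add: c_def K_def mu_def E_uminus)
  have cU: "c s y \<in> U" "E (c s y) = E (s *s \<eta>) + E y - E (s *s \<eta>)"
      if "norm s < \<rho>" "y \<in> l" "norm y < \<rho>" for s y
    using E_lg[OF g(2)[OF that]] by (simp_all add: c_def)
  have mU: "mu (s *s \<eta>) y \<in> U" "E (mu (s *s \<eta>) y) = E (s *s \<eta>) + E y"
      if "norm s < \<rho>" "y \<in> l" "norm y < \<rho>" for s y
    using E_lg[OF g(1)[OF that]] by (simp_all add: mu_def)
  have K0: "K s 0 = 0" "K 0 y = 0" for s y by (simp_all add: K_def E_0 lg_0)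
  have c0: "c s 0 = 0" for s by (simp add: c_def E_0 lg_0)
  have der: "\<exists>w\<in>l. cderiv (\<lambda>t. c s (t *s x)) w t" "\<exists>w\<in>l. cderiv (\<lambda>t. K s (t *s x)) w t"
    if s: "norm s < \<rho>" and x: "x \<in> l" and t: "t \<in> {t. norm (t *s x) < \<rho>}" for s x t
  proof -
    have op: "open {t::complex. norm (t *s x) < \<rho>}"
      by (intro open_Collect_less continuous_intros bounded_linear.continuous_on[OF bounded_linear_scale_left])
    have tx: "t *s x \<in> l" "norm (t *s x) < \<rho>" if "t \<in> {t. norm (t *s x) < \<rho>}" for t
      using that x l_closed by auto
    obtain w1 where w1: "cderiv (\<lambda>t. mu (s *s \<eta>) (t *s x)) w1 t" "w1 \<in> l"
      by (rule cderiv_mu[OF cderiv_const[of "s *s \<eta>"] cderiv_scale[of x] op t])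
         (use g(1)[OF s tx] s\<eta>[OF s] yU[OF tx] x l_closed in auto)
    obtain w2 where w2: "cderiv (\<lambda>t. mu (mu (s *s \<eta>) (t *s x)) (- (s *s \<eta>))) w2 t" "w2 \<in> l"
      by (rule cderiv_mu[OF w1(1) cderiv_const[of "- (s *s \<eta>)"] op t])
         (use mU[OF s tx] g(2)[OF s tx] s\<eta>[OF s] w1 l_closed E_uminus in auto)
    have ev: "cderiv f w t" if "cderiv h w t" "\<And>t. t \<in> {t. norm (t *s x) < \<rho>} \<Longrightarrow> h t = f t" for f h w
      using that(1) has_derivative_transform_within_open[of h _ t UNIV "{t. norm (t *s x) < \<rho>}" f] op t that(2)
      unfolding cderiv_def by auto
    have w2': "cderiv (\<lambda>t. c s (t *s x)) w2 t"
      by (rule ev[OF w2(1)]) (simp add: c_mu[OF s tx])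
    then show "\<exists>w\<in>l. cderiv (\<lambda>t. c s (t *s x)) w t" using w2 by blast
    obtain w3 where w3: "cderiv (\<lambda>t. mu (c s (t *s x)) (- (t *s x))) w3 t" "w3 \<in> l"
      by (rule cderiv_mu[OF w2' cderiv_minus_scale[of x] op t])
         (use cU[OF s tx] g(3)[OF s tx] yU[OF tx] w2 x l_closed E_uminus[OF tx(1)] in auto)
    have "cderiv (\<lambda>t. K s (t *s x)) w3 t"
      by (rule ev[OF w3(1)]) (simp add: K_mu[OF s tx])
    then show "\<exists>w\<in>l. cderiv (\<lambda>t. K s (t *s x)) w t" using w3 by blast
  qed
  have conj_w: "conj_rel (E (s *s \<eta>)) x w" if "norm s < \<rho>" "x \<in> l" "w \<in> l" "cderiv (\<lambda>t. c s (t *s x)) w 0" for s x w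
    using conj_relI[OF that(2,3)] cderiv_real[OF that(4)] by (simp add: c_def scaleR_as_scale)
  have Kder: "cderiv (\<lambda>t. K s (t *s x)) (w - x) 0"
    if s: "norm s < \<rho>" and x: "x \<in> l" and w: "cderiv (\<lambda>t. c s (t *s x)) w 0" for s x w
  proof -
    let ?h = "\<lambda>t. K s (t *s x) - (c s (t *s x) - t *s x)"
    have cont_c: "((\<lambda>t. c s (t *s x)) \<longlongrightarrow> 0) (at 0)"
      using w has_derivative_continuous[of "\<lambda>t. c s (t *s x)" "\<lambda>h. h *s w" 0 UNIV]
      by (simp add: cderiv_def continuous_within c0)
    have t0: "((\<lambda>t. t *s x) \<longlongrightarrow> 0 *s x) (at 0)"
      by (rule bounded_linear.tendsto[OF bounded_linear_scale_left]) (rule tendsto_ident_at)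
    have "(?h has_derivative (\<lambda>h. 0)) (at 0)"
      unfolding has_derivative_at
    proof (intro conjI bounded_linear_zero, rule Lim_null_comparison)
      show "((\<lambda>t. C * norm (c s (t *s x)) * norm x) \<longlongrightarrow> 0) (at 0)"
        using tendsto_mult[OF tendsto_mult[OF tendsto_const[of C] tendsto_norm_zero[OF cont_c]] tendsto_const[of "norm x"]]
        by simp
      have "\<forall>\<^sub>F t in at 0. norm (c s (t *s x)) < r"
        using order_tendstoD(2)[OF tendsto_norm_zero[OF cont_c] rC(1)] .
      moreover have "\<forall>\<^sub>F t in at 0. norm (t *s x) < \<rho>"
        using order_tendstoD(2)[OF tendsto_norm[OF t0], of \<rho>] \<rho>(1) by simp
      ultimately show "\<forall>\<^sub>F t in at 0. norm (norm (?h (0 + t) - ?h 0 - 0) / norm t)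
          \<le> C * norm (c s (t *s x)) * norm x"
      proof eventually_elim
        case (elim t)
        have tx: "t *s x \<in> l" using x l_closed by simp
        have "norm (mu (c s (t *s x)) (- (t *s x)) - c s (t *s x) - (- (t *s x)))
            \<le> C * norm (c s (t *s x)) * norm (- (t *s x))"
          using rC(3)[of "c s (t *s x)" "- (t *s x)"] elim tx \<rho>(5) cU(1)[OF s tx elim(2)] U_facts(1) l_closed(4)
          by (auto simp: subset_iff)
        then have "norm (?h t) \<le> C * norm (c s (t *s x)) * norm x * norm t"
          by (simp add: K_mu[OF s tx elim(2)] norm_scale_vec algebra_simps)
        then show ?case using K0 c0 by (cases "t = 0") (simp_all add: divide_le_eq)
      qed
    qed
    then have "cderiv ?h 0 0" by (simp add: cderiv_def)
    from cderiv_add[OF this cderiv_diff[OF w cderiv_scale[of x]]] show ?thesis by simp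
  qed
  show ?thesis
  proof (rule that[OF \<rho>(1)])
    fix s :: complex and x assume "norm s < \<rho>" "x \<in> l"
    then show "\<exists>y. conj_rel (E (s *s \<eta>)) x y"
      using der(1)[of s x 0] conj_w \<rho>(1) by auto
  next
    fix x and w :: "real \<Rightarrow> complex^'n"
    assume x: "x \<in> l" and w: "\<And>s::real. \<bar>s\<bar> < \<rho> \<Longrightarrow> conj_rel (E (s *\<^sub>R \<eta>)) x (w s)"
    define R where "R = \<rho> / (1 + norm x)"
    have R: "R > 0" "R \<le> \<rho>" using \<rho>(1) by (auto simp: R_def divide_le_eq add_pos_nonneg algebra_simps)
    have tx: "norm (t *s x) < \<rho>" if "norm t < R" for t
    proof -
      have "norm t * norm x \<le> norm t * (1 + norm x)" by (intro mult_left_mono) auto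
      also have "\<dots> < \<rho>" using that by (simp add: R_def pos_less_divide_eq add_pos_nonneg)
      finally show ?thesis by (simp add: norm_scale_vec)
    qed
    have bound: "norm (K s (s *s x) $ i - s * (w a - x) $ i) \<le> 6 / R ^ 3 * norm s ^ 3"
      if a: "s = of_real a" "\<bar>a\<bar> < R" "a \<noteq> 0" for s a i
    proof -
      have s: "norm s < R" "norm s < \<rho>" "s \<noteq> 0" using a R by auto
      have hs: "(\<lambda>s. K s (t *s x) $ i) holomorphic_on ball 0 R" if t: "norm t < R" for t
      proof (rule holomorphic_onI)
        fix s0 :: complex assume "s0 \<in> ball 0 R"
        then have s0: "norm s0 < R" by simp
        have tt: "t *s x \<in> l" "norm (t *s x) < \<rho>" using x l_closed tx[OF t] by auto
        have S: "norm s < \<rho>" if "s \<in> ball 0 R" for s :: complex using that R by simp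
        obtain w1 where w1: "cderiv (\<lambda>s. mu (s *s \<eta>) (t *s x)) w1 s0" "w1 \<in> l"
          by (rule cderiv_mu[OF cderiv_scale[of \<eta>] cderiv_const[of "t *s x"] open_ball \<open>s0 \<in> ball 0 R\<close>])
             (use g(1)[OF S tt] s\<eta>[OF S] yU[OF tt] \<eta> l_closed in auto)
        obtain w2 where w2: "cderiv (\<lambda>s. mu (mu (s *s \<eta>) (t *s x)) (- (s *s \<eta>))) w2 s0" "w2 \<in> l"
          by (rule cderiv_mu[OF w1(1) cderiv_minus_scale[of \<eta>] open_ball \<open>s0 \<in> ball 0 R\<close>])
             (use mU[OF S tt] g(2)[OF S tt] s\<eta>[OF S] w1 \<eta> l_closed E_uminus in auto)
        obtain w3 where w3: "cderiv (\<lambda>s. mu (mu (mu (s *s \<eta>) (t *s x)) (- (s *s \<eta>))) (- (t *s x))) w3 s0"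
          by (rule cderiv_mu[OF w2(1) cderiv_const[of "- (t *s x)"] open_ball \<open>s0 \<in> ball 0 R\<close>])
             (use cU[OF S tt] c_mu[OF S tt] g(3)[OF S tt] yU[OF tt] w2 l_closed E_uminus[OF tt(1)] in auto)
        have "((\<lambda>s. K s (t *s x) $ i) has_field_derivative w3 $ i) (at s0)"
          by (rule has_field_derivative_transform_within_open[OF cderiv_nth[OF w3] open_ball \<open>s0 \<in> ball 0 R\<close>])
             (simp add: K_mu[OF S tt] c_mu[OF S tt])
        then show "(\<lambda>s. K s (t *s x) $ i) field_differentiable at s0 within ball 0 R"
          unfolding field_differentiable_def by (blast intro: DERIV_subset)
      qed
      have ht: "(\<lambda>t. K s (t *s x) $ i) holomorphic_on ball 0 R"
      proof (rule holomorphic_onI)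
        fix t :: complex assume "t \<in> ball 0 R"
        then obtain w where "cderiv (\<lambda>t. K s (t *s x)) w t"
          using der(2)[OF s(2) x, of t] tx by auto
        from cderiv_nth[OF this] show "(\<lambda>t. K s (t *s x) $ i) field_differentiable at t within ball 0 R"
          unfolding field_differentiable_def by (blast intro: DERIV_subset)
      qed
      have Kn: "norm (K s' (t *s x) $ i) < 1" if "norm s' < R" "norm t < R" for s' t
        using K1[of s' "t *s x"] that R tx[OF that(2)] x l_closed Finite_Cartesian_Product.norm_nth_le[of "K s' (t *s x)" i]
        by force
      \<comment> \<open>the Schwarz lemma in \<open>s\<close> makes \<open>K\<close> of order \<open>s\<close> uniformly in \<open>t\<close>; its second order version is then applied in \<open>t\<close>\<close>
      have B: "norm (K s (t *s x) $ i) < 2 * norm s / R" if t: "norm t < R" for t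
      proof -
        have "norm (K s (t *s x) $ i) \<le> 1 * norm s / R"
          by (rule schwarz_bound(1)[OF hs[OF t] R(1)]) (use K0 Kn t s in auto)
        also have "\<dots> < 2 * norm s / R" using s R by (simp add: divide_strict_right_mono)
        finally show ?thesis .
      qed
      have "w a \<in> l" "conj_rel (E (s *s \<eta>)) x (w a)"
        using w[of a] a R by (auto simp: conj_rel_def scaleR_as_scale)
      moreover obtain w' where w': "w' \<in> l" "cderiv (\<lambda>t. c s (t *s x)) w' 0"
        using der(1)[OF s(2) x, of 0] \<rho>(1) by auto
      ultimately have "w a = w'" using conj_w[OF s(2) x w'] conj_rel_unique by blast
      then have "cderiv (\<lambda>t. K s (t *s x)) (w a - x) 0" using Kder[OF s(2) x w'(2)] by simp
      from DERIV_imp_deriv[OF cderiv_nth[OF this]]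
      have dv: "deriv (\<lambda>t. K s (t *s x) $ i) 0 = (w a - x) $ i" .
      have "norm (K s (s *s x) $ i - s * deriv (\<lambda>t. K s (t *s x) $ i) 0)
          \<le> 3 * (2 * norm s / R) * (norm s)\<^sup>2 / R\<^sup>2"
        by (rule schwarz_second_order[OF ht R(1)]) (use K0 B s in auto)
      also have "\<dots> = 6 / R ^ 3 * norm s ^ 3" using R by (simp add: power2_eq_square power3_eq_cube)
      finally show ?thesis unfolding dv .
    qed
    have lim: "((\<lambda>a::real. (1 / a\<^sup>2) *\<^sub>R K (of_real a) (of_real a *s x)) \<longlongrightarrow> br \<eta> x) (at 0)"
      using comm_E[OF \<eta> x] by (simp add: K_def lg_def scaleR_as_scale)
    show "((\<lambda>s. (1 / s) *\<^sub>R (w s - x)) \<longlongrightarrow> br \<eta> x) (at 0)"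
    proof (rule vec_tendstoI)
      fix i
      have z: "((\<lambda>a::real. ((1 / a\<^sup>2) *\<^sub>R K (of_real a) (of_real a *s x)) $ i - ((1 / a) *\<^sub>R (w a - x)) $ i) \<longlongrightarrow> 0) (at 0)"
      proof (rule Lim_null_comparison)
        show "((\<lambda>a::real. 6 / R ^ 3 * \<bar>a\<bar>) \<longlongrightarrow> 0) (at 0)"
          using R(1) by (auto intro!: tendsto_eq_intros)
        have "\<forall>\<^sub>F a::real in at 0. \<bar>a\<bar> < R \<and> a \<noteq> 0"
          unfolding eventually_at using R(1) by (intro exI[of _ R]) auto
        then show "\<forall>\<^sub>F a::real in at 0. norm (((1 / a\<^sup>2) *\<^sub>R K (of_real a) (of_real a *s x)) $ i - ((1 / a) *\<^sub>R (w a - x)) $ i)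
            \<le> 6 / R ^ 3 * \<bar>a\<bar>"
        proof eventually_elim
          case (elim a)
          have "((1 / a\<^sup>2) *\<^sub>R K (of_real a) (of_real a *s x)) $ i - ((1 / a) *\<^sub>R (w a - x)) $ i
              = of_real (1 / a\<^sup>2) * (K (of_real a) (of_real a *s x) $ i - of_real a * (w a - x) $ i)"
            unfolding vector_scaleR_component unfolding scaleR_conv_of_real
            using elim by (simp add: power2_eq_square field_simps)
          then have "norm (((1 / a\<^sup>2) *\<^sub>R K (of_real a) (of_real a *s x)) $ i - ((1 / a) *\<^sub>R (w a - x)) $ i)
              = 1 / a\<^sup>2 * norm (K (of_real a) (of_real a *s x) $ i - of_real a * (w a - x) $ i)"
            by (simp only: norm_mult norm_of_real) simp
          also have "\<dots> \<le> 1 / a\<^sup>2 * (6 / R ^ 3 * norm (complex_of_real a) ^ 3)"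
            by (intro mult_left_mono bound[OF refl]) (use elim in auto)
          also have "\<dots> = 6 / R ^ 3 * \<bar>a\<bar>"
            using elim by (simp add: power3_eq_cube power2_eq_square)
          finally show ?case .
        qed
      qed
      from tendsto_diff[OF tendsto_vec_nth[OF lim, of i] z]
      show "((\<lambda>s. ((1 / s) *\<^sub>R (w s - x)) $ i) \<longlongrightarrow> br \<eta> x $ i) (at 0)" by simp
    qed
  qed
qed

text \<open>\<open>E \<eta>\<close> is a power of the element \<open>E (\<eta> / k)\<close>, which is close to the identity.\<close>

lemma conj_rel_exists: "\<eta> \<in> l \<Longrightarrow> x \<in> l \<Longrightarrow> \<exists>y. conj_rel (E \<eta>) x y"
proof -
  assume \<eta>: "\<eta> \<in> l" and x: "x \<in> l"
  obtain \<rho> where \<rho>: "\<rho> > 0" "\<And>s x. norm s < \<rho> \<Longrightarrow> x \<in> l \<Longrightarrow> \<exists>y. conj_rel (E (s *s \<eta>)) x y"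
    by (rule small_conjugation[OF \<eta>]) blast
  obtain k where k: "inverse (real (Suc k)) < \<rho>" using reals_Archimedean[OF \<rho>(1)] by blast
  define h where "h = E ((1 / real (Suc k)) *\<^sub>R \<eta>)"
  have step: "\<exists>y. conj_rel h x y" if "x \<in> l" for x
    using \<rho>(2)[of "of_real (1 / real (Suc k))" x] k that
    by (simp add: h_def scaleR_as_scale inverse_eq_divide norm_divide del: of_nat_Suc of_real_divide)
  have "\<exists>y. conj_rel (npow m h) x y" if "x \<in> l" for m x
    using that
  proof (induction m arbitrary: x)
    case 0
    then show ?case by (intro exI[of _ x]) (simp add: conj_rel_def)
  next
    case (Suc m)
    then obtain y where y: "conj_rel h x y" using step by blast
    then obtain z where "conj_rel (npow m h) y z" using Suc.IH[of y] by (auto simp: conj_rel_def)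
    then show ?case using conj_rel_compose[OF y] by auto
  qed
  moreover have "npow (Suc k) h = E \<eta>"
    using E_npow[of "(1 / real (Suc k)) *\<^sub>R \<eta>" "Suc k"] \<eta> l_closed by (simp add: h_def)
  ultimately show ?thesis using x by metis
qed

text \<open>Both sides solve the differential equation \<open>y' = [\<eta>, y]\<close> along the ray of \<open>\<eta>\<close>.\<close>

lemma conjugation:
  assumes \<eta>: "\<eta> \<in> l" and x: "x \<in> l"
  shows "conj_rel (E \<eta>) x (app (exp (ad_op br \<eta>)) x)"
proof -
  define P where "P s = (SOME y. conj_rel (E (s *\<^sub>R \<eta>)) x y)" for s :: real
  have P: "conj_rel (E (s *\<^sub>R \<eta>)) x (P s)" for s
    unfolding P_def by (rule someI_ex) (use conj_rel_exists \<eta> x l_closed in auto)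
  have P0: "P 0 = x"
    by (rule conj_rel_unique[OF P]) (use x in \<open>simp add: conj_rel_def E_0\<close>)
  obtain \<rho> where \<rho>: "\<rho> > 0" 
    "\<And>x w. x \<in> l \<Longrightarrow> (\<And>s::real. \<bar>s\<bar> < \<rho> \<Longrightarrow> conj_rel (E (s *\<^sub>R \<eta>)) x (w s)) \<Longrightarrow>
       ((\<lambda>s. (1 / s) *\<^sub>R (w s - x)) \<longlongrightarrow> br \<eta> x) (at 0)"
    by (rule small_conjugation[OF \<eta>]) blast
  have "(P has_vector_derivative app (ad_op br \<eta>) (P s)) (at s)" for s
  proof -
    define Q where "Q h = (SOME y. conj_rel (E (h *\<^sub>R \<eta>)) (P s) y)" for h :: real
    have Ps: "P s \<in> l" using P by (simp add: conj_rel_def)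
    have Q: "conj_rel (E (h *\<^sub>R \<eta>)) (P s) (Q h)" for h
      unfolding Q_def by (rule someI_ex) (use conj_rel_exists \<eta> Ps l_closed in auto)
    have "P (s + h) = Q h" for h
    proof (rule conj_rel_unique[OF P])
      have "E (h *\<^sub>R \<eta>) + E (s *\<^sub>R \<eta>) = E ((s + h) *\<^sub>R \<eta>)"
        using E_add_scaleR[OF \<eta>, of h s] by (simp add: add.commute)
      then show "conj_rel (E ((s + h) *\<^sub>R \<eta>)) x (Q h)"
        using conj_rel_compose[OF P[of s] Q[of h]] by simp
    qed
    moreover have "((\<lambda>h. (1 / h) *\<^sub>R (Q h - P s)) \<longlongrightarrow> br \<eta> (P s)) (at 0)"
      by (rule \<rho>(2)[OF Ps Q])
    ultimately have "((\<lambda>h. (1 / h) *\<^sub>R (P (s + h) - P (s + 0))) \<longlongrightarrow> br \<eta> (P s)) (at 0)" by simp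
    then have "((\<lambda>h. P (s + h)) has_vector_derivative br \<eta> (P s)) (at 0)"
      by (simp only: has_vector_derivative_at_0_iff)
    then have d: "((\<lambda>h. P (s + h)) has_vector_derivative br \<eta> (P s)) (at (s - s))" by simp
    have "((\<lambda>u. u - s) has_vector_derivative 1) (at s)" by (auto intro!: derivative_eq_intros)
    from vector_diff_chain_at[OF this d] show ?thesis by (simp add: app_ad o_def)
  qed
  from exp_solves_linear_ode[OF this, of 1] have "P 1 = app (exp (ad_op br \<eta>)) x" by (simp add: P0)
  then show ?thesis using P[of 1] by simp
qed

end

section \<open>The differential of the exponential map\<close>

text \<open>The function \<open>(exp s - 1) / s\<close>; its value at \<open>ad A\<close> is the differential of the exponential map, trivialized by
  right translations.\<close>

definition phi :: "complex \<Rightarrow> complex" where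
  "phi s = (if s = 0 then 1 else (exp s - 1) / s)"

lemma entire_phi: "entire phi"
proof -
  have "deriv exp (0::complex) = 1" using DERIV_imp_deriv[OF DERIV_exp[of 0]] by simp
  then show ?thesis
    using pole_lemma_open[of exp UNIV 0] by (simp add: phi_def[abs_def] holomorphic_intros cong: if_cong)
qed

lemma phi_mult: "phi s * s = exp s - 1"
  by (simp add: phi_def)

lemma fcalc_phi: "fcalc phi T * T = exp T - 1"
proof -
  have "fcalc (\<lambda>s. phi s * s) T = fcalc phi T * T"
    by (simp add: fcalc_mult entire_phi fcalc_id holomorphic_intros)
  moreover have "fcalc (\<lambda>s. exp s - 1) T = exp T - 1"
    by (simp add: fcalc_linear holomorphic_intros fcalc_exp1 fcalc_const scal_simps)
  ultimately show ?thesis by (simp add: phi_mult)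
qed

lemma scal_mult_power: "(scal c * T) ^ k = scal (c ^ k) * T ^ k"
proof (induction k)
  case (Suc k)
  then show ?case
    by (simp add: scal_simps mult.assoc scal_left_commute[of T])
qed (simp add: scal_simps)

lemma fcalc_scale_arg:
  assumes "entire f"
  shows "fcalc (\<lambda>s. f (c * s)) T = fcalc f (scal c * T)"
proof -
  have "tcoeff (\<lambda>s. f (c * s)) k = c ^ k * tcoeff f k" for k
    using higher_deriv_compose_linear[OF assms open_UNIV open_UNIV, of 0 c k] by (simp add: tcoeff_def)
  then show ?thesis
    unfolding fcalc_def by (simp add: scal_mult_power scal_simps mult.assoc scal_left_commute[of "scal _"])
qed

lemma fcalc_zero: "entire f \<Longrightarrow> fcalc f 0 = scal (f 0)"
  by (rule endo_eqI) (use fcalc_on_geig[of f 0 0 1] in \<open>simp add: scal_simps taylor_def\<close>)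

lemma fcalc_sum:
  assumes "\<And>i. i \<in> I \<Longrightarrow> entire (f i)"
  shows "fcalc (\<lambda>s. \<Sum>i\<in>I. f i s) T = (\<Sum>i\<in>I. fcalc (f i) T)"
  using assms
  by (induction I rule: infinite_finite_induct) (simp_all add: fcalc_linear fcalc_const scal_simps holomorphic_intros)

text \<open>The Riemann sums of \<open>\<integral>\<^sub>0\<^sup>1 exp (u D) du = (exp D - 1) / D\<close>, evaluated as geometric sums.\<close>

lemma exp_average_tendsto:
  fixes D :: "'n::finite endo"
  shows "(\<lambda>k. (1 / real (Suc k)) *\<^sub>R (\<Sum>i<Suc k. exp ((real (Suc i) / real (Suc k)) *\<^sub>R D)))
    \<longlonglongrightarrow> fcalc phi D"
proof -
  define a where "a k = (1 / real (Suc k)) *\<^sub>R (\<Sum>i<Suc k. exp ((real (Suc i) / real (Suc k)) *\<^sub>R D))" for k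
  define h where "h k = 1 / real (Suc k)" for k
  have h0: "h \<longlonglongrightarrow> 0" unfolding h_def using LIMSEQ_Suc[OF lim_inverse_n'] by simp
  have ident: "a k * fcalc phi (h k *\<^sub>R D) = exp (h k *\<^sub>R D) * fcalc phi D" for k
  proof -
    define m where "m = real (Suc k)"
    have m: "m > 0" by (simp add: m_def)
    \<comment> \<open>the Riemann sum as an entire function; its product with \<open>phi\<close> at the step size is a geometric sum\<close>
    define \<psi> where "\<psi> s = of_real (h k) * (\<Sum>i<Suc k. exp (of_real (real (Suc i) / m) * s))" for s :: complex
    have f: "\<psi> s * phi (of_real (h k) * s) = exp (of_real (h k) * s) * phi s" for s
    proof (cases "s = 0")
      case True
      then show ?thesis
        by (simp add: \<psi>_def phi_def h_def m_def del: of_nat_Suc sum.lessThan_Suc)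
    next
      case False
      define z where "z = exp (of_real (h k) * s)"
      have e: "exp (of_real (real (Suc i) / m) * s) = z * z ^ i" for i
      proof -
        have "of_real (real (Suc i) / m) * s = of_nat (Suc i) * (of_real (h k) * s)"
          by (simp add: h_def m_def)
        then show ?thesis unfolding z_def by (simp only: exp_of_nat_mult power_Suc)
      qed
      have zm: "z ^ Suc k = exp s"
      proof -
        have "z ^ Suc k = exp (of_nat (Suc k) * (of_real (h k) * s))"
          unfolding z_def by (simp only: exp_of_nat_mult)
        also have "of_nat (Suc k) * (of_real (h k) * s) = s" by (simp add: h_def del: of_nat_Suc)
        finally show ?thesis .
      qed
      have hk: "complex_of_real (h k) \<noteq> 0" by (simp add: h_def del: of_nat_Suc)
      have "\<psi> s * phi (of_real (h k) * s) = of_real (h k) * (z * (\<Sum>i<Suc k. z ^ i)) * ((z - 1) / (of_real (h k) * s))"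
        using False hk by (simp only: \<psi>_def e phi_def z_def sum_distrib_left mult_eq_0_iff if_False simp_thms)
      also have "\<dots> = z * ((z - 1) * (\<Sum>i<Suc k. z ^ i)) / s"
        using hk False by (simp add: field_simps)
      also have "(z - 1) * (\<Sum>i<Suc k. z ^ i) = z ^ Suc k - 1"
        by (rule power_diff_1_eq[symmetric])
      finally have fin: "\<psi> s * phi (of_real (h k) * s) = z * (z ^ Suc k - 1) / s" .
      show ?thesis unfolding fin zm using False by (simp add: phi_def z_def)
    qed
    have ent: "entire \<psi>" unfolding \<psi>_def by (intro holomorphic_intros)
    have "fcalc \<psi> D = scal (of_real (h k)) * (\<Sum>i<Suc k. exp (scal (of_real (real (Suc i) / m)) * D))"
      unfolding \<psi>_def
      by (subst fcalc_mult fcalc_const fcalc_sum fcalc_exp; (intro holomorphic_intros)?)+ simp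
    then have pa: "fcalc \<psi> D = a k"
      by (simp only: scal_of_real_mult a_def h_def m_def)
    have "fcalc (\<lambda>s. \<psi> s * phi (of_real (h k) * s)) D = a k * fcalc phi (h k *\<^sub>R D)"
      using fcalc_mult[OF ent, of "\<lambda>s. phi (of_real (h k) * s)" D] fcalc_scale_arg[OF entire_phi, of "of_real (h k)" D]
        holomorphic_on_compose[of "\<lambda>s. of_real (h k) * s" UNIV phi]
      by (simp add: pa scal_of_real_mult o_def holomorphic_intros holomorphic_on_subset[OF entire_phi])
    moreover have "fcalc (\<lambda>s. exp (of_real (h k) * s) * phi s) D = exp (h k *\<^sub>R D) * fcalc phi D"
      by (simp add: fcalc_mult entire_phi fcalc_exp holomorphic_intros scal_of_real_mult)
    ultimately show ?thesis by (simp add: f)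
  qed
  have hD: "(\<lambda>k. h k *\<^sub>R D) \<longlonglongrightarrow> 0" using tendsto_scaleR[OF h0 tendsto_const, of D] by simp
  have p1: "(\<lambda>k. fcalc phi (h k *\<^sub>R D)) \<longlonglongrightarrow> 1"
    using tendsto_fcalc[OF entire_phi hD] by (simp add: fcalc_zero entire_phi phi_def scal_simps)
  have e1: "(\<lambda>k. exp (h k *\<^sub>R D)) \<longlonglongrightarrow> exp 0"
    using tendsto_fcalc[of exp, OF _ hD] by (simp add: fcalc_exp1 holomorphic_intros)
  have "(\<lambda>k. exp (h k *\<^sub>R D) * fcalc phi D * einv (fcalc phi (h k *\<^sub>R D)))
      \<longlonglongrightarrow> exp 0 * fcalc phi D * einv 1"
    by (intro tendsto_mult tendsto_const tendsto_einv p1 e1) (simp add: edet_one)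
  moreover have "einv (1 :: 'n endo) = 1" using einv_unique[of 1 1] by simp
  moreover have "\<forall>\<^sub>F k in sequentially. exp (h k *\<^sub>R D) * fcalc phi D * einv (fcalc phi (h k *\<^sub>R D)) = a k"
    using tendsto_imp_eventually_ne[OF tendsto_edet[OF p1], of 0]
    by (auto simp: edet_one ident[symmetric] mult.assoc einv elim!: eventually_mono)
  ultimately have "a \<longlonglongrightarrow> fcalc phi D"
    using Lim_transform_eventually by fastforce
  then show ?thesis by (simp add: a_def[abs_def])
qed

context lie_group_chart
begin

lemma ad_scaleR: "ad_op br (r *\<^sub>R x) = r *\<^sub>R ad_op br x"
  by (rule endo_eqI) (simp add: app_ad scaleR_as_scale br_scale app_lin)

lemma fcalc_in_l:
  assumes f: "entire f" and A: "A \<in> l" and x: "x \<in> l"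
  shows "app (fcalc f (ad_op br A)) x \<in> l"
proof -
  have p: "app (ad_op br A ^ k) x \<in> l" for k
    by (induction k) (auto simp: x app_ad intro: br_l A)
  have "(\<lambda>k. app (scal (tcoeff f k) * ad_op br A ^ k) x) sums app (fcalc f (ad_op br A)) x"
    by (rule bounded_linear.sums[OF app.bounded_linear_left fcalc_sums[OF f]])
  then show ?thesis
    unfolding sums_def
    by (rule closed_sequentially[OF closed_l, rotated])
       (auto intro!: subspace_sum[OF sub_real] l_closed p)
qed

text \<open>On \<open>N\<close> the exponential map is injective, whereas an eigenvector \<open>v\<close> of \<open>ad A\<close> with eigenvalue
  \<open>\<mu>\<close>, \<open>exp \<mu> = 1\<close>, gives the curve \<open>A - s \<mu> v\<close> of points with the same exponential as \<open>A\<close>.\<close>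

lemma no_resonance:
  assumes N: "exp_parametrizes l E N" and A: "A \<in> N" and v: "v \<in> l" "v \<noteq> 0"
    and ev: "br A v = \<mu> *s v" and e1: "exp \<mu> = 1"
  shows "\<mu> = 0"
proof (rule ccontr)
  assume \<mu>: "\<mu> \<noteq> 0"
  obtain T where T: "open T" "N = l \<inter> T"
    using N by (auto simp: exp_parametrizes_def openin_open)
  then have Al: "A \<in> l" using A by simp
  have "app (fcalc exp (ad_op br A)) v = exp \<mu> *s v"
    using fcalc_on_geig[of exp "ad_op br A" \<mu> 1 v]
    by (simp add: holomorphic_intros app_lin app_ad ev taylor_def)
  then have ev': "app (exp (ad_op br A)) v = v" by (simp add: fcalc_exp1 e1)
  have same: "E (A - s *\<^sub>R (\<mu> *s v)) = E A" for s :: real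
  proof -
    define y where "y t = A - t *\<^sub>R (s *\<^sub>R (\<mu> *s v))" for t :: real
    have "(y has_vector_derivative app (ad_op br (s *\<^sub>R v)) (y t)) (at t)" for t
    proof -
      have "app (ad_op br (s *\<^sub>R v)) (y t) = - (s *\<^sub>R (\<mu> *s v))"
        using ev br_anti[of v A]
        by (simp add: app_ad y_def scaleR_as_scale vec.linear_diff[OF lin_br(1)] br_scale br_self)
      then show ?thesis unfolding y_def by (auto intro!: derivative_eq_intros)
    qed
    from exp_solves_linear_ode[OF this, of 1]
    have "app (exp (ad_op br (s *\<^sub>R v))) A = A - s *\<^sub>R (\<mu> *s v)" by (simp add: y_def)
    then have "E (s *\<^sub>R v) + E A - E (s *\<^sub>R v) = E (A - s *\<^sub>R (\<mu> *s v))"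
      using conjugation[OF l_closed(5)[OF v(1)] Al, of s]
      unfolding conj_rel_def by (metis scaleR_one)
    moreover have "E A + E (s *\<^sub>R v) - E A = E (s *\<^sub>R v)"
      using conjugation[OF Al v(1)] by (simp add: conj_rel_def ev')
    then have "E A + E (s *\<^sub>R v) = E (s *\<^sub>R v) + E A" by (simp add: diff_eq_eq)
    then have "E (s *\<^sub>R v) + E A - E (s *\<^sub>R v) = E A" by (simp add: diff_eq_eq)
    ultimately show ?thesis by simp
  qed
  have "((\<lambda>s::real. A - s *\<^sub>R (\<mu> *s v)) \<longlongrightarrow> A - 0 *\<^sub>R (\<mu> *s v)) (at 0)" by (intro tendsto_intros)
  from topological_tendstoD[OF this T(1)]
  have "\<forall>\<^sub>F s::real in at 0. A - s *\<^sub>R (\<mu> *s v) \<in> T"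
    using A T(2) by simp
  moreover have "\<forall>\<^sub>F s::real in at 0. s \<noteq> 0" by (simp add: eventually_at_filter)
  ultimately have "\<forall>\<^sub>F s::real in at 0. A - s *\<^sub>R (\<mu> *s v) \<in> T \<and> s \<noteq> 0" by (rule eventually_conj)
  then obtain s :: real where s: "A - s *\<^sub>R (\<mu> *s v) \<in> T" "s \<noteq> 0"
    using eventually_happens'[of "at (0::real)"] by auto
  then have "A - s *\<^sub>R (\<mu> *s v) \<in> N" using T(2) Al v(1) l_closed by simp
  moreover have "inj_on E N" using N by (simp add: exp_parametrizes_def)
  ultimately have "A - s *\<^sub>R (\<mu> *s v) = A" using inj_onD[OF _ same _ A] by blast
  then show False using s \<mu> v(2) by simp
qed

text \<open>The kernel of \<open>phi (ad A)\<close> on \<open>l\<close> is invariant under \<open>ad A\<close>; if it is not zero, it contains an eigenvector,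
  whose eigenvalue is a zero of \<open>phi\<close>. This is excluded by the injectivity of \<open>E\<close> on \<open>N\<close>.\<close>

lemma phi_injective_on_l:
  assumes N: "exp_parametrizes l E N" and A: "A \<in> N" and w: "w \<in> l" "app (fcalc phi (ad_op br A)) w = 0"
  shows "w = 0"
proof (rule ccontr)
  assume w0: "w \<noteq> 0"
  let ?D = "ad_op br A"
  have Al: "A \<in> l" using N A openin_imp_subset by (fastforce simp: exp_parametrizes_def)
  obtain p where p: "p \<noteq> 0" "app (fcalc (poly p) ?D) w = 0" using exists_annihilating_poly by blast
  have "\<exists>\<mu> v. v \<in> l \<and> v \<noteq> 0 \<and> app (fcalc phi ?D) v = 0 \<and> br A v = \<mu> *s v"
    using p
  proof (induction "degree p" arbitrary: p)
    case 0
    then obtain c where c: "p = [:c:]" "c \<noteq> 0" by (metis degree_eq_zeroE pCons_eq_0_iff)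
    then have "poly p = (\<lambda>s. c)" by (simp add: fun_eq_iff)
    then have "c *s w = 0" using fcalc_const[of c ?D] 0 by simp
    then show ?case using c w0 by simp
  next
    case (Suc d)
    obtain \<mu> where "poly p \<mu> = 0" using alg_closed_imp_poly_has_root[of p] Suc by auto
    then obtain q where q: "p = [:- \<mu>, 1:] * q" by (auto simp: poly_eq_0_iff_dvd)
    then have q0: "q \<noteq> 0" using Suc by auto
    then have dq: "d = degree q" using Suc(2) q by (simp add: degree_mult_eq del: mult_pCons_left)
    have pq: "poly p = (\<lambda>s. (s - \<mu>) * poly q s)" by (simp add: q fun_eq_iff algebra_simps)
    have fp: "fcalc (poly p) ?D = (?D - scal \<mu>) * fcalc (poly q) ?D"
      by (simp add: pq fcalc_linear fcalc_mult fcalc_const fcalc_id holomorphic_intros entire_poly)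
    define v where "v = app (fcalc (poly q) ?D) w"
    show ?case
    proof (cases "v = 0")
      case True
      then show ?thesis using Suc.hyps(1)[OF dq q0] by (simp add: v_def)
    next
      case False
      have "app (fcalc phi ?D) v = app (fcalc (poly q) ?D) (app (fcalc phi ?D) w)"
        unfolding v_def by (simp add: fcalc_commute_fcalc[OF entire_phi entire_poly] flip: app_simps(3))
      moreover have "br A v = \<mu> *s v"
        using Suc.prems(2) by (simp add: fp v_def app_lin app_ad)
      ultimately show ?thesis
        using False w fcalc_in_l[OF entire_poly Al w(1)] by (intro exI[of _ \<mu>] exI[of _ v]) (auto simp: v_def)
    qed
  qed
  then obtain \<mu> v where v: "v \<in> l" "v \<noteq> 0" "app (fcalc phi ?D) v = 0" "br A v = \<mu> *s v" by blast
  have "app (fcalc phi ?D) v = phi \<mu> *s v"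
    using fcalc_on_geig[OF entire_phi, of ?D \<mu> 1 v] by (simp add: app_lin app_ad v taylor_def)
  then have ph: "phi \<mu> = 0" using v by simp
  then have "exp \<mu> = 1" using phi_mult[of \<mu>] by simp
  then have "\<mu> = 0" using no_resonance[OF N A v(1,2,4)] by simp
  then show False using ph by (simp add: phi_def)
qed

primrec gprod :: "(nat \<Rightarrow> complex^'n) \<Rightarrow> nat \<Rightarrow> 'g" where
  "gprod x 0 = 0"
| "gprod x (Suc k) = gprod x k + E (x k)"

text \<open>A product of exponentials of short vectors is the exponential of their sum, up to a quadratic
  error that does not depend on the number of factors.\<close>

lemma gprod_estimate:
  "\<exists>\<delta>>0. \<exists>C>0. \<forall>x k. (\<forall>i<k. x i \<in> l) \<longrightarrow> (\<Sum>i<k. norm (x i)) < \<delta> \<longrightarrow>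
     (\<exists>p\<in>U. gprod x k = E p \<and> norm (p - (\<Sum>i<k. x i)) \<le> C * (\<Sum>i<k. norm (x i))\<^sup>2)"
proof -
  obtain r C where r: "r > 0" "C > 0" and est: "\<And>x y. x \<in> l \<Longrightarrow> y \<in> l \<Longrightarrow> norm x < r \<Longrightarrow> norm y < r \<Longrightarrow>
       x \<in> U \<and> y \<in> U \<and> E x + E y \<in> E ` U \<and> norm (mu x y - x - y) \<le> C * norm x * norm y"
    using mult_estimate by blast
  \<comment> \<open>for a total norm \<open>s\<close> below \<open>\<delta>\<close> the error \<open>2 * C * s\<^sup>2\<close> is at most \<open>s\<close>, so that the partial products have logarithms shorter than \<open>r\<close>\<close>
  define \<delta> where "\<delta> = min (r / 2) (1 / (2 * C))"
  have \<delta>: "\<delta> > 0" "2 * \<delta> \<le> r" "2 * C * \<delta> \<le> 1"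
  proof -
    show "\<delta> > 0" "2 * \<delta> \<le> r" using r by (auto simp: \<delta>_def)
    have "2 * C * \<delta> \<le> 2 * C * (1 / (2 * C))" using r by (intro mult_left_mono) (auto simp: \<delta>_def)
    then show "2 * C * \<delta> \<le> 1" using r by simp
  qed
  have "\<exists>p\<in>U. gprod x k = E p \<and> norm (p - (\<Sum>i<k. x i)) \<le> 2 * C * (\<Sum>i<k. norm (x i))\<^sup>2"
    if "\<forall>i<k. x i \<in> l" "(\<Sum>i<k. norm (x i)) < \<delta>" for x k
    using that
  proof (induction k)
    case 0
    show ?case using U_facts(2) by (intro bexI[of _ 0]) (auto simp: E_0)
  next
    case (Suc k)
    define S where "S = (\<Sum>i<k. norm (x i))"
    define u where "u = norm (x k)"
    have Su: "S + u < \<delta>" "S \<ge> 0" "u \<ge> 0" using Suc.prems by (auto simp: S_def u_def sum_nonneg)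
    have xk: "x k \<in> l" using Suc.prems by simp
    obtain p where p: "p \<in> U" "gprod x k = E p" "norm (p - (\<Sum>i<k. x i)) \<le> 2 * C * S\<^sup>2"
      using Suc.IH Suc.prems Su by (auto simp: S_def)
    have pl: "p \<in> l" using p U_facts(1) by blast
    have "2 * C * S\<^sup>2 = (2 * C * S) * S" by (simp add: power2_eq_square)
    also have "\<dots> \<le> 1 * S"
    proof (rule mult_right_mono)
      have "2 * C * S \<le> 2 * C * \<delta>" using r Su by (intro mult_left_mono) auto
      then show "2 * C * S \<le> 1" using \<delta>(3) by simp
    qed (use Su in auto)
    finally have CS: "2 * C * S\<^sup>2 \<le> S" by simp
    have "norm p \<le> norm (p - (\<Sum>i<k. x i)) + norm (\<Sum>i<k. x i)" by (metis norm_triangle_sub add.commute)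
    also have "\<dots> \<le> S + S" using p(3) CS norm_sum[of x "{..<k}"] by (intro add_mono) (auto simp: S_def)
    finally have np: "norm p \<le> 2 * S" by simp
    have "2 * S < r" "u < r" using Su \<delta> by linarith+
    then have e: "norm p < r" "norm (x k) < r" using np by (auto simp: u_def)
    from est[OF pl xk e] have m: "E p + E (x k) \<in> E ` U" "norm (mu p (x k) - p - x k) \<le> C * norm p * u"
      by (auto simp: u_def)
    have "norm (mu p (x k) - (\<Sum>i<Suc k. x i)) \<le> norm (mu p (x k) - p - x k) + norm (p - (\<Sum>i<k. x i))"
      by (rule order_trans[OF _ norm_triangle_ineq]) (simp add: algebra_simps)
    also have "\<dots> \<le> C * (2 * S) * u + 2 * C * S\<^sup>2"
      using m(2) p(3) np Su r by (intro add_mono order_trans[OF m(2)] mult_right_mono mult_left_mono) auto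
    also have "\<dots> \<le> 2 * C * (S + u)\<^sup>2"
      using Su r by (simp add: power2_eq_square algebra_simps)
    finally have "norm (mu p (x k) - (\<Sum>i<Suc k. x i)) \<le> 2 * C * (\<Sum>i<Suc k. norm (x i))\<^sup>2"
      by (simp add: S_def u_def)
    then show ?case
      using E_lg[OF m(1)] p(2) by (intro bexI[of _ "mu p (x k)"]) (auto simp: mu_def)
  qed
  then show ?thesis using \<delta>(1) r(2) by (intro exI[of _ \<delta>] conjI exI[of _ "2 * C"]) auto
qed

text \<open>Moving all factors \<open>g\<close> to the right.\<close>

lemma npow_telescope:
  "(\<And>i. i < k \<Longrightarrow> npow (Suc i) g + h - npow (Suc i) g = E (x i)) \<Longrightarrow>
    npow k (g + h) = gprod x k + npow k g"
proof (induction k)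
  case (Suc k)
  have "npow (Suc k) (g + h) = gprod x k + npow k g + (g + h)" using Suc by simp
  also have "\<dots> = gprod x k + (npow (Suc k) g + h - npow (Suc k) g) + npow (Suc k) g"
    by (simp add: add.assoc)
  finally show ?case using Suc.prems[of k] by simp
qed simp

text \<open>The differential of the exponential map at \<open>A\<close>. Writing \<open>E (A + w)\<close> as the \<open>k\<close>-th power of
  \<open>E ((A + w) / k) = E (A / k) E (u)\<close> with \<open>u \<approx> w / k\<close> and moving all factors \<open>E (A / k)\<close> to the right
  gives \<open>E (A + w) E (A)\<^sup>-\<^sup>1 = \<Prod>\<^sub>i E (exp (i / k ad A) u)\<close>, whose logarithm is
  \<open>\<Sum>\<^sub>i exp (i / k ad A) u\<close> up to order two; the limit of this sum is \<open>\<phi> (ad A) w\<close>.\<close>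

lemma dexp_estimate:
  assumes A: "A \<in> l"
  shows "\<exists>\<delta>>0. \<exists>C. \<forall>w\<in>l. norm w < \<delta> \<longrightarrow>
    (\<exists>p\<in>U. E (A + w) - E A = E p \<and> norm (p - app (fcalc phi (ad_op br A)) w) \<le> C * (norm w)\<^sup>2)"
proof -
  let ?D = "ad_op br A"
  obtain r C1 where r: "r > 0" "C1 > 0" and est: "\<And>x y. x \<in> l \<Longrightarrow> y \<in> l \<Longrightarrow> norm x < r \<Longrightarrow> norm y < r \<Longrightarrow>
       x \<in> U \<and> y \<in> U \<and> E x + E y \<in> E ` U \<and> norm (mu x y - x - y) \<le> C1 * norm x * norm y"
    using mult_estimate by blast
  obtain \<delta>1 C2 where \<delta>1: "\<delta>1 > 0" "C2 > 0" and prod_est: "\<And>x k. \<forall>i<k. x i \<in> l \<Longrightarrow> (\<Sum>i<k. norm (x i)) < \<delta>1 \<Longrightarrow>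
     (\<exists>p\<in>U. gprod x k = E p \<and> norm (p - (\<Sum>i<k. x i)) \<le> C2 * (\<Sum>i<k. norm (x i))\<^sup>2)"
    using gprod_estimate by metis
  define M where "M = exp (norm ?D)"
  have M: "M > 0" by (simp add: M_def)
  \<comment> \<open>the vectors \<open>x k i\<close> below have total norm at most \<open>M * (2 * norm w)\<close> for large \<open>k\<close>\<close>
  define \<delta> where "\<delta> = \<delta>1 / (2 * M)"
  have "\<exists>p\<in>U. E (A + w) - E A = E p \<and> norm (p - app (fcalc phi ?D) w) \<le> (C2 * 4 * M\<^sup>2) * (norm w)\<^sup>2"
    if w: "w \<in> l" "norm w < \<delta>" for w
  proof (cases "w = 0")
    case True
    then show ?thesis using U_facts(2) by (intro bexI[of _ 0]) (auto simp: E_0)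
  next
    case False
    \<comment> \<open>\<open>E (x k i)\<close> is the conjugate of \<open>E (u k)\<close> by the \<open>Suc i\<close>-th power of \<open>E (a k)\<close>\<close>
    define K where "K k = real (Suc k)" for k
    have K: "K k > 0" for k by (simp add: K_def)
    define a where "a k = (1 / K k) *\<^sub>R A" for k
    define b where "b k = (1 / K k) *\<^sub>R (A + w)" for k
    define u where "u k = mu (- a k) (b k)" for k
    define x where "x k i = app (exp ((real (Suc i) / K k) *\<^sub>R ?D)) (u k)" for k i
    have ab: "- a k \<in> l" "b k \<in> l" "a k \<in> l" for k using A w l_closed by (auto simp: a_def b_def)
    have Kinv: "(\<lambda>k. 1 / K k) \<longlonglongrightarrow> 0" unfolding K_def using LIMSEQ_Suc[OF lim_inverse_n'] by simp
    have a0: "(\<lambda>k. - a k) \<longlonglongrightarrow> 0"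
      using tendsto_minus[OF tendsto_scaleR[OF Kinv tendsto_const[of A]]] by (simp add: a_def)
    have b0: "b \<longlonglongrightarrow> 0"
      using tendsto_scaleR[OF Kinv tendsto_const[of "A + w"]] by (simp add: b_def[abs_def])
    have small: "\<forall>\<^sub>F k in sequentially. norm (- a k) < r \<and> norm (b k) < r"
      using order_tendstoD(2)[OF tendsto_norm_zero[OF a0] r(1)] order_tendstoD(2)[OF tendsto_norm_zero[OF b0] r(1)]
      by (rule eventually_conj)
    have Ku: "(\<lambda>k. K k *\<^sub>R u k) \<longlonglongrightarrow> w"
    proof (rule LIM_zero_cancel, rule Lim_null_comparison)
      show "\<forall>\<^sub>F k in sequentially. norm (K k *\<^sub>R u k - w) \<le> C1 * norm A * norm (A + w) * (1 / K k)"
        using small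
      proof eventually_elim
        case (elim k)
        have "K k *\<^sub>R u k - w = K k *\<^sub>R (mu (- a k) (b k) - (- a k) - b k)"
          using K[of k] by (simp add: u_def a_def b_def scaleR_diff_right scaleR_add_right)
        then have "norm (K k *\<^sub>R u k - w) = K k * norm (mu (- a k) (b k) - (- a k) - b k)"
          using K[of k] by simp
        also have "\<dots> \<le> K k * (C1 * norm (- a k) * norm (b k))"
          using est[OF ab(1,2)] elim K[of k] by (intro mult_left_mono) auto
        also have "\<dots> = C1 * norm A * norm (A + w) * (1 / K k)"
          using K[of k] by (simp add: a_def b_def)
        finally show ?case .
      qed
      show "(\<lambda>k. C1 * norm A * norm (A + w) * (1 / K k)) \<longlonglongrightarrow> 0"
        using tendsto_mult[OF tendsto_const[of "C1 * norm A * norm (A + w)"] Kinv] by simp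
    qed
    have sum_x: "(\<Sum>i<Suc k. x k i)
        = app ((1 / K k) *\<^sub>R (\<Sum>i<Suc k. exp ((real (Suc i) / K k) *\<^sub>R ?D))) (K k *\<^sub>R u k)" for k
      unfolding x_def app_sum_left[symmetric] app_lin(4,8) using K[of k] by (simp del: sum.lessThan_Suc)
    have lim: "(\<lambda>k. \<Sum>i<Suc k. x k i) \<longlonglongrightarrow> app (fcalc phi ?D) w"
      unfolding sum_x by (intro tendsto_app Ku) (use exp_average_tendsto[of ?D] in \<open>simp only: K_def\<close>)
    have nx: "(\<Sum>i<Suc k. norm (x k i)) \<le> M * norm (K k *\<^sub>R u k)" for k
    proof -
      have "norm (x k i) \<le> M * norm (u k)" if "i < Suc k" for i
      proof -
        have "norm (exp ((real (Suc i) / K k) *\<^sub>R ?D)) \<le> exp (norm ((real (Suc i) / K k) *\<^sub>R ?D))"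
          by (rule norm_exp)
        also have "\<dots> \<le> M"
        proof -
          have "real (Suc i) / K k \<le> 1" "0 \<le> real (Suc i) / K k" using that K[of k] by (auto simp: K_def)
          then have "real (Suc i) / K k * norm ?D \<le> norm ?D" by (intro mult_left_le_one_le) auto
          then show ?thesis
            using \<open>0 \<le> real (Suc i) / K k\<close> by (simp only: M_def exp_le_cancel_iff norm_scaleR abs_of_nonneg)
        qed
        finally show ?thesis
          unfolding x_def by (intro order_trans[OF norm_app] mult_right_mono) auto
      qed
      then have "(\<Sum>i<Suc k. norm (x k i)) \<le> (\<Sum>i<Suc k. M * norm (u k))" by (intro sum_mono) auto
      then show ?thesis
        by (simp add: K_def mult.left_commute del: of_nat_Suc sum.lessThan_Suc)
    qed
    have "(\<lambda>k. norm (K k *\<^sub>R u k)) \<longlonglongrightarrow> norm w" by (intro tendsto_norm Ku)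
    then have "\<forall>\<^sub>F k in sequentially. norm (K k *\<^sub>R u k) < 2 * norm w"
      by (rule order_tendstoD(2)) (use False in simp)
    with small have evk: "\<forall>\<^sub>F k in sequentially. \<exists>p\<in>U. E (A + w) - E A = E p \<and>
        norm (p - (\<Sum>i<Suc k. x k i)) \<le> (C2 * 4 * M\<^sup>2) * (norm w)\<^sup>2"
    proof eventually_elim
      case (elim k)
      from est[OF ab(1,2)] elim(1) have g: "E (- a k) + E (b k) \<in> E ` U" by blast
      have ul: "u k \<in> l" using lg_in_l[OF g] by (simp add: u_def mu_def)
      have Eu: "E (u k) = - E (a k) + E (b k)" using E_lg[OF g] by (simp add: u_def mu_def E_uminus ab)
      have xl: "x k i \<in> l" for i
        using fcalc_in_l[of exp "(real (Suc i) / K k) *\<^sub>R A" "u k"] A ul l_closed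
        by (simp add: x_def fcalc_exp1 holomorphic_intros ad_scaleR)
      have "gprod (x k) (Suc k) + npow (Suc k) (E (a k)) = npow (Suc k) (E (a k) + E (u k))"
      proof (rule npow_telescope[symmetric])
        fix i
        have "npow (Suc i) (E (a k)) = E ((real (Suc i) / K k) *\<^sub>R A)"
          using E_npow[OF ab(3), of "Suc i" k] by (simp add: a_def)
        then show "npow (Suc i) (E (a k)) + E (u k) - npow (Suc i) (E (a k)) = E (x k i)"
          using conjugation[of "(real (Suc i) / K k) *\<^sub>R A" "u k"] A ul l_closed
          unfolding conj_rel_def x_def ad_scaleR by (metis scaleR_one)
      qed
      also have "E (a k) + E (u k) = E (b k)" by (simp add: Eu add.assoc[symmetric])
      also have "npow (Suc k) (E (b k)) = E (A + w)"
        using E_npow[OF ab(2), of "Suc k" k] K[of k] by (simp add: b_def K_def)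
      also have "npow (Suc k) (E (a k)) = E A"
        using E_npow[OF ab(3), of "Suc k" k] K[of k] by (simp add: a_def K_def)
      finally have gp: "gprod (x k) (Suc k) = E (A + w) - E A" by (simp add: eq_diff_eq)
      have S: "(\<Sum>i<Suc k. norm (x k i)) \<le> M * (2 * norm w)"
        by (rule order_trans[OF nx]) (use elim(2) M in \<open>intro mult_left_mono, auto\<close>)
      also have "\<dots> < \<delta>1" using w(2) M by (simp add: \<delta>_def pos_less_divide_eq mult.commute mult.left_commute)
      finally obtain p where p: "p \<in> U" "gprod (x k) (Suc k) = E p"
        "norm (p - (\<Sum>i<Suc k. x k i)) \<le> C2 * (\<Sum>i<Suc k. norm (x k i))\<^sup>2"
        using prod_est[of "Suc k" "x k"] xl by blast
      have "(\<Sum>i<Suc k. norm (x k i))\<^sup>2 \<le> (M * (2 * norm w))\<^sup>2"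
        by (intro power_mono S sum_nonneg) auto
      then have "C2 * (\<Sum>i<Suc k. norm (x k i))\<^sup>2 \<le> C2 * (M * (2 * norm w))\<^sup>2"
        using \<delta>1(2) by (intro mult_left_mono) auto
      also have "\<dots> = (C2 * 4 * M\<^sup>2) * (norm w)\<^sup>2" by (simp add: power_mult_distrib)
      finally show ?case using p gp by (intro bexI[of _ p]) auto
    qed
    obtain p where p: "p \<in> U" "E (A + w) - E A = E p"
      using eventually_happens'[OF _ evk] by auto
    have "\<forall>\<^sub>F k in sequentially. norm (p - (\<Sum>i<Suc k. x k i)) \<le> (C2 * 4 * M\<^sup>2) * (norm w)\<^sup>2"
      using evk
    proof eventually_elim
      case (elim k)
      then obtain p' where "p' \<in> U" "E p' = E p" "norm (p' - (\<Sum>i<Suc k. x k i)) \<le> (C2 * 4 * M\<^sup>2) * (norm w)\<^sup>2"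
        using p by metis
      then show ?case using p(1) U_facts(3) by (metis inj_onD)
    qed
    then have "norm (p - app (fcalc phi ?D) w) \<le> (C2 * 4 * M\<^sup>2) * (norm w)\<^sup>2"
      by (intro tendsto_upperbound[OF tendsto_norm[OF tendsto_diff[OF tendsto_const lim]]]) auto
    then show ?thesis using p by blast
  qed
  moreover have "\<delta> > 0" using \<delta>1 M by (simp add: \<delta>_def)
  ultimately show ?thesis by blast
qed

text \<open>The curve \<open>\<gamma>(t)\<close> is continuous with \<open>E (\<gamma>(t)) - E A = E (t \<xi>)\<close>, so that \<open>phi (ad A) (\<gamma>(t) - A)\<close> equals \<open>t \<xi>\<close>
  up to second order in \<open>\<gamma>(t) - A\<close>. As \<open>phi (ad A)\<close> is bounded below on \<open>l\<close>, this makes \<open>\<gamma>(t) - A\<close> of order \<open>t\<close>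
  and determines its derivative.\<close>

lemma right_translation_curve:
  assumes N: "exp_parametrizes l E N" and A: "A \<in> N" and \<xi>: "\<xi> \<in> l" and J: "J \<in> l"
    and J\<xi>: "app (fcalc phi (ad_op br A)) J = \<xi>"
  shows "((\<lambda>t::real. inv_into N E (E (t *\<^sub>R \<xi>) + E A)) has_vector_derivative J) (at 0)"
    "\<forall>\<^sub>F t::real in nhds 0. inv_into N E (E (t *\<^sub>R \<xi>) + E A) \<in> N"
proof -
  let ?Ph = "fcalc phi (ad_op br A)"
  let ?\<gamma> = "\<lambda>t::real. inv_into N E (E (t *\<^sub>R \<xi>) + E A)"
  have Nl: "N \<subseteq> l" using N openin_imp_subset by (fastforce simp: exp_parametrizes_def)
  then have Al: "A \<in> l" using A by blast
  have N': "inj_on E N" "open (E ` N)" "continuous_on (E ` N) (inv_into N E)"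
    using N by (auto simp: exp_parametrizes_def)
  have g: "((\<lambda>t::real. E (t *\<^sub>R \<xi>) + E A) \<longlongrightarrow> E (0 *\<^sub>R \<xi>) + E A) (nhds 0)"
    by (intro tendsto_intros tendsto_E filterlim_ident always_eventually) (auto simp: l_closed \<xi>)
  have ev: "\<forall>\<^sub>F t::real in nhds 0. E (t *\<^sub>R \<xi>) + E A \<in> E ` N"
    using topological_tendstoD[OF g N'(2)] A by (simp add: E_0)
  then show evN: "\<forall>\<^sub>F t::real in nhds 0. ?\<gamma> t \<in> N"
    by eventually_elim (rule inv_into_into)
  have gam0: "?\<gamma> 0 = A" using inv_into_f_f[OF N'(1) A] by (simp add: E_0)
  have "(?\<gamma> \<longlongrightarrow> inv_into N E (E (0 *\<^sub>R \<xi>) + E A)) (nhds 0)"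
    using continuous_on_tendsto_compose[OF N'(3) g _ ev] A by (simp add: E_0)
  then have lim: "((\<lambda>t. ?\<gamma> t - A) \<longlongrightarrow> 0) (nhds 0)" using gam0 by (simp add: LIM_zero)
  obtain \<delta> C where \<delta>: "\<delta> > 0" and est: "\<And>w. w \<in> l \<Longrightarrow> norm w < \<delta> \<Longrightarrow>
    (\<exists>p\<in>U. E (A + w) - E A = E p \<and> norm (p - app ?Ph w) \<le> C * (norm w)\<^sup>2)"
    using dexp_estimate[OF Al] by metis
  define C' where "C' = \<bar>C\<bar> + 1"
  have C': "C' > 0" "C \<le> C'" by (auto simp: C'_def)
  have "\<exists>c>0. \<forall>w\<in>l. norm (app ?Ph w) \<ge> c * norm w"
    using injective_imp_isometric[OF closed_l sub_real app.bounded_linear_right[of ?Ph]]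
      phi_injective_on_l[OF N A] by (auto simp: mult.commute)
  then obtain c where c: "c > 0" "\<And>w. w \<in> l \<Longrightarrow> norm (app ?Ph w) \<ge> c * norm w" by blast
  obtain r where r: "r > 0" "\<forall>x\<in>l. norm x < r \<longrightarrow> x \<in> U" using U_ball by blast
  define \<delta>2 where "\<delta>2 = min \<delta> (c / (2 * C'))"
  have \<delta>2: "\<delta>2 > 0" using \<delta> c C' by (simp add: \<delta>2_def)
  have "\<forall>\<^sub>F t in nhds 0. norm (?\<gamma> t - A) < \<delta>2"
    using order_tendstoD(2)[OF tendsto_norm_zero[OF lim] \<delta>2] .
  moreover have "\<forall>\<^sub>F t::real in nhds 0. norm (t *\<^sub>R \<xi>) < r"
  proof -
    have "((\<lambda>t::real. norm (t *\<^sub>R \<xi>)) \<longlongrightarrow> norm (0 *\<^sub>R \<xi>)) (nhds 0)"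
      by (intro tendsto_intros filterlim_ident)
    then show ?thesis by (rule order_tendstoD(2)) (use r in simp)
  qed
  ultimately have main: "\<forall>\<^sub>F t in nhds 0. norm (t *\<^sub>R \<xi> - app ?Ph (?\<gamma> t - A)) \<le> C' * (norm (?\<gamma> t - A))\<^sup>2 \<and>
      norm (?\<gamma> t - A) \<le> 2 / c * (\<bar>t\<bar> * norm \<xi>) \<and> ?\<gamma> t - A \<in> l"
    using ev evN
  proof eventually_elim
    case (elim t)
    define w where "w = ?\<gamma> t - A"
    have wl: "w \<in> l" using elim(4) Nl Al l_closed(3) by (auto simp: w_def)
    have nw: "norm w < \<delta>" "norm w < c / (2 * C')" using elim(1) by (auto simp: w_def \<delta>2_def)
    have "E (A + w) = E (t *\<^sub>R \<xi>) + E A" using f_inv_into_f[OF elim(3)] by (simp add: w_def)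
    then have "E (A + w) - E A = E (t *\<^sub>R \<xi>)" by (simp add: diff_eq_eq)
    moreover obtain p where p: "p \<in> U" "E (A + w) - E A = E p" "norm (p - app ?Ph w) \<le> C * (norm w)\<^sup>2"
      using est[OF wl nw(1)] by blast
    moreover have "t *\<^sub>R \<xi> \<in> U" using r elim(2) l_closed(5)[OF \<xi>] by blast
    ultimately have "p = t *\<^sub>R \<xi>" using U_facts(3) by (metis inj_onD)
    then have 1: "norm (t *\<^sub>R \<xi> - app ?Ph w) \<le> C' * (norm w)\<^sup>2"
      using order_trans[OF p(3) mult_right_mono[OF C'(2)]] by simp
    have "c * norm w \<le> norm (app ?Ph w)" by (rule c(2)[OF wl])
    also have "\<dots> \<le> norm (t *\<^sub>R \<xi>) + norm (t *\<^sub>R \<xi> - app ?Ph w)"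
      by (metis norm_minus_commute norm_triangle_sub)
    also have "\<dots> \<le> \<bar>t\<bar> * norm \<xi> + C' * norm w * norm w"
      using 1 by (simp add: power2_eq_square mult.assoc)
    also have "C' * norm w * norm w \<le> (c / 2) * norm w"
    proof (rule mult_right_mono)
      have "C' * norm w \<le> C' * (c / (2 * C'))" using nw(2) C' by (intro mult_left_mono) auto
      then show "C' * norm w \<le> c / 2" using C' by simp
    qed simp
    finally have "norm w \<le> 2 / c * (\<bar>t\<bar> * norm \<xi>)" using c(1) by (simp add: field_simps)
    then show ?case using 1 wl by (simp add: w_def)
  qed
  have "((\<lambda>t. (1 / t) *\<^sub>R (?\<gamma> t - ?\<gamma> 0)) \<longlongrightarrow> J) (at 0)"
  proof (rule LIM_zero_cancel, rule Lim_null_comparison)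
    show "\<forall>\<^sub>F t in at 0. norm ((1 / t) *\<^sub>R (?\<gamma> t - ?\<gamma> 0) - J) \<le> 1 / c * (C' * (2 / c * norm \<xi>)\<^sup>2 * \<bar>t\<bar>)"
      using main[unfolded eventually_nhds_conv_at, THEN conjunct1] eventually_at_filter[of "\<lambda>t. t \<noteq> 0" "0::real" UNIV, simplified]
    proof eventually_elim
      case (elim t)
      define w where "w = ?\<gamma> t - A"
      have wl: "w \<in> l" and 1: "norm (t *\<^sub>R \<xi> - app ?Ph w) \<le> C' * (norm w)\<^sup>2" and 2: "norm w \<le> 2 / c * (\<bar>t\<bar> * norm \<xi>)"
        using elim by (auto simp: w_def)
      have "(1 / t) *\<^sub>R w - J \<in> l" using wl J l_closed by simp
      from c(2)[OF this] have "c * norm ((1 / t) *\<^sub>R w - J) \<le> norm (app ?Ph ((1 / t) *\<^sub>R w - J))" .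
      also have "app ?Ph ((1 / t) *\<^sub>R w - J) = - ((1 / t) *\<^sub>R (t *\<^sub>R \<xi> - app ?Ph w))"
        using elim(2) by (simp add: app_lin J\<xi> scaleR_diff_right)
      also have "norm \<dots> \<le> 1 / \<bar>t\<bar> * (C' * (norm w)\<^sup>2)"
        using 1 by (simp add: divide_right_mono)
      also have "\<dots> \<le> 1 / \<bar>t\<bar> * (C' * (2 / c * (\<bar>t\<bar> * norm \<xi>))\<^sup>2)"
        using 2 C' by (intro mult_left_mono power_mono) auto
      also have "\<dots> = C' * (2 / c * norm \<xi>)\<^sup>2 * \<bar>t\<bar>"
        using elim(2) by (simp add: power2_eq_square)
      finally have "c * norm ((1 / t) *\<^sub>R w - J) \<le> C' * (2 / c * norm \<xi>)\<^sup>2 * \<bar>t\<bar>" .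
      then have "norm ((1 / t) *\<^sub>R w - J) \<le> 1 / c * (C' * (2 / c * norm \<xi>)\<^sup>2 * \<bar>t\<bar>)"
        using c(1) by (simp add: pos_le_divide_eq mult.commute)
      then show ?case by (simp only: w_def gam0)
    qed
    show "((\<lambda>t::real. 1 / c * (C' * (2 / c * norm \<xi>)\<^sup>2 * \<bar>t\<bar>)) \<longlongrightarrow> 0) (at 0)"
      using c(1) by (auto intro!: tendsto_eq_intros)
  qed
  then show "(?\<gamma> has_vector_derivative J) (at 0)"
    by (simp add: has_vector_derivative_at_0_iff)
qed

lemma left_translation_as_right:
  assumes "A \<in> l" "\<xi> \<in> l"
  shows "E A + E (t *\<^sub>R \<xi>) = E (t *\<^sub>R app (exp (ad_op br A)) \<xi>) + E A"
  using conjugation[OF assms] by (simp add: conj_rel_def diff_eq_eq)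

end

section \<open>The graded quadratic Lie algebra\<close>

locale graded_lie =
  fixes br :: "complex^'n::finite \<Rightarrow> complex^'n \<Rightarrow> complex^'n" and B :: "complex^'n \<Rightarrow> complex^'n"
    and n :: nat and form :: "complex^'n \<Rightarrow> complex^'n \<Rightarrow> complex" and l :: "(complex^'n) set"
    and \<epsilon> :: complex
  assumes lie: "complex_lie_algebra br" and aut: "lie_automorphism br B" and ord: "has_order B n"
    and l_def: "l = graded_part B n 0" and nondeg: "nondegenerate_symmetric_form form"
    and form_inv: "form (br x y) z + form y (br x z) = 0" and form_B: "form (B x) (B y) = form x y"
    and eps: "\<epsilon> \<noteq> 0"
begin

lemma lin_br: "Vector_Spaces.linear (*s) (*s) (br x)" "Vector_Spaces.linear (*s) (*s) (\<lambda>x. br x y)"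
  using lie by (auto simp: complex_lie_algebra_def complex_bilinear_def)

lemma app_ad: "app (ad_op br x) y = br x y"
  unfolding ad_op_def by (rule app_op[OF lin_br(1)])

lemma br_self: "br x x = 0"
  using lie by (simp add: complex_lie_algebra_def)

lemma br_add: "br (x + y) z = br x z + br y z" "br x (y + z) = br x y + br x z"
  using vec.linear_add[OF lin_br(1)] vec.linear_add[OF lin_br(2)] by auto

lemma br_diff: "br (x - y) z = br x z - br y z" "br x (y - z) = br x y - br x z"
  using vec.linear_diff[OF lin_br(1)] vec.linear_diff[OF lin_br(2)] by auto

lemma br_scale: "br (c *s x) z = c *s br x z" "br x (c *s z) = c *s br x z"
  using vec.linear_scale[OF lin_br(1)] vec.linear_scale[OF lin_br(2)] by auto

lemma br_zero: "br 0 x = 0" "br x 0 = 0"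
  using vec.linear_0[OF lin_br(1)] vec.linear_0[OF lin_br(2)] by auto

lemma br_anti: "br x y = - br y x"
proof -
  have "br x (x + y) + br y (x + y) = 0" using br_self[of "x + y"] by (simp only: br_add(1))
  then have "br x y + br y x = 0" by (simp add: br_add(2) br_self)
  then show ?thesis by (simp add: eq_neg_iff_add_eq_0)
qed

lemma jacobi: "br x (br y z) = br (br x y) z + br y (br x z)"
proof -
  have "br x (br y z) + br y (br z x) + br z (br x y) = 0"
    using lie by (simp add: complex_lie_algebra_def)
  moreover have "br y (br z x) = - br y (br x z)"
    using br_anti[of z x] vec.linear_neg[OF lin_br(1)] by simp
  moreover have "br z (br x y) = - br (br x y) z" by (rule br_anti)
  ultimately show ?thesis by (simp add: algebra_simps)
qed

lemma lin_form: "Vector_Spaces.linear (*s) (*) (form x)" "Vector_Spaces.linear (*s) (*) (\<lambda>x. form x y)"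
  using nondeg by (auto simp: nondegenerate_symmetric_form_def complex_bilinear_def)

lemma form_lin:
  "form (x + y) z = form x z + form y z" "form x (y + z) = form x y + form x z"
  "form (x - y) z = form x z - form y z" "form x (y - z) = form x y - form x z"
  "form (c *s x) z = c * form x z" "form x (c *s z) = c * form x z"
  "form 0 z = 0" "form x 0 = 0" "form (- x) z = - form x z" "form x (- z) = - form x z"
proof -
  interpret l: Vector_Spaces.linear "(*s)" "(*)" "form x" for x by (rule lin_form)
  interpret r: Vector_Spaces.linear "(*s)" "(*)" "\<lambda>x. form x y" for y by (rule lin_form)
  show "form (x + y) z = form x z + form y z" "form x (y + z) = form x y + form x z"
  "form (x - y) z = form x z - form y z" "form x (y - z) = form x y - form x z"
  "form (c *s x) z = c * form x z" "form x (c *s z) = c * form x z"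
  "form 0 z = 0" "form x 0 = 0" "form (- x) z = - form x z" "form x (- z) = - form x z"
    by (rule r.add l.add r.diff l.diff r.scale l.scale r.zero l.zero r.neg l.neg)+
qed

lemma form_sum_left: "form (\<Sum>i\<in>I. f i) z = (\<Sum>i\<in>I. form (f i) z)"
  by (induction I rule: infinite_finite_induct) (auto simp: form_lin)

lemma form_sym: "form x y = form y x"
  using nondeg by (simp add: nondegenerate_symmetric_form_def)

lemma form_eqI: "(\<And>y. form x y = form x' y) \<Longrightarrow> x = x'"
proof -
  assume "\<And>y. form x y = form x' y"
  then have "\<forall>y. form (x - x') y = 0" by (simp add: form_lin)
  then have "x - x' = 0" using nondeg unfolding nondegenerate_symmetric_form_def by blast
  then show ?thesis by simp
qed

text \<open>The invariant trilinear form, in terms of which all identities in the third tensor power are written.\<close>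

definition \<beta> :: "complex^'n \<Rightarrow> complex^'n \<Rightarrow> complex^'n \<Rightarrow> complex" where
  "\<beta> x y z = form x (br y z)"

lemma \<beta>_form: "\<beta> x y z = form (br x y) z"
proof -
  have "form (br x y) z = - form (br y x) z" using br_anti[of x y] form_lin(9) by metis
  moreover have "form x (br y z) = - form (br y x) z"
    using form_inv[of y x z] by (simp only: add_eq_0_iff)
  ultimately show ?thesis by (simp only: \<beta>_def)
qed

lemma \<beta>_cyc: "\<beta> x y z = \<beta> y z x"
  by (metis \<beta>_form \<beta>_def form_sym)

lemma \<beta>_anti: "\<beta> x y z = - \<beta> x z y"
  using br_anti[of y z] by (simp add: \<beta>_def form_lin)

lemma \<beta>_lin:
  "\<beta> (x + x') y z = \<beta> x y z + \<beta> x' y z" "\<beta> (x - x') y z = \<beta> x y z - \<beta> x' y z" "\<beta> (c *s x) y z = c * \<beta> x y z"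
  "\<beta> x (y + y') z = \<beta> x y z + \<beta> x y' z" "\<beta> x (y - y') z = \<beta> x y z - \<beta> x y' z" "\<beta> x (c *s y) z = c * \<beta> x y z"
  "\<beta> x y (z + z') = \<beta> x y z + \<beta> x y z'" "\<beta> x y (z - z') = \<beta> x y z - \<beta> x y z'" "\<beta> x y (c *s z) = c * \<beta> x y z"
  by (simp_all add: \<beta>_def form_lin br_add br_diff br_scale)

subsection \<open>The grading\<close>

definition zeta :: "nat \<Rightarrow> complex" where
  "zeta j = exp (2 * \<i> * of_real pi * of_nat j / of_nat n)"

lemma n_pos: "n > 0" using ord by (simp add: has_order_def)

lemma zeta_nonzero: "zeta j \<noteq> 0" by (simp add: zeta_def)

lemma zeta_power_n: "zeta j ^ n = 1"
proof -
  have "zeta j ^ n = exp (of_nat n * (2 * \<i> * of_real pi * of_nat j / of_nat n))"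
    unfolding zeta_def by (simp only: exp_of_nat_mult)
  also have "of_nat n * (2 * \<i> * of_real pi * of_nat j / of_nat n) = 2 * of_nat j * (of_real pi * \<i>)"
    using n_pos by simp
  finally show ?thesis by (simp add: exp_eq_1) (metis of_int_of_nat_eq mult.commute mult.left_commute)
qed

lemma zeta_inj: "i < n \<Longrightarrow> j < n \<Longrightarrow> zeta i = zeta j \<Longrightarrow> i = j"
proof -
  assume a: "i < n" "j < n" "zeta i = zeta j"
  then obtain m :: int where
    "2 * \<i> * of_real pi * of_nat i / of_nat n = 2 * \<i> * of_real pi * of_nat j / of_nat n + (of_int (2 * m) * pi) * \<i>"
    unfolding zeta_def exp_eq by blast
  then have "(2 * \<i> * of_real pi) * of_nat i = (2 * \<i> * of_real pi) * (of_nat j + of_int m * of_nat n)"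
    using n_pos by (simp add: field_simps)
  then have "(of_nat i :: complex) = of_nat j + of_int m * of_nat n"
    by (subst (asm) mult_cancel_left) simp
  then have "of_int (int i) = (of_int (int j + m * int n) :: complex)" by simp
  then have e: "int i = int j + m * int n" by (simp only: of_int_eq_iff)
  then have "int i mod int n = int j mod int n" by simp
  then show "i = j" using a by simp
qed

lemma zeta_0: "zeta 0 = 1" by (simp add: zeta_def)

lemma graded_part_iff: "x \<in> graded_part B n j \<longleftrightarrow> B x = zeta j *s x"
  by (simp add: graded_part_def zeta_def)

lemma l_iff: "x \<in> l \<longleftrightarrow> B x = x"
  by (simp add: l_def graded_part_iff zeta_0)

lemma root_sum:
  assumes "z ^ n = 1" "z \<noteq> 1"
  shows "(\<Sum>m<n. z ^ m) = (0::complex)"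
  using power_diff_1_eq[of z n] assms by simp

lemma lin_B: "Vector_Spaces.linear (*s) (*s) B"
  using aut by (simp add: lie_automorphism_def)

definition Bop :: "'n endo" where "Bop = op B"

lemma app_Bop: "app Bop x = B x"
  unfolding Bop_def by (rule app_op[OF lin_B])

lemma B_br: "B (br x y) = br (B x) (B y)"
  using aut by (simp add: lie_automorphism_def)

lemma Bop_power_n: "Bop ^ n = 1"
proof (rule endo_eqI)
  fix x
  have "app (Bop ^ m) x = (B ^^ m) x" for m
    by (induction m arbitrary: x) (simp_all add: app_Bop)
  then show "app (Bop ^ n) x = app 1 x" using ord by (simp add: has_order_def)
qed

text \<open>The projection onto \<open>graded_part B n j\<close>, by averaging over the cyclic group generated by \<open>B\<close>.\<close>

definition P :: "nat \<Rightarrow> 'n endo" where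
  "P j = (\<Sum>m<n. scal (inverse (zeta j) ^ m / of_nat n) * Bop ^ m)"

lemma Bop_P: "Bop * P j = scal (zeta j) * P j"
proof -
  define t where "t m = scal (inverse (zeta j) ^ m / of_nat n) * Bop ^ m" for m
  have step: "Bop * t m = scal (zeta j) * t (Suc m)" for m
  proof -
    have "zeta j * (inverse (zeta j) ^ Suc m / of_nat n) = inverse (zeta j) ^ m / of_nat n"
      using zeta_nonzero[of j] by simp
    then have "scal (zeta j) * t (Suc m) = scal (inverse (zeta j) ^ m / of_nat n) * Bop ^ Suc m"
      unfolding t_def by (metis mult.assoc scal_simps(6))
    then show ?thesis by (simp only: t_def scal_left_commute[of Bop] power_Suc)
  qed
  have tn: "t n = t 0"
    by (simp add: t_def Bop_power_n power_inverse zeta_power_n)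
  have "(\<Sum>m<n. t (Suc m)) = (\<Sum>m<n. t m)"
    using sum.lessThan_Suc_shift[of t n] sum.lessThan_Suc[of t n] tn by simp
  moreover have "Bop * (\<Sum>m<n. t m) = scal (zeta j) * (\<Sum>m<n. t (Suc m))"
    by (simp only: sum_distrib_left step)
  ultimately show ?thesis unfolding P_def t_def[symmetric] by simp
qed

lemma P_graded: "B (app (P j) x) = zeta j *s app (P j) x"
  using arg_cong[OF Bop_P, of "\<lambda>T. app T x"] by (simp add: app_Bop)

lemma sum_P: "(\<Sum>j<n. P j) = 1"
proof -
  have "(\<Sum>j<n. inverse (zeta j) ^ m / of_nat n) = (if m = 0 then 1 else 0)" if "m < n" for m
  proof (cases "m = 0")
    case False
    have "inverse (zeta j) ^ m = (inverse (zeta m)) ^ j" for j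
    proof -
      have "zeta j ^ m = zeta m ^ j"
        unfolding zeta_def by (simp flip: exp_of_nat_mult add: mult_ac)
      then show ?thesis by (simp add: power_inverse)
    qed
    moreover have "inverse (zeta m) \<noteq> 1"
      using zeta_inj[of m 0] that False n_pos zeta_0 by (metis inverse_1 inverse_inverse_eq)
    ultimately have "(\<Sum>j<n. inverse (zeta j) ^ m) = 0"
      using root_sum[of "inverse (zeta m)"] by (simp add: power_inverse zeta_power_n)
    then show ?thesis using False by (simp flip: sum_divide_distrib)
  qed (use n_pos in simp)
  then have e: "scal (\<Sum>j<n. inverse (zeta j) ^ m / of_nat n) * Bop ^ m = (if m = 0 then 1 else 0)" if "m < n" for m
    using that by (simp add: scal_simps)
  have "(\<Sum>j<n. P j) = (\<Sum>m<n. \<Sum>j<n. scal (inverse (zeta j) ^ m / of_nat n) * Bop ^ m)"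
    unfolding P_def by (rule sum.swap)
  also have "\<dots> = (\<Sum>m<n. scal (\<Sum>j<n. inverse (zeta j) ^ m / of_nat n) * Bop ^ m)"
    by (simp add: sum_distrib_right linear_sum[OF bounded_linear.linear[OF bounded_linear_scal]])
  also have "\<dots> = (\<Sum>m<n. if m = 0 then 1 else 0)" by (rule sum.cong) (use e in auto)
  also have "\<dots> = 1" using n_pos by simp
  finally show ?thesis .
qed

lemma P_on_graded:
  assumes "B x = zeta j *s x" "i < n" "j < n"
  shows "app (P i) x = (if i = j then x else 0)"
proof -
  have b: "app (Bop ^ m) x = zeta j ^ m *s x" for m
    by (induction m) (simp_all add: app_Bop assms(1) vec.linear_scale[OF lin_B] mult.commute)
  have "app (P i) x = (\<Sum>m<n. (inverse (zeta i) * zeta j) ^ m / of_nat n) *s x"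
    unfolding P_def by (simp add: app_sum_left b vec.scale_sum_left power_mult_distrib)
  moreover have "(\<Sum>m<n. (inverse (zeta i) * zeta j) ^ m / of_nat n) = (if i = j then 1 else 0)"
  proof (cases "i = j")
    case True
    then show ?thesis using n_pos zeta_nonzero by simp
  next
    case False
    have "inverse (zeta i) * zeta j \<noteq> 1"
      using zeta_inj[OF assms(2,3)] False zeta_nonzero[of i] by (auto simp: field_simps)
    then have "(\<Sum>m<n. (inverse (zeta i) * zeta j) ^ m) = 0"
      by (intro root_sum) (simp_all add: power_mult_distrib power_inverse zeta_power_n)
    then show ?thesis using False by (simp flip: sum_divide_distrib)
  qed
  ultimately show ?thesis by simp
qed

lemma P_mult: "i < n \<Longrightarrow> j < n \<Longrightarrow> P i * P j = (if i = j then P j else 0)"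
  by (rule endo_eqI) (simp add: P_on_graded[OF P_graded])

lemma P0_in_l: "app (P 0) x \<in> l"
  using P_graded[of 0 x] by (simp add: l_iff zeta_0)

lemma P0_on_l: "x \<in> l \<Longrightarrow> app (P 0) x = x"
  using P_on_graded[of x 0 0] n_pos by (simp add: l_iff zeta_0)

lemma P_commute:
  assumes "Bop * T = T * Bop"
  shows "P j * T = T * P j"
proof -
  have "Bop ^ m * T = T * Bop ^ m" for m
    by (induction m) (simp_all add: mult.assoc assms, metis assms mult.assoc)
  then show ?thesis
    unfolding P_def by (simp add: sum_distrib_left sum_distrib_right mult.assoc scal_left_commute[of T])
qed

lemma ad_B_commute: "A \<in> l \<Longrightarrow> Bop * ad_op br A = ad_op br A * Bop"
  by (rule endo_eqI) (simp add: app_Bop app_ad B_br l_iff)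

lemma ad_P_commute: "A \<in> l \<Longrightarrow> P j * ad_op br A = ad_op br A * P j"
  by (intro P_commute ad_B_commute)

text \<open>Invariance under \<open>B\<close> makes \<open>l\<close> orthogonal to the other parts of the grading.\<close>

lemma form_P0: "form (app (P 0) x) y = form x (app (P 0) y)"
proof -
  have z: "form (app (P i) u) (app (P 0) v) = 0" if "i < n" "i \<noteq> 0" for i u v
  proof -
    have "form (app (P i) u) (app (P 0) v) = zeta i * form (app (P i) u) (app (P 0) v)"
      using form_B[of "app (P i) u" "app (P 0) v"] P_graded[of i u] P0_in_l[of v]
      by (simp add: l_iff form_lin)
    moreover have "zeta i \<noteq> 1" using zeta_inj[of i 0] that zeta_0 n_pos by metis
    ultimately show ?thesis by simp
  qed
  have s: "form u (app (P 0) v) = form (app (P 0) u) (app (P 0) v)" for u v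
  proof -
    have "u = app (\<Sum>j<n. P j) u" by (simp add: sum_P)
    then have "form u (app (P 0) v) = (\<Sum>j<n. form (app (P j) u) (app (P 0) v))"
      by (metis app_sum_left form_sum_left)
    also have "\<dots> = (\<Sum>j\<in>{0}. form (app (P j) u) (app (P 0) v))"
      by (rule sum.mono_neutral_right) (use n_pos z in auto)
    finally show ?thesis by simp
  qed
  show ?thesis using s[of x y] s[of y x] form_sym by metis
qed

lemma l_sub: "vec.subspace l"
  by (rule vec_subspaceI) (simp_all add: l_iff vec.linear_0[OF lin_B] vec.linear_add[OF lin_B] vec.linear_scale[OF lin_B])

lemma br_in_l: "x \<in> l \<Longrightarrow> y \<in> l \<Longrightarrow> br x y \<in> l"
  by (simp add: l_iff B_br)

lemma ad_diff_commutator: "ad_op br A * ad_op br x - ad_op br x * ad_op br A = ad_op br (br A x)"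
  by (rule endo_eqI) (simp add: app_lin app_ad jacobi[of A x])

lemma ad_lin: "ad_op br (x + y) = ad_op br x + ad_op br y" "ad_op br (c *s x) = scal c * ad_op br x"
  "ad_op br (x - y) = ad_op br x - ad_op br y"
  by (rule endo_eqI; simp add: app_lin app_ad br_add br_scale br_diff)+

lemma bounded_linear_ad: "bounded_linear (ad_op br)"
  by (rule linear_conv_bounded_linear[THEN iffD1], rule linearI)
     (simp_all add: ad_lin scaleR_as_scale scal_of_real_mult)

subsection \<open>Automorphisms\<close>

lemma bounded_bilinear_br: "bounded_bilinear br"
  by (rule bilinear_conv_bounded_bilinear[THEN iffD1])
     (auto simp: bilinear_def br_add br_scale scaleR_as_scale intro!: linearI)

lemma bounded_bilinear_form: "bounded_bilinear form"
  by (rule bilinear_conv_bounded_bilinear[THEN iffD1])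
     (auto simp: bilinear_def form_lin scaleR_as_scale scaleR_conv_of_real intro!: linearI)

lemma exp_ad_automorphism:
  "app (exp (ad_op br X)) (br x y) = br (app (exp (ad_op br X)) x) (app (exp (ad_op br X)) y)"
proof -
  define e where "e t z = app (exp (t *\<^sub>R ad_op br X)) z" for t z
  have de: "((\<lambda>t. e t z) has_vector_derivative br X (e t z)) (at t)" for t z
    using app.has_vector_derivative[OF exp_scaleR_has_vector_derivative_left[of "ad_op br X" t] has_vector_derivative_const]
    by (simp add: e_def app_ad)
  define y' where "y' t = br (e t x) (e t y)" for t
  have "(y' has_vector_derivative app (ad_op br X) (y' t)) (at t)" for t
  proof -
    have "(y' has_vector_derivative (br (e t x) (br X (e t y)) + br (br X (e t x)) (e t y))) (at t)"
      unfolding y'_def by (rule bounded_bilinear.has_vector_derivative[OF bounded_bilinear_br de de])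
    then show ?thesis by (simp add: app_ad y'_def jacobi[of X] add.commute)
  qed
  from exp_solves_linear_ode[OF this, of 1] show ?thesis by (simp add: y'_def e_def)
qed

lemma exp_ad_isometry:
  "form (app (exp (ad_op br X)) x) (app (exp (ad_op br X)) y) = form x y"
proof -
  define e where "e t z = app (exp (t *\<^sub>R ad_op br X)) z" for t z
  have de: "((\<lambda>t. e t z) has_vector_derivative br X (e t z)) (at t)" for t z
    using app.has_vector_derivative[OF exp_scaleR_has_vector_derivative_left[of "ad_op br X" t] has_vector_derivative_const]
    by (simp add: e_def app_ad)
  have "((\<lambda>t. form (e t x) (e t y)) has_vector_derivative 0) (at t)" for t
    using bounded_bilinear.has_vector_derivative[OF bounded_bilinear_form de[of x t] de[of y t]]
      form_inv[of X "e t x" "e t y"] by (simp add: add.commute)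
  then obtain c where "\<And>t. form (e t x) (e t y) = c"
    using has_vector_derivative_zero_constant[of UNIV "\<lambda>t. form (e t x) (e t y)"] by auto
  from this[of 1] this[of 0] show ?thesis by (simp add: e_def)
qed

lemma exp_scal: "exp (scal c) = scal (exp c)"
proof (rule endo_eqI)
  fix x
  show "app (exp (scal c)) x = app (scal (exp c)) x"
    using fcalc_on_geig[of exp "scal c" c 1 x] by (simp add: fcalc_exp1 holomorphic_intros scal_simps taylor_def)
qed

lemma exp_shift: "exp (T + scal c) = scal (exp c) * exp T"
  using exp_add_commuting[of T "scal c"] by (simp add: exp_scal scal_commute)

end

section \<open>The trigonometric operator\<close>

context graded_lie
begin

text \<open>All functions \<open>f_trig n \<epsilon> j\<close> are written as \<open>k j / w\<close> with one entire denominator \<open>w\<close>. The factors of \<open>w\<close> are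
  \<open>phi s\<close>, which comes from \<open>coth (s / 2)\<close>, and \<open>h j s\<close>, which comes from the term with \<open>\<epsilon>\<close>; for \<open>j = 0\<close> the zero
  at \<open>s = 0\<close> is divided out of both, so that \<open>w 0 \<noteq> 0\<close>.\<close>

definition h :: "nat \<Rightarrow> complex \<Rightarrow> complex" where
  "h j s = (if j = 0 then \<epsilon> * phi (\<epsilon> * s) else zeta j * exp (\<epsilon> * s) - 1)"

definition w :: "complex \<Rightarrow> complex" where
  "w s = phi s * (\<Prod>j<n. h j s)"

text \<open>The cofactor \<open>w / h j\<close> of \<open>h j\<close>.\<close>

definition u :: "nat \<Rightarrow> complex \<Rightarrow> complex" where
  "u j s = phi s * (\<Prod>i\<in>{..<n} - {j}. h i s)"

text \<open>The poles of the two terms of \<open>f_trig n \<epsilon> 0\<close> at \<open>s = 0\<close> cancel: their common numerator over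
  \<open>phi s * h 0 s\<close> vanishes at \<open>0\<close> and is divisible by \<open>s\<close>.\<close>

definition \<kappa> :: "complex \<Rightarrow> complex" where
  "\<kappa> = (SOME K. entire K \<and> (\<forall>s. (1/2) * (exp s + 1) * h 0 s - (\<epsilon> / 2) * (exp (\<epsilon> * s) + 1) * phi s = s * K s))"

definition k :: "nat \<Rightarrow> complex \<Rightarrow> complex" where
  "k j s = (if j = 0 then \<kappa> s * (\<Prod>i\<in>{..<n} - {0}. h i s)
    else - (\<epsilon> / 2) * (zeta j * exp (\<epsilon> * s) + 1) * u j s)"

lemma entire_phi_eps: "entire (\<lambda>s. phi (\<epsilon> * s))"
  using holomorphic_on_compose_gen[of "\<lambda>s. \<epsilon> * s" UNIV phi UNIV] entire_phi
  by (simp add: o_def holomorphic_intros)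

lemma entire_h: "entire (h j)"
  by (cases "j = 0") (simp_all add: h_def[abs_def] holomorphic_intros entire_phi_eps)

lemma entire_w: "entire w"
  unfolding w_def[abs_def] by (intro holomorphic_intros entire_phi entire_h)

lemma entire_u: "entire (u j)"
  unfolding u_def[abs_def] by (intro holomorphic_intros entire_phi entire_h)

lemma \<kappa>: "entire \<kappa>" "(1/2) * (exp s + 1) * h 0 s - (\<epsilon> / 2) * (exp (\<epsilon> * s) + 1) * phi s = s * \<kappa> s"
proof -
  let ?g = "\<lambda>s. (1/2) * (exp s + 1) * h 0 s - (\<epsilon> / 2) * (exp (\<epsilon> * s) + 1) * phi s"
  have g: "entire ?g" by (intro holomorphic_intros entire_h entire_phi)
  have g0: "?g 0 = 0" by (simp add: h_def phi_def)
  obtain G where "entire G" "\<And>s. ?g s = (s - 0) * G s" using entire_divide[OF g g0] by auto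
  then have "\<exists>K. entire K \<and> (\<forall>s. ?g s = s * K s)" by auto
  then have "entire \<kappa> \<and> (\<forall>s. ?g s = s * \<kappa> s)" unfolding \<kappa>_def by (rule someI_ex)
  then show "entire \<kappa>" "?g s = s * \<kappa> s" by blast+
qed

lemma entire_k: "entire (k j)"
  by (cases "j = 0") (simp_all add: k_def[abs_def] holomorphic_intros \<kappa>(1) entire_h entire_u)

lemma w_split: "j < n \<Longrightarrow> w s = h j s * u j s"
  unfolding w_def u_def using prod.remove[of "{..<n}" j "\<lambda>i. h i s"] by simp

lemma s_h0: "s * h 0 s = exp (\<epsilon> * s) - 1"
  using phi_mult[of "\<epsilon> * s"] by (simp add: h_def mult_ac)

text \<open>The defining relation \<open>k j / w = f_trig n \<epsilon> j\<close>, with the denominators of the hyperbolic cotangents cleared.\<close>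

lemma k_identity: "j < n \<Longrightarrow> j \<noteq> 0 \<Longrightarrow>
    k j s * (zeta j * exp (\<epsilon> * s) - 1) = - (\<epsilon> / 2) * (zeta j * exp (\<epsilon> * s) + 1) * w s"
  using w_split[of j s] by (simp add: k_def h_def)

lemma k0_identity:
  "k 0 s * (exp s - 1) * (exp (\<epsilon> * s) - 1) =
    ((1/2) * (exp s + 1) * (exp (\<epsilon> * s) - 1) - (\<epsilon> / 2) * (exp (\<epsilon> * s) + 1) * (exp s - 1)) * w s"
proof -
  define Q where "Q = (\<Prod>i\<in>{..<n} - {0}. h i s)"
  have w: "w s = h 0 s * (phi s * Q)" using w_split[OF n_pos, of s] by (simp add: u_def Q_def)
  have "k 0 s * (exp s - 1) * (exp (\<epsilon> * s) - 1) = (s * \<kappa> s) * s * phi s * h 0 s * Q"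
    by (simp add: k_def Q_def s_h0[of s, symmetric] phi_mult[of s, symmetric])
  also have "\<dots> = ((1/2) * (exp s + 1) * (s * h 0 s) - (\<epsilon> / 2) * (exp (\<epsilon> * s) + 1) * (phi s * s)) * w s"
    unfolding \<kappa>(2)[symmetric] w by (simp add: algebra_simps)
  finally show ?thesis by (simp only: s_h0 phi_mult)
qed

lemma w_0: "w 0 \<noteq> 0"
proof -
  have "h j 0 \<noteq> 0" if "j < n" for j
    using that eps zeta_inj[of j 0] n_pos zeta_0 by (auto simp: h_def phi_def)
  then show ?thesis by (simp add: w_def phi_def)
qed

lemma coth_exp: "coth z = (exp (2 * z) + 1) / (exp (2 * z) - 1)"
proof -
  have e: "exp (2 * z) = exp z * exp z" by (simp add: exp_add[symmetric])
  have "(x / 2) / (y / 2) = x / y" for x y :: complex by simp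
  then have "coth z = (exp z + exp (- z)) / (exp z - exp (- z))"
    by (simp only: coth_def cosh_field_def sinh_field_def)
  also have "\<dots> = (exp z * (exp z + exp (- z))) / (exp z * (exp z - exp (- z)))" by simp
  also have "\<dots> = (exp (2 * z) + 1) / (exp (2 * z) - 1)"
    by (simp add: distrib_left right_diff_distrib e flip: exp_minus) (simp add: exp_minus)
  finally show ?thesis .
qed

lemma f_trig_quotient:
  assumes j: "j < n" and w: "w s \<noteq> 0" and s: "s \<noteq> 0"
  shows "f_trig n \<epsilon> j s = k j s / w s"
proof (cases "j = 0")
  case False
  have ne: "zeta j * exp (\<epsilon> * s) - 1 \<noteq> 0" using w w_split[OF j, of s] False by (auto simp: h_def)
  have "exp (2 * (\<epsilon> / 2 * s + \<i> * of_real pi * of_nat j / of_nat n)) = zeta j * exp (\<epsilon> * s)"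
    by (simp add: zeta_def algebra_simps flip: exp_add)
  then have "f_trig n \<epsilon> j s = (- (\<epsilon> / 2) * (zeta j * exp (\<epsilon> * s) + 1)) / (zeta j * exp (\<epsilon> * s) - 1)"
    using False by (simp add: f_trig_def coth_exp)
  then show ?thesis
    using k_identity[OF j False, of s] by (simp only: frac_eq_eq[OF ne w])
next
  case True
  have "phi s \<noteq> 0" "h 0 s \<noteq> 0" using w w_split[OF n_pos, of s] by (auto simp: w_def)
  then have ne: "exp s - 1 \<noteq> 0" "exp (\<epsilon> * s) - 1 \<noteq> 0"
    using s phi_mult[of s] s_h0[of s] by (metis mult_eq_0_iff)+
  have "f_trig n \<epsilon> 0 s = (1/2) * ((exp s + 1) / (exp s - 1)) - (\<epsilon> / 2) * ((exp (\<epsilon> * s) + 1) / (exp (\<epsilon> * s) - 1))"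
    by (simp add: f_trig_def coth_exp)
  also have "\<dots> = ((1/2) * (exp s + 1) * (exp (\<epsilon> * s) - 1) - (\<epsilon> / 2) * (exp (\<epsilon> * s) + 1) * (exp s - 1))
      / ((exp s - 1) * (exp (\<epsilon> * s) - 1))"
    using ne by (simp add: divide_simps) (simp add: algebra_simps)
  also have "\<dots> = k 0 s / w s"
    using k0_identity[of s] ne w by (simp add: frac_eq_eq mult.assoc)
  finally show ?thesis using True by simp
qed

text \<open>\<open>R (ad A)\<close> is the operator of the trigonometric r-matrix at every \<open>A\<close> for which \<open>W (ad A)\<close> is invertible. It is
  regarded as a function of an arbitrary operator because the Yang-Baxter equation is proved by adding scalars to \<open>ad A\<close>.\<close>

definition W :: "'n endo \<Rightarrow> 'n endo" where "W T = fcalc w T"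
definition K :: "nat \<Rightarrow> 'n endo \<Rightarrow> 'n endo" where "K j T = fcalc (k j) T"
definition V :: "'n endo \<Rightarrow> 'n endo" where "V T = einv (W T)"
definition R :: "'n endo \<Rightarrow> 'n endo" where "R T = (\<Sum>j<n. V T * K j T * P j)"

lemma operator_function_trig:
  assumes d: "edet (W (ad_op br A)) \<noteq> 0" and j: "j < n"
  shows "operator_function (f_trig n \<epsilon> j) (br A) x = app (V (ad_op br A) * K j (ad_op br A)) x"
proof -
  have "app (ad_op br A) = br A" by (rule ext) (rule app_ad)
  moreover have "operator_function (f_trig n \<epsilon> j) (app (ad_op br A)) x
      = app (einv (fcalc w (ad_op br A)) * fcalc (k j) (ad_op br A)) x"
  proof (rule operator_function_quotient[OF entire_w entire_k d[unfolded W_def]])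
    fix \<mu> assume "w \<mu> \<noteq> 0"
    have "isCont w \<mu>" using entire_w holomorphic_on_imp_continuous_on continuous_on_eq_continuous_at by blast
    then have "\<forall>\<^sub>F s in at \<mu>. w s \<noteq> 0" using \<open>w \<mu> \<noteq> 0\<close> tendsto_imp_eventually_ne by (auto simp: isCont_def)
    moreover have "\<forall>\<^sub>F s in at \<mu>. s \<noteq> 0"
      using tendsto_imp_eventually_ne[OF tendsto_ident_at, of \<mu> 0 UNIV]
      by (cases "\<mu> = 0") (auto simp: eventually_at_filter)
    ultimately show "\<forall>\<^sub>F s in at \<mu>. f_trig n \<epsilon> j s = k j s / w s"
      by eventually_elim (rule f_trig_quotient[OF j])
  qed
  ultimately show ?thesis by (simp add: V_def W_def K_def)
qed

lemma VK_graded: "j < n \<Longrightarrow> app (R T) (app (P j) x) = app (V T * K j T) (app (P j) x)"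
proof -
  assume j: "j < n"
  have "app (R T) (app (P j) x) = (\<Sum>i<n. if i = j then app (V T * K j T) (app (P j) x) else 0)"
    unfolding R_def app_sum_left using j
    by (intro sum.cong) (auto simp: P_on_graded[OF P_graded])
  then show ?thesis using j by simp
qed

subsection \<open>Tensors as operators\<close>

text \<open>The coordinates of a tensor are pairings with the vectors dual to the coordinate axes; these exist because the form
  is nondegenerate.\<close>

definition dual_basis :: "'n \<Rightarrow> complex^'n" where
  "dual_basis = (SOME d. \<forall>i j. form (d i) (axis j 1) = (if i = j then 1 else 0))"

lemma dual_basis: "form (dual_basis i) (axis j 1) = (if i = j then 1 else 0)"
proof -
  define F where "F x = (\<chi> j. form x (axis j 1))" for x :: "complex^'n"
  have lF: "Vector_Spaces.linear (*s) (*s) F"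
    by (rule linear_scaleI) (simp_all add: F_def form_lin vec_eq_iff)
  have "app (op F) x = 0 \<Longrightarrow> x = 0" for x
  proof -
    assume "app (op F) x = 0"
    then have "F x = 0" by (simp add: app_op[OF lF])
    then have z: "form x (axis j 1) = 0" for j by (simp add: F_def vec_eq_iff)
    have "form x y = form 0 y" for y
      by (subst vec_axis_sum[of y]) (simp add: form_sym[of x] form_sum_left form_lin z[unfolded form_sym[of x]])
    then show "x = 0" by (rule form_eqI)
  qed
  then have "edet (op F) \<noteq> 0" by (rule edet_nonzero_inj)
  then have "F (app (einv (op F)) y) = y" for y
    using einv_app(2)[of "op F" y] by (simp add: app_op[OF lF])
  moreover have "F v $ j = form v (axis j 1)" for v j by (simp add: F_def)
  ultimately have "form (app (einv (op F)) (axis i 1)) (axis j 1) = axis i 1 $ j" for i j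
    by metis
  moreover have "axis i 1 $ j = (if i = j then 1 else (0::complex))" for i j :: 'n
    by (simp add: axis_def)
  ultimately have "form (app (einv (op F)) (axis i 1)) (axis j 1) = (if i = j then 1 else 0)" for i j
    by metis
  then have "\<exists>d. \<forall>i j. form (d i) (axis j 1) = (if i = j then 1 else (0::complex))"
    by (intro exI[of _ "\<lambda>i. app (einv (op F)) (axis i 1)"]) auto
  from someI_ex[OF this] show ?thesis unfolding dual_basis_def by blast
qed

lemma dual_basis_expand: "(\<Sum>i\<in>UNIV. form (dual_basis i) x *s axis i 1) = x"
proof -
  have "form (dual_basis i) x = x $ i" for i
  proof -
    have "form (dual_basis i) x = (\<Sum>j\<in>UNIV. x $ j * form (axis j 1) (dual_basis i))"
      by (subst vec_axis_sum[of x]) (simp add: form_sym[of "dual_basis i"] form_sum_left form_lin)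
    also have "\<dots> = (\<Sum>j\<in>UNIV. if i = j then x $ j else 0)"
      by (intro sum.cong) (auto simp: form_sym[of _ "dual_basis i"] dual_basis)
    finally show ?thesis by simp
  qed
  then show ?thesis by (simp add: basis_expansion)
qed

definition tensor_of :: "'n endo \<Rightarrow> complex^'n^'n" where
  "tensor_of T = (\<chi> p q. \<Sum>i\<in>UNIV. dual_basis i $ p * app T (axis i 1) $ q)"

abbreviation top :: "complex^'n^'n \<Rightarrow> complex^'n \<Rightarrow> complex^'n" where
  "top \<equiv> tensor_operator form"

lemma form_axis_sum: "form x y = (\<Sum>p\<in>UNIV. x $ p * form (axis p 1) y)"
  by (subst vec_axis_sum[of x]) (simp add: form_sum_left form_lin)

lemma top_tensor_of: "top (tensor_of T) x = app T x"
proof -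
  have "top (tensor_of T) x $ q = (\<Sum>i\<in>UNIV. form (dual_basis i) x * app T (axis i 1) $ q)" for q
  proof -
    have "top (tensor_of T) x $ q
        = (\<Sum>p\<in>UNIV. \<Sum>i\<in>UNIV. dual_basis i $ p * app T (axis i 1) $ q * form (axis p 1) x)"
      by (simp add: tensor_operator_def tensor_of_def sum_distrib_right)
    also have "\<dots> = (\<Sum>i\<in>UNIV. (\<Sum>p\<in>UNIV. dual_basis i $ p * form (axis p 1) x) * app T (axis i 1) $ q)"
      by (subst sum.swap) (simp add: sum_distrib_right sum_distrib_left mult_ac)
    finally show ?thesis by (simp only: form_axis_sum[symmetric])
  qed
  then have "top (tensor_of T) x = app T (\<Sum>i\<in>UNIV. form (dual_basis i) x *s axis i 1)"
    by (simp add: vec_eq_iff app_sum app_scale)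
  then show ?thesis by (simp add: dual_basis_expand)
qed

lemma top_dual: "t $ p $ q = top t (dual_basis p) $ q"
proof -
  have "top t (dual_basis p) $ q = (\<Sum>i\<in>UNIV. t $ i $ q * form (axis i 1) (dual_basis p))"
    by (simp add: tensor_operator_def)
  also have "\<dots> = (\<Sum>i\<in>UNIV. if i = p then t $ i $ q else 0)"
    by (intro sum.cong) (auto simp: form_sym[of _ "dual_basis p"] dual_basis)
  finally show ?thesis by simp
qed

lemma top_inj: "(\<And>x. top t x = top t' x) \<Longrightarrow> t = t'"
  by (simp add: vec_eq_iff top_dual)

lemma r_trig'_eq:
  assumes "edet (W (ad_op br A)) \<noteq> 0"
  shows "r_trig' br form B n \<epsilon> A = tensor_of (R (ad_op br A))"
proof -
  let ?D = "ad_op br A"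
  have gr: "top (tensor_of (R ?D)) x = operator_function (f_trig n \<epsilon> j) (br A) x"
    if "j < n" "x \<in> graded_part B n j" for j x
  proof -
    have "app (P j) x = x" using that P_on_graded[of x j j] by (simp add: graded_part_iff)
    then show ?thesis
      using VK_graded[OF that(1), of ?D x] operator_function_trig[OF assms that(1), of x] top_tensor_of by simp
  qed
  moreover have "t = tensor_of (R ?D)"
    if t: "\<forall>j<n. \<forall>x\<in>graded_part B n j. top t x = operator_function (f_trig n \<epsilon> j) (br A) x" for t
  proof (rule top_inj)
    fix x
    have lin: "top t (x + y) = top t x + top t y" "top t 0 = 0" for t x y
      by (simp_all add: tensor_operator_def form_lin vec_eq_iff distrib_left sum.distrib)
    have "top t (\<Sum>j\<in>I. app (P j) x) = top (tensor_of (R ?D)) (\<Sum>j\<in>I. app (P j) x)" if "I \<subseteq> {..<n}" for I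
      using finite_subset[OF that] that
      by (induction I rule: finite_induct)
         (use t gr P_graded in \<open>auto simp: lin graded_part_iff subset_iff\<close>)
    from this[of "{..<n}"] show "top t x = top (tensor_of (R ?D)) x"
      by (simp add: sum_P flip: app_sum_left)
  qed
  ultimately show ?thesis unfolding r_trig'_def by (intro the_equality) auto
qed

end

section \<open>The derivative of the trigonometric operator\<close>

context graded_lie
begin

text \<open>The noncommutative divided difference of \<open>R\<close>, obtained from those of the numerators and of the denominator by the
  quotient rule.\<close>

definition N :: "'n endo \<Rightarrow> 'n endo \<Rightarrow> 'n endo \<Rightarrow> 'n endo" where
  "N S T X = (\<Sum>j<n. V S * (fdd (k j) S T X - fdd w S T X * (V T * K j T)) * P j)"

text \<open>The quotient rule for intertwiners that respect the grading.\<close>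

lemma N_intertwines:
  assumes "edet (W S) \<noteq> 0" "edet (W T) \<noteq> 0" and Y: "\<And>j. P j * Y = Y * P j"
  shows "R S * Y - Y * R T = N S T (S * Y - Y * T)"
proof -
  have "V S * K j S * P j * Y - Y * (V T * K j T * P j)
      = V S * (fdd (k j) S T (S * Y - Y * T) - fdd w S T (S * Y - Y * T) * (V T * K j T)) * P j" for j
  proof -
    have k: "K j S * Y - Y * K j T = fdd (k j) S T (S * Y - Y * T)"
      and w: "W S * Y - Y * W T = fdd w S T (S * Y - Y * T)"
      unfolding K_def W_def by (rule fdd_intertwines[OF entire_k] fdd_intertwines[OF entire_w])+
    have v: "V S * W S = 1" "W T * V T = 1"
      using einv assms by (simp_all add: V_def)
    have "V S * ((K j S * Y - Y * K j T) - (W S * Y - Y * W T) * (V T * K j T))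
        = V S * K j S * Y - V S * (Y * K j T) - (V S * W S) * (Y * (V T * K j T)) + V S * (Y * ((W T * V T) * K j T))"
      by (simp add: algebra_simps)
    also have "\<dots> = V S * K j S * Y - Y * (V T * K j T)" by (simp add: v algebra_simps)
    finally have e: "V S * ((K j S * Y - Y * K j T) - (W S * Y - Y * W T) * (V T * K j T))
        = V S * K j S * Y - Y * (V T * K j T)" .
    have "V S * K j S * P j * Y - Y * (V T * K j T * P j) = (V S * K j S * Y - Y * (V T * K j T)) * P j"
      by (simp only: mult.assoc Y left_diff_distrib)
    then show ?thesis by (simp only: e[symmetric] k w)
  qed
  then show ?thesis
    unfolding R_def N_def by (simp add: sum_distrib_left sum_distrib_right sum_subtractf[symmetric])
qed

lemma N_lin:
  "N S T (X + Y) = N S T X + N S T Y" "N S T (r *\<^sub>R X) = r *\<^sub>R N S T X" "N S T (scal c * X) = scal c * N S T X"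
proof -
  show "N S T (X + Y) = N S T X + N S T Y"
    unfolding N_def by (simp add: fdd_lin entire_k entire_w sum.distrib[symmetric] algebra_simps)
  show "N S T (r *\<^sub>R X) = r *\<^sub>R N S T X"
    unfolding N_def by (simp add: fdd_lin entire_k entire_w scaleR_sum_right algebra_simps)
  show "N S T (scal c * X) = scal c * N S T X"
    unfolding N_def
    by (simp add: fdd_lin entire_k entire_w sum_distrib_left mult.assoc scal_left_commute[of "V S"]
        right_diff_distrib[symmetric] left_diff_distrib[symmetric])
qed

lemma tendsto_V: "(T \<longlongrightarrow> T0) F \<Longrightarrow> edet (W T0) \<noteq> 0 \<Longrightarrow> ((\<lambda>i. V (T i)) \<longlongrightarrow> V T0) F"
  unfolding V_def W_def by (intro tendsto_einv tendsto_fcalc entire_w)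

lemma tendsto_N:
  assumes "(S \<longlongrightarrow> S0) F" "(T \<longlongrightarrow> T0) F" "(X \<longlongrightarrow> X0) F" "edet (W S0) \<noteq> 0" "edet (W T0) \<noteq> 0"
  shows "((\<lambda>i. N (S i) (T i) (X i)) \<longlongrightarrow> N S0 T0 X0) F"
  unfolding N_def K_def
  by (intro tendsto_sum tendsto_mult tendsto_diff tendsto_const tendsto_V tendsto_fdd tendsto_fcalc
      entire_w entire_k assms)

lemma tendsto_R:
  "(T \<longlongrightarrow> T0) F \<Longrightarrow> edet (W T0) \<noteq> 0 \<Longrightarrow> ((\<lambda>i. R (T i)) \<longlongrightarrow> R T0) F"
  unfolding R_def K_def
  by (intro tendsto_sum tendsto_mult tendsto_const tendsto_V tendsto_fcalc entire_k)

lemma tendsto_ad: "(f \<longlongrightarrow> x) F \<Longrightarrow> ((\<lambda>i. ad_op br (f i)) \<longlongrightarrow> ad_op br x) F"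
  by (rule bounded_linear.tendsto[OF bounded_linear_ad])

lemma R_has_derivative:
  assumes "edet (W (ad_op br A)) \<noteq> 0"
  shows "((\<lambda>A. R (ad_op br A)) has_derivative (\<lambda>v. N (ad_op br A) (ad_op br A) (ad_op br v))) (at A within S)"
proof (rule has_derivative_from_slope[where N = "\<lambda>x v. N (ad_op br x) (ad_op br A) (ad_op br v)"])
  have t: "((\<lambda>x. ad_op br x) \<longlongrightarrow> ad_op br A) (at A within S)" by (intro tendsto_ad tendsto_ident_at)
  show "linear (\<lambda>v. N (ad_op br x) (ad_op br A) (ad_op br v))" for x
    by (rule linearI) (simp_all add: ad_lin N_lin scaleR_as_scale scal_of_real_mult)
  show "((\<lambda>x. N (ad_op br x) (ad_op br A) (ad_op br b)) \<longlongrightarrow> N (ad_op br A) (ad_op br A) (ad_op br b)) (at A within S)" for b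
    by (intro tendsto_N t tendsto_const assms)
  have "((\<lambda>x. edet (W (ad_op br x))) \<longlongrightarrow> edet (W (ad_op br A))) (at A within S)"
    unfolding W_def by (intro tendsto_edet tendsto_fcalc entire_w t)
  from tendsto_imp_eventually_ne[OF this assms]
  show "\<forall>\<^sub>F x in at A within S. R (ad_op br x) - R (ad_op br A) = N (ad_op br x) (ad_op br A) (ad_op br (x - A))"
  proof eventually_elim
    case (elim x)
    from N_intertwines[OF elim assms, of 1] show ?case by (simp add: ad_lin)
  qed
qed

section \<open>The dynamical Yang-Baxter identity\<close>

text \<open>For a scalar \<open>a\<close> the trigonometric operator at \<open>D + a\<close> is \<open>C D a - G D a\<close>, where \<open>C\<close> and \<open>G\<close> are multiples of
  the Cayley transforms of \<open>S D a = exp (D + a)\<close>, on \<open>l\<close>, and \<open>T D a = exp (\<epsilon> (D + a)) B\<close>. Small nonzero shifts make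
  the operators \<open>S D a - 1\<close> and \<open>T D a - 1\<close> invertible. For \<open>D = ad A\<close> and \<open>a = 0\<close> the operators \<open>S\<close> and \<open>T\<close> are
  automorphisms, so that the operators for three shifts with
  \<open>a + b + c = 0\<close> jointly preserve the invariant trilinear form.\<close>

definition S :: "'n endo \<Rightarrow> complex \<Rightarrow> 'n endo" where
  "S D a = exp (D + scal a)"

definition T :: "'n endo \<Rightarrow> complex \<Rightarrow> 'n endo" where
  "T D a = exp (scal \<epsilon> * (D + scal a)) * Bop"

definition cayley :: "'n endo \<Rightarrow> 'n endo" where
  "cayley X = (X + 1) * einv (X - 1)"

definition G :: "'n endo \<Rightarrow> complex \<Rightarrow> 'n endo" where
  "G D a = scal (\<epsilon> / 2) * cayley (T D a)"

definition C :: "'n endo \<Rightarrow> complex \<Rightarrow> 'n endo" where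
  "C D a = scal (1/2) * cayley (S D a) * P 0"

lemma S_eq: "S D a = scal (exp a) * exp D"
  by (simp add: S_def exp_shift)

lemma T_eq: "T (ad_op br A) a = scal (exp (\<epsilon> * a)) * (exp (ad_op br (\<epsilon> *s A)) * Bop)"
proof -
  have "scal \<epsilon> * (ad_op br A + scal a) = ad_op br (\<epsilon> *s A) + scal (\<epsilon> * a)"
    by (simp add: distrib_left ad_lin scal_simps)
  then show ?thesis by (simp add: T_def exp_shift mult.assoc)
qed

lemma \<beta>_exp: "\<beta> (app (exp (ad_op br X)) x) (app (exp (ad_op br X)) y) (app (exp (ad_op br X)) z) = \<beta> x y z"
  by (simp only: \<beta>_def exp_ad_automorphism[symmetric] exp_ad_isometry)

lemma \<beta>_B: "\<beta> (B x) (B y) (B z) = \<beta> x y z"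
  by (simp only: \<beta>_def B_br[symmetric] form_B)

lemma S_invariant:
  "form (app (S (ad_op br A) (- c)) x) (app (S (ad_op br A) c) y) = form x y"
  "a + b + c = 0 \<Longrightarrow> \<beta> (app (S (ad_op br A) a) x) (app (S (ad_op br A) b) y) (app (S (ad_op br A) c) z) = \<beta> x y z"
proof -
  show "form (app (S (ad_op br A) (- c)) x) (app (S (ad_op br A) c) y) = form x y"
    by (simp add: S_eq form_lin exp_ad_isometry flip: mult.assoc exp_add)
  assume "a + b + c = 0"
  then have "exp a * exp b * exp c = 1" by (simp flip: exp_add)
  then show "\<beta> (app (S (ad_op br A) a) x) (app (S (ad_op br A) b) y) (app (S (ad_op br A) c) z) = \<beta> x y z"
    by (simp add: S_eq \<beta>_lin \<beta>_exp mult.assoc[symmetric])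
       (simp add: mult.commute mult.left_commute)
qed

lemma T_invariant:
  "form (app (T (ad_op br A) (- c)) x) (app (T (ad_op br A) c) y) = form x y"
  "a + b + c = 0 \<Longrightarrow> \<beta> (app (T (ad_op br A) a) x) (app (T (ad_op br A) b) y) (app (T (ad_op br A) c) z) = \<beta> x y z"
proof -
  show "form (app (T (ad_op br A) (- c)) x) (app (T (ad_op br A) c) y) = form x y"
    by (simp add: T_eq form_lin exp_ad_isometry app_Bop form_B flip: mult.assoc exp_add)
  assume "a + b + c = 0"
  then have "\<epsilon> * a + \<epsilon> * b + \<epsilon> * c = 0" by (simp flip: distrib_left)
  then have "exp (\<epsilon> * a) * exp (\<epsilon> * b) * exp (\<epsilon> * c) = 1" by (simp flip: exp_add)
  then show "\<beta> (app (T (ad_op br A) a) x) (app (T (ad_op br A) b) y) (app (T (ad_op br A) c) z) = \<beta> x y z"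
    by (simp add: T_eq \<beta>_lin \<beta>_exp app_Bop \<beta>_B mult.assoc[symmetric])
       (simp add: mult.commute mult.left_commute)
qed

text \<open>With \<open>x = X x' - x'\<close> the Cayley transform of \<open>X\<close> maps \<open>x\<close> to \<open>X x' + x'\<close>. Hence operators that jointly preserve
  a bilinear form have negatively adjoint Cayley transforms, and those of operators that jointly preserve a
  trilinear form satisfy the modified classical Yang-Baxter equation.\<close>

lemma cayley_form:
  assumes "edet (X - 1) \<noteq> 0" "edet (Y - 1) \<noteq> 0" "\<And>x y. form (app X x) (app Y y) = form x y"
  shows "form (app (cayley X) x) y = - form x (app (cayley Y) y)"
proof -
  define x' y' where "x' = app (einv (X - 1)) x" and "y' = app (einv (Y - 1)) y"
  have x: "x = app X x' - x'" using einv_app(2)[OF assms(1), of x] by (simp add: x'_def app_lin)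
  have y: "y = app Y y' - y'" using einv_app(2)[OF assms(2), of y] by (simp add: y'_def app_lin)
  have c: "app (cayley X) x = app X x' + x'" "app (cayley Y) y = app Y y' + y'"
    by (simp_all add: cayley_def x'_def y'_def app_lin)
  have "form (app X x' + x') (app Y y' - y') = - form (app X x' - x') (app Y y' + y')"
    by (simp add: form_lin assms(3))
  then show ?thesis by (simp only: c x[symmetric] y[symmetric])
qed

lemma cayley_trilinear:
  assumes "edet (X - 1) \<noteq> 0" "edet (Y - 1) \<noteq> 0" "edet (Z - 1) \<noteq> 0"
    and inv: "\<And>x y z. \<beta> (app X x) (app Y y) (app Z z) = \<beta> x y z"
  shows "\<beta> x (app (cayley Y) y) (app (cayley Z) z) + \<beta> (app (cayley X) x) y (app (cayley Z) z)
    + \<beta> (app (cayley X) x) (app (cayley Y) y) z = - \<beta> x y z"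
proof -
  define x' y' z' where "x' = app (einv (X - 1)) x" and "y' = app (einv (Y - 1)) y" and "z' = app (einv (Z - 1)) z"
  have x: "x = app X x' - x'" using einv_app(2)[OF assms(1), of x] by (simp add: x'_def app_lin)
  have y: "y = app Y y' - y'" using einv_app(2)[OF assms(2), of y] by (simp add: y'_def app_lin)
  have z: "z = app Z z' - z'" using einv_app(2)[OF assms(3), of z] by (simp add: z'_def app_lin)
  have c: "app (cayley X) x = app X x' + x'" "app (cayley Y) y = app Y y' + y'" "app (cayley Z) z = app Z z' + z'"
    by (simp_all add: cayley_def x'_def y'_def z'_def app_lin)
  have "\<beta> (app X x' - x') (app Y y' + y') (app Z z' + z') + \<beta> (app X x' + x') (app Y y' - y') (app Z z' + z')
    + \<beta> (app X x' + x') (app Y y' + y') (app Z z' - z')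
    = - \<beta> (app X x' - x') (app Y y' - y') (app Z z' - z')"
    by (simp add: \<beta>_lin inv)
  then show ?thesis by (simp only: c x[symmetric] y[symmetric] z[symmetric])
qed

lemma P0_exp_commute: "A \<in> l \<Longrightarrow> P 0 * S (ad_op br A) a = S (ad_op br A) a * P 0"
  using fcalc_commute[of exp "ad_op br A" "P 0"] ad_P_commute[of A 0]
  by (simp add: S_eq fcalc_exp1 holomorphic_intros scal_left_commute mult.assoc)

lemma cayley_commute:
  assumes "edet (X - 1) \<noteq> 0" "X * Y = Y * X"
  shows "cayley X * Y = Y * cayley X"
proof -
  have "(X - 1) * Y = Y * (X - 1)" using assms(2) by (simp add: algebra_simps)
  from einv_commute[OF assms(1) this] have "einv (X - 1) * Y = Y * einv (X - 1)" .
  moreover have "(X + 1) * Y = Y * (X + 1)" using assms(2) by (simp add: algebra_simps)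
  ultimately show ?thesis unfolding cayley_def by (metis mult.assoc)
qed

definition regular :: "'n endo \<Rightarrow> complex \<Rightarrow> bool" where
  "regular D a \<longleftrightarrow> edet (W (D + scal a)) \<noteq> 0 \<and> edet (S D a - 1) \<noteq> 0 \<and> edet (T D a - 1) \<noteq> 0"

lemma C_in_l: "A \<in> l \<Longrightarrow> regular (ad_op br A) a \<Longrightarrow> app (C (ad_op br A) a) x \<in> l"
  and C_P0: "A \<in> l \<Longrightarrow> regular (ad_op br A) a \<Longrightarrow> C (ad_op br A) a = scal (1/2) * (P 0 * cayley (S (ad_op br A) a))"
proof -
  assume A: "A \<in> l" "regular (ad_op br A) a"
  show c: "C (ad_op br A) a = scal (1/2) * (P 0 * cayley (S (ad_op br A) a))"
    unfolding C_def using A cayley_commute[of "S (ad_op br A) a" "P 0"] P0_exp_commute[OF A(1), of a]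
    by (simp add: regular_def mult.assoc)
  show "app (C (ad_op br A) a) x \<in> l"
    unfolding c using vec.subspace_scale[OF l_sub P0_in_l] by simp
qed

lemma CG_adjoint:
  assumes A: "A \<in> l" and r: "regular (ad_op br A) (- c)" "regular (ad_op br A) c"
  shows "form (app (C (ad_op br A) (- c)) x) y = - form x (app (C (ad_op br A) c) y)"
    "form (app (G (ad_op br A) (- c)) x) y = - form x (app (G (ad_op br A) c) y)"
proof -
  have "form (app (cayley (S (ad_op br A) (- c))) (app (P 0) x)) y
      = - form (app (P 0) x) (app (cayley (S (ad_op br A) c)) y)"
    by (rule cayley_form) (use r S_invariant(1) in \<open>auto simp: regular_def\<close>)
  then show "form (app (C (ad_op br A) (- c)) x) y = - form x (app (C (ad_op br A) c) y)"
    unfolding C_P0[OF A r(2)] by (simp add: C_def form_lin form_P0)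
  have "form (app (cayley (T (ad_op br A) (- c))) x) y = - form x (app (cayley (T (ad_op br A) c)) y)"
    by (rule cayley_form) (use r T_invariant(1) in \<open>auto simp: regular_def\<close>)
  then show "form (app (G (ad_op br A) (- c)) x) y = - form x (app (G (ad_op br A) c) y)"
    by (simp add: G_def form_lin)
qed

text \<open>The classical Yang-Baxter equations of the two Cayley transforms. In the second one the projection to \<open>l\<close> may be
  applied to the remaining argument, because \<open>l\<close> is orthogonal to the other parts of the grading.\<close>

lemma CG_yang_baxter:
  assumes A: "A \<in> l" and r: "regular (ad_op br A) a" "regular (ad_op br A) b" "regular (ad_op br A) c"
    and abc: "a + b + c = 0"
  shows "\<beta> x (app (G (ad_op br A) b) y) (app (G (ad_op br A) c) z) + \<beta> (app (G (ad_op br A) a) x) y (app (G (ad_op br A) c) z)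
    + \<beta> (app (G (ad_op br A) a) x) (app (G (ad_op br A) b) y) z = - (\<epsilon>\<^sup>2 / 4) * \<beta> x y z"
    "\<beta> x (app (C (ad_op br A) b) y) (app (C (ad_op br A) c) z) + \<beta> (app (C (ad_op br A) a) x) y (app (C (ad_op br A) c) z)
    + \<beta> (app (C (ad_op br A) a) x) (app (C (ad_op br A) b) y) z
    = - (1/4) * \<beta> (app (P 0) x) (app (P 0) y) (app (P 0) z)"
proof -
  let ?D = "ad_op br A"
  have "\<beta> x (app (cayley (T ?D b)) y) (app (cayley (T ?D c)) z) + \<beta> (app (cayley (T ?D a)) x) y (app (cayley (T ?D c)) z)
    + \<beta> (app (cayley (T ?D a)) x) (app (cayley (T ?D b)) y) z = - \<beta> x y z"
    by (rule cayley_trilinear) (use r T_invariant(2)[OF abc] in \<open>auto simp: regular_def\<close>)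
  from arg_cong[OF this, of "\<lambda>t. \<epsilon>\<^sup>2 / 4 * t"]
  show "\<beta> x (app (G ?D b) y) (app (G ?D c) z) + \<beta> (app (G ?D a) x) y (app (G ?D c) z)
    + \<beta> (app (G ?D a) x) (app (G ?D b) y) z = - (\<epsilon>\<^sup>2 / 4) * \<beta> x y z"
    by (simp add: G_def \<beta>_lin power2_eq_square algebra_simps)
  have inl: "app (C ?D a) x \<in> l" "app (C ?D b) x \<in> l" "app (C ?D c) x \<in> l" for x
    using C_in_l A r by auto
  have p: "\<beta> u v v' = \<beta> (app (P 0) u) v v'" if "v \<in> l" "v' \<in> l" for u v v'
    using form_P0[of u "br v v'"] P0_on_l[OF br_in_l[OF that]] by (simp add: \<beta>_def)
  have p1: "\<beta> x v v' = \<beta> (app (P 0) x) v v'" "\<beta> v y v' = \<beta> v (app (P 0) y) v'" "\<beta> v v' z = \<beta> v v' (app (P 0) z)"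
    if "v \<in> l" "v' \<in> l" for v v'
    using p[OF that, of x] p[OF that(2,1), of y] p[OF that, of z] \<beta>_cyc by metis+
  have "\<beta> (app (P 0) x) (app (cayley (S ?D b)) (app (P 0) y)) (app (cayley (S ?D c)) (app (P 0) z))
    + \<beta> (app (cayley (S ?D a)) (app (P 0) x)) (app (P 0) y) (app (cayley (S ?D c)) (app (P 0) z))
    + \<beta> (app (cayley (S ?D a)) (app (P 0) x)) (app (cayley (S ?D b)) (app (P 0) y)) (app (P 0) z)
    = - \<beta> (app (P 0) x) (app (P 0) y) (app (P 0) z)"
    by (rule cayley_trilinear) (use r S_invariant(2)[OF abc] in \<open>auto simp: regular_def\<close>)
  from arg_cong[OF this, of "\<lambda>t. 1 / 4 * t"]
  have "\<beta> (app (P 0) x) (app (C ?D b) y) (app (C ?D c) z) + \<beta> (app (C ?D a) x) (app (P 0) y) (app (C ?D c) z)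
    + \<beta> (app (C ?D a) x) (app (C ?D b) y) (app (P 0) z)
    = - (1/4) * \<beta> (app (P 0) x) (app (P 0) y) (app (P 0) z)"
    by (simp add: C_def \<beta>_lin algebra_simps)
  then show "\<beta> x (app (C ?D b) y) (app (C ?D c) z) + \<beta> (app (C ?D a) x) y (app (C ?D c) z)
    + \<beta> (app (C ?D a) x) (app (C ?D b) y) z
    = - (1/4) * \<beta> (app (P 0) x) (app (P 0) y) (app (P 0) z)"
    by (simp only: p1(1)[OF inl(2,3)] p1(2)[OF inl(1,3)] p1(3)[OF inl(1,2)])
qed

text \<open>Clearing denominators in \<open>k j / w = q / p\<close>.\<close>

lemma fcalc_quotient:
  assumes "edet (W D) \<noteq> 0" and e: "entire p" "entire q" and pq: "\<And>s. k j s * p s = q s * w s"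
  shows "fcalc p D * (V D * K j D) = fcalc q D"
proof -
  have VW: "V D * W D = 1" using einv(1)[OF assms(1)] by (simp add: V_def)
  have Vc: "V D * fcalc f D = fcalc f D * V D" if "entire f" for f
    unfolding V_def W_def
    by (rule einv_commute) (use assms(1) fcalc_commute_fcalc[OF entire_w that] in \<open>simp_all add: W_def\<close>)
  have "fcalc p D * (V D * K j D) = V D * (fcalc p D * K j D)"
    by (simp only: mult.assoc[symmetric] Vc[OF e(1)])
  also have "fcalc p D * K j D = fcalc (\<lambda>s. k j s * p s) D"
    unfolding K_def fcalc_commute_fcalc[OF e(1) entire_k] by (rule fcalc_mult[symmetric, OF entire_k e(1)])
  also have "\<dots> = fcalc q D * W D"
    unfolding pq W_def by (rule fcalc_mult[OF e(2) entire_w])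
  also have "V D * (fcalc q D * W D) = fcalc q D * (V D * W D)"
    by (simp only: mult.assoc[symmetric] Vc[OF e(2)])
  finally show ?thesis by (simp add: VW)
qed

text \<open>On the part of degree \<open>j\<close> the automorphism \<open>B\<close> is the scalar \<open>zeta j\<close>, so that the Cayley transform of \<open>T\<close> is the
  hyperbolic cotangent with its argument translated by \<open>i \<pi> j / n\<close>.\<close>

lemma R_shift:
  assumes A: "A \<in> l" and r: "regular (ad_op br A) a"
  shows "R (ad_op br A + scal a) = C (ad_op br A) a - G (ad_op br A) a"
proof -
  let ?D = "ad_op br A + scal a"
  let ?S = "S (ad_op br A) a" and ?T = "T (ad_op br A) a"
  define e where "e = exp (scal \<epsilon> * ?D)"
  have d: "edet (W ?D) \<noteq> 0" "edet (?S - 1) \<noteq> 0" "edet (?T - 1) \<noteq> 0" using r by (auto simp: regular_def)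
  have BD: "?D * Bop = Bop * ?D"
    using ad_B_commute[OF A] by (simp add: distrib_left distrib_right scal_commute)
  have ent: "entire (\<lambda>s. exp (\<epsilon> * s))" "entire exp" by (intro holomorphic_intros)+
  have ef: "fcalc (\<lambda>s. exp (\<epsilon> * s)) ?D = e" by (simp add: fcalc_exp e_def)
  have Sf: "fcalc exp ?D = ?S" by (simp add: fcalc_exp1 S_def)
  have SB: "?S * Bop = Bop * ?S" using fcalc_commute[OF ent(2) BD] by (simp add: Sf)
  have Se: "?S * e = e * ?S" using fcalc_commute_fcalc[OF ent(2,1), of ?D] by (simp add: Sf ef)
  have Tdef: "?T = e * Bop" by (simp add: T_def e_def)
  have "?S * (e * Bop) = e * (?S * Bop)" by (simp only: mult.assoc[symmetric] Se)
  then have ST: "?S * ?T = ?T * ?S" by (simp only: Tdef SB mult.assoc)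
  have VB: "V ?D * K j ?D * Bop = Bop * (V ?D * K j ?D)" for j
  proof -
    have a: "V ?D * Bop = Bop * V ?D"
      unfolding V_def W_def
      by (rule einv_commute) (use d fcalc_commute[OF entire_w BD] in \<open>simp_all add: W_def\<close>)
    have b: "K j ?D * Bop = Bop * K j ?D" unfolding K_def by (rule fcalc_commute[OF entire_k BD])
    have "V ?D * K j ?D * Bop = V ?D * (Bop * K j ?D)" by (simp only: mult.assoc b)
    also have "\<dots> = Bop * (V ?D * K j ?D)" by (simp only: mult.assoc[symmetric] a)
    finally show ?thesis .
  qed
  have part: "app (R ?D) (app (P j) x) = app (C (ad_op br A) a - G (ad_op br A) a) (app (P j) x)"
    if j: "j < n" for j x
  proof -
    define y where "y = app (P j) x"
    define z where "z = app (V ?D * K j ?D) y"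
    have By: "app Bop y = zeta j *s y" by (simp add: y_def app_Bop P_graded)
    have Bz: "app Bop z = zeta j *s z"
      using arg_cong[OF VB[of j], of "\<lambda>T. app T y"] by (simp add: z_def By app_scale)
    have R: "app (R ?D) y = z" using VK_graded[OF j] by (simp add: y_def z_def)
    have Te: "app ?T v = zeta j *s app e v" if "app Bop v = zeta j *s v" for v
      using that by (simp add: Tdef app_scale)
    show ?thesis
    proof (cases "j = 0")
      case False
      let ?p = "\<lambda>s. zeta j * exp (\<epsilon> * s) - 1" and ?q = "\<lambda>s. - (\<epsilon> / 2) * (zeta j * exp (\<epsilon> * s) + 1)"
      have pq: "entire ?p" "entire ?q" by (intro holomorphic_intros)+
      have fp: "fcalc ?p ?D = scal (zeta j) * e - 1"
        by (simp add: fcalc_mult fcalc_linear fcalc_const ent ef holomorphic_intros scal_simps(2))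
      have "fcalc (\<lambda>s. (- (\<epsilon> / 2)) * (zeta j * exp (\<epsilon> * s) + 1)) ?D
          = scal (- (\<epsilon> / 2)) * fcalc (\<lambda>s. zeta j * exp (\<epsilon> * s) + 1) ?D"
        by (subst fcalc_mult) (intro holomorphic_intros, intro holomorphic_intros, simp only: fcalc_const)
      also have "fcalc (\<lambda>s. zeta j * exp (\<epsilon> * s) + 1) ?D = scal (zeta j) * e + 1"
        by (simp add: fcalc_mult fcalc_linear fcalc_const ent ef holomorphic_intros scal_simps(2))
      finally have fq: "fcalc ?q ?D = scal (- (\<epsilon> / 2)) * (scal (zeta j) * e + 1)" .
      have "app (?T - 1) z = app (fcalc ?p ?D) z"
        unfolding fp by (simp add: app_lin Te[OF Bz])
      also have "\<dots> = app (fcalc ?q ?D) y"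
        using fcalc_quotient[OF d(1) pq, of j] k_identity[OF j False]
        by (simp add: z_def flip: app_simps(3))
      also have "\<dots> = app (scal (- (\<epsilon> / 2)) * (?T + 1)) y"
        unfolding fq by (simp add: app_lin Te[OF By])
      finally have "z = app (einv (?T - 1) * (scal (- (\<epsilon> / 2)) * (?T + 1))) y"
        using einv_app(1)[OF d(3), of z] by simp
      also have "einv (?T - 1) * (scal (- (\<epsilon> / 2)) * (?T + 1)) = - G (ad_op br A) a"
      proof -
        have "einv (?T - 1) * (?T + 1) = (?T + 1) * einv (?T - 1)"
          by (rule einv_commute[OF d(3)]) (simp add: algebra_simps)
        then show ?thesis
          by (simp add: G_def cayley_def scal_left_commute[of "einv _"] scal_simps)
      qed
      moreover have "app (C (ad_op br A) a) y = 0"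
        using P_mult[OF n_pos j] False by (simp add: C_def y_def flip: app_simps(3)) (simp add: mult.assoc)
      ultimately show ?thesis using R by (simp add: app_lin y_def)
    next
      case True
      let ?p = "\<lambda>s. (exp s - 1) * (exp (\<epsilon> * s) - 1)"
      let ?q = "\<lambda>s. (1/2) * (exp s + 1) * (exp (\<epsilon> * s) - 1) - (\<epsilon> / 2) * (exp (\<epsilon> * s) + 1) * (exp s - 1)"
      have pq: "entire ?p" "entire ?q" by (intro holomorphic_intros)+
      have z0: "zeta j = 1" using True zeta_0 by simp
      have fp: "fcalc ?p ?D = (?S - 1) * (e - 1)"
        by (simp add: fcalc_mult fcalc_linear fcalc_const ent ef Sf holomorphic_intros scal_simps(2))
      have fq: "fcalc ?q ?D = scal (1/2) * (?S + 1) * (e - 1) - scal (\<epsilon> / 2) * (e + 1) * (?S - 1)"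
        by (simp add: fcalc_mult fcalc_linear fcalc_const ent ef Sf holomorphic_intros scal_simps(2)
            del: times_divide_eq_left)
      have Te': "app ?T v = app e v" if "app Bop v = v" for v using Te[of v] that z0 by simp
      have By': "app Bop y = y" and Bz': "app Bop z = z" using By Bz z0 by simp_all
      have BSy: "app Bop (app (?S - 1) y) = app (?S - 1) y"
        using By' arg_cong[OF SB, of "\<lambda>T. app T y"] by (simp add: app_lin)
      then have TSy: "app ?T (app ?S y - y) = app e (app ?S y - y)"
        by (intro Te') (simp add: app_lin)
      define Q where "Q = scal (1/2) * cayley ?S - G (ad_op br A) a"
      have "app ((?S - 1) * (?T - 1)) z = app (fcalc ?p ?D) z"
        unfolding fp by (simp add: app_lin Te'[OF Bz'])
      also have "\<dots> = app (fcalc ?q ?D) y"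
        using fcalc_quotient[OF d(1) pq, of 0] k0_identity True
        by (simp add: z_def mult.assoc flip: app_simps(3))
      also have "\<dots> = app (scal (1/2) * (?S + 1) * (?T - 1) - scal (\<epsilon> / 2) * (?T + 1) * (?S - 1)) y"
        unfolding fq by (simp only: app_lin(1,2) app_simps Te'[OF By'] TSy)
      also have "scal (1/2) * (?S + 1) * (?T - 1) - scal (\<epsilon> / 2) * (?T + 1) * (?S - 1) = (?S - 1) * (?T - 1) * Q"
      proof -
        have c1: "(?S - 1) * (?T - 1) = (?T - 1) * (?S - 1)" using ST by (simp add: algebra_simps)
        have c2: "(?S + 1) * (?T - 1) = (?T - 1) * (?S + 1)" using ST by (simp add: algebra_simps)
        have c3: "(?T + 1) * (?S - 1) = (?S - 1) * (?T + 1)" using ST by (simp add: algebra_simps)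
        have cay: "(X - 1) * cayley X = X + 1" if "edet (X - 1) \<noteq> 0" for X
        proof -
          have "(X - 1) * cayley X = (X + 1) * ((X - 1) * einv (X - 1))"
            unfolding cayley_def by (simp add: algebra_simps)
          then show ?thesis by (simp add: einv(2)[OF that])
        qed
        have "(?S - 1) * (?T - 1) * Q = (?S - 1) * (?T - 1) * (scal (1/2) * cayley ?S)
            - (?S - 1) * (?T - 1) * (scal (\<epsilon> / 2) * cayley ?T)"
          unfolding Q_def G_def by (rule right_diff_distrib)
        also have "(?S - 1) * (?T - 1) * (scal (1/2) * cayley ?S) = (?T - 1) * ((?S - 1) * (scal (1/2) * cayley ?S))"
          unfolding c1 by (rule mult.assoc)
        also have "(?S - 1) * (?T - 1) * (scal (\<epsilon> / 2) * cayley ?T) = (?S - 1) * ((?T - 1) * (scal (\<epsilon> / 2) * cayley ?T))"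
          by (rule mult.assoc)
        also have "(?T - 1) * ((?S - 1) * (scal (1/2) * cayley ?S)) - (?S - 1) * ((?T - 1) * (scal (\<epsilon> / 2) * cayley ?T))
            = scal (1/2) * ((?T - 1) * (?S + 1)) - scal (\<epsilon> / 2) * ((?S - 1) * (?T + 1))"
          by (simp only: scal_left_commute[of "?S - 1"] scal_left_commute[of "?T - 1"] cay[OF d(2)] cay[OF d(3)])
        finally show ?thesis by (simp only: c2 c3 mult.assoc)
      qed
      finally have "app ((?S - 1) * (?T - 1)) (z - app Q y) = 0" by (simp add: app_lin)
      then have "z = app Q y" using einv_app(1)[OF d(2)] einv_app(1)[OF d(3)] by (metis app_simps(3,4) eq_iff_diff_eq_0)
      moreover have "app (P 0) y = y" using True P_mult[OF j j] by (simp add: y_def flip: app_simps(3))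
      ultimately show ?thesis using R by (simp add: Q_def C_def app_lin flip: y_def)
    qed
  qed
  show ?thesis
  proof (rule endo_eqI)
    fix x
    have "x = (\<Sum>j<n. app (P j) x)" by (simp add: sum_P flip: app_sum_left)
    moreover have "app (R ?D) (\<Sum>j<n. app (P j) x)
        = app (C (ad_op br A) a - G (ad_op br A) a) (\<Sum>j<n. app (P j) x)"
      unfolding app_sum by (rule sum.cong) (use part in auto)
    ultimately show "app (R ?D) x = app (C (ad_op br A) a - G (ad_op br A) a) x" by simp
  qed
qed

end

context graded_lie
begin

text \<open>The determinant is an entire function of \<open>\<tau>\<close>, and not zero at the value for which \<open>exp (c \<tau>) \<Theta>\<close> has norm less than \<open>1\<close>.\<close>

lemma eventually_shift_invertible:
  fixes \<Theta> :: "'n endo"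
  assumes c: "c \<noteq> 0"
  shows "\<forall>\<^sub>F \<tau> in at 0. edet (scal (exp (c * \<tau>)) * \<Theta> - 1) \<noteq> 0"
proof -
  define f where "f \<tau> = edet (scal (exp (c * \<tau>)) * \<Theta> - 1)" for \<tau>
  have f: "entire f"
    unfolding f_def edet_def matrix_def det_def
    by (simp add: app_lin) (intro holomorphic_intros)
  define \<tau>0 where "\<tau>0 = - of_real (norm \<Theta>) / c"
  have "f \<tau>0 \<noteq> 0" unfolding f_def
  proof (rule edet_nonzero_inj)
    fix x :: "complex^'n" assume "app (scal (exp (c * \<tau>0)) * \<Theta> - 1) x = 0"
    then have ex: "exp (c * \<tau>0) *s app \<Theta> x = x" by (simp add: app_lin)
    have "norm x = norm (exp (c * \<tau>0) *s app \<Theta> x)" by (simp only: ex)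
    also have "\<dots> = norm (exp (c * \<tau>0)) * norm (app \<Theta> x)" by (rule norm_scale_vec)
    also have "norm (exp (c * \<tau>0)) = exp (- norm \<Theta>)" using c by (simp add: \<tau>0_def)
    also have "exp (- norm \<Theta>) * norm (app \<Theta> x) \<le> exp (- norm \<Theta>) * (norm \<Theta> * norm x)"
      by (intro mult_left_mono norm_app) auto
    finally have le: "norm x \<le> (exp (- norm \<Theta>) * norm \<Theta>) * norm x" by simp
    have "norm \<Theta> < exp (norm \<Theta>)" using exp_ge_add_one_self[of "norm \<Theta>"] by linarith
    then have "exp (- norm \<Theta>) * norm \<Theta> < exp (- norm \<Theta>) * exp (norm \<Theta>)" by (intro mult_strict_left_mono) auto
    also have "\<dots> = 1" by (simp flip: exp_add)
    finally show "x = 0" using le by (metis mult_le_cancel_right1 norm_le_zero_iff not_le)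
  qed
  then have "\<forall>\<^sub>F \<tau> in at 0. f \<tau> \<noteq> 0" by (rule entire_eventually_nonzero[OF f])
  then show ?thesis by (simp add: f_def)
qed

lemma tendsto_shift: "((\<lambda>\<tau>. D + scal (m * \<tau>)) \<longlongrightarrow> D) (at 0)"
proof -
  have "((\<lambda>\<tau>. D + scal (m * \<tau>)) \<longlongrightarrow> D + scal (m * 0)) (at 0)"
    by (intro tendsto_intros bounded_linear.tendsto[OF bounded_linear_scal])
  then show ?thesis by (simp add: scal_simps)
qed

lemma eventually_regular:
  assumes "edet (W (ad_op br A)) \<noteq> 0" "m \<noteq> 0"
  shows "\<forall>\<^sub>F \<tau> in at 0. regular (ad_op br A) (m * \<tau>)"
proof -
  have "((\<lambda>\<tau>. edet (W (ad_op br A + scal (m * \<tau>)))) \<longlongrightarrow> edet (W (ad_op br A))) (at 0)"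
    unfolding W_def by (intro tendsto_edet tendsto_fcalc entire_w tendsto_shift)
  from tendsto_imp_eventually_ne[OF this assms(1)]
    eventually_shift_invertible[OF assms(2), of "exp (ad_op br A)"]
    eventually_shift_invertible[of "\<epsilon> * m" "exp (ad_op br (\<epsilon> *s A)) * Bop"]
  show ?thesis using eps assms(2)
    by (simp add: regular_def S_eq T_eq mult.assoc eventually_conj_iff)
qed

lemma phi_invertible: "edet (W X) \<noteq> 0 \<Longrightarrow> edet (fcalc phi X) \<noteq> 0"
proof -
  assume a: "edet (W X) \<noteq> 0"
  have "entire (\<lambda>s. \<Prod>j<n. h j s)" by (intro holomorphic_intros entire_h)
  then have "W X = fcalc phi X * fcalc (\<lambda>s. \<Prod>j<n. h j s) X"
    unfolding W_def w_def[abs_def] by (rule fcalc_mult[OF entire_phi])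
  then show ?thesis using a by (auto simp: edet_mult)
qed

text \<open>The direction in \<open>l\<close> of the average of the left and the right invariant vector field of \<open>P 0 x\<close>; it is
  \<open>(X / 2) coth (X / 2)\<close> applied to \<open>P 0 x\<close>.\<close>

definition vdir :: "'n endo \<Rightarrow> complex^'n \<Rightarrow> complex^'n" where
  "vdir X x = app (einv (fcalc phi X) * (scal (1/2) * (exp X + 1)) * P 0) x"

text \<open>\<open>s * (1/2) coth (s / 2) = (1/2) (exp s + 1) / phi s\<close>.\<close>

lemma shift_C:
  assumes r: "regular D a"
  shows "app (D + scal a) (app (C D a) x) = vdir (D + scal a) x"
proof -
  let ?T = "D + scal a"
  have d: "edet (fcalc phi ?T) \<noteq> 0" "edet (S D a - 1) \<noteq> 0" using r phi_invertible by (auto simp: regular_def)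
  have cS: "(S D a - 1) * cayley (S D a) = S D a + 1"
  proof -
    have "(S D a - 1) * cayley (S D a) = (S D a + 1) * ((S D a - 1) * einv (S D a - 1))"
      unfolding cayley_def by (simp add: algebra_simps)
    then show ?thesis by (simp add: einv(2)[OF d(2)])
  qed
  have "fcalc phi ?T * (?T * C D a) = (S D a - 1) * (scal (1/2) * cayley (S D a) * P 0)"
    using fcalc_phi[of ?T] by (simp add: C_def S_def flip: mult.assoc)
  also have "\<dots> = scal (1/2) * ((S D a - 1) * cayley (S D a)) * P 0"
    by (simp only: mult.assoc scal_left_commute[of "S D a - 1"])
  finally have f: "fcalc phi ?T * (?T * C D a) = scal (1/2) * (S D a + 1) * P 0" by (simp only: cS)
  have "?T * C D a = einv (fcalc phi ?T) * (fcalc phi ?T * (?T * C D a))"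
    by (simp only: mult.assoc[symmetric] einv(1)[OF d(1)] mult_1_left)
  also have "\<dots> = einv (fcalc phi ?T) * (scal (1/2) * (exp ?T + 1)) * P 0"
    unfolding f S_def by (simp only: mult.assoc)
  finally have "?T * C D a = einv (fcalc phi ?T) * (scal (1/2) * (exp ?T + 1)) * P 0" .
  from arg_cong[OF this, of "\<lambda>F. app F x"] show ?thesis by (simp add: vdir_def)
qed

lemma tendsto_vdir:
  assumes "(X \<longlongrightarrow> X0) F" "edet (W X0) \<noteq> 0"
  shows "((\<lambda>i. vdir (X i) x) \<longlongrightarrow> vdir X0 x) F"
proof -
  have "((\<lambda>i. exp (X i)) \<longlongrightarrow> exp X0) F"
    using tendsto_fcalc[of exp, OF _ assms(1)] by (simp add: fcalc_exp1 holomorphic_intros)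
  then show ?thesis
    unfolding vdir_def
    by (intro tendsto_app tendsto_mult tendsto_add tendsto_const tendsto_einv tendsto_fcalc entire_phi assms
        phi_invertible)
qed

text \<open>The key step. Put \<open>x' = C D a x\<close>. Because \<open>ad x'\<close> shifts by \<open>[D, ad x'] = ad (D x')\<close>, it intertwines \<open>D + b\<close> and
  \<open>D + a + b = D - c\<close> up to \<open>ad ((D + a) x')\<close>, and \<open>(D + a) x'\<close> is the direction \<open>vdir\<close>. Therefore the derivative
  of \<open>R\<close> in this direction, as a divided difference, is \<open>R (D - c) ad x' - ad x' R (D + b)\<close>: no derivative is left.\<close>

lemma shifted_term:
  assumes A: "A \<in> l" and r: "regular (ad_op br A) a" "regular (ad_op br A) b" "regular (ad_op br A) c"
      "regular (ad_op br A) (- c)" and abc: "a + b + c = 0"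
  shows "form (app (N (ad_op br A + scal (- c)) (ad_op br A + scal b) (ad_op br (vdir (ad_op br A + scal a) x))) y) z
    = - (\<beta> (app (C (ad_op br A) a) x) y (app (R (ad_op br A + scal c)) z)
       + \<beta> (app (C (ad_op br A) a) x) (app (R (ad_op br A + scal b)) y) z)"
proof -
  let ?D = "ad_op br A"
  define x' where "x' = app (C ?D a) x"
  have x': "x' \<in> l" using C_in_l A r(1) by (simp add: x'_def)
  have ab: "- c = a + b" by (rule sym, rule eq_neg_iff_add_eq_0[THEN iffD2], rule abc)
  have "(?D + scal (- c)) * ad_op br x' - ad_op br x' * (?D + scal b)
      = (?D * ad_op br x' - ad_op br x' * ?D) + scal a * ad_op br x'"
    unfolding ab by (simp add: algebra_simps scal_simps scal_commute[of _ "ad_op br x'"])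
  also have "\<dots> = ad_op br (app (?D + scal a) x')"
    by (simp add: ad_diff_commutator app_lin app_ad ad_lin)
  also have "app (?D + scal a) x' = vdir (?D + scal a) x" unfolding x'_def by (rule shift_C[OF r(1)])
  finally have X: "(?D + scal (- c)) * ad_op br x' - ad_op br x' * (?D + scal b) = ad_op br (vdir (?D + scal a) x)" .
  have NX: "R (?D + scal (- c)) * ad_op br x' - ad_op br x' * R (?D + scal b)
      = N (?D + scal (- c)) (?D + scal b) (ad_op br (vdir (?D + scal a) x))"
    unfolding X[symmetric] by (rule N_intertwines) (use r ad_P_commute[OF x'] in \<open>auto simp: regular_def\<close>)
  have "form (app (N (?D + scal (- c)) (?D + scal b) (ad_op br (vdir (?D + scal a) x))) y) z
      = form (app (R (?D + scal (- c))) (br x' y)) z - form (br x' (app (R (?D + scal b)) y)) z"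
    unfolding NX[symmetric] by (simp only: app_lin(2) app_simps(3) app_ad form_lin)
  also have "form (app (R (?D + scal (- c))) (br x' y)) z = - form (br x' y) (app (R (?D + scal c)) z)"
    using CG_adjoint[OF A r(4,3)] by (simp add: R_shift A r app_lin form_lin)
  finally show ?thesis by (simp add: \<beta>_form x'_def)
qed

text \<open>In terms of \<open>C\<close> and \<open>G\<close> the divided differences cancel all mixed terms of the Yang-Baxter expression of
  \<open>C - G\<close> and reverse the sign of its terms in \<open>C\<close>; what is left is the Yang-Baxter expression of \<open>G\<close> minus that of \<open>C\<close>.\<close>

lemma shifted_identity:
  assumes A: "A \<in> l" and r: "regular (ad_op br A) a" "regular (ad_op br A) b" "regular (ad_op br A) c"
      "regular (ad_op br A) (- a)" "regular (ad_op br A) (- b)" "regular (ad_op br A) (- c)"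
    and abc: "a + b + c = 0"
  defines "D \<equiv> \<lambda>a. ad_op br A + scal a"
  shows "form (app (N (D (- c)) (D b) (ad_op br (vdir (D a) x))) y) z
    + form (app (N (D (- a)) (D c) (ad_op br (vdir (D b) y))) z) x
    + form (app (N (D (- b)) (D a) (ad_op br (vdir (D c) z))) x) y
    + (\<beta> x (app (R (D b)) y) (app (R (D c)) z) + \<beta> (app (R (D a)) x) y (app (R (D c)) z)
       + \<beta> (app (R (D a)) x) (app (R (D b)) y) z)
    = (1/4) * \<beta> (app (P 0) x) (app (P 0) y) (app (P 0) z) - (\<epsilon>\<^sup>2 / 4) * \<beta> x y z"
proof -
  have bca: "b + c + a = 0" and cab: "c + a + b = 0" using abc by (simp_all add: algebra_simps)
  define c1 c2 c3 where "c1 = app (C (ad_op br A) a) x" and "c2 = app (C (ad_op br A) b) y" and "c3 = app (C (ad_op br A) c) z"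
  define g1 g2 g3 where "g1 = app (G (ad_op br A) a) x" and "g2 = app (G (ad_op br A) b) y" and "g3 = app (G (ad_op br A) c) z"
  have R: "app (R (D a)) x = c1 - g1" "app (R (D b)) y = c2 - g2" "app (R (D c)) z = c3 - g3"
    unfolding D_def c1_def c2_def c3_def g1_def g2_def g3_def using A r by (simp_all add: R_shift app_lin)
  have t1: "form (app (N (D (- c)) (D b) (ad_op br (vdir (D a) x))) y) z = - (\<beta> c1 y (c3 - g3) + \<beta> c1 (c2 - g2) z)"
    using shifted_term[OF A r(1,2,3,6) abc, of x y z] R unfolding D_def c1_def by simp
  have t2: "form (app (N (D (- a)) (D c) (ad_op br (vdir (D b) y))) z) x = - (\<beta> (c1 - g1) c2 z + \<beta> x c2 (c3 - g3))"
    using shifted_term[OF A r(2,3,1,4) bca, of y z x] R \<beta>_cyc[of "c1 - g1" c2 z] \<beta>_cyc[of x c2 "c3 - g3"]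
    unfolding D_def c2_def by simp
  have t3: "form (app (N (D (- b)) (D a) (ad_op br (vdir (D c) z))) x) y = - (\<beta> x (c2 - g2) c3 + \<beta> (c1 - g1) y c3)"
    using shifted_term[OF A r(3,1,2,5) cab, of z x y] R \<beta>_cyc[of c3 x "c2 - g2"] \<beta>_cyc[of c3 "c1 - g1" y]
    unfolding D_def c3_def by simp
  have g: "\<beta> x g2 g3 + \<beta> g1 y g3 + \<beta> g1 g2 z = - (\<epsilon>\<^sup>2 / 4) * \<beta> x y z"
    unfolding g1_def g2_def g3_def by (rule CG_yang_baxter(1)[OF A r(1-3) abc])
  have c: "\<beta> x c2 c3 + \<beta> c1 y c3 + \<beta> c1 c2 z = - (1/4) * \<beta> (app (P 0) x) (app (P 0) y) (app (P 0) z)"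
    unfolding c1_def c2_def c3_def by (rule CG_yang_baxter(2)[OF A r(1-3) abc])
  have "- (\<beta> c1 y (c3 - g3) + \<beta> c1 (c2 - g2) z) + - (\<beta> (c1 - g1) c2 z + \<beta> x c2 (c3 - g3))
      + - (\<beta> x (c2 - g2) c3 + \<beta> (c1 - g1) y c3)
      + (\<beta> x (c2 - g2) (c3 - g3) + \<beta> (c1 - g1) y (c3 - g3) + \<beta> (c1 - g1) (c2 - g2) z)
      = (\<beta> x g2 g3 + \<beta> g1 y g3 + \<beta> g1 g2 z) - (\<beta> x c2 c3 + \<beta> c1 y c3 + \<beta> c1 c2 z)"
    by (simp add: \<beta>_lin)
  then show ?thesis unfolding t1 t2 t3 R g c by simp
qed

text \<open>The dynamical Yang-Baxter equation of the trigonometric operator, as the limit \<open>\<tau> \<rightarrow> 0\<close> of the shifted identity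
  for \<open>(a, b, c) = (\<tau>, \<tau>, - 2 \<tau>)\<close>. At \<open>\<tau> = 0\<close> itself the two Cayley transforms need not exist.\<close>

lemma dynamical_identity:
  assumes A: "A \<in> l" and d: "edet (W (ad_op br A)) \<noteq> 0"
  defines "D \<equiv> ad_op br A"
  shows "form (app (N D D (ad_op br (vdir D x))) y) z
    + form (app (N D D (ad_op br (vdir D y))) z) x
    + form (app (N D D (ad_op br (vdir D z))) x) y
    + (\<beta> x (app (R D) y) (app (R D) z) + \<beta> (app (R D) x) y (app (R D) z)
       + \<beta> (app (R D) x) (app (R D) y) z)
    = (1/4) * \<beta> (app (P 0) x) (app (P 0) y) (app (P 0) z) - (\<epsilon>\<^sup>2 / 4) * \<beta> x y z"
proof -
  define Dm where "Dm m \<tau> = D + scal (m * \<tau>)" for m \<tau>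
  define L where "L a b c a' b' c' = form (app (N c' b (ad_op br (vdir a x))) y) z
    + form (app (N a' c (ad_op br (vdir b y))) z) x
    + form (app (N b' a (ad_op br (vdir c z))) x) y
    + (\<beta> x (app (R b) y) (app (R c) z) + \<beta> (app (R a) x) y (app (R c) z)
       + \<beta> (app (R a) x) (app (R b) y) z)" for a b c a' b' c'
  have t: "(Dm m \<longlongrightarrow> D) (at 0)" for m unfolding Dm_def[abs_def] by (rule tendsto_shift)
  have tf: "((\<lambda>i. form (f i) z) \<longlongrightarrow> form f0 z) F" if "(f \<longlongrightarrow> f0) F" for f f0 z and F :: "complex filter"
    by (rule bounded_bilinear.tendsto[OF bounded_bilinear_form that tendsto_const])
  have tb: "((\<lambda>i. \<beta> (f i) (g i) (h i)) \<longlongrightarrow> \<beta> f0 g0 h0) F"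
    if "(f \<longlongrightarrow> f0) F" "(g \<longlongrightarrow> g0) F" "(h \<longlongrightarrow> h0) F" for f f0 g g0 h h0 and F :: "complex filter"
    unfolding \<beta>_def
    by (intro bounded_bilinear.tendsto[OF bounded_bilinear_form] bounded_bilinear.tendsto[OF bounded_bilinear_br] that)
  have dD: "edet (W D) \<noteq> 0" using d by (simp add: D_def)
  have "((\<lambda>\<tau>. L (Dm 1 \<tau>) (Dm 1 \<tau>) (Dm (-2) \<tau>) (Dm (-1) \<tau>) (Dm (-1) \<tau>) (Dm 2 \<tau>)) \<longlongrightarrow> L D D D D D D) (at 0)"
    unfolding L_def
    by (intro tendsto_add tf tb tendsto_app tendsto_N tendsto_R tendsto_ad tendsto_vdir tendsto_const t dD)
  moreover have "\<forall>\<^sub>F \<tau> in at 0. L (Dm 1 \<tau>) (Dm 1 \<tau>) (Dm (-2) \<tau>) (Dm (-1) \<tau>) (Dm (-1) \<tau>) (Dm 2 \<tau>)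
      = (1/4) * \<beta> (app (P 0) x) (app (P 0) y) (app (P 0) z) - (\<epsilon>\<^sup>2 / 4) * \<beta> x y z"
    using eventually_regular[OF d, of 1, OF one_neq_zero] eventually_regular[OF d, of "-2", simplified]
      eventually_regular[OF d, of "-1", simplified] eventually_regular[OF d, of 2, simplified]
  proof (eventually_elim)
    case (elim \<tau>)
    show ?case
      using shifted_identity[OF A, of \<tau> \<tau> "-2 * \<tau>" x y z] elim
      by (simp add: L_def Dm_def D_def)
  qed
  ultimately have "((\<lambda>\<tau>::complex. (1/4) * \<beta> (app (P 0) x) (app (P 0) y) (app (P 0) z) - (\<epsilon>\<^sup>2 / 4) * \<beta> x y z)
      \<longlongrightarrow> L D D D D D D) (at 0)"
    by (rule Lim_transform_eventually)
  then have "L D D D D D D = (1/4) * \<beta> (app (P 0) x) (app (P 0) y) (app (P 0) z) - (\<epsilon>\<^sup>2 / 4) * \<beta> x y z"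
    by (simp add: tendsto_const_iff)
  then show ?thesis by (simp add: L_def)
qed

lemma R_antisymmetric:
  assumes A: "A \<in> l" and d: "edet (W (ad_op br A)) \<noteq> 0"
  shows "form (app (R (ad_op br A)) x) y = - form x (app (R (ad_op br A)) y)"
proof -
  let ?D = "ad_op br A"
  have tf: "((\<lambda>\<tau>. form (app (R (?D + scal (- 1 * \<tau>))) x) y + form x (app (R (?D + scal (1 * \<tau>))) y))
      \<longlongrightarrow> form (app (R ?D) x) y + form x (app (R ?D) y)) (at 0)"
    by (intro tendsto_add bounded_bilinear.tendsto[OF bounded_bilinear_form] tendsto_app tendsto_R tendsto_shift
        tendsto_const d)
  moreover have "\<forall>\<^sub>F \<tau> in at 0. form (app (R (?D + scal (- 1 * \<tau>))) x) y + form x (app (R (?D + scal (1 * \<tau>))) y) = 0"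
    using eventually_regular[OF d, of 1, OF one_neq_zero] eventually_regular[OF d, of "-1", simplified]
  proof (eventually_elim)
    case (elim \<tau>)
    show ?case
      using CG_adjoint[OF A, of \<tau> x y] elim by (simp add: R_shift A app_lin form_lin)
  qed
  ultimately have "((\<lambda>\<tau>::complex. 0) \<longlongrightarrow> form (app (R ?D) x) y + form x (app (R ?D) y)) (at 0)"
    by (rule Lim_transform_eventually)
  then show ?thesis by (simp add: tendsto_const_iff eq_neg_iff_add_eq_0)
qed

text \<open>\<open>ad \<xi>\<close> preserves the grading and its commutator with \<open>ad A\<close> is \<open>ad (br A \<xi>)\<close>.\<close>

lemma R_equivariant:
  assumes A: "A \<in> l" and d: "edet (W (ad_op br A)) \<noteq> 0" and \<xi>: "\<xi> \<in> l"
  shows "N (ad_op br A) (ad_op br A) (ad_op br (br A \<xi>)) = R (ad_op br A) * ad_op br \<xi> - ad_op br \<xi> * R (ad_op br A)"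
  using N_intertwines[OF d d, of "ad_op br \<xi>"] ad_P_commute[OF \<xi>] by (simp add: ad_diff_commutator)

end

section \<open>Tensors in coordinates\<close>

context graded_lie
begin

lemma form_dual: "form v (dual_basis p) = v $ p"
proof -
  have "form v (dual_basis p) = (\<Sum>j\<in>UNIV. v $ j * form (dual_basis p) (axis j 1))"
    by (subst form_axis_sum) (simp only: form_sym[of "dual_basis p"])
  also have "\<dots> = (\<Sum>j\<in>UNIV. if j = p then v $ j else 0)"
    by (intro sum.cong) (auto simp: dual_basis)
  finally show ?thesis by simp
qed

lemma dual_basis_expand': "(\<Sum>i\<in>UNIV. form (axis i 1) v0 *s dual_basis i) = v0"
proof -
  have "form (\<Sum>i\<in>UNIV. form (axis i 1) v0 *s dual_basis i) y = form v0 y" for y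
  proof -
    have "form (\<Sum>i\<in>UNIV. form (axis i 1) v0 *s dual_basis i) y = (\<Sum>i\<in>UNIV. y $ i * form (axis i 1) v0)"
      by (simp add: form_sum_left form_lin form_sym[of "dual_basis _" y] form_dual mult.commute)
    also have "\<dots> = form y v0" by (rule form_axis_sum[symmetric])
    finally show ?thesis by (simp only: form_sym)
  qed
  then show ?thesis by (rule form_eqI)
qed

lemma form_sum_right: "form z (\<Sum>i\<in>I. f i) = (\<Sum>i\<in>I. form z (f i))"
  by (induction I rule: infinite_finite_induct) (auto simp: form_lin)

lemma top_lin:
  "top (s + t) x = top s x + top t x" "top (s - t) x = top s x - top t x" "top (r *\<^sub>R t) x = r *\<^sub>R top t x"
  "top (scale2 c t) x = c *s top t x" "top 0 x = 0"
  "top t (x + y) = top t x + top t y" "top t (x - y) = top t x - top t y" "top t (c *s x) = c *s top t x" "top t (- x) = - top t x"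
  by (simp_all add: tensor_operator_def vec_eq_iff form_lin sum.distrib sum_subtractf scale2_def algebra_simps
      sum_distrib_left scaleR_sum_right sum_negf)

lemma top_nth: "top t (dual_basis p) $ q = t $ p $ q"
  by (rule top_dual[symmetric])

text \<open>Exchanging the two factors of a tensor transposes its operator.\<close>

definition transp :: "complex^'n^'n \<Rightarrow> complex^'n^'n" where
  "transp t = (\<chi> p q. t $ q $ p)"

lemma top_transp: "form (top t x) y = form x (top (transp t) y)"
proof -
  have "form (top t x) y = (\<Sum>q\<in>UNIV. \<Sum>p\<in>UNIV. t $ p $ q * form (axis p 1) x * form (axis q 1) y)"
    by (subst form_axis_sum) (simp add: tensor_operator_def sum_distrib_right)
  also have "\<dots> = (\<Sum>p\<in>UNIV. \<Sum>q\<in>UNIV. t $ p $ q * form (axis p 1) x * form (axis q 1) y)"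
    by (rule sum.swap)
  also have "\<dots> = form (top (transp t) y) x"
    by (subst form_axis_sum) (simp add: tensor_operator_def transp_def sum_distrib_left sum_distrib_right mult_ac)
  finally show ?thesis by (simp add: form_sym)
qed

lemma antisymmetric2_iff: "antisymmetric2 t \<longleftrightarrow> (\<forall>x y. form (top t x) y = - form x (top t y))"
proof
  assume "antisymmetric2 t"
  then have "t $ q $ p = - (t $ p $ q)" for p q unfolding antisymmetric2_def by blast
  then have "\<forall>p q. t $ q $ p = (- t) $ p $ q" unfolding vector_uminus_component by blast
  then have "transp t = - t" unfolding transp_def vec_eq_iff vec_lambda_beta by blast
  then have "top (transp t) y = - top t y" for y
    using top_lin(2)[of 0 t y] by (simp add: top_lin(5))
  then show "\<forall>x y. form (top t x) y = - form x (top t y)" by (simp add: top_transp form_lin)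
next
  assume a: "\<forall>x y. form (top t x) y = - form x (top t y)"
  show "antisymmetric2 t" unfolding antisymmetric2_def
  proof (intro allI)
    fix p q
    have "t $ p $ q = form (top t (dual_basis p)) (dual_basis q)" by (simp add: form_dual top_nth)
    also have "\<dots> = - form (top t (dual_basis q)) (dual_basis p)" using a form_sym by metis
    finally show "t $ p $ q = - t $ q $ p" by (simp add: form_dual top_nth)
  qed
qed

lemma br_expand: "br a b = (\<Sum>i\<in>UNIV. \<Sum>k\<in>UNIV. (a $ i * b $ k) *s br (axis i 1) (axis k 1))"
proof -
  have s1: "br (\<Sum>i\<in>I. f i) y = (\<Sum>i\<in>I. br (f i) y)" for I :: "'n set" and f y
    by (induction I rule: infinite_finite_induct) (auto simp: br_add br_zero)
  have s2: "br y (\<Sum>i\<in>I. f i) = (\<Sum>i\<in>I. br y (f i))" for I :: "'n set" and f y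
    by (induction I rule: infinite_finite_induct) (auto simp: br_add br_zero)
  show ?thesis
    by (subst vec_axis_sum[of a], subst vec_axis_sum[of b])
       (subst s1, simp only: s2 br_scale vec.scale_scale mult.commute)
qed

text \<open>The coordinates of \<open>CYB\<close> are values of the invariant trilinear form. For an antisymmetric tensor they take the shape
  in which the Yang-Baxter equation has been proved for operators.\<close>

lemma CYB_nth:
  "CYB br t $ p $ q $ r = \<beta> (top (transp t) (dual_basis q)) (top (transp t) (dual_basis r)) (dual_basis p)
    + \<beta> (top t (dual_basis p)) (top (transp t) (dual_basis r)) (dual_basis q)
    + \<beta> (top t (dual_basis p)) (top t (dual_basis q)) (dual_basis r)"
proof -
  have e: "\<beta> a b (dual_basis s) = (\<Sum>i\<in>UNIV. \<Sum>k\<in>UNIV. a $ i * b $ k * br (axis i 1) (axis k 1) $ s)" for a b s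
    by (simp add: \<beta>_form form_dual) (subst br_expand, simp)
  show ?thesis
    unfolding e by (simp add: CYB_def top_nth transp_def)
qed

lemma CYB_antisymmetric_nth:
  assumes "antisymmetric2 t"
  defines "d \<equiv> dual_basis"
  shows "CYB br t $ p $ q $ r = \<beta> (d p) (top t (d q)) (top t (d r)) + \<beta> (top t (d p)) (d q) (top t (d r))
    + \<beta> (top t (d p)) (top t (d q)) (d r)"
proof -
  have m: "top (transp t) y = - top t y" for y
  proof (rule form_eqI)
    fix x
    have "form (top (transp t) y) x = form (top t x) y" using top_transp form_sym by metis
    also have "\<dots> = - form x (top t y)" using assms(1) antisymmetric2_iff by blast
    finally show "form (top (transp t) y) x = form (- top t y) x" by (simp add: form_lin form_sym)
  qed
  have neg: "\<beta> (- x) y z = - \<beta> x y z" "\<beta> x (- y) z = - \<beta> x y z" for x y z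
    using \<beta>_lin(3)[of "-1" x y z] \<beta>_lin(6)[of x "-1" y z] by (simp_all add: vec.scale_minus_left)
  have "\<beta> (top t (d q)) (top t (d r)) (d p) = \<beta> (d p) (top t (d q)) (top t (d r))" by (metis \<beta>_cyc)
  moreover have "\<beta> (top t (d p)) (top t (d r)) (d q) = - \<beta> (top t (d p)) (d q) (top t (d r))" by (rule \<beta>_anti)
  ultimately show ?thesis unfolding CYB_nth m neg d_def by simp
qed

text \<open>Invariance of the form turns the action on the first factor into composition with \<open>- ad x\<close>.\<close>

lemma ad2_top: "top (ad2 br x t) y = br x (top t y) - top t (br x y)"
proof -
  have e: "ad2 br x t $ p $ q = (br x (top t (dual_basis p)) - top t (br x (dual_basis p))) $ q" for p q
  proof -
    have "(\<Sum>i\<in>UNIV. t $ p $ i * br x (axis i 1) $ q) = br x (top t (dual_basis p)) $ q"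
    proof -
      have "br x (top t (dual_basis p)) = app (ad_op br x) (\<Sum>i\<in>UNIV. top t (dual_basis p) $ i *s axis i 1)"
        by (simp only: vec_axis_sum[symmetric] app_ad)
      then show ?thesis by (simp add: app_sum app_scale app_ad top_nth)
    qed
    moreover have "(\<Sum>i\<in>UNIV. t $ i $ q * br x (axis i 1) $ p) = - top t (br x (dual_basis p)) $ q"
    proof -
      have "br x (axis i 1) $ p = - form (axis i 1) (br x (dual_basis p))" for i
        using form_inv[of x "axis i 1" "dual_basis p"] by (simp add: form_dual eq_neg_iff_add_eq_0)
      then show ?thesis by (simp add: tensor_operator_def sum_negf)
    qed
    ultimately show ?thesis by (simp add: ad2_def)
  qed
  define F where "F = ad_op br x * op (top t) - op (top t) * ad_op br x"
  have lt: "Vector_Spaces.linear (*s) (*s) (top t)" by (rule linear_scaleI) (simp_all add: top_lin)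
  have F: "app F v = br x (top t v) - top t (br x v)" for v
    by (simp add: F_def app_lin app_ad app_op[OF lt])
  have "ad2 br x t = tensor_of F"
    by (simp add: vec_eq_iff top_dual[of "tensor_of F"] top_tensor_of F e)
  then show ?thesis by (simp add: top_tensor_of F)
qed

text \<open>The tensors that occur as the right hand side of the dynamical Yang-Baxter equation; the action of \<open>x\<close> on them
  vanishes by the Jacobi identity and the invariance of the form.\<close>

lemma invariant_tensor:
  fixes c :: complex
  defines "Z \<equiv> (\<chi> p q r. c * \<beta> (dual_basis p) (dual_basis q) (dual_basis r))"
  shows "antisymmetric3 Z" "ad3 br x Z = 0"
proof -
  have "\<beta> y x z = - \<beta> x y z" for x y z using \<beta>_anti[of y x z] \<beta>_cyc[of y z x] \<beta>_cyc[of z x y] by simp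
  then show "antisymmetric3 Z"
    unfolding antisymmetric3_def Z_def vec_lambda_beta using \<beta>_anti by (metis minus_mult_right)
  have m: "br x (axis i 1) $ p = - form (axis i 1) (br x (dual_basis p))" for i p
    using form_inv[of x "axis i 1" "dual_basis p"] by (simp add: form_dual eq_neg_iff_add_eq_0)
  have s: "(\<Sum>i\<in>UNIV. c * f (dual_basis i) * - form (axis i 1) v0) = - (c * f v0)"
    if f: "\<And>x y. f (x + y) = f x + f y" "\<And>a x. f (a *s x) = a * f x" for f v0
  proof -
    have "f (\<Sum>i\<in>I. g i) = (\<Sum>i\<in>I. f (g i))" for I :: "'n set" and g
      by (induction I rule: infinite_finite_induct) (auto simp: f(1) f(2)[of 0 0, simplified])
    then have "f v0 = (\<Sum>i\<in>UNIV. form (axis i 1) v0 * f (dual_basis i))"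
      by (subst dual_basis_expand'[of v0, symmetric]) (simp add: f(2))
    then show ?thesis by (simp add: sum_distrib_left sum_negf mult_ac)
  qed
  have "ad3 br x Z $ p $ q $ r = 0" for p q r
  proof -
    let ?a = "dual_basis p" and ?b = "dual_basis q" and ?d = "dual_basis r"
    have "ad3 br x Z $ p $ q $ r = - (c * \<beta> (br x ?a) ?b ?d) - c * \<beta> ?a (br x ?b) ?d - c * \<beta> ?a ?b (br x ?d)"
      unfolding ad3_def Z_def using s[of "\<lambda>v. \<beta> v ?b ?d" "br x ?a"] s[of "\<lambda>v. \<beta> ?a v ?d" "br x ?b"]
        s[of "\<lambda>v. \<beta> ?a ?b v" "br x ?d"]
      by (simp add: m \<beta>_lin)
    also have "\<dots> = - c * (form (br x ?a) (br ?b ?d) + form ?a (br x (br ?b ?d)))"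
      by (simp add: \<beta>_def jacobi[of x ?b ?d] form_lin algebra_simps)
    finally show ?thesis by (simp add: form_inv)
  qed
  then show "ad3 br x Z = 0" by (simp add: vec_eq_iff)
qed

subsection \<open>Tensors over the fixed subalgebra\<close>

lemma top_tensor2: "top (tensor2 a c) x = form a x *s c"
  by (simp add: tensor_operator_def tensor2_def vec_eq_iff form_axis_sum[of a] sum_distrib_right sum_distrib_left mult_ac)

lemma tensor_square_induct:
  assumes t: "t \<in> tensor_square l" and Q0: "Q 0" and Qadd: "\<And>s t. Q s \<Longrightarrow> Q t \<Longrightarrow> Q (s + t)"
    and Qs: "\<And>r t. Q t \<Longrightarrow> Q (r *\<^sub>R t)" and Q2: "\<And>a c. a \<in> l \<Longrightarrow> c \<in> l \<Longrightarrow> Q (tensor2 a c)"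
  shows "Q t"
  using t unfolding tensor_square_def
proof (induction rule: span_induct_alt)
  case base
  show ?case by (rule Q0)
next
  case (step r s t)
  then show ?case using Qadd Qs Q2 by blast
qed

lemma l_real: "subspace l" by (rule vec_linear_real[OF l_sub])

lemma top_in_l: "t \<in> tensor_square l \<Longrightarrow> top t x \<in> l"
  by (erule tensor_square_induct)
     (auto simp: top_lin top_tensor2 intro: subspace_0[OF l_real] subspace_add[OF l_real] subspace_scale[OF l_real] vec.subspace_scale[OF l_sub])

lemma contract_lin:
  "contract 0 \<eta> = 0" "contract (s + t) \<eta> = contract s \<eta> + contract t \<eta>" "contract (r *\<^sub>R t) \<eta> = r *\<^sub>R contract t \<eta>"
  by (simp_all add: contract_def vec_eq_iff sum.distrib algebra_simps scaleR_sum_right)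

lemma contract_tensor2:
  assumes "Vector_Spaces.linear (*s) (*) \<eta>"
  shows "contract (tensor2 a c) \<eta> = \<eta> a *s c"
proof -
  interpret e: Vector_Spaces.linear "(*s)" "(*)" \<eta> by fact
  have "\<eta> a = (\<Sum>p\<in>UNIV. a $ p * \<eta> (axis p 1))"
    by (subst vec_axis_sum[of a]) (simp add: e.sum e.scale)
  then show ?thesis by (simp add: contract_def tensor2_def vec_eq_iff sum_distrib_right sum_distrib_left mult_ac)
qed

lemma contract_in_l: "Vector_Spaces.linear (*s) (*) \<eta> \<Longrightarrow> t \<in> tensor_square l \<Longrightarrow> contract t \<eta> \<in> l"
  by (erule tensor_square_induct)
     (auto simp: contract_lin contract_tensor2 intro: subspace_0[OF l_real] subspace_add[OF l_real] subspace_scale[OF l_real] vec.subspace_scale[OF l_sub])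

lemma finite_basis: "basis_of l bs \<Longrightarrow> finite bs"
  using vec.finiteI_independent by (auto simp: basis_of_def)

lemma dual_bases_expand:
  assumes "dual_bases l bs \<eta>" "a \<in> l"
  shows "a = (\<Sum>b\<in>bs. \<eta> b a *s b)"
proof -
  have bs: "basis_of l bs" and lin: "\<And>b. b \<in> bs \<Longrightarrow> Vector_Spaces.linear (*s) (*) (\<eta> b)"
    and d: "\<And>b b'. b \<in> bs \<Longrightarrow> b' \<in> bs \<Longrightarrow> \<eta> b b' = (if b = b' then 1 else 0)"
    using assms(1) by (auto simp: dual_bases_def)
  have fin: "finite bs" by (rule finite_basis[OF bs])
  have "a \<in> vec.span bs" using bs assms(2) by (simp add: basis_of_def)
  then obtain c where a: "a = (\<Sum>b\<in>bs. c b *s b)" by (auto simp: vec.span_finite[OF fin])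
  have "\<eta> b a = c b" if b: "b \<in> bs" for b
  proof -
    interpret e: Vector_Spaces.linear "(*s)" "(*)" "\<eta> b" by (rule lin[OF b])
    have "\<eta> b a = (\<Sum>b'\<in>bs. if b' = b then c b' else 0)"
      unfolding a by (simp add: e.sum e.scale) (intro sum.cong, auto simp: d b)
    then show ?thesis using fin b by simp
  qed
  then show ?thesis by (subst a) simp
qed

lemma contract_sum:
  assumes "dual_bases l bs \<eta>" "t \<in> tensor_square l"
  shows "(\<Sum>b\<in>bs. form b x *s contract t (\<eta> b)) = top t x"
  using assms(2)
proof (rule tensor_square_induct)
  fix a c assume a: "a \<in> l"
  have lin: "Vector_Spaces.linear (*s) (*) (\<eta> b)" if "b \<in> bs" for b using assms(1) that by (auto simp: dual_bases_def)
  have "(\<Sum>b\<in>bs. form b x *s contract (tensor2 a c) (\<eta> b)) = (\<Sum>b\<in>bs. \<eta> b a * form b x) *s c"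
    by (simp add: contract_tensor2 lin vec.scale_sum_left mult.commute)
  also have "(\<Sum>b\<in>bs. \<eta> b a * form b x) = form a x"
    by (subst (2) dual_bases_expand[OF assms(1) a]) (simp add: form_sum_left form_lin)
  finally show "(\<Sum>b\<in>bs. form b x *s contract (tensor2 a c) (\<eta> b)) = top (tensor2 a c) x"
    by (simp add: top_tensor2)
next
  fix r t assume "(\<Sum>b\<in>bs. form b x *s contract t (\<eta> b)) = top t x"
  then show "(\<Sum>b\<in>bs. form b x *s contract (r *\<^sub>R t) (\<eta> b)) = top (r *\<^sub>R t) x"
    by (simp only: contract_lin top_lin scaleR_as_scale vec.scale_left_commute vec.scale_sum_right[symmetric])
qed (simp_all add: contract_lin top_lin vec.scale_right_distrib sum.distrib)

lemma casimir_top: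
  assumes "casimir_element form l \<Omega>"
  shows "top \<Omega> x = app (P 0) x"
proof -
  obtain bs D where bs: "basis_of l bs" "\<And>b. b \<in> bs \<Longrightarrow> D b \<in> l"
    and d: "\<And>b b'. b \<in> bs \<Longrightarrow> b' \<in> bs \<Longrightarrow> form (D b) b' = (if b = b' then 1 else 0)"
    and \<Omega>: "\<Omega> = (\<Sum>b\<in>bs. tensor2 b (D b))"
    using assms unfolding casimir_element_def by blast
  have fin: "finite bs" by (rule finite_basis[OF bs(1)])
  have top\<Omega>: "top \<Omega> x = (\<Sum>b\<in>bs. form b x *s D b)"
  proof -
    have "top (\<Sum>b\<in>I. f b) x = (\<Sum>b\<in>I. top (f b) x)" for I :: "(complex^'n) set" and f
      by (induction I rule: infinite_finite_induct) (auto simp: top_lin)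
    then show ?thesis by (simp add: \<Omega> top_tensor2)
  qed
  define y where "y = top \<Omega> x - app (P 0) x"
  have "top \<Omega> x \<in> l" unfolding top\<Omega> using bs(2) l_sub by (intro vec.subspace_sum vec.subspace_scale) auto
  then have yl: "y \<in> l" unfolding y_def using P0_in_l l_sub by (intro vec.subspace_diff)
  have "form (top \<Omega> x) v0 = form x v0" if "v0 \<in> l" for v0
  proof -
    have "v0 \<in> vec.span bs" using bs that by (simp add: basis_of_def)
    then obtain c where v0: "v0 = (\<Sum>b\<in>bs. c b *s b)" by (auto simp: vec.span_finite[OF fin])
    have "form (D b) v0 = c b" if b: "b \<in> bs" for b
    proof -
      have "form (D b) v0 = (\<Sum>b'\<in>bs. if b' = b then c b' else 0)"
        unfolding v0 by (simp add: form_sum_right form_lin) (intro sum.cong, auto simp: d b)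
      then show ?thesis using fin b by simp
    qed
    then have "form (top \<Omega> x) v0 = (\<Sum>b\<in>bs. c b * form b x)"
      unfolding top\<Omega> by (simp add: form_sum_left form_lin mult.commute)
    also have "\<dots> = form v0 x" unfolding v0 by (simp add: form_sum_left form_lin)
    finally show ?thesis by (simp add: form_sym)
  qed
  then have "form y v0 = 0" if "v0 \<in> l" for v0
    using that P0_on_l[OF that] by (simp add: y_def form_lin form_P0)
  then have "form y v = form 0 v" for v
    using form_P0[of y v] P0_in_l[of v] P0_on_l[OF yl] by (simp add: form_lin)
  then have "y = 0" by (rule form_eqI)
  then show ?thesis by (simp add: y_def)
qed

text \<open>The operator of \<open>rl + \<Omega> / 2\<close> is \<open>\<rho> + P 0 / 2\<close> with \<open>\<rho>\<close> antisymmetric. In its Yang-Baxter expression the terms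
  linear in \<open>P 0\<close> cancel.\<close>

lemma quasitriangular_CYB:
  assumes q: "quasitriangular_structure br l \<delta> rl \<Omega>" and cas: "casimir_element form l \<Omega>"
  shows "\<beta> x (top rl y) (top rl z) + \<beta> (top rl x) y (top rl z) + \<beta> (top rl x) (top rl y) z
    = - (1/4) * \<beta> (app (P 0) x) (app (P 0) y) (app (P 0) z)"
proof -
  have rl: "rl \<in> tensor_square l" and anti: "antisymmetric2 rl" and cyb: "CYB br (rl + (1/2) *\<^sub>R \<Omega>) = 0"
    using q by (auto simp: quasitriangular_structure_def)
  define \<rho> where "\<rho> = top rl"
  define p where "p = app (P 0)"
  have \<rho>l: "\<rho> x \<in> l" for x unfolding \<rho>_def by (rule top_in_l[OF rl])
  have pl: "p x \<in> l" for x unfolding p_def by (rule P0_in_l)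
  have pp: "p v0 = v0" if "v0 \<in> l" for v0 unfolding p_def by (rule P0_on_l[OF that])
  have \<beta>p: "\<beta> v0 v v' = \<beta> (p v0) v v'" "\<beta> v v0 v' = \<beta> v (p v0) v'" "\<beta> v v' v0 = \<beta> v v' (p v0)"
    if "v \<in> l" "v' \<in> l" for v0 v v'
  proof -
    have e: "\<beta> v0 v v' = \<beta> (p v0) v v'" if "v \<in> l" "v' \<in> l" for v0 v v'
      using form_P0[of v0 "br v v'"] P0_on_l[OF br_in_l[OF that]] by (simp add: \<beta>_def p_def)
    then show "\<beta> v0 v v' = \<beta> (p v0) v v'" using that by blast
    show "\<beta> v v0 v' = \<beta> v (p v0) v'" "\<beta> v v' v0 = \<beta> v v' (p v0)"
      using e[OF that(2,1), of v0] e[OF that, of v0] \<beta>_cyc by metis+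
  qed
  let ?t = "rl + (1/2) *\<^sub>R \<Omega>"
  have t: "top ?t x = \<rho> x + (1/2) *s p x" for x
    by (simp add: top_lin casimir_top[OF cas] \<rho>_def p_def scaleR_as_scale)
  have tt: "top (transp ?t) x = (1/2) *s p x - \<rho> x" for x
  proof (rule form_eqI)
    fix y
    have "form (top (transp ?t) x) y = form (top ?t y) x" using top_transp form_sym by metis
    also have "\<dots> = form (\<rho> y) x + (1/2) * form (p y) x" by (simp add: t form_lin)
    also have "form (\<rho> y) x = - form y (\<rho> x)" using anti antisymmetric2_iff by (simp add: \<rho>_def)
    finally show "form (top (transp ?t) x) y = form ((1/2) *s p x - \<rho> x) y"
      using form_P0[of y x] by (simp add: form_lin p_def form_sym)
  qed
  let ?d = "dual_basis"
  define c :: complex where "c = 1/2"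
  define F where "F x y z = \<beta> (c *s p y - \<rho> y) (c *s p z - \<rho> z) x
    + \<beta> (\<rho> x + c *s p x) (c *s p z - \<rho> z) y + \<beta> (\<rho> x + c *s p x) (\<rho> y + c *s p y) z" for x y z
  have F0: "F (?d i) (?d j) (?d k) = 0" for i j k
    using arg_cong[OF cyb, of "\<lambda>T. T $ i $ j $ k"] by (simp add: CYB_nth t tt F_def c_def)
  have \<rho>lin: "\<rho> (x + y) = \<rho> x + \<rho> y" "\<rho> (c *s x) = c *s \<rho> x" for x y c by (simp_all add: \<rho>_def top_lin)
  have plin: "p (x + y) = p x + p y" "p (c *s x) = c *s p x" for x y c by (simp_all add: p_def app_lin app_scale)
  have Flin: "F (x + x') y z = F x y z + F x' y z" "F (a *s x) y z = a * F x y z"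
    "F x (y + y') z = F x y z + F x y' z" "F x (a *s y) z = a * F x y z"
    "F x y (z + z') = F x y z + F x y z'" "F x y (a *s z) = a * F x y z" for x x' y y' z z' a
    by (simp_all add: F_def \<rho>lin plin \<beta>_lin algebra_simps)
  have vanish: "f v0 = 0" if "\<And>x y. f (x + y) = f x + f y" "\<And>c x. f (c *s x) = c * f x" "\<And>i. f (?d i) = 0"
    for f :: "complex^'n \<Rightarrow> complex" and v0
  proof -
    have "f (\<Sum>i\<in>I. g i) = (\<Sum>i\<in>I. f (g i))" for I :: "'n set" and g
      by (induction I rule: infinite_finite_induct) (auto simp: that(1) that(2)[of 0 0, simplified])
    then show ?thesis by (subst dual_basis_expand'[of v0, symmetric]) (simp add: that(2,3))
  qed
  have F1: "F x (?d j) (?d k) = 0" for x j k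
    by (rule vanish[of "\<lambda>x. F x (?d j) (?d k)" x]) (simp_all add: Flin F0)
  have F2: "F x y (?d k) = 0" for x y k
    by (rule vanish[of "\<lambda>y. F x y (?d k)" y]) (simp_all add: Flin F1)
  have "F x y z = 0" by (rule vanish[of "\<lambda>z. F x y z" z]) (simp_all add: Flin F2)
  moreover have "F x y z = \<beta> x (\<rho> y) (\<rho> z) + \<beta> (\<rho> x) y (\<rho> z) + \<beta> (\<rho> x) (\<rho> y) z + c * c * \<beta> (p x) (p y) (p z)"
  proof -
    have e: "\<beta> v0 v x = \<beta> x v0 v" "\<beta> v0 v y = - \<beta> v0 y v" for v0 v by (metis \<beta>_cyc, rule \<beta>_anti)
    have "F x y z = \<beta> x (c *s p y - \<rho> y) (c *s p z - \<rho> z)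
      - \<beta> (\<rho> x + c *s p x) y (c *s p z - \<rho> z) + \<beta> (\<rho> x + c *s p x) (\<rho> y + c *s p y) z"
      unfolding F_def e(1) e(2)[of "\<rho> x + c *s p x"] by simp
    moreover have
      "\<beta> x (p y) (p z) = \<beta> (p x) (p y) (p z)" "\<beta> x (p y) (\<rho> z) = \<beta> (p x) (p y) (\<rho> z)" "\<beta> x (\<rho> y) (p z) = \<beta> (p x) (\<rho> y) (p z)"
      "\<beta> (p x) y (p z) = \<beta> (p x) (p y) (p z)" "\<beta> (p x) y (\<rho> z) = \<beta> (p x) (p y) (\<rho> z)" "\<beta> (\<rho> x) y (p z) = \<beta> (\<rho> x) (p y) (p z)"
      "\<beta> (p x) (p y) z = \<beta> (p x) (p y) (p z)" "\<beta> (p x) (\<rho> y) z = \<beta> (p x) (\<rho> y) (p z)" "\<beta> (\<rho> x) (p y) z = \<beta> (\<rho> x) (p y) (p z)"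
      using \<beta>p[OF pl pl] \<beta>p[OF pl \<rho>l] \<beta>p[OF \<rho>l pl] by simp_all
    ultimately show ?thesis by (simp add: \<beta>_lin algebra_simps)
  qed
  ultimately show ?thesis by (simp add: \<rho>_def p_def c_def eq_neg_iff_add_eq_0)
qed

end

section \<open>Holomorphic functions on a subspace\<close>

lemma has_derivative_along_curve:
  fixes f :: "'a::real_normed_vector \<Rightarrow> 'b::real_normed_vector" and \<gamma> :: "real \<Rightarrow> 'a"
  assumes f: "(f has_derivative L) (at A within V)" and \<gamma>: "(\<gamma> has_vector_derivative v) (at 0)"
    and A: "\<gamma> 0 = A" and ev: "\<forall>\<^sub>F t in nhds 0. \<gamma> t \<in> V"
  shows "((\<lambda>t. f (\<gamma> t)) has_vector_derivative L v) (at 0)"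
proof -
  obtain s where s: "open s" "0 \<in> s" "\<And>t. t \<in> s \<Longrightarrow> \<gamma> t \<in> V"
    using ev unfolding eventually_nhds by blast
  have f': "(f has_derivative L) (at (\<gamma> 0) within \<gamma> ` s)"
    unfolding A by (rule has_derivative_subset[OF f]) (use s(3) in blast)
  have "(\<gamma> has_derivative (\<lambda>t. t *\<^sub>R v)) (at 0 within s)"
    using \<gamma> by (simp add: has_vector_derivative_def has_derivative_at_withinI)
  from has_derivative_in_compose[OF this f']
  have "((\<lambda>t. f (\<gamma> t)) has_derivative (\<lambda>t. L (t *\<^sub>R v))) (at 0 within s)" .
  moreover have "L (t *\<^sub>R v) = t *\<^sub>R L v" for t
    by (rule linear_cmul[OF has_derivative_linear[OF f]])
  ultimately show ?thesis by (simp only: at_within_open[OF s(2,1)] has_vector_derivative_def)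
qed

lemma holomorphic_along_line:
  fixes f :: "complex^'n::finite \<Rightarrow> complex"
  assumes l: "vec.subspace l" and x: "x \<in> l" and v: "v \<in> l"
    and f: "(f has_derivative L) (at (x + \<sigma> *s v) within l)" and L: "\<And>c. L (c *s v) = c * L v"
  shows "((\<lambda>\<sigma>. f (x + \<sigma> *s v)) has_field_derivative L v) (at \<sigma>)"
proof -
  have im: "range (\<lambda>\<sigma>. x + \<sigma> *s v) \<subseteq> l"
    using vec.subspace_add[OF l x vec.subspace_scale[OF l v]] by auto
  have "((\<lambda>\<sigma>. x + \<sigma> *s v) has_derivative (\<lambda>d. d *s v)) (at \<sigma>)"
    using has_derivative_add[OF has_derivative_const bounded_linear.has_derivative[OF bounded_linear_scale_left has_derivative_ident]]
    by simp
  from has_derivative_in_compose[OF this has_derivative_subset[OF f im]]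
  have "((\<lambda>\<sigma>. f (x + \<sigma> *s v)) has_derivative (\<lambda>d. L (d *s v))) (at \<sigma>)" by simp
  then show ?thesis by (simp add: has_field_derivative_def L mult.commute[of _ "L v"])
qed

text \<open>Cauchy's estimate along complex lines in the direction \<open>v\<close>, applied to the difference of \<open>f\<close> at two nearby base
  points, bounds the difference of the derivatives; \<open>f\<close> is uniformly continuous on a compact neighbourhood.\<close>

lemma derivative_continuous:
  fixes f :: "complex^'n::finite \<Rightarrow> complex"
  assumes l: "vec.subspace l" and U: "openin (top_of_set l) U" "A \<in> U"
    and f: "\<And>x. x \<in> U \<Longrightarrow> (f has_derivative L x) (at x within l)"
    and L: "\<And>x c v. x \<in> U \<Longrightarrow> v \<in> l \<Longrightarrow> L x (c *s v) = c * L x v"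
    and v: "v \<in> l"
  shows "continuous (at A within l) (\<lambda>x. L x v)"
proof -
  obtain T where T: "open T" "U = l \<inter> T" using U(1) openin_open by blast
  then obtain e where e: "e > 0" "cball A e \<subseteq> T" using U(2) open_contains_cball by blast
  let ?Q = "cball A e \<inter> l"
  have QU: "?Q \<subseteq> U" using T e by auto
  have "continuous_on ?Q f"
    unfolding continuous_on_eq_continuous_within
  proof
    fix x assume "x \<in> ?Q"
    then have "(f has_derivative L x) (at x within ?Q)" using f QU has_derivative_subset by blast
    then show "continuous (at x within ?Q) f" by (rule has_derivative_continuous)
  qed
  moreover have "compact ?Q"
    by (intro compact_Int_closed compact_cball closed_subspace vec_linear_real l)
  ultimately have uc: "uniformly_continuous_on ?Q f" by (rule compact_uniformly_continuous)
  define \<rho> where "\<rho> = e / (2 * (norm v + 1))"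
  have \<rho>: "\<rho> > 0" using e by (simp add: \<rho>_def add_nonneg_pos)
  have \<rho>v: "\<rho> * norm v \<le> e / 2"
  proof -
    have "\<rho> * norm v \<le> \<rho> * (norm v + 1)" using \<rho> by (intro mult_left_mono) auto
    also have "\<dots> = e / 2" using norm_ge_zero[of v] unfolding \<rho>_def by (simp add: field_simps add_nonneg_eq_0_iff)
    finally show ?thesis .
  qed
  have mem: "x + \<sigma> *s v \<in> ?Q" if "x \<in> l" "dist x A \<le> e / 2" "norm \<sigma> \<le> \<rho>" for x \<sigma>
  proof -
    have "norm \<sigma> * norm v \<le> \<rho> * norm v" using that by (intro mult_right_mono) auto
    then have "norm (\<sigma> *s v) \<le> e / 2" using \<rho>v by (simp add: norm_scale_vec)
    moreover have "dist (x + \<sigma> *s v) A \<le> dist x A + norm (\<sigma> *s v)"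
      using norm_triangle_ineq[of "x - A" "\<sigma> *s v"] by (simp add: dist_norm algebra_simps)
    ultimately have "dist A (x + \<sigma> *s v) \<le> e" using that by (simp add: dist_commute)
    then show ?thesis using vec.subspace_add[OF l that(1) vec.subspace_scale[OF l v]] by simp
  qed
  have Al: "A \<in> l" using U T by auto
  show ?thesis
    unfolding continuous_within Lim_within
  proof (intro allI impI)
    fix \<epsilon> :: real assume \<epsilon>: "\<epsilon> > 0"
    then have "\<epsilon> * \<rho> / 2 > 0" using \<rho> by simp
    then obtain d where d: "d > 0" "\<And>x y. x \<in> ?Q \<Longrightarrow> y \<in> ?Q \<Longrightarrow> dist y x < d \<Longrightarrow> dist (f y) (f x) < \<epsilon> * \<rho> / 2"
      using uc unfolding uniformly_continuous_on_def by metis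
    show "\<exists>d>0. \<forall>x\<in>l. 0 < dist x A \<and> dist x A < d \<longrightarrow> dist (L x v) (L A v) < \<epsilon>"
    proof (intro exI[of _ "min d (e/2)"] conjI ballI impI)
      show "min d (e/2) > 0" using d e by simp
      fix x assume x: "x \<in> l" "0 < dist x A \<and> dist x A < min d (e/2)"
      have xd: "dist x A \<le> e / 2" "dist x A < d" using x by auto
      let ?g = "\<lambda>\<sigma>. f (x + \<sigma> *s v) - f (A + \<sigma> *s v)"
      have der: "((\<lambda>\<sigma>. f (y + \<sigma> *s v)) has_field_derivative L (y + \<sigma> *s v) v) (at \<sigma>)"
        if "y \<in> l" "dist y A \<le> e / 2" "norm \<sigma> \<le> \<rho>" for y \<sigma>
        using mem[OF that] QU by (intro holomorphic_along_line[OF l that(1) v] f L v) auto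
      have dg: "(?g has_field_derivative L (x + \<sigma> *s v) v - L (A + \<sigma> *s v) v) (at \<sigma>)" if "norm \<sigma> \<le> \<rho>" for \<sigma>
        using e by (intro DERIV_diff der that x(1) Al xd(1)) auto
      have "norm ((deriv ^^ 1) ?g 0) \<le> fact 1 * (\<epsilon> * \<rho> / 2) / \<rho> ^ 1"
      proof (rule Cauchy_inequality)
        show "?g holomorphic_on ball 0 \<rho>"
          unfolding holomorphic_on_open[OF open_ball]
        proof
          fix z :: complex assume "z \<in> ball 0 \<rho>"
          then have "norm z \<le> \<rho>" by simp
          from dg[OF this] show "\<exists>f'. (?g has_field_derivative f') (at z)" by (rule exI)
        qed
        show "continuous_on (cball 0 \<rho>) ?g"
          using dg by (intro DERIV_continuous_on[of _ _ "\<lambda>\<sigma>. L (x + \<sigma> *s v) v - L (A + \<sigma> *s v) v"])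
            (auto intro: has_field_derivative_at_within)
        show "norm (?g \<sigma>) \<le> \<epsilon> * \<rho> / 2" if "norm (0 - \<sigma>) = \<rho>" for \<sigma>
        proof -
          have "dist (x + \<sigma> *s v) (A + \<sigma> *s v) < d" using xd(2) by (simp add: dist_norm)
          then have "dist (f (x + \<sigma> *s v)) (f (A + \<sigma> *s v)) < \<epsilon> * \<rho> / 2"
            using that e by (intro d(2) mem x(1) Al xd(1)) auto
          then show ?thesis by (simp add: dist_norm)
        qed
      qed (rule \<rho>)
      then have "norm (deriv ?g 0) \<le> \<epsilon> / 2" using \<rho> by simp
      moreover have "deriv ?g 0 = L x v - L A v" using DERIV_imp_deriv[OF dg[of 0]] \<rho> by simp
      ultimately show "dist (L x v) (L A v) < \<epsilon>" using \<epsilon> by (simp add: dist_norm)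
    qed
  qed
qed

abbreviation scalar_differentiable :: "(complex^'n) set \<Rightarrow> (complex^'n \<Rightarrow> complex) \<Rightarrow> complex^'n::finite \<Rightarrow> bool" where
  "scalar_differentiable \<equiv> complex_differentiable (*s) (*)"

lemma scalar_differentiable_const: "scalar_differentiable l (\<lambda>x. c) x"
  unfolding complex_differentiable_def by (intro exI[of _ "\<lambda>v. 0"]) auto

lemma scalar_differentiable_add:
  "scalar_differentiable l f x \<Longrightarrow> scalar_differentiable l g x \<Longrightarrow> scalar_differentiable l (\<lambda>x. f x + g x) x"
  unfolding complex_differentiable_def
  by (elim exE conjE, intro exI conjI, erule (1) has_derivative_add) (simp add: distrib_left)

lemma scalar_differentiable_diff:
  "scalar_differentiable l f x \<Longrightarrow> scalar_differentiable l g x \<Longrightarrow> scalar_differentiable l (\<lambda>x. f x - g x) x"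
  unfolding complex_differentiable_def
  by (elim exE conjE, intro exI conjI, erule (1) has_derivative_diff) (simp add: right_diff_distrib)

lemma scalar_differentiable_mult:
  "scalar_differentiable l f x \<Longrightarrow> scalar_differentiable l g x \<Longrightarrow> scalar_differentiable l (\<lambda>x. f x * g x) x"
  unfolding complex_differentiable_def
  by (elim exE conjE, intro exI conjI, erule (1) has_derivative_mult) (simp add: algebra_simps)

lemma scalar_differentiable_sum:
  "(\<And>i. i \<in> I \<Longrightarrow> scalar_differentiable l (f i) x) \<Longrightarrow> scalar_differentiable l (\<lambda>x. \<Sum>i\<in>I. f i x) x"
  by (induction I rule: infinite_finite_induct) (simp_all add: scalar_differentiable_const scalar_differentiable_add)

lemma scalar_differentiable_prod:
  "(\<And>i. i \<in> I \<Longrightarrow> scalar_differentiable l (f i) x) \<Longrightarrow> scalar_differentiable l (\<lambda>x. \<Prod>i\<in>I. f i x) x"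
  by (induction I rule: infinite_finite_induct) (simp_all add: scalar_differentiable_const scalar_differentiable_mult)

lemma scalar_differentiable_det:
  fixes M :: "complex^'n::finite \<Rightarrow> complex^'n^'n"
  shows "(\<And>i j. scalar_differentiable l (\<lambda>x. M x $ i $ j) x) \<Longrightarrow> scalar_differentiable l (\<lambda>x. det (M x)) x"
  unfolding det_def
  by (intro scalar_differentiable_sum scalar_differentiable_mult scalar_differentiable_const scalar_differentiable_prod)

lemma scalar_differentiable_tensor:
  fixes p :: "complex^'n::finite \<Rightarrow> complex^'n^'n"
  assumes "\<And>i j. scalar_differentiable l (\<lambda>x. p x $ i $ j) x"
  shows "complex_differentiable (*s) scale2 l p x"
proof -
  obtain L where L: "\<And>i j. ((\<lambda>x. p x $ i $ j) has_derivative L i j) (at x within l)"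
    "\<And>i j c v. v \<in> l \<Longrightarrow> L i j (c *s v) = c * L i j v"
    using assms unfolding complex_differentiable_def by metis
  have ax: "bounded_linear (axis i :: complex \<Rightarrow> complex^'n)" "bounded_linear (axis i :: complex^'n \<Rightarrow> complex^'n^'n)" for i :: 'n
    unfolding linear_conv_bounded_linear[symmetric] by (rule linearI; simp add: axis_def vec_eq_iff)+
  have "(p has_derivative (\<lambda>v. \<chi> i j. L i j v)) (at x within l)"
  proof -
    have "((\<lambda>x. p x $ i) has_derivative (\<lambda>v. \<chi> j. L i j v)) (at x within l)" for i
    proof -
      have "((\<lambda>x. \<Sum>j\<in>UNIV. axis j (p x $ i $ j)) has_derivative (\<lambda>v. \<Sum>j\<in>UNIV. axis j (L i j v))) (at x within l)"
        by (intro has_derivative_sum bounded_linear.has_derivative[OF ax(1)] L(1))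
      moreover have "(\<Sum>j\<in>UNIV. axis j (f j)) = (\<chi> j. f j)" for f :: "'n \<Rightarrow> complex"
        by (simp add: vec_eq_iff axis_def if_distrib cong: if_cong)
      ultimately show ?thesis by (simp add: vec_lambda_eta)
    qed
    then have "((\<lambda>x. \<Sum>i\<in>UNIV. axis i (p x $ i)) has_derivative (\<lambda>v. \<Sum>i\<in>UNIV. axis i (\<chi> j. L i j v))) (at x within l)"
      by (intro has_derivative_sum bounded_linear.has_derivative[OF ax(2)])
    moreover have "(\<Sum>j\<in>UNIV. axis j (f j)) = (\<chi> j. f j)" for f :: "'n \<Rightarrow> complex^'n"
      by (simp add: vec_eq_iff axis_def if_distrib cong: if_cong)
    ultimately show ?thesis by (simp add: vec_lambda_eta)
  qed
  moreover have "(\<chi> i j. L i j (c *s v)) = scale2 c (\<chi> i j. L i j v)" if "v \<in> l" for c v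
    using L(2)[OF that] by (simp add: scale2_def vec_eq_iff)
  ultimately show ?thesis unfolding complex_differentiable_def by blast
qed

section \<open>Passing to the poles\<close>

context graded_lie
begin

text \<open>The common denominator of the coordinates of the r-matrix, a holomorphic function of \<open>A\<close>.\<close>

definition den :: "complex^'n \<Rightarrow> complex" where
  "den A = edet (W (ad_op br A))"

lemma fcalc_ad_differentiable:
  assumes "entire f"
  shows "scalar_differentiable Y (\<lambda>x. app (fcalc f (ad_op br x)) b $ q) A"
proof -
  let ?D = "ad_op br A"
  have t: "((\<lambda>x. ad_op br x) \<longlongrightarrow> ?D) (at A within Y)" by (intro tendsto_ad tendsto_ident_at)
  have "((\<lambda>x. fcalc f (ad_op br x)) has_derivative (\<lambda>v. fdd f ?D ?D (ad_op br v))) (at A within Y)"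
  proof (rule has_derivative_from_slope[where N = "\<lambda>x v. fdd f (ad_op br x) ?D (ad_op br v)"])
    show "linear (\<lambda>v. fdd f (ad_op br x) ?D (ad_op br v))" for x
      by (rule linearI) (simp_all add: ad_lin fdd_lin assms scaleR_as_scale scal_of_real_mult)
    show "((\<lambda>x. fdd f (ad_op br x) ?D (ad_op br b)) \<longlongrightarrow> fdd f ?D ?D (ad_op br b)) (at A within Y)" for b
      by (intro tendsto_fdd t tendsto_const assms)
    show "\<forall>\<^sub>F x in at A within Y. fcalc f (ad_op br x) - fcalc f ?D = fdd f (ad_op br x) ?D (ad_op br (x - A))"
    proof (rule always_eventually, rule allI)
      fix x
      have "ad_op br (x - A) = ad_op br x - ad_op br A" by (rule linear_diff[OF bounded_linear.linear[OF bounded_linear_ad]])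
      then show "fcalc f (ad_op br x) - fcalc f ?D = fdd f (ad_op br x) ?D (ad_op br (x - A))"
        using fdd_intertwines[OF assms, of "ad_op br x" 1 ?D] by simp
    qed
  qed
  then have "((\<lambda>x. app (fcalc f (ad_op br x)) b $ q) has_derivative (\<lambda>v. app (fdd f ?D ?D (ad_op br v)) b $ q)) (at A within Y)"
    by (intro bounded_linear.has_derivative[OF bounded_linear_vec_nth] bounded_linear.has_derivative[OF app.bounded_linear_left])
  then show ?thesis
    unfolding complex_differentiable_def by (intro exI conjI) (auto simp: ad_lin fdd_lin assms)
qed

lemma den_differentiable: "scalar_differentiable Y den A"
  unfolding den_def[abs_def] edet_def matrix_def W_def
  by (intro scalar_differentiable_det) (simp add: fcalc_ad_differentiable entire_w)

lemma den_0: "den 0 \<noteq> 0"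
  unfolding den_def
proof (rule edet_nonzero_inj)
  fix x :: "complex^'n" assume "app (W (ad_op br 0)) x = 0"
  moreover have "ad_op br 0 = 0" by (rule linear_0[OF bounded_linear.linear[OF bounded_linear_ad]])
  ultimately show "x = 0" using w_0 by (simp add: W_def fcalc_zero entire_w)
qed

lemma dilation_tendsto: "((\<lambda>\<tau>. \<tau> *s (A::complex^'n)) \<longlongrightarrow> A) (at 1)"
  using bounded_linear.tendsto[OF bounded_linear_scale_left tendsto_ident_at, of A 1 UNIV] by simp

lemma dilation_in_l: "A \<in> l \<Longrightarrow> \<tau> *s A \<in> l"
  by (rule vec.subspace_scale[OF l_sub])

text \<open>On the complex line through \<open>0\<close> and \<open>A\<close> the denominator is an entire function that does not vanish at \<open>0\<close>. Thus \<open>A\<close>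
  is a limit of points \<open>\<tau> A\<close> with nonzero denominator, even if \<open>den A = 0\<close>.\<close>

lemma eventually_den:
  assumes A: "A \<in> l"
  shows "\<forall>\<^sub>F \<tau> in at 1. den (\<tau> *s A) \<noteq> 0"
proof -
  define f where "f \<tau> = den (\<tau> *s A)" for \<tau>
  have "\<exists>f'. (f has_field_derivative f') (at \<tau>)" for \<tau>
  proof -
    obtain L where "(den has_derivative L) (at (\<tau> *s A) within l)" "\<And>c v. v \<in> l \<Longrightarrow> L (c *s v) = c * L v"
      using den_differentiable unfolding complex_differentiable_def by metis
    with holomorphic_along_line[OF l_sub vec.subspace_0[OF l_sub] A, of den L \<tau>] A
    show ?thesis unfolding f_def by auto
  qed
  then have f: "entire f" by (simp add: holomorphic_on_open)
  have f0: "f 0 \<noteq> 0" by (simp add: f_def den_0)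
  then have "\<forall>\<^sub>F \<tau> in at 1. f \<tau> \<noteq> 0" by (rule entire_eventually_nonzero[OF f])
  then show ?thesis by (simp add: f_def)
qed

lemma eventually_dilation_in:
  assumes "openin (top_of_set l) U" "A \<in> U"
  shows "\<forall>\<^sub>F \<tau> in at 1. \<tau> *s A \<in> U"
proof -
  obtain Y where Y: "open Y" "U = l \<inter> Y" using assms(1) openin_open by blast
  from topological_tendstoD[OF dilation_tendsto Y(1)] assms(2) Y(2)
  show ?thesis using dilation_in_l by (auto elim!: eventually_mono)
qed

text \<open>Cramer's rule for the inverse of \<open>W (ad x)\<close> exhibits the r-matrix as a quotient of holomorphic functions.\<close>

lemma meromorphic_r_trig:
  assumes U: "openin (top_of_set l) U"
  shows "meromorphic_on_domain l U (\<lambda>A. r_trig' br form B n \<epsilon> A - t)"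
  unfolding meromorphic_on_domain_def
proof (intro ballI)
  fix A assume "A \<in> U"
  define num where "num x p = (\<Sum>j<n. app (K j (ad_op br x) * P j) (dual_basis p))" for x p
  define N' where "N' x = (\<chi> p q. cramer_num (W (ad_op br x)) (num x p) q - den x * t $ p $ q)" for x
  have num: "scalar_differentiable Y (\<lambda>x. num x p $ i) x" for Y x p i
    unfolding num_def K_def
    by (simp add: sum_component) (intro scalar_differentiable_sum fcalc_ad_differentiable entire_k)
  have N': "complex_differentiable (*s) scale2 l N' x" for x
  proof (rule scalar_differentiable_tensor)
    fix p q
    have "scalar_differentiable l (\<lambda>x. cramer_num (W (ad_op br x)) (num x p) q) x"
      unfolding cramer_num_def
    proof (rule scalar_differentiable_det)
      fix i j
      show "scalar_differentiable l (\<lambda>x. (\<chi> i j. if j = q then num x p $ i else app (W (ad_op br x)) (axis j 1) $ i) $ i $ j) x"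
        by (cases "j = q") (simp_all add: num W_def fcalc_ad_differentiable entire_w)
    qed
    then show "scalar_differentiable l (\<lambda>x. N' x $ p $ q) x"
      by (simp add: N'_def) (intro scalar_differentiable_diff scalar_differentiable_mult den_differentiable scalar_differentiable_const)
  qed
  have r: "r_trig' br form B n \<epsilon> x - t = scale2 (1 / den x) (N' x)" if "den x \<noteq> 0" for x
  proof -
    have "tensor_of (R (ad_op br x)) $ p $ q = app (V (ad_op br x)) (num x p) $ q" for p q
      by (simp add: top_dual[of "tensor_of _"] top_tensor_of R_def num_def app_sum app_sum_left)
    then show ?thesis
      using that r_trig'_eq[of x] einv_cramer[of "W (ad_op br x)"]
      by (simp add: den_def V_def scale2_def N'_def vec_eq_iff field_simps)
  qed
  have "x \<in> closure {x \<in> U. den x \<noteq> 0}" if x: "x \<in> U" for x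
  proof (rule Lim_in_closed_set[OF closed_closure])
    have "x \<in> l" using x U openin_imp_subset by blast
    from eventually_den[OF this] eventually_dilation_in[OF U x]
    show "\<forall>\<^sub>F \<tau> in at 1. \<tau> *s x \<in> closure {x \<in> U. den x \<noteq> 0}"
      by eventually_elim (rule subsetD[OF closure_subset], simp)
  qed (auto intro: dilation_tendsto)
  then have cl: "U \<subseteq> closure {x \<in> U. den x \<noteq> 0}" by blast
  show "\<exists>U' p h. openin (top_of_set l) U' \<and> A \<in> U' \<and> U' \<subseteq> U \<and>
      (\<forall>x\<in>U'. complex_differentiable (*s) scale2 l p x) \<and> (\<forall>x\<in>U'. scalar_differentiable l h x) \<and>
      U' \<subseteq> closure {x \<in> U'. h x \<noteq> 0} \<and> (\<forall>x\<in>U'. h x \<noteq> 0 \<longrightarrow> r_trig' br form B n \<epsilon> x - t = scale2 (1 / h x) (p x))"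
    by (intro exI[of _ U] exI[of _ N'] exI[of _ den] conjI ballI impI U \<open>A \<in> U\<close> N' den_differentiable r cl order_refl)
qed

lemma bounded_linear_top: "bounded_linear (\<lambda>t. top t y)"
  unfolding linear_conv_bounded_linear[symmetric] by (rule linearI) (simp_all add: top_lin)

lemma derivative_at_regular_point:
  assumes f: "((\<lambda>A. r_trig' br form B n \<epsilon> A - t) has_derivative L) (at A within l)"
    and A: "A \<in> l" and d: "den A \<noteq> 0" and v: "v \<in> l"
  shows "top (L v) y = app (N (ad_op br A) (ad_op br A) (ad_op br v)) y"
proof -
  let ?f = "\<lambda>A. r_trig' br form B n \<epsilon> A - t"
  define \<gamma> where "\<gamma> s = A + s *\<^sub>R v" for s
  have \<gamma>: "(\<gamma> has_vector_derivative v) (at 0)"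
    unfolding \<gamma>_def by (auto intro!: derivative_eq_intros)
  have \<gamma>l: "\<gamma> s \<in> l" for s
    unfolding \<gamma>_def by (intro subspace_add subspace_scale l_real A v)
  have "((\<lambda>s. ?f (\<gamma> s)) has_vector_derivative L v) (at 0)"
    by (rule has_derivative_along_curve[OF f \<gamma>]) (auto simp: \<gamma>_def[of 0] \<gamma>l)
  then have 1: "((\<lambda>s. top (?f (\<gamma> s)) y) has_vector_derivative top (L v) y) (at 0)"
    by (rule bounded_linear.has_vector_derivative[OF bounded_linear_top])
  have "((\<lambda>s. R (ad_op br (\<gamma> s))) has_vector_derivative N (ad_op br A) (ad_op br A) (ad_op br v)) (at 0)"
    using d by (intro has_derivative_along_curve[OF R_has_derivative[where S = UNIV] \<gamma>]) (auto simp: \<gamma>_def[of 0] den_def)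
  then have "((\<lambda>s. app (R (ad_op br (\<gamma> s))) y) has_vector_derivative app (N (ad_op br A) (ad_op br A) (ad_op br v)) y) (at 0)"
    by (rule bounded_linear.has_vector_derivative[OF app.bounded_linear_left])
  from has_vector_derivative_diff[OF this has_vector_derivative_const]
  have 2: "((\<lambda>s. app (R (ad_op br (\<gamma> s))) y - top t y) has_vector_derivative app (N (ad_op br A) (ad_op br A) (ad_op br v)) y) (at 0)"
    by simp
  have "(\<gamma> \<longlongrightarrow> A + 0 *\<^sub>R v) (nhds 0)"
    unfolding \<gamma>_def by (intro tendsto_intros filterlim_ident)
  then have "(\<gamma> \<longlongrightarrow> A) (nhds 0)" by simp
  then have "((\<lambda>s. den (\<gamma> s)) \<longlongrightarrow> den A) (nhds 0)"
    unfolding den_def W_def by (intro tendsto_edet tendsto_fcalc entire_w tendsto_ad)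
  then have "\<forall>\<^sub>F s in nhds 0. den (\<gamma> s) \<noteq> 0" using d by (rule tendsto_imp_eventually_ne)
  then obtain s where s: "open s" "0 \<in> s" "\<And>\<sigma>. \<sigma> \<in> s \<Longrightarrow> den (\<gamma> \<sigma>) \<noteq> 0"
    unfolding eventually_nhds by blast
  have "((\<lambda>s. top (?f (\<gamma> s)) y) has_vector_derivative app (N (ad_op br A) (ad_op br A) (ad_op br v)) y) (at 0)"
  proof (rule has_vector_derivative_transform_within_open[OF 2 s(1,2)])
    fix \<sigma> assume "\<sigma> \<in> s"
    from r_trig'_eq[of "\<gamma> \<sigma>"] s(3)[OF this]
    show "app (R (ad_op br (\<gamma> \<sigma>))) y - top t y = top (?f (\<gamma> \<sigma>)) y"
      by (simp add: den_def top_lin top_tensor_of)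
  qed
  from vector_derivative_unique_at[OF 1 this] show ?thesis .
qed

text \<open>\<open>phi (ad A)\<close> need not be invertible on the whole Lie algebra. It is invertible on \<open>l\<close> when \<open>A\<close> lies in the domain of
  the exponential chart, and \<open>\<Phi> A\<close> extends its restriction to \<open>l\<close> by the identity of the other graded parts.\<close>

definition \<Phi> :: "complex^'n \<Rightarrow> 'n endo" where
  "\<Phi> A = fcalc phi (ad_op br A) * P 0 + (1 - P 0)"

lemma P0_idem: "P 0 * P 0 = P 0" using P_mult[of 0 0] n_pos by simp

lemma P0_fcalc: "entire f \<Longrightarrow> A \<in> l \<Longrightarrow> fcalc f (ad_op br A) * P 0 = P 0 * fcalc f (ad_op br A)"
  using fcalc_commute ad_P_commute[of A 0] by metis

lemma \<Phi>_in_l: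
  assumes A: "A \<in> l"
  shows "app (P 0) (app (\<Phi> A) x) = app (fcalc phi (ad_op br A)) (app (P 0) x)"
    "app (\<Phi> A) x - app (P 0) (app (\<Phi> A) x) = x - app (P 0) x"
proof -
  have e: "P 0 * \<Phi> A = fcalc phi (ad_op br A) * P 0"
    unfolding \<Phi>_def by (simp add: distrib_left right_diff_distrib P0_idem P0_fcalc[OF entire_phi A])
       (simp add: mult.assoc[symmetric] P0_idem)
  show "app (P 0) (app (\<Phi> A) x) = app (fcalc phi (ad_op br A)) (app (P 0) x)"
    using arg_cong[OF e, of "\<lambda>T. app T x"] by simp
  then show "app (\<Phi> A) x - app (P 0) (app (\<Phi> A) x) = x - app (P 0) x"
    by (simp add: \<Phi>_def app_lin)
qed

lemma \<Phi>_invertible: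
  assumes A: "A \<in> l" and inj: "\<And>x. x \<in> l \<Longrightarrow> app (fcalc phi (ad_op br A)) x = 0 \<Longrightarrow> x = 0"
  shows "edet (\<Phi> A) \<noteq> 0"
proof (rule edet_nonzero_inj)
  fix x assume x: "app (\<Phi> A) x = 0"
  have "app (P 0) x = 0"
    using \<Phi>_in_l(1)[OF A, of x] inj[OF P0_in_l, of x] by (simp add: x app.zero_right)
  then show "x = 0" using \<Phi>_in_l(2)[OF A, of x] by (simp add: x app.zero_right)
qed

lemma \<Phi>_solves:
  assumes A: "A \<in> l" and d: "edet (\<Phi> A) \<noteq> 0" and \<xi>: "\<xi> \<in> l"
  shows "app (einv (\<Phi> A)) \<xi> \<in> l" "app (fcalc phi (ad_op br A)) (app (einv (\<Phi> A)) \<xi>) = \<xi>"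
proof -
  let ?J = "app (einv (\<Phi> A)) \<xi>"
  have e: "app (\<Phi> A) ?J = \<xi>" by (rule einv_app(2)[OF d])
  have J: "app (P 0) ?J = ?J" using \<Phi>_in_l(2)[OF A, of ?J] P0_on_l[OF \<xi>] by (simp add: e)
  then show "?J \<in> l" using P0_in_l by metis
  show "app (fcalc phi (ad_op br A)) ?J = \<xi>"
    using \<Phi>_in_l(1)[OF A, of ?J] P0_on_l[OF \<xi>] by (simp add: e J)
qed

text \<open>The direction \<open>vdir (ad A) x\<close> in the form that also makes sense where \<open>phi (ad A)\<close> is singular outside \<open>l\<close>.\<close>

definition adir :: "complex^'n \<Rightarrow> complex^'n \<Rightarrow> complex^'n" where
  "adir A x = app (einv (\<Phi> A)) (app (scal (1/2) * (exp (ad_op br A) + 1) * P 0) x)"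

lemma average_in_l: "A \<in> l \<Longrightarrow> app (scal (1/2) * (exp (ad_op br A) + 1) * P 0) x \<in> l"
proof -
  assume "A \<in> l"
  from P0_fcalc[of exp, OF _ this] have "exp (ad_op br A) * P 0 = P 0 * exp (ad_op br A)"
    by (simp add: fcalc_exp1 holomorphic_intros)
  then have "(exp (ad_op br A) + 1) * P 0 = P 0 * (exp (ad_op br A) + 1)"
    by (simp add: distrib_right distrib_left)
  then have "scal (1/2) * (exp (ad_op br A) + 1) * P 0 = P 0 * (scal (1/2) * (exp (ad_op br A) + 1))"
    by (simp only: mult.assoc scal_left_commute)
  then show ?thesis by (simp add: P0_in_l)
qed

lemma adir_in_l: "A \<in> l \<Longrightarrow> edet (\<Phi> A) \<noteq> 0 \<Longrightarrow> adir A x \<in> l"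
  unfolding adir_def by (rule \<Phi>_solves(1)[OF _ _ average_in_l])

lemma adir_regular:
  assumes A: "A \<in> l" and d: "edet (W (ad_op br A)) \<noteq> 0"
  shows "edet (\<Phi> A) \<noteq> 0" "adir A x = vdir (ad_op br A) x"
proof -
  let ?F = "fcalc phi (ad_op br A)"
  have F: "edet ?F \<noteq> 0" by (rule phi_invertible[OF d])
  show \<Phi>: "edet (\<Phi> A) \<noteq> 0"
  proof (rule \<Phi>_invertible[OF A])
    fix x assume "app ?F x = 0"
    then show "x = 0" using einv_app(1)[OF F, of x] by (simp add: app.zero_right)
  qed
  show "adir A x = vdir (ad_op br A) x"
    using einv_app(1)[OF F, of "adir A x"] \<Phi>_solves(2)[OF A \<Phi> average_in_l[OF A], of x]
    by (simp add: adir_def vdir_def)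
qed

lemma tendsto_adir:
  assumes "(a \<longlongrightarrow> A) F" "edet (\<Phi> A) \<noteq> 0"
  shows "((\<lambda>i. adir (a i) x) \<longlongrightarrow> adir A x) F"
proof -
  have t: "((\<lambda>i. fcalc f (ad_op br (a i))) \<longlongrightarrow> fcalc f (ad_op br A)) F" if "entire f" for f
    by (intro tendsto_fcalc that tendsto_ad assms(1))
  have "((\<lambda>i. exp (ad_op br (a i))) \<longlongrightarrow> exp (ad_op br A)) F"
    using t[of exp] by (simp add: fcalc_exp1 holomorphic_intros)
  then show ?thesis
    using assms(2) unfolding adir_def \<Phi>_def
    by (intro tendsto_app tendsto_mult tendsto_add tendsto_diff tendsto_const tendsto_einv t entire_phi)
qed

end

context graded_lie
begin

text \<open>Where the r-matrix is analytic although its denominator vanishes, nothing is known about its values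
  except that they are limits. The following context is such a neighbourhood \<open>U\<close>, in which \<open>f\<close> has
  the derivatives \<open>L\<close>.\<close>

context
  fixes t :: "complex^'n^'n" and U :: "(complex^'n) set" and f :: "complex^'n \<Rightarrow> complex^'n^'n"
    and L :: "complex^'n \<Rightarrow> complex^'n \<Rightarrow> complex^'n^'n"
  assumes U: "openin (top_of_set l) U" and f_def: "f = (\<lambda>A. r_trig' br form B n \<epsilon> A - t)"
    and der: "\<And>x. x \<in> U \<Longrightarrow> (f has_derivative L x) (at x within l)"
    and L_scale: "\<And>x v c. x \<in> U \<Longrightarrow> v \<in> l \<Longrightarrow> L x (c *s v) = scale2 c (L x v)"
    and t_anti: "antisymmetric2 t"
begin

lemma U_in_l: "x \<in> U \<Longrightarrow> x \<in> l"
  using U openin_imp_subset by blast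

lemma f_regular: "den x \<noteq> 0 \<Longrightarrow> top (f x) y = app (R (ad_op br x)) y - top t y"
  by (simp add: f_def r_trig'_eq den_def top_lin top_tensor_of)

lemma L_regular: "x \<in> U \<Longrightarrow> den x \<noteq> 0 \<Longrightarrow> v \<in> l \<Longrightarrow>
    top (L x v) y = app (N (ad_op br x) (ad_op br x) (ad_op br v)) y"
  using derivative_at_regular_point[of t "L x" x v y] der[of x] U_in_l[of x] by (simp add: f_def)

lemma tendsto_f:
  assumes A: "A \<in> U"
  shows "((\<lambda>\<tau>. top (f (\<tau> *s A)) y) \<longlongrightarrow> top (f A) y) (at 1)"
proof -
  have "continuous (at A within l) f" by (rule has_derivative_continuous[OF der[OF A]])
  then have "((\<lambda>\<tau>. f (\<tau> *s A)) \<longlongrightarrow> f A) (at 1)"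
    by (rule continuous_within_tendsto_compose'[OF _ dilation_in_l[OF U_in_l[OF A]] dilation_tendsto])
  then show ?thesis by (rule bounded_linear.tendsto[OF bounded_linear_top])
qed

lemma tendsto_L:
  assumes A: "A \<in> U" and v: "v \<in> l"
  shows "((\<lambda>\<tau>. top (L (\<tau> *s A) v) y) \<longlongrightarrow> top (L A v) y) (at 1)"
proof -
  have "((\<lambda>\<tau>. L (\<tau> *s A) v $ p $ q) \<longlongrightarrow> L A v $ p $ q) (at 1)" for p q
  proof (rule continuous_within_tendsto_compose'[OF _ dilation_in_l[OF U_in_l[OF A]] dilation_tendsto])
    show "continuous (at A within l) (\<lambda>x. L x v $ p $ q)"
    proof (rule derivative_continuous[where f = "\<lambda>x. f x $ p $ q" and L = "\<lambda>x v. L x v $ p $ q", OF l_sub U A _ _ v])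
      show "((\<lambda>x. f x $ p $ q) has_derivative (\<lambda>v. L x v $ p $ q)) (at x within l)" if "x \<in> U" for x
        by (intro bounded_linear.has_derivative[OF bounded_linear_vec_nth] der that)
    qed (simp add: L_scale scale2_def)
  qed
  then have "((\<lambda>\<tau>. L (\<tau> *s A) v) \<longlongrightarrow> L A v) (at 1)" by (intro vec_tendstoI)
  then show ?thesis by (rule bounded_linear.tendsto[OF bounded_linear_top])
qed

text \<open>Identities at the points of the line through \<open>0\<close> and \<open>A\<close> where \<open>den\<close> does not vanish persist at \<open>A\<close>.\<close>

lemma limit_identity:
  fixes g g' :: "complex \<Rightarrow> 'c::t2_space"
  assumes A: "A \<in> U" and g: "(g \<longlongrightarrow> a) (at 1)" "(g' \<longlongrightarrow> a') (at 1)"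
    and eq: "\<And>\<tau>. \<tau> *s A \<in> U \<Longrightarrow> den (\<tau> *s A) \<noteq> 0 \<Longrightarrow> g \<tau> = g' \<tau>"
  shows "a = a'"
proof -
  have "\<forall>\<^sub>F \<tau> in at 1. g \<tau> = g' \<tau>"
    using eventually_den[OF U_in_l[OF A]] eventually_dilation_in[OF U A] by eventually_elim (rule eq)
  from Lim_transform_eventually[OF g(1) this] g(2) show ?thesis by (intro tendsto_unique[of "at (1::complex)"]) auto
qed

lemmas form_tendsto = bounded_bilinear.tendsto[OF bounded_bilinear_form]
  and br_tendsto = bounded_bilinear.tendsto[OF bounded_bilinear_br]

lemma f_antisymmetric:
  assumes A: "A \<in> U"
  shows "antisymmetric2 (f A)"
  unfolding antisymmetric2_iff
proof (intro allI)
  fix y z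
  show "form (top (f A) y) z = - form y (top (f A) z)"
  proof (rule limit_identity[OF A])
    show "((\<lambda>\<tau>. form (top (f (\<tau> *s A)) y) z) \<longlongrightarrow> form (top (f A) y) z) (at 1)"
      "((\<lambda>\<tau>. - form y (top (f (\<tau> *s A)) z)) \<longlongrightarrow> - form y (top (f A) z)) (at 1)"
      by (intro tendsto_minus form_tendsto tendsto_const tendsto_f A)+
    fix \<tau> assume "\<tau> *s A \<in> U" and d: "den (\<tau> *s A) \<noteq> 0"
    then show "form (top (f (\<tau> *s A)) y) z = - form y (top (f (\<tau> *s A)) z)"
      using R_antisymmetric[of "\<tau> *s A" y z] t_anti U_in_l
      by (simp add: f_regular form_lin antisymmetric2_iff den_def)
  qed
qed

lemma L_antisymmetric:
  assumes A: "A \<in> U" and v: "v \<in> l"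
  shows "antisymmetric2 (L A v)"
  unfolding antisymmetric2_def
proof (intro allI)
  fix p q
  define \<gamma> where "\<gamma> s = A + s *\<^sub>R v" for s
  have \<gamma>: "(\<gamma> has_vector_derivative v) (at 0)"
    unfolding \<gamma>_def by (auto intro!: derivative_eq_intros)
  obtain Y where Y: "open Y" "U = l \<inter> Y" using U openin_open by blast
  have "(\<gamma> \<longlongrightarrow> A + 0 *\<^sub>R v) (nhds 0)"
    unfolding \<gamma>_def by (intro tendsto_intros filterlim_ident)
  from topological_tendstoD[OF this Y(1)] have "\<forall>\<^sub>F s in nhds 0. \<gamma> s \<in> U"
    using A Y(2) subspace_add[OF l_real U_in_l[OF A] subspace_scale[OF l_real v]]
    by (auto simp: \<gamma>_def elim!: eventually_mono)
  then obtain s where s: "open s" "0 \<in> s" "\<And>\<sigma>. \<sigma> \<in> s \<Longrightarrow> \<gamma> \<sigma> \<in> U"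
    unfolding eventually_nhds by blast
  have "((\<lambda>x. f x $ p $ q + f x $ q $ p) has_derivative (\<lambda>v. L A v $ p $ q + L A v $ q $ p)) (at A within l)"
    by (intro has_derivative_add bounded_linear.has_derivative[OF bounded_linear_vec_nth] der A)
  from has_derivative_along_curve[OF this \<gamma>]
  have 1: "((\<lambda>s. f (\<gamma> s) $ p $ q + f (\<gamma> s) $ q $ p) has_vector_derivative L A v $ p $ q + L A v $ q $ p) (at 0)"
    using subspace_add[OF l_real U_in_l[OF A] subspace_scale[OF l_real v]] by (simp add: \<gamma>_def)
  have "((\<lambda>s. f (\<gamma> s) $ p $ q + f (\<gamma> s) $ q $ p) has_vector_derivative 0) (at 0)"
  proof (rule has_vector_derivative_transform_within_open[OF has_vector_derivative_const s(1,2)])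
    show "0 = f (\<gamma> \<sigma>) $ p $ q + f (\<gamma> \<sigma>) $ q $ p" if "\<sigma> \<in> s" for \<sigma>
      using f_antisymmetric[OF s(3)[OF that]] unfolding antisymmetric2_def
      by (metis add.commute add.right_inverse)
  qed
  from vector_derivative_unique_at[OF 1 this]
  show "L A v $ p $ q = - (L A v $ q $ p)" by (simp add: eq_neg_iff_add_eq_0)
qed

text \<open>The direction \<open>br (\<tau> A) \<xi>\<close> at \<open>\<tau> A\<close> is \<open>\<tau>\<close> times the fixed direction \<open>br A \<xi>\<close>.\<close>

lemma f_equivariant:
  assumes A: "A \<in> U" and \<xi>: "\<xi> \<in> l"
  shows "top (L A (br A \<xi>)) y = (top (f A) (br \<xi> y) + top t (br \<xi> y)) - br \<xi> (top (f A) y + top t y)"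
proof (rule limit_identity[OF A])
  have Al: "A \<in> l" by (rule U_in_l[OF A])
  have v: "br A \<xi> \<in> l" by (rule br_in_l[OF Al \<xi>])
  show "((\<lambda>\<tau>. app (scal \<tau>) (top (L (\<tau> *s A) (br A \<xi>)) y)) \<longlongrightarrow> top (L A (br A \<xi>)) y) (at 1)"
  proof -
    have "((\<lambda>\<tau>. app (scal \<tau>) (top (L (\<tau> *s A) (br A \<xi>)) y)) \<longlongrightarrow> app (scal 1) (top (L A (br A \<xi>)) y)) (at 1)"
      by (intro tendsto_app tendsto_L A v bounded_linear.tendsto[OF bounded_linear_scal] tendsto_ident_at)
    then show ?thesis by simp
  qed
  show "((\<lambda>\<tau>. (top (f (\<tau> *s A)) (br \<xi> y) + top t (br \<xi> y)) - br \<xi> (top (f (\<tau> *s A)) y + top t y))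
    \<longlongrightarrow> (top (f A) (br \<xi> y) + top t (br \<xi> y)) - br \<xi> (top (f A) y + top t y)) (at 1)"
    by (intro tendsto_diff tendsto_add tendsto_const br_tendsto tendsto_f A)
  fix \<tau> assume x: "\<tau> *s A \<in> U" and d: "den (\<tau> *s A) \<noteq> 0"
  have "app (scal \<tau>) (top (L (\<tau> *s A) (br A \<xi>)) y) = top (L (\<tau> *s A) (br (\<tau> *s A) \<xi>)) y"
    by (simp add: br_scale L_scale[OF x v] top_lin)
  also have "\<dots> = app (R (ad_op br (\<tau> *s A))) (br \<xi> y) - br \<xi> (app (R (ad_op br (\<tau> *s A))) y)"
    using L_regular[OF x d br_in_l[OF U_in_l[OF x] \<xi>], of y] R_equivariant[OF U_in_l[OF x] d[unfolded den_def] \<xi>]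
    by (simp add: app_lin app_ad)
  finally show "app (scal \<tau>) (top (L (\<tau> *s A) (br A \<xi>)) y)
      = (top (f (\<tau> *s A)) (br \<xi> y) + top t (br \<xi> y)) - br \<xi> (top (f (\<tau> *s A)) y + top t y)"
    by (simp add: f_regular[OF d])
qed

text \<open>Reduces derivatives in directions that depend on the point to derivatives in finitely many fixed directions, which
  are continuous.\<close>

lemma L_expand:
  assumes x: "x \<in> U" and v: "v \<in> l"
  shows "top (L x v) y = (\<Sum>j\<in>UNIV. v $ j *s top (L x (app (P 0) (axis j 1))) y)"
proof -
  have "v = (\<Sum>j\<in>UNIV. v $ j *s app (P 0) (axis j 1))"
    using P0_on_l[OF v] app_sum[of "P 0" "\<lambda>j. v $ j *s axis j 1" UNIV] vec_axis_sum[of v]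
    by (simp add: app_scale)
  then have "L x v = (\<Sum>j\<in>UNIV. L x (v $ j *s app (P 0) (axis j 1)))"
    using linear_sum[OF has_derivative_linear[OF der[OF x]], of "\<lambda>j. v $ j *s app (P 0) (axis j 1)" UNIV] by simp
  also have "\<dots> = (\<Sum>j\<in>UNIV. scale2 (v $ j) (L x (app (P 0) (axis j 1))))"
    by (simp add: L_scale x P0_in_l)
  finally show ?thesis
    by (simp add: linear_sum[OF bounded_linear.linear[OF bounded_linear_top[of y]]] top_lin)
qed

lemma tendsto_L_adir:
  assumes A: "A \<in> U" and d: "edet (\<Phi> A) \<noteq> 0"
  shows "((\<lambda>\<tau>. \<Sum>j\<in>UNIV. adir (\<tau> *s A) x $ j *s top (L (\<tau> *s A) (app (P 0) (axis j 1))) y)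
    \<longlongrightarrow> top (L A (adir A x)) y) (at 1)"
proof -
  have "((\<lambda>\<tau>. app (scal (adir (\<tau> *s A) x $ j)) (top (L (\<tau> *s A) (app (P 0) (axis j 1))) y))
    \<longlongrightarrow> app (scal (adir A x $ j)) (top (L A (app (P 0) (axis j 1))) y)) (at 1)" for j
    by (intro tendsto_app tendsto_L A P0_in_l bounded_linear.tendsto[OF bounded_linear_scal] tendsto_vec_nth
        tendsto_adir dilation_tendsto d)
  then show ?thesis
    unfolding L_expand[OF A adir_in_l[OF U_in_l[OF A] d]] by (intro tendsto_sum) simp
qed

lemma f_dynamical:
  assumes A: "A \<in> U" and d: "edet (\<Phi> A) \<noteq> 0"
  defines "Q \<equiv> \<lambda>y. top (f A) y + top t y"
  shows "form (top (L A (adir A x)) y) z + form (top (L A (adir A y)) z) x + form (top (L A (adir A z)) x) y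
    + (\<beta> x (Q y) (Q z) + \<beta> (Q x) y (Q z) + \<beta> (Q x) (Q y) z)
    = (1/4) * \<beta> (app (P 0) x) (app (P 0) y) (app (P 0) z) - (\<epsilon>\<^sup>2 / 4) * \<beta> x y z"
proof (rule limit_identity[OF A])
  define q where "q \<tau> y = top (f (\<tau> *s A)) y + top t y" for \<tau> y
  define G' where "G' \<tau> x y = (\<Sum>j\<in>UNIV. adir (\<tau> *s A) x $ j *s top (L (\<tau> *s A) (app (P 0) (axis j 1))) y)" for \<tau> x y
  have q: "((\<lambda>\<tau>. q \<tau> y) \<longlongrightarrow> Q y) (at 1)" for y
    unfolding q_def Q_def by (intro tendsto_add tendsto_f A tendsto_const)
  have G': "((\<lambda>\<tau>. G' \<tau> x y) \<longlongrightarrow> top (L A (adir A x)) y) (at 1)" for x y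
    unfolding G'_def by (rule tendsto_L_adir[OF A d])
  show "((\<lambda>\<tau>. form (G' \<tau> x y) z + form (G' \<tau> y z) x + form (G' \<tau> z x) y
    + (\<beta> x (q \<tau> y) (q \<tau> z) + \<beta> (q \<tau> x) y (q \<tau> z) + \<beta> (q \<tau> x) (q \<tau> y) z)) \<longlongrightarrow>
    form (top (L A (adir A x)) y) z + form (top (L A (adir A y)) z) x + form (top (L A (adir A z)) x) y
    + (\<beta> x (Q y) (Q z) + \<beta> (Q x) y (Q z) + \<beta> (Q x) (Q y) z)) (at 1)"
    unfolding \<beta>_def by (intro tendsto_add form_tendsto br_tendsto tendsto_const q G')
  show "((\<lambda>\<tau>. (1/4) * \<beta> (app (P 0) x) (app (P 0) y) (app (P 0) z) - (\<epsilon>\<^sup>2 / 4) * \<beta> x y z) \<longlongrightarrow>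
    (1/4) * \<beta> (app (P 0) x) (app (P 0) y) (app (P 0) z) - (\<epsilon>\<^sup>2 / 4) * \<beta> x y z) (at (1::complex))"
    by (rule tendsto_const)
  fix \<tau> assume x: "\<tau> *s A \<in> U" and d: "den (\<tau> *s A) \<noteq> 0"
  let ?D = "ad_op br (\<tau> *s A)"
  have l: "\<tau> *s A \<in> l" and d': "edet (W ?D) \<noteq> 0" using U_in_l[OF x] d by (auto simp: den_def)
  have q: "q \<tau> y = app (R ?D) y" for y by (simp add: q_def f_regular[OF d])
  have G': "G' \<tau> x' y = app (N ?D ?D (ad_op br (vdir ?D x'))) y" for x' y
    using L_expand[OF x adir_in_l[OF l adir_regular(1)[OF l d']], of x' y]
      L_regular[OF x d adir_in_l[OF l adir_regular(1)[OF l d']], of x' y]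
    by (simp add: G'_def adir_regular(2)[OF l d'])
  show "form (G' \<tau> x y) z + form (G' \<tau> y z) x + form (G' \<tau> z x) y
    + (\<beta> x (q \<tau> y) (q \<tau> z) + \<beta> (q \<tau> x) y (q \<tau> z) + \<beta> (q \<tau> x) (q \<tau> y) z)
    = (1/4) * \<beta> (app (P 0) x) (app (P 0) y) (app (P 0) z) - (\<epsilon>\<^sup>2 / 4) * \<beta> x y z"
    unfolding q G' by (rule dynamical_identity[OF l d'])
qed

end

end

section \<open>The dynamical r-matrix\<close>

context graded_lie
begin

text \<open>In the exponential chart the right and the left invariant fields of \<open>\<xi>\<close> are the derivatives in the directions
  \<open>J \<xi>\<close> and \<open>J (exp (ad A) \<xi>)\<close>, where \<open>J\<close> inverts \<open>phi (ad A)\<close> on \<open>l\<close>. Their difference is the derivative in the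
  direction \<open>br A \<xi>\<close>, which makes quasi-invariance the equivariance of the trigonometric operator. In the dynamical
  equation, equivariance expresses the terms of the connection that contain \<open>rl\<close> without derivatives, and they cancel the mixed terms of
  \<open>CYB (r' - rl)\<close>, \<open>r'\<close> being the trigonometric part; the remaining terms are the dynamical equation of \<open>r'\<close> and the
  Yang-Baxter equation of \<open>rl\<close>, whose contributions from \<open>l\<close> cancel.\<close>

lemma r_trig_dynamical:
  fixes E :: "complex^'n \<Rightarrow> 'g::{topological_group_add,t2_space}"
  assumes G: "simply_connected_lie_group br l E" and M: "exp_parametrizes l E M"
    and quasi: "quasitriangular_structure br l \<delta> rl \<Omega>" and casimir: "casimir_element form l \<Omega>"
  shows "dynamical_r_matrix br l \<delta> rl \<Omega> E M (\<lambda>A. r_trig' br form B n \<epsilon> A - rl)"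
proof -
  define f where "f = (\<lambda>A. r_trig' br form B n \<epsilon> A - rl)"
  obtain Y where Y: "lie_group_chart br l E Y"
    using G lie l_sub br_in_l unfolding simply_connected_lie_group_def lie_group_chart_def by blast
  interpret chart: lie_group_chart br l E Y by (rule Y)
  have rl: "rl \<in> tensor_square l" and t_anti: "antisymmetric2 rl" and \<Omega>: "\<Omega> \<in> tensor_square l"
    and \<delta>: "\<And>\<xi>. \<xi> \<in> l \<Longrightarrow> \<delta> \<xi> = ad2 br \<xi> rl"
    using quasi by (auto simp: quasitriangular_structure_def)
  have M': "openin (top_of_set l) M" "inj_on E M" using M by (auto simp: exp_parametrizes_def)
  have Ml: "M \<subseteq> l" using M'(1) openin_imp_subset by blast
  define \<rho> where "\<rho> = top rl"
  have \<rho>l: "\<rho> x \<in> l" for x unfolding \<rho>_def by (rule top_in_l[OF rl])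
  define Z where "Z = (\<chi> p q r. - (\<epsilon>\<^sup>2 / 4) * \<beta> (dual_basis p) (dual_basis q) (dual_basis r))"
  have anti_f: "antisymmetric2 (f A)"
    and quasi_f: "\<And>\<xi>. \<xi> \<in> l \<Longrightarrow> adjoint_field M E \<xi> f A + ad2 br \<xi> (f A) = - \<delta> \<xi>"
    and dyn_f: "\<And>bs \<eta>. dual_bases l bs \<eta> \<Longrightarrow>
      (\<Sum>b\<in>bs. Alt (tensor12 b (nabla_field rl \<Omega> M E (\<eta> b) f A))) + CYB br (f A) = Z"
    if AM: "A \<in> M" and an: "analytic_at l M f A" for A
  proof -
    obtain U where U: "openin (top_of_set l) U" and A: "A \<in> U"
      and cd: "\<And>x. x \<in> U \<Longrightarrow> complex_differentiable (*s) scale2 l f x"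
      using an unfolding analytic_at_def by blast
    have "\<forall>x\<in>U. \<exists>L. (f has_derivative L) (at x within l) \<and> (\<forall>c. \<forall>v\<in>l. L (c *s v) = scale2 c (L v))"
      using cd unfolding complex_differentiable_def by blast
    then obtain L where der: "\<And>x. x \<in> U \<Longrightarrow> (f has_derivative L x) (at x within l)"
      and L_scale: "\<And>x v c. x \<in> U \<Longrightarrow> v \<in> l \<Longrightarrow> L x (c *s v) = scale2 c (L x v)"
      by metis
    note ctxt = U f_def der L_scale t_anti
    show anti: "antisymmetric2 (f A)" by (rule f_antisymmetric[OF ctxt A])
    let ?D = "ad_op br A"
    have Al: "A \<in> l" using AM Ml by blast
    have inj: "x = 0" if "x \<in> l" "app (fcalc phi ?D) x = 0" for x
      by (rule chart.phi_injective_on_l[OF M AM that])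
    have d: "edet (\<Phi> A) \<noteq> 0" by (rule \<Phi>_invertible[OF Al inj])
    define J where "J = app (einv (\<Phi> A))"
    have J: "J \<xi> \<in> l" "app (fcalc phi ?D) (J \<xi>) = \<xi>" if "\<xi> \<in> l" for \<xi>
      unfolding J_def by (rule \<Phi>_solves[OF Al d that])+
    have J_lin: "J (x + y) = J x + J y" "J (x - y) = J x - J y" "J (c *s x) = c *s J x" for x y c
      by (simp_all add: J_def app_lin app_scale)
    have exp_l: "app (exp ?D) \<xi> \<in> l" if "\<xi> \<in> l" for \<xi>
      using chart.fcalc_in_l[of exp A \<xi>] Al that by (simp add: fcalc_exp1 holomorphic_intros)
    \<comment> \<open>\<open>phi (s) * s = exp s - 1\<close>\<close>
    have J_ad: "J (app (exp ?D) \<xi> - \<xi>) = br A \<xi>" if \<xi>: "\<xi> \<in> l" for \<xi>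
    proof -
      have e: "app (exp ?D) \<xi> - \<xi> \<in> l" by (intro vec.subspace_diff l_sub exp_l \<xi>)
      have "app (fcalc phi ?D) (br A \<xi>) = app (exp ?D) \<xi> - \<xi>"
        using arg_cong[OF fcalc_phi[of ?D], of "\<lambda>T. app T \<xi>"] by (simp add: app_ad app_lin)
      then have "app (fcalc phi ?D) (J (app (exp ?D) \<xi> - \<xi>) - br A \<xi>) = 0"
        by (simp add: app_lin J(2)[OF e])
      from inj[OF _ this] show ?thesis
        using vec.subspace_diff[OF l_sub J(1)[OF e] br_in_l[OF Al \<xi>]] by simp
    qed
    have L_lin: "L A (v + v') = L A v + L A v'" "L A (v - v') = L A v - L A v'" "L A (a *\<^sub>R v) = a *\<^sub>R L A v" for v v' a
      using has_derivative_linear[OF der[OF A]] by (simp_all add: linear_add linear_diff linear_cmul)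
    have right: "right_field M E \<xi> f A = L A (J \<xi>)" if \<xi>: "\<xi> \<in> l" for \<xi>
      unfolding right_field_def
    proof (rule vector_derivative_at, rule has_derivative_along_curve[OF der[OF A]])
      note c = chart.right_translation_curve[OF M AM \<xi> J[OF \<xi>]]
      show "((\<lambda>t. inv_into M E (E (t *\<^sub>R \<xi>) + E A)) has_vector_derivative J \<xi>) (at 0)" by (rule c(1))
      show "inv_into M E (E (0 *\<^sub>R \<xi>) + E A) = A" using M'(2) AM by (simp add: chart.E_0)
      show "\<forall>\<^sub>F t in nhds 0. inv_into M E (E (t *\<^sub>R \<xi>) + E A) \<in> l"
        using c(2) by eventually_elim (use Ml in blast)
    qed
    have left: "left_field M E \<xi> f A = L A (J (app (exp ?D) \<xi>))" if \<xi>: "\<xi> \<in> l" for \<xi>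
    proof -
      have "left_field M E \<xi> f A = right_field M E (app (exp ?D) \<xi>) f A"
        unfolding left_field_def right_field_def by (simp only: chart.left_translation_as_right[OF Al \<xi>])
      then show ?thesis by (simp only: right[OF exp_l[OF \<xi>]])
    qed
    define Q where "Q = (\<lambda>y. top (f A) y + \<rho> y)"
    have equiv: "top (L A (br A \<xi>)) y = Q (br \<xi> y) - br \<xi> (Q y)" if "\<xi> \<in> l" for \<xi> y
      unfolding Q_def \<rho>_def by (rule f_equivariant[OF ctxt A that])
    have adj: "left_field M E \<xi> f A - right_field M E \<xi> f A = L A (br A \<xi>)" if \<xi>: "\<xi> \<in> l" for \<xi>
      by (simp only: left[OF \<xi>] right[OF \<xi>] L_lin(2)[symmetric] J_lin(2)[symmetric] J_ad[OF \<xi>])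
    show "adjoint_field M E \<xi> f A + ad2 br \<xi> (f A) = - \<delta> \<xi>" if \<xi>: "\<xi> \<in> l" for \<xi>
    proof -
      have "L A (br A \<xi>) + ad2 br \<xi> (f A) + ad2 br \<xi> rl = 0"
        by (rule top_inj) (simp add: top_lin ad2_top equiv[OF \<xi>] Q_def \<rho>_def br_add)
      then show ?thesis
        unfolding adjoint_field_def adj[OF \<xi>] \<delta>[OF \<xi>] by (simp add: eq_neg_iff_add_eq_0)
    qed
    fix bs \<eta> assume db: "dual_bases l bs \<eta>"
    have \<eta>: "Vector_Spaces.linear (*s) (*) (\<eta> b)" if "b \<in> bs" for b using db that by (auto simp: dual_bases_def)
    let ?H = "scal (1/2) * (exp ?D + 1)"
    define nab where "nab b = nabla_field rl \<Omega> M E (\<eta> b) f A" for b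
    define crl where "crl b = contract rl (\<eta> b)" for b
    define c\<Omega> where "c\<Omega> b = contract \<Omega> (\<eta> b)" for b
    have cl: "crl b \<in> l" "c\<Omega> b \<in> l" if "b \<in> bs" for b
      unfolding crl_def c\<Omega>_def by (intro contract_in_l \<eta> that rl \<Omega>)+
    have nab: "nab b = L A (app (einv (\<Phi> A) * ?H) (c\<Omega> b) - app ?D (crl b))" if b: "b \<in> bs" for b
    proof -
      have "app (einv (\<Phi> A) * ?H) (c\<Omega> b) = (1/2) *\<^sub>R (J (app (exp ?D) (c\<Omega> b)) + J (c\<Omega> b))"
        by (simp add: J_def app_lin app_scale scaleR_as_scale)
      moreover have "right_field M E (crl b) f A - left_field M E (crl b) f A = - L A (br A (crl b))"
        using adj[OF cl(1)[OF b]] by (metis minus_diff_eq)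
      ultimately show ?thesis
        unfolding nab_def nabla_field_def crl_def[symmetric] c\<Omega>_def[symmetric] left[OF cl(2)[OF b]] right[OF cl(2)[OF b]]
        by (simp add: L_lin app_ad)
    qed
    have sum_l: "(\<Sum>b\<in>bs. form b x * nab b $ q $ r) = (L A (adir A x) - L A (br A (\<rho> x))) $ q $ r" for x q r
    proof -
      let ?v = "\<lambda>b. app (einv (\<Phi> A) * ?H) (c\<Omega> b) - app ?D (crl b)"
      have H: "app ?H \<xi> \<in> l" if "\<xi> \<in> l" for \<xi>
        using average_in_l[OF Al, of \<xi>] by (simp add: P0_on_l[OF that])
      have v: "?v b \<in> l" if "b \<in> bs" for b
        using \<Phi>_solves(1)[OF Al d H[OF cl(2)[OF that]]] br_in_l[OF Al cl(1)[OF that]]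
        by (intro vec.subspace_diff l_sub) (simp_all add: app_ad)
      have "(\<Sum>b\<in>bs. form b x *s ?v b) = app (einv (\<Phi> A) * ?H) (\<Sum>b\<in>bs. form b x *s c\<Omega> b) - app ?D (\<Sum>b\<in>bs. form b x *s crl b)"
        by (simp only: app_sum app_scale sum_subtractf vec.scale_right_diff_distrib)
      also have "\<dots> = adir A x - br A (\<rho> x)"
        using contract_sum[OF db rl] contract_sum[OF db \<Omega>] casimir_top[OF casimir]
        by (simp add: crl_def c\<Omega>_def adir_def app_ad \<rho>_def)
      finally have s: "(\<Sum>b\<in>bs. form b x *s ?v b) = adir A x - br A (\<rho> x)" .
      have "form b x * nab b $ q $ r = L A (form b x *s ?v b) $ q $ r" if b: "b \<in> bs" for b
        unfolding nab[OF b] L_scale[OF A v[OF b]] by (simp only: scale2_def vec_lambda_beta)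
      then have "(\<Sum>b\<in>bs. form b x * nab b $ q $ r) = (\<Sum>b\<in>bs. L A (form b x *s ?v b)) $ q $ r"
        by (simp only: sum_component cong: sum.cong)
      also have "(\<Sum>b\<in>bs. L A (form b x *s ?v b)) = L A (adir A x - br A (\<rho> x))"
        by (simp only: linear_sum[OF has_derivative_linear[OF der[OF A]], symmetric] s)
      finally show ?thesis by (simp only: L_lin)
    qed
    have "((\<Sum>b\<in>bs. Alt (tensor12 b (nab b))) + CYB br (f A)) $ p $ q $ r = Z $ p $ q $ r" for p q r
    proof -
      define x y z where "x = dual_basis p" and "y = dual_basis q" and "z = dual_basis r"
      define \<Lambda> where "\<Lambda> x = L A (adir A x) - L A (br A (\<rho> x))" for x
      have "(\<Sum>b\<in>bs. Alt (tensor12 b (nab b))) $ p $ q $ r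
          = (\<Sum>b\<in>bs. form b x * nab b $ q $ r) - (\<Sum>b\<in>bs. form b y * nab b $ p $ r) + (\<Sum>b\<in>bs. form b z * nab b $ p $ q)"
        by (simp add: sum_component Alt_def tensor12_def x_def y_def z_def form_dual sum.distrib sum_subtractf)
      also have "\<dots> = \<Lambda> x $ q $ r - \<Lambda> y $ p $ r + \<Lambda> z $ p $ q"
        by (simp only: sum_l \<Lambda>_def)
      also have "\<Lambda> y $ p $ r = - \<Lambda> y $ r $ p"
        using L_antisymmetric[OF ctxt A adir_in_l[OF Al d], of y, unfolded antisymmetric2_def, rule_format, of p r]
          L_antisymmetric[OF ctxt A br_in_l[OF Al \<rho>l], of y, unfolded antisymmetric2_def, rule_format, of p r]
        by (simp only: \<Lambda>_def vector_minus_component minus_diff_minus)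
      also have "\<Lambda> x $ q $ r - - \<Lambda> y $ r $ p + \<Lambda> z $ p $ q
          = form (top (\<Lambda> x) y) z + form (top (\<Lambda> y) z) x + form (top (\<Lambda> z) x) y"
        by (simp add: form_dual top_nth x_def y_def z_def)
      finally have 1: "(\<Sum>b\<in>bs. Alt (tensor12 b (nab b))) $ p $ q $ r
        = form (top (\<Lambda> x) y) z + form (top (\<Lambda> y) z) x + form (top (\<Lambda> z) x) y" .
      have Q_anti: "form (Q a) b = - form a (Q b)" for a b
        using anti t_anti by (simp add: antisymmetric2_iff Q_def \<rho>_def form_lin)
      have \<Lambda>: "form (top (\<Lambda> x) y) z = form (top (L A (adir A x)) y) z + \<beta> (\<rho> x) y (Q z) + \<beta> (\<rho> x) (Q y) z" for x y z
        by (simp add: \<Lambda>_def top_lin equiv[OF \<rho>l] form_lin Q_anti[of "br _ _"] \<beta>_form)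
      have "top (f A) a = Q a - \<rho> a" for a by (simp add: Q_def)
      then have 2: "CYB br (f A) $ p $ q $ r = \<beta> x (Q y - \<rho> y) (Q z - \<rho> z) + \<beta> (Q x - \<rho> x) y (Q z - \<rho> z)
          + \<beta> (Q x - \<rho> x) (Q y - \<rho> y) z"
        by (simp only: CYB_antisymmetric_nth[OF anti] x_def y_def z_def)
      \<comment> \<open>brings the mixed terms of the three cyclic permutations into the order in which \<open>CYB\<close> contains them\<close>
      have cyc: "\<beta> (\<rho> y) z (Q x) = \<beta> (Q x) (\<rho> y) z" "\<beta> (\<rho> y) (Q z) x = \<beta> x (\<rho> y) (Q z)"
        "\<beta> (\<rho> z) x (Q y) = \<beta> x (Q y) (\<rho> z)" "\<beta> (\<rho> z) (Q x) y = \<beta> (Q x) y (\<rho> z)"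
        using \<beta>_cyc by metis+
      have 3: "form (top (L A (adir A x)) y) z + form (top (L A (adir A y)) z) x + form (top (L A (adir A z)) x) y
        + (\<beta> x (Q y) (Q z) + \<beta> (Q x) y (Q z) + \<beta> (Q x) (Q y) z)
        = (1/4) * \<beta> (app (P 0) x) (app (P 0) y) (app (P 0) z) - (\<epsilon>\<^sup>2 / 4) * \<beta> x y z"
        unfolding Q_def \<rho>_def by (rule f_dynamical[OF ctxt A d])
      have 4: "\<beta> x (\<rho> y) (\<rho> z) + \<beta> (\<rho> x) y (\<rho> z) + \<beta> (\<rho> x) (\<rho> y) z
        = - (1/4) * \<beta> (app (P 0) x) (app (P 0) y) (app (P 0) z)"
        unfolding \<rho>_def by (rule quasitriangular_CYB[OF quasi casimir])
      have "((\<Sum>b\<in>bs. Alt (tensor12 b (nab b))) + CYB br (f A)) $ p $ q $ r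
        = (form (top (L A (adir A x)) y) z + form (top (L A (adir A y)) z) x + form (top (L A (adir A z)) x) y
           + (\<beta> x (Q y) (Q z) + \<beta> (Q x) y (Q z) + \<beta> (Q x) (Q y) z))
          + (\<beta> x (\<rho> y) (\<rho> z) + \<beta> (\<rho> x) y (\<rho> z) + \<beta> (\<rho> x) (\<rho> y) z)"
        by (simp only: vector_add_component 1 2 \<Lambda> cyc \<beta>_lin) (simp add: algebra_simps)
      also have "\<dots> = - (\<epsilon>\<^sup>2 / 4) * \<beta> x y z" unfolding 3 4 by simp
      finally show ?thesis by (simp add: Z_def x_def y_def z_def)
    qed
    then show "(\<Sum>b\<in>bs. Alt (tensor12 b (nabla_field rl \<Omega> M E (\<eta> b) f A))) + CYB br (f A) = Z"
      by (simp only: vec_eq_iff nab_def simp_thms)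
  qed
  show ?thesis
    unfolding dynamical_r_matrix_def quasi_invariant_def f_def[symmetric]
  proof (intro conjI ballI impI exI[of _ Z] allI)
    show "meromorphic_on_domain l M f" unfolding f_def by (rule meromorphic_r_trig[OF M'(1)])
    show "antisymmetric3 Z" "ad3 br x Z = 0" for x unfolding Z_def by (rule invariant_tensor)+
  qed (intro anti_f quasi_f dyn_f; assumption)+
qed

end

theorem corollary6p2:
  fixes br :: "complex^'n \<Rightarrow> complex^'n \<Rightarrow> complex^'n"
    and B :: "complex^'n \<Rightarrow> complex^'n"
    and n :: nat
    and form :: "complex^'n \<Rightarrow> complex^'n \<Rightarrow> complex"
    and l :: "(complex^'n) set"
    and \<epsilon> :: complex
    and \<delta> :: "complex^'n \<Rightarrow> complex^'n^'n"
    and rl \<Omega> :: "complex^'n^'n"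
    and E :: "complex^'n \<Rightarrow> 'g::{topological_group_add,t2_space}"
    and N :: "(complex^'n) set"
  assumes "complex_lie_algebra br"
    and "lie_automorphism br B"
    and "has_order B n"
    and l_def: "l = graded_part B n 0"
    and "nondegenerate_symmetric_form form"
    and "\<forall>x y z. form (br x y) z + form y (br x z) = 0"
    and "\<forall>x y. form (B x) (B y) = form x y"
    and "casimir_element form l \<Omega>"
    and "\<epsilon> \<noteq> 0"
    and "simply_connected_lie_group br l E"
    and "exp_parametrizes l E N"
    and "connected N"
    and "quasitriangular_structure br l \<delta> rl \<Omega>"
  shows "dynamical_r_matrix br l \<delta> rl \<Omega> E N (\<lambda>A. r_trig' br form B n \<epsilon> A - rl)"
proof -
  interpret graded_lie br B n form l \<epsilon>
    by unfold_locales (use assms in blast)+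
  show ?thesis by (rule r_trig_dynamical) fact+
qed

end
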